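(* Let $M$ be a manifold of dimension $2n+1\geq 5$. In each regular stable homotopy class on $M$ there is a stable Hamiltonian structure $(\lambda',\omega')$ that cannot be $C^2$-perturbed to a non-degenerate stable Hamiltonian structure; that is, there is a $C^2$-neighborhood of the pair $(\lambda',\omega')$ in the set of stable Hamiltonian structures on $M$ that contains no non-degenerate stable Hamiltonian structure.
   Context: $M$ is oriented and not required to be closed. A stable Hamiltonian structure on $M$ (of dimension $2n+1$) is a pair $(\lambda,\omega)$ where $\omega$ is a closed two-form of maximal rank and $\lambda$ is a one-form with $\lambda\wedge\omega^n>0$ and $\ker\omega\subset\ker d\lambda$. Its Reeb vector field $R$ is defined by $\lambda(R)=1$, $\iota_R\omega=0$. A stable homotopy is a homotopy $(\lambda_t,\omega_t)$ of stable Hamiltonian structures along which the cohomology class of $\omega_t$ is constant; a stable homotopy class is an equivalence class of stable Hamiltonian structures under stable homotopy. A stable homotopy class is regular if it contains a stable Hamiltonian structure $(\lambda,\omega)$ such that, on some (non-empty) open set $U\subset M$, $d\lambda$ is a non-zero constant multiple of $\omega$. A stable Hamiltonian structure is non-degenerate if for every closed orbit $\gamma$ of its Reeb vector field $R$, the linearized Poincaré (first return) map of $R$ along $\gamma$ (transverse to $R$) has no root of unity among its eigenvalues. *)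

theory Defs
  imports "HOL-Analysis.Analysis"
begin

text \<open>
  Manifolds are given by a topology and a smooth oriented atlas modelled on \<open>real ^ 'm\<close>; they are
  without boundary and need be neither compact nor connected. Vector fields and differential forms
  are families of local representatives, one per chart, which transform correctly under changes of
  charts.
\<close>

section \<open>Smooth functions on open sets\<close>

text \<open>These notions are meant for open sets \<open>S\<close> of finite-dimensional spaces only.\<close>

primrec Ck_on :: "nat \<Rightarrow> ('a::euclidean_space \<Rightarrow> 'b::real_normed_vector) \<Rightarrow> 'a set \<Rightarrow> bool" where
  "Ck_on 0 f S \<longleftrightarrow> continuous_on S f"
| "Ck_on (Suc k) f S \<longleftrightarrow> (\<forall>x\<in>S. f differentiable (at x)) \<and>
     (\<forall>v. Ck_on k (\<lambda>x. frechet_derivative f (at x) v) S)"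

definition smooth_on :: "('a::euclidean_space \<Rightarrow> 'b::real_normed_vector) \<Rightarrow> 'a set \<Rightarrow> bool" where
  "smooth_on f S \<longleftrightarrow> (\<forall>k. Ck_on k f S)"

section \<open>Oriented manifolds\<close>

type_synonym ('a, 'm) chart = "'a set \<times> ('a \<Rightarrow> real ^ 'm)"

abbreviation cdom :: "('a, 'm::finite) chart \<Rightarrow> 'a set" where
  "cdom c \<equiv> fst c"

abbreviation cmap :: "('a, 'm::finite) chart \<Rightarrow> 'a \<Rightarrow> real ^ 'm" where
  "cmap c \<equiv> snd c"

definition cimg :: "('a, 'm::finite) chart \<Rightarrow> (real ^ 'm) set" where
  "cimg c = cmap c ` cdom c"

definition cinv :: "('a, 'm::finite) chart \<Rightarrow> real ^ 'm \<Rightarrow> 'a" where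
  "cinv c = inv_into (cdom c) (cmap c)"

definition is_chart :: "'a topology \<Rightarrow> ('a, 'm::finite) chart \<Rightarrow> bool" where
  "is_chart X c \<longleftrightarrow> openin X (cdom c) \<and> open (cimg c) \<and>
     homeomorphic_map (subtopology X (cdom c)) (top_of_set (cimg c)) (cmap c)"

definition overlap :: "('a, 'm::finite) chart \<Rightarrow> ('a, 'm) chart \<Rightarrow> (real ^ 'm) set" where
  "overlap c d = cmap c ` (cdom c \<inter> cdom d)"

definition transition :: "('a, 'm::finite) chart \<Rightarrow> ('a, 'm) chart \<Rightarrow> real ^ 'm \<Rightarrow> real ^ 'm" where
  "transition c d = cmap d \<circ> cinv c"

definition oriented_manifold :: "'a topology \<Rightarrow> ('a, 'm::finite) chart set \<Rightarrow> bool" where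
  "oriented_manifold X A \<longleftrightarrow>
     Hausdorff_space X \<and> second_countable X \<and>
     (\<forall>c\<in>A. is_chart X c) \<and> topspace X = (\<Union>c\<in>A. cdom c) \<and>
     (\<forall>c\<in>A. \<forall>d\<in>A. smooth_on (transition c d) (overlap c d) \<and>
        (\<forall>x\<in>overlap c d. det (matrix (frechet_derivative (transition c d) (at x))) > 0))"

section \<open>Multilinear algebra and forms in coordinates\<close>

text \<open>A \<open>k\<close>-covector on \<open>'e\<close> takes its arguments as a sequence of vectors, of which only the entries
  with index \<open>< k\<close> matter.\<close>

type_synonym 'e covector = "(nat \<Rightarrow> 'e) \<Rightarrow> real"

definition alternating_form :: "nat \<Rightarrow> 'e::real_vector covector \<Rightarrow> bool" where
  "alternating_form k \<alpha> \<longleftrightarrow>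
     (\<forall>v w. (\<forall>i<k. v i = w i) \<longrightarrow> \<alpha> v = \<alpha> w) \<and>
     (\<forall>i<k. \<forall>v. linear (\<lambda>x. \<alpha> (v(i := x)))) \<and>
     (\<forall>i j v. i < j \<and> j < k \<and> v i = v j \<longrightarrow> \<alpha> v = 0)"

text \<open>Normalised so that \<open>dx\<^sub>1 \<and> \<dots> \<and> dx\<^sub>k\<close> is \<open>1\<close> on the first \<open>k\<close> standard basis vectors.\<close>

definition wedge :: "nat \<Rightarrow> nat \<Rightarrow> 'e covector \<Rightarrow> 'e covector \<Rightarrow> 'e covector" where
  "wedge k l \<alpha> \<beta> v =
     (\<Sum>\<sigma> | \<sigma> permutes {..<k+l}. of_int (sign \<sigma>) * \<alpha> (\<lambda>i. v (\<sigma> i)) * \<beta> (\<lambda>i. v (\<sigma> (k + i))))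
       / (fact k * fact l)"

text \<open>The \<open>n\<close>-th exterior power of a \<open>2\<close>-covector, a \<open>2n\<close>-covector.\<close>

primrec wedge_power :: "'e covector \<Rightarrow> nat \<Rightarrow> 'e covector" where
  "wedge_power \<omega> 0 = (\<lambda>v. 1)"
| "wedge_power \<omega> (Suc n) = wedge 2 (2 * n) \<omega> (wedge_power \<omega> n)"

definition pair_seq :: "'e \<Rightarrow> 'e \<Rightarrow> nat \<Rightarrow> 'e" where
  "pair_seq v w = (\<lambda>i. if i = 0 then v else w)"

definition form_kernel :: "'e covector \<Rightarrow> 'e set" where
  "form_kernel \<beta> = {v. \<forall>w. \<beta> (pair_seq v w) = 0}"

text \<open>Exterior derivative of a \<open>k\<close>-form on an open set, with the \<open>i\<close>-th argument omitted in the
  \<open>i\<close>-th summand; in particular \<open>d\<alpha> (u, v) = D\<^sub>u(\<alpha> v) - D\<^sub>v(\<alpha> u)\<close> for \<open>1\<close>-forms.\<close>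

definition ext_deriv ::
  "nat \<Rightarrow> ('e::euclidean_space \<Rightarrow> 'e covector) \<Rightarrow> 'e \<Rightarrow> 'e covector" where
  "ext_deriv k \<alpha> x v =
     (\<Sum>i\<le>k. (-1) ^ i *
        frechet_derivative (\<lambda>y. \<alpha> y (\<lambda>j. if j < i then v j else v (Suc j))) (at x) (v i))"

text \<open>The standard basis of \<open>real ^ 'm\<close>, ordered by the order of the index type; it fixes the
  orientation of the model space.\<close>

definition std_basis :: "nat \<Rightarrow> real ^ 'm::{finite,linorder}" where
  "std_basis i = axis (sorted_list_of_set UNIV ! i) 1"

section \<open>Differential forms and vector fields on manifolds\<close>

type_synonym ('a, 'm) form = "('a, 'm) chart \<Rightarrow> real ^ 'm \<Rightarrow> (real ^ 'm) covector"

text \<open>The last conjunct makes the family of local representatives determined by the form.\<close>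

definition smooth_form :: "('a, 'm::finite) chart set \<Rightarrow> nat \<Rightarrow> ('a, 'm) form \<Rightarrow> bool" where
  "smooth_form A k \<alpha> \<longleftrightarrow>
     (\<forall>c\<in>A. (\<forall>x\<in>cimg c. alternating_form k (\<alpha> c x)) \<and> (\<forall>v. smooth_on (\<lambda>x. \<alpha> c x v) (cimg c))) \<and>
     (\<forall>c\<in>A. \<forall>d\<in>A. \<forall>x\<in>overlap c d. \<forall>v.
        \<alpha> c x v =
        \<alpha> d (transition c d x) (\<lambda>i. frechet_derivative (transition c d) (at x) (v i))) \<and>
     (\<forall>c x v. \<not> (c \<in> A \<and> x \<in> cimg c) \<longrightarrow> \<alpha> c x v = 0)"

type_synonym ('a, 'm) vfield = "('a, 'm) chart \<Rightarrow> real ^ 'm \<Rightarrow> real ^ 'm"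

definition smooth_vfield :: "('a, 'm::finite) chart set \<Rightarrow> ('a, 'm) vfield \<Rightarrow> bool" where
  "smooth_vfield A R \<longleftrightarrow>
     (\<forall>c\<in>A. smooth_on (R c) (cimg c)) \<and>
     (\<forall>c\<in>A. \<forall>d\<in>A. \<forall>x\<in>overlap c d.
        R d (transition c d x) = frechet_derivative (transition c d) (at x) (R c x))"

section \<open>Stable Hamiltonian structures\<close>

text \<open>On a manifold of dimension \<open>2n+1\<close>, maximal rank \<open>2n\<close> means that the kernel is a line.\<close>

definition SHS ::
  "('a, 'm::{finite,linorder}) chart set \<Rightarrow> nat \<Rightarrow> (('a, 'm) form \<times> ('a, 'm) form) set" where
  "SHS A n = {(lam, \<omega>). smooth_form A 1 lam \<and> smooth_form A 2 \<omega> \<and>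
     (\<forall>c\<in>A. \<forall>x\<in>cimg c.
        (\<forall>v. ext_deriv 2 (\<omega> c) x v = 0) \<and>
        dim (form_kernel (\<omega> c x)) = 1 \<and>
        wedge 1 (2 * n) (lam c x) (wedge_power (\<omega> c x) n) std_basis > 0 \<and>
        form_kernel (\<omega> c x) \<subseteq> form_kernel (ext_deriv 1 (lam c) x))}"

text \<open>Smoothness on \<open>[0,1] \<times> M\<close> is expressed by smooth extension of the coefficients to
  \<open>\<real> \<times> M\<close>; outside \<open>[0,1]\<close> nothing else is required.\<close>

definition smooth_family ::
  "('a, 'm::finite) chart set \<Rightarrow> (real \<Rightarrow> ('a, 'm) form) \<Rightarrow> bool" where
  "smooth_family A \<alpha> \<longleftrightarrow>
     (\<forall>c\<in>A. \<forall>v. smooth_on (\<lambda>(t, x). \<alpha> t c x v) (UNIV \<times> cimg c))"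

text \<open>Closed two-forms represent the same de Rham class.\<close>

definition cohomologous2 ::
  "('a, 'm::finite) chart set \<Rightarrow> ('a, 'm) form \<Rightarrow> ('a, 'm) form \<Rightarrow> bool" where
  "cohomologous2 A \<omega> \<omega>' \<longleftrightarrow> (\<exists>\<eta>. smooth_form A 1 \<eta> \<and>
     (\<forall>c\<in>A. \<forall>x\<in>cimg c. \<forall>v. \<omega>' c x v - \<omega> c x v = ext_deriv 1 (\<eta> c) x v))"

definition stable_homotopy_rel ::
  "('a, 'm::{finite,linorder}) chart set \<Rightarrow> nat \<Rightarrow>
     ((('a, 'm) form \<times> ('a, 'm) form) \<times> (('a, 'm) form \<times> ('a, 'm) form)) set" where
  "stable_homotopy_rel A n =
     {((lam, \<omega>), (lam', \<omega>')). \<exists>L W.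
        smooth_family A L \<and> smooth_family A W \<and>
        L 0 = lam \<and> W 0 = \<omega> \<and> L 1 = lam' \<and> W 1 = \<omega>' \<and>
        (\<forall>t\<in>{0..1}. (L t, W t) \<in> SHS A n \<and> cohomologous2 A (W 0) (W t))}"

definition stable_homotopy_classes ::
  "('a, 'm::{finite,linorder}) chart set \<Rightarrow> nat \<Rightarrow> (('a, 'm) form \<times> ('a, 'm) form) set set" where
  "stable_homotopy_classes A n = SHS A n // stable_homotopy_rel A n"

definition regular_class ::
  "'a topology \<Rightarrow> ('a, 'm::finite) chart set \<Rightarrow> (('a, 'm) form \<times> ('a, 'm) form) set \<Rightarrow> bool" where
  "regular_class X A C \<longleftrightarrow> (\<exists>(lam, \<omega>)\<in>C. \<exists>U a. openin X U \<and> U \<noteq> {} \<and> a \<noteq> 0 \<and>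
     (\<forall>c\<in>A. \<forall>x\<in>cmap c ` (cdom c \<inter> U). \<forall>v. ext_deriv 1 (lam c) x v = a * \<omega> c x v))"

section \<open>Non-degeneracy\<close>

definition reeb_field ::
  "('a, 'm::finite) chart set \<Rightarrow> ('a, 'm) form \<Rightarrow> ('a, 'm) form \<Rightarrow> ('a, 'm) vfield \<Rightarrow> bool" where
  "reeb_field A lam \<omega> R \<longleftrightarrow> smooth_vfield A R \<and>
     (\<forall>c\<in>A. \<forall>x\<in>cimg c. lam c x (\<lambda>i. R c x) = 1 \<and> (\<forall>w. \<omega> c x (pair_seq (R c x) w) = 0))"

definition integral_curve ::
  "'a topology \<Rightarrow> ('a, 'm::finite) chart set \<Rightarrow> ('a, 'm) vfield \<Rightarrow> (real \<Rightarrow> 'a) \<Rightarrow> real set \<Rightarrow> bool" where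
  "integral_curve X A R \<gamma> I \<longleftrightarrow> continuous_map (top_of_set I) X \<gamma> \<and>
     (\<forall>t\<in>I. \<forall>c\<in>A. \<gamma> t \<in> cdom c \<longrightarrow>
        ((\<lambda>s. cmap c (\<gamma> s)) has_vector_derivative R c (cmap c (\<gamma> t))) (at t within I))"

text \<open>A closed orbit, parametrised by \<open>\<gamma>\<close>, with minimal period \<open>T\<close>.\<close>

definition closed_orbit ::
  "'a topology \<Rightarrow> ('a, 'm::finite) chart set \<Rightarrow> ('a, 'm) vfield \<Rightarrow> (real \<Rightarrow> 'a) \<Rightarrow> real \<Rightarrow> bool" where
  "closed_orbit X A R \<gamma> T \<longleftrightarrow> integral_curve X A R \<gamma> UNIV \<and> 0 < T \<and>
     (\<forall>t. \<gamma> (t + T) = \<gamma> t) \<and> (\<forall>s. 0 < s \<and> s < T \<longrightarrow> \<gamma> s \<noteq> \<gamma> 0)"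

text \<open>
  \<open>P\<close> is a Poincare return map of the closed orbit \<open>\<gamma>\<close>. The local transversal section through
  \<open>\<gamma> 0\<close> is, in the chart \<open>c\<close>, a neighbourhood of \<open>\<gamma> 0\<close> in an affine hyperplane with direction \<open>H\<close>;
  points of the section are given by their displacement in \<open>H\<close> from \<open>\<gamma> 0\<close>. The first return time
  \<open>\<tau>\<close> is continuous and extends the minimal period of \<open>\<gamma>\<close>.
\<close>

definition poincare_map ::
  "'a topology \<Rightarrow> ('a, 'm::finite) chart set \<Rightarrow> ('a, 'm) vfield \<Rightarrow> (real \<Rightarrow> 'a) \<Rightarrow> real \<Rightarrow>
   ('a, 'm) chart \<Rightarrow> (real ^ 'm) set \<Rightarrow> (real ^ 'm \<Rightarrow> real ^ 'm) \<Rightarrow> bool" where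
  "poincare_map X A R \<gamma> T c H P \<longleftrightarrow>
     c \<in> A \<and> \<gamma> 0 \<in> cdom c \<and> subspace H \<and> dim H = CARD('m) - 1 \<and>
     (let pt = (\<lambda>h. cmap c (\<gamma> 0) + h) in
      \<exists>W \<tau>. openin (top_of_set H) W \<and> 0 \<in> W \<and>
        continuous_on W \<tau> \<and> \<tau> 0 = T \<and>
        (\<forall>h\<in>W. pt h \<in> cimg c \<and> R c (pt h) \<notin> H \<and> P h \<in> H \<and> pt (P h) \<in> cimg c \<and> 0 < \<tau> h \<and>
          (\<exists>\<sigma>. integral_curve X A R \<sigma> {0..\<tau> h} \<and>
               \<sigma> 0 = cinv c (pt h) \<and> \<sigma> (\<tau> h) = cinv c (pt (P h)) \<and>
               (\<forall>t. 0 < t \<and> t < \<tau> h \<longrightarrow> \<sigma> t \<notin> (\<lambda>h'. cinv c (pt h')) ` W))))"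

text \<open>\<open>\<mu>\<close> is an eigenvalue of the complexification of the endomorphism \<open>L\<close> of \<open>H\<close>, with
  eigenvector \<open>u + \<i> w\<close>.\<close>

definition complex_eigenvalue_on ::
  "'e::real_vector set \<Rightarrow> ('e \<Rightarrow> 'e) \<Rightarrow> complex \<Rightarrow> bool" where
  "complex_eigenvalue_on H L \<mu> \<longleftrightarrow> (\<exists>u\<in>H. \<exists>w\<in>H. (u \<noteq> 0 \<or> w \<noteq> 0) \<and>
     L u = Re \<mu> *\<^sub>R u - Im \<mu> *\<^sub>R w \<and> L w = Im \<mu> *\<^sub>R u + Re \<mu> *\<^sub>R w)"

definition root_of_unity :: "complex \<Rightarrow> bool" where
  "root_of_unity z \<longleftrightarrow> (\<exists>k\<ge>1. z ^ k = 1)"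

definition nondegenerate ::
  "'a topology \<Rightarrow> ('a, 'm::finite) chart set \<Rightarrow> ('a, 'm) form \<times> ('a, 'm) form \<Rightarrow> bool" where
  "nondegenerate X A s \<longleftrightarrow> (\<forall>R \<gamma> T c H P L.
     reeb_field A (fst s) (snd s) R \<and> closed_orbit X A R \<gamma> T \<and>
     poincare_map X A R \<gamma> T c H P \<and> (P has_derivative L) (at 0 within H) \<longrightarrow>
     (\<forall>\<mu>. complex_eigenvalue_on H L \<mu> \<longrightarrow> \<not> root_of_unity \<mu>))"

section \<open>The \<open>C\<^sup>2\<close> topology\<close>

text \<open>All coefficients of \<open>\<alpha> - \<beta>\<close> and their partial derivatives up to order two are smaller than
  \<open>e\<close> on \<open>K\<close>.\<close>

definition C2_close_on ::
  "'e::euclidean_space set \<Rightarrow> real \<Rightarrow> ('e \<Rightarrow> 'e covector) \<Rightarrow> ('e \<Rightarrow> 'e covector) \<Rightarrow> bool" where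
  "C2_close_on K e \<alpha> \<beta> \<longleftrightarrow> (\<forall>x\<in>K. \<forall>v. range v \<subseteq> Basis \<longrightarrow>
     (let h = (\<lambda>y. \<alpha> y v - \<beta> y v) in
       \<bar>h x\<bar> < e \<and>
       (\<forall>a\<in>Basis. \<bar>frechet_derivative h (at x) a\<bar> < e) \<and>
       (\<forall>a\<in>Basis. \<forall>b\<in>Basis.
          \<bar>frechet_derivative (\<lambda>y. frechet_derivative h (at y) a) (at x) b\<bar> < e)))"

text \<open>The topology of \<open>C\<^sup>2\<close> convergence on compact sets. On a compact manifold it is the \<open>C\<^sup>2\<close>
  topology; otherwise it is the coarsest of the usual ones (it is contained in the Whitney
  topology), so that its neighbourhoods are neighbourhoods for all of them.\<close>

definition C2_topology ::
  "('a, 'm::{finite,linorder}) chart set \<Rightarrow> nat \<Rightarrow> (('a, 'm) form \<times> ('a, 'm) form) topology" where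
  "C2_topology A n = topology_generated_by
     {{s \<in> SHS A n. C2_close_on K e (fst s c) (fst s0 c) \<and> C2_close_on K e (snd s c) (snd s0 c)}
      | s0 c K e. s0 \<in> SHS A n \<and> c \<in> A \<and> compact K \<and> K \<subseteq> cimg c \<and> 0 < e}"

end

theory Submission
 imports Defs
begin

text \<open>
Let \<open>f\<close> be the trace of the endomorphism by which \<open>\<omega>\<close> represents \<open>d\<lambda>\<close> transversally to the Reeb field \<open>R\<close>.
As \<open>R\<close> annihilates and preserves both two-forms, \<open>f\<close> is constant along Reeb orbits. Hence every return map
\<open>P\<close> satisfies \<open>f \<circ> P = f\<close>; if \<open>df\<close> does not vanish on the section at the closed orbit, the derivative of
\<open>P\<close> preserves a non-zero covector and has the eigenvalue 1. So it suffices to construct a structure for which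
every perturbation has a closed orbit in a region where \<open>df\<close> is non-zero.

Where \<open>d\<lambda> = a \<omega>\<close>, the structure is deformed to an affine contact form, and then, by a conformal factor, to a form
\<open>\<lambda>\<^sub>0\<close> whose Reeb orbits are circles with angle \<open>\<phi>\<close>. With \<open>h\<close> a function of half the squared radius \<open>r\<close> in the
\<open>(x\<^sub>2, y\<^sub>2)\<close>-plane and of the transverse distance \<open>s\<close>, \<open>\<kappa> = \<partial>h/\<partial>r\<close> and \<open>\<theta>\<close> the angle in that plane, the pairs
\<open>\<lambda>\<^sub>t = \<lambda>\<^sub>0 + t (h d\<phi> + 2 \<kappa> d\<theta>) + (t\<^sup>2/2) \<kappa>\<^sup>2 d\<phi>\<close> and \<open>\<omega>\<^sub>t = (d\<lambda>\<^sub>0 + t d(h d\<phi>)) / a\<close> are stable, with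
\<open>f = const + 2 t a (1/2 + r)\<close>. Under a perturbation, the displacement after one turn of the points of the slice
\<open>y\<^sub>2 = 0\<close> of the section pairs positively with the position on a small sphere, so by Brouwer's theorem some
point of the slice is displaced in the characteristic direction of the slice only. As \<open>f\<close> is preserved and
strictly monotone in this direction, this displacement is zero and the orbit is closed.
\<close>

section \<open>Smooth functions\<close>

text \<open>The obstacle is that a closed orbit along which df is non-zero has the eigenvalue 1, so
  the implicit function theorem cannot preserve it. Therefore \<open>h\<close> has a whole circle r
  = 1/2, s = 0 of critical points, non-degenerate in the transverse directions. Non-degeneracy
  supplies all equations for a closed orbit but one, and conservation of f supplies the last. The
  slice y2 = 0 cuts the circle transversally; it has odd dimension, and its characteristic direction
  is the x2-direction, in which r and hence f is monotone. As f is affine in the second derivative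
  of \<open>h\<close> in r, \<open>h\<close> needs a cubic term. The quadratic term in \<lambda>_t
  completes the formula d\<lambda>_t = a \<omega>_t + t d\<kappa> \<and> (2 d\<theta> + t \<kappa>
  d\<phi>), where both factors of the correction vanish on the Reeb field. Dimension five is needed
  for two symplectic planes: \<phi> is the angle of one, (r, \<theta>) belong to the other. Second
  derivatives enter only through df, as f contains d\<lambda>; for the flow uniform closeness of the
  Reeb fields is enough.\<close>

notation scaleR (infixr ".*" 75)

abbreviation LIM (infix "---->" 60) where "X ----> L \<equiv> X \<longlonglongrightarrow> L"

abbreviation "FD f x \<equiv> frechet_derivative f (at x)"

lemma Ck_on_SucD:
 assumes "Ck_on (Suc k) f S"
 shows "!!x. x : S ==> (f has_derivative FD f x) (at x)"
  and "!!v. Ck_on k (%x. FD f x v) S" using assms by (auto simp: frechet_derivative_works)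

lemma FD_cong:
 assumes "open S" "x : S" "!!y. y : S ==> f y = g y"
 shows "FD f x = FD g x"
proof -
 have "(f has_derivative D) (at x) \<longleftrightarrow> (g has_derivative D) (at x)" for D
  using has_derivative_transform_within_open[OF _ assms(1,2), of f D UNIV g]
   has_derivative_transform_within_open[OF _ assms(1,2), of g D UNIV f] assms(3) by auto
 thus ?thesis by (simp add: frechet_derivative_def)
qed

lemma Ck_on_cong:
 assumes "Ck_on k g S" "!!x. x : S ==> f x = g x" "open S"
 shows "Ck_on k f S" using assms(1,2)
proof (induction k arbitrary: f g)
 case 0
 thus ?case using continuous_on_cong by (metis Ck_on.simps(1))
next
 case (Suc k)
 note d = Ck_on_SucD[OF Suc.prems(1)]
 have "f differentiable (at x)" if "x : S" for x
  using has_derivative_transform_within_open[OF d(1)[OF that] `open S` that, of f] Suc.prems(2)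
  by (force simp: differentiable_def)
 moreover have "Ck_on k (%x. FD f x v) S" for v
  by (rule Suc.IH[OF d(2)[of v]]) (simp add: FD_cong[OF `open S` _ Suc.prems(2)])
 ultimately show ?case by simp
qed

lemma Ck_on_SucI:
 assumes "!!x. x : S ==> (f has_derivative f' x) (at x)"
  and "!!v. Ck_on k (%x. f' x v) S" and "open S"
 shows "Ck_on (Suc k) f S"
proof -
 have "FD f x = f' x" if "x : S" for x using frechet_derivative_at[OF assms(1)[OF that]] by simp
 hence "Ck_on k (%x. FD f x v) S" for v by (intro Ck_on_cong[OF assms(2)[of v] _ assms(3)]) simp
 moreover have "f differentiable (at x)" if "x : S" for x
  using assms(1)[OF that] by (auto simp: differentiable_def)
 ultimately show ?thesis by simp
qed

lemma Ck_on_lower: "Ck_on (Suc k) f S ==> Ck_on k f S"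
proof (induction k arbitrary: f)
 case 0
 thus ?case by (auto intro!: continuous_at_imp_continuous_on differentiable_imp_continuous_within)
next
 case (Suc k)
 thus ?case by (metis Ck_on.simps(2))
qed

lemma Ck_on_subset: "Ck_on k f S ==> T <= S ==> Ck_on k f T"
 by (induction k arbitrary: f) (auto intro: continuous_on_subset)

lemma Ck_on_local:
 assumes "!!x. x : S ==> EX U. open U & x : U & Ck_on k f U"
 shows "Ck_on k f S" using assms
proof (induction k arbitrary: f)
 case 0
 have "isCont f x" if "x : S" for x using 0[OF that] by (auto simp: continuous_on_eq_continuous_at)
 thus ?case by (simp add: continuous_at_imp_continuous_on)
next
 case (Suc k)
 have "f differentiable (at x)" if "x : S" for x using Suc.prems[OF that] by auto
 moreover have "Ck_on k (%x. FD f x v) S" for v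
 proof (rule Suc.IH)
  fix x assume "x : S"
  then obtain U where "open U" "x : U" "Ck_on (Suc k) f U" using Suc.prems by blast
  thus "EX U. open U & x : U & Ck_on k (%x. FD f x v) U"  by (intro exI[of _ U]) simp
 qed
 ultimately show ?case by simp
qed

lemma Ck_on_const: "open S ==> Ck_on k (%x. c) S"
proof (induction k arbitrary: c)
 case (Suc k)
 show ?case by (rule Ck_on_SucI[where f'="%x v. 0"]) (use Suc in auto)
qed auto

lemma Ck_on_linear:
 assumes "bounded_linear L" "Ck_on k f S" "open S"
 shows "Ck_on k (%x. L (f x)) S" using assms(2)
proof (induction k arbitrary: f)
 case 0
 thus ?case using assms(1) by (auto intro: bounded_linear.continuous_on)
next
 case (Suc k)
 note d = Ck_on_SucD[OF Suc.prems]
 show ?case by (rule Ck_on_SucI[OF bounded_linear.has_derivative[OF assms(1) d(1)] Suc.IH[OF d(2)] `open S`])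
qed

lemma Ck_on_ident: "open S ==> Ck_on k (%x. x) S"
proof (cases k)
 case (Suc j)
 assume "open S"
 thus ?thesis unfolding Suc by (intro Ck_on_SucI[where f'="%x v. v"]) (auto intro: Ck_on_const)
qed auto

lemma Ck_on_add:
 assumes "Ck_on k f S" "Ck_on k g S" "open S"
 shows "Ck_on k (%x. f x + g x) S" using assms(1,2)
proof (induction k arbitrary: f g)
 case 0
 thus ?case by (auto intro: continuous_on_add)
next
 case (Suc k)
 note d = Ck_on_SucD[OF Suc.prems(1)] Ck_on_SucD[OF Suc.prems(2)]
 show ?case by (rule Ck_on_SucI[OF has_derivative_add[OF d(1,3)] Suc.IH[OF d(2,4)] `open S`])
qed

lemma Ck_on_bilinear:
 assumes "bounded_bilinear B" "Ck_on k f S" "Ck_on k g S" "open S"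
 shows "Ck_on k (%x. B (f x) (g x)) S" using assms(2,3)
proof (induction k arbitrary: f g)
 case 0
 thus ?case using assms(1) by (auto intro: bounded_bilinear.continuous_on)
next
 case (Suc k)
 note d = Ck_on_SucD[OF Suc.prems(1)] Ck_on_SucD[OF Suc.prems(2)]
 show ?case by (rule Ck_on_SucI[OF bounded_bilinear.FDERIV[OF assms(1) d(1,3)] _ `open S`])
    (auto intro!: Ck_on_add Suc.IH d Ck_on_lower[OF Suc.prems(1)] Ck_on_lower[OF Suc.prems(2)] assms(4))
qed

lemma Ck_on_sum:
 assumes "!!i. i : I ==> Ck_on k (f i) S" "open S"
 shows "Ck_on k (%x. \<Sum>i\<in>I. f i x) S"
 using assms by (induction I rule: infinite_finite_induct) (auto intro: Ck_on_const Ck_on_add)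

lemma Ck_on_compose:
 fixes f :: "'b::euclidean_space => 'c::real_normed_vector" and g :: "'a::euclidean_space => 'b"
 assumes "Ck_on k f T" "Ck_on k g S" "g ` S <= T" "open S" "open T"
 shows "Ck_on k (%x. f (g x)) S" using assms(1,2)
proof (induction k arbitrary: f)
 case 0
 thus ?case using assms(3) by (auto intro: continuous_on_compose2)
next
 case (Suc k)
 note d = Ck_on_SucD[OF Suc.prems(1)] Ck_on_SucD[OF Suc.prems(2)]
 have gT: "g x : T" if "x : S" for x using that assms(3) by auto
 let ?f' = "%x. FD f x" and ?g' = "%x. FD g x"
 have D: "((%x. f (g x)) has_derivative (%v. ?f' (g x) (?g' x v))) (at x)" if "x : S" for x
  using d(3)[OF that] d(1)[OF gT[OF that]] by (rule has_derivative_compose)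
 \<comment> \<open>\<open>Ck_on\<close> speaks of derivatives in fixed directions; expanding the
   moving direction in the basis lets the induction hypothesis apply to each
   \<open>?f' (g x) b\<close>.\<close>
 have eq: "?f' (g x) (?g' x v) = (\<Sum>b\<in>Basis. (?g' x v \<bullet> b) .* ?f' (g x) b)" if "x : S" for x v
 proof -
  interpret linear "?f' (g x)" using d(1)[OF gT[OF that]] has_derivative_linear by blast
  show ?thesis by (subst euclidean_representation[symmetric, of "?g' x v"]) (simp only: sum scale)
 qed
 show ?case
 proof (rule Ck_on_SucI[OF D _ `open S`])
  fix v
  have "Ck_on k (%x. \<Sum>b\<in>Basis. (?g' x v \<bullet> b) .* ?f' (g x) b) S"
   by (intro Ck_on_sum Ck_on_bilinear[OF bounded_bilinear_scaleR]
     Ck_on_linear[OF bounded_linear_inner_left] d Suc.IH Ck_on_lower[OF Suc.prems(2)] assms)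
  thus "Ck_on k (%x. ?f' (g x) (?g' x v)) S" by (rule Ck_on_cong) (use eq assms in auto)
 qed
qed

text \<open>A closed form for all derivatives at once reduces smoothness of a special function to a
  single differentiation rule; applied to inverses, real powers, cosine and sine.\<close>

lemma Ck_on_deriv_sequence:
 fixes F :: "nat => real => real"
 assumes "!!j x. x : S ==> (F j has_real_derivative F (Suc j) x) (at x)" "open S"
 shows "Ck_on k (F j) S"
proof (induction k arbitrary: j)
 case 0
 show ?case using assms(1)  by (auto intro!: continuous_at_imp_continuous_on DERIV_isCont)
next
 case (Suc k)
 show ?case by (rule Ck_on_SucI[where f'="%x v. F (Suc j) x * v"])
    (use assms(1) in \<open>auto simp: has_field_derivative_def
     intro!: Ck_on_linear[OF bounded_linear_mult_left] Suc assms(2)\<close>)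
qed

lemma smooth_cong:
 "smooth_on g S ==> (!!x. x : S ==> f x = g x) ==> open S ==> smooth_on f S"
 unfolding smooth_on_def using Ck_on_cong by blast

lemma smooth_subset: "smooth_on f S ==> T <= S ==> smooth_on f T"
 unfolding smooth_on_def using Ck_on_subset by blast

lemma smooth_local:
 "(!!x. x : S ==> EX U. open U & x : U & smooth_on f U) ==> smooth_on f S"
 unfolding smooth_on_def by (meson Ck_on_local)

lemma smooth_const: "open S ==> smooth_on (%x. c) S" unfolding smooth_on_def by (simp add: Ck_on_const)

lemma smooth_ident: "open S ==> smooth_on (%x. x) S" unfolding smooth_on_def by (simp add: Ck_on_ident)

lemma smooth_linear:
 "bounded_linear L ==> smooth_on f S ==> open S ==> smooth_on (%x. L (f x)) S"
 unfolding smooth_on_def by (simp add: Ck_on_linear)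

lemma smooth_blinear: "bounded_linear L ==> open S ==> smooth_on L S"
 using smooth_linear[OF _ smooth_ident] by blast

lemma smooth_add: "smooth_on f S ==> smooth_on g S ==> open S ==> smooth_on (%x. f x + g x) S"
 unfolding smooth_on_def by (simp add: Ck_on_add)

lemma smooth_bilinear:
 "bounded_bilinear B ==> smooth_on f S ==> smooth_on g S ==> open S
  ==> smooth_on (%x. B (f x) (g x)) S" unfolding smooth_on_def by (simp add: Ck_on_bilinear)

lemmas smooth_scaleR = smooth_bilinear[OF bounded_bilinear_scaleR]
lemmas smooth_mult = smooth_bilinear[OF bounded_bilinear_mult]
lemmas smooth_inner = smooth_bilinear[OF bounded_bilinear_inner]
lemmas smooth_minus = smooth_linear[OF bounded_linear_minus[OF bounded_linear_ident]]

lemma smooth_diff: "smooth_on f S ==> smooth_on g S ==> open S ==> smooth_on (%x. f x - g x) S"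
 using smooth_add[OF _ smooth_minus] by force

lemma smooth_sum:
 "(!!i. i : I ==> smooth_on (f i) S) ==> open S ==> smooth_on (%x. \<Sum>i\<in>I. f i x) S"
 unfolding smooth_on_def by (simp add: Ck_on_sum)

lemma smooth_prod:
 fixes f :: "'i => 'a::euclidean_space => real"
 shows "(!!i. i : I ==> smooth_on (f i) S) ==> open S ==> smooth_on (%x. \<Prod>i\<in>I. f i x) S"
 by (induction I rule: infinite_finite_induct) (auto intro: smooth_const smooth_mult)

lemma smooth_power:
 fixes f :: "'a::euclidean_space => real"
 shows "smooth_on f S ==> open S ==> smooth_on (%x. f x ^ k) S"
 by (induction k) (auto intro: smooth_const smooth_mult)

lemma smooth_compose:
 fixes f :: "'b::euclidean_space => 'c::real_normed_vector" and g :: "'a::euclidean_space => 'b"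
 shows "smooth_on f T ==> smooth_on g S ==> g ` S <= T ==> open S ==> open T
  ==> smooth_on (%x. f (g x)) S" unfolding smooth_on_def using Ck_on_compose by blast

lemma smooth_vec_lambda:
 fixes f :: "'i::finite => 'a::euclidean_space => real"
 assumes "!!i. smooth_on (f i) S" "open S"
 shows "smooth_on (%x. \<chi> i. f i x) S"
proof -
 have "smooth_on (%x. \<Sum>i\<in>UNIV. f i x .* axis i 1) S"
  by (intro smooth_sum smooth_scaleR smooth_const assms)
 moreover have "(\<chi> i. f i x) = (\<Sum>i\<in>UNIV. f i x .* axis i 1)" for x
  by (vector axis_def) (simp add: if_distrib cong: if_cong)
 ultimately show ?thesis by simp
qed

lemma smooth_Pair:
 fixes f :: "'a::euclidean_space => 'b::euclidean_space" and g :: "'a => 'c::euclidean_space"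
 assumes "smooth_on f S" "smooth_on g S" "open S"
 shows "smooth_on (%x. (f x, g x)) S"
proof -
 have "smooth_on (%x. (f x, 0) + (0, g x)) S"
  by (intro smooth_add smooth_linear[where L="%x. (x, 0)"] smooth_linear[where L="%x. (0, x)"]
    assms bounded_linear_Pair bounded_linear_ident bounded_linear_zero)
 thus ?thesis by simp
qed

lemma smooth_FD:
 "smooth_on f S ==> smooth_on (%x. FD f x v) S" unfolding smooth_on_def using Ck_on_SucD(2) by blast

lemma smooth_deriv:
 "smooth_on f S ==> x : S ==> (f has_derivative FD f x) (at x)"
 unfolding smooth_on_def using Ck_on_SucD(1) by blast

lemma smooth_cont: "smooth_on f S ==> continuous_on S f" unfolding smooth_on_def by (metis Ck_on.simps(1))

lemma smooth_real_inverse: "smooth_on (%x::real. inverse x) {x. x ~= 0}"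
proof -
 define F where "F j x = (-1) ^ j * fact j * inverse x ^ Suc j" for j and x :: real
 have "(F j has_real_derivative F (Suc j) x) (at x)" if "x ~= 0" for j x unfolding F_def
  using DERIV_cmult[OF DERIV_power[OF DERIV_inverse[OF that], where n="Suc j"], of "(-1) ^ j * fact j"]
  by (simp add: algebra_simps)
 moreover have "open {x::real. x ~= 0}" by (simp add: open_Collect_neq)
 ultimately have "Ck_on k (F 0) {x. x ~= 0}" for k by (intro Ck_on_deriv_sequence) auto
 moreover have "F 0 = inverse" by (auto simp: F_def)
 ultimately show ?thesis by (simp add: smooth_on_def)
qed

lemma smooth_inverse:
 fixes f :: "'a::euclidean_space => real"
 assumes "smooth_on f S" "!!x. x : S ==> f x ~= 0" "open S"
 shows "smooth_on (%x. inverse (f x)) S"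
 by (rule smooth_compose[OF smooth_real_inverse assms(1)]) (use assms in \<open>auto simp: open_Collect_neq\<close>)

lemma smooth_divide:
 fixes f g :: "'a::euclidean_space => real"
 assumes "smooth_on f S" "smooth_on g S" "!!x. x : S ==> g x ~= 0" "open S"
 shows "smooth_on (%x. f x / g x) S" unfolding divide_inverse by (intro smooth_mult smooth_inverse assms)

lemma smooth_powr: "smooth_on (%x::real. x powr a) {0<..}"
proof -
 define F where "F j x = (\<Prod>i<j. a - real i) * x powr (a - real j)" for j and x :: real
 have "(F j has_real_derivative F (Suc j) x) (at x)" if "x > 0" for j x unfolding F_def using that
  by (auto intro!: derivative_eq_intros DERIV_powr[where g="%x. x" and r=1]
    simp: field_simps powr_diff powr_add)
 hence "Ck_on k (F 0) {0<..}" for k by (intro Ck_on_deriv_sequence) auto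
 hence "smooth_on (F 0) {0<..}" by (simp add: smooth_on_def)
 thus ?thesis by (rule smooth_cong) (auto simp: F_def)
qed

lemma smooth_cos_sin: "smooth_on cos (UNIV::real set)" "smooth_on sin (UNIV::real set)"
proof -
 \<comment> \<open>Each derivative is a shift by a quarter turn; the phase \<open>c\<close> makes
   the same sequence serve for sine, which is a delayed cosine.\<close>
 define F where "F c j x = cos (x + c + real j * pi / 2)" for c j and x :: real
 have "(F c j has_real_derivative F c (Suc j) x) (at x)" for c j x
 proof -
  have "cos (x + c + real (Suc j) * pi / 2) = - sin (x + c + real j * pi / 2)"
   by (simp add: add_divide_distrib distrib_right cos_add sin_add)
  thus ?thesis unfolding F_def by (auto intro!: derivative_eq_intros)
 qed
 hence "Ck_on k (F c 0) UNIV" for c k by (intro Ck_on_deriv_sequence) auto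
 hence F: "smooth_on (F c 0) UNIV" for c by (simp add: smooth_on_def)
 have "F 0 0 = cos" by (auto simp: F_def)
 thus "smooth_on cos (UNIV::real set)" using F[of 0] by simp
 have "F (- (pi/2)) 0 = sin" by (auto simp: F_def cos_diff)
 thus "smooth_on sin (UNIV::real set)" using F[of "- (pi/2)"] by simp
qed

section \<open>A smooth step function\<close>

definition flat_exp :: "nat => real => real" where
 "flat_exp p x = (if x > 0 then inverse x ^ p * exp (- inverse x) else 0)"

lemma flat_exp_tendsto_0: "(flat_exp p \<longlongrightarrow> 0) (at 0)"
proof -
 have "((%x. inverse x ^ p / exp (inverse x)) \<longlongrightarrow> 0) (at_right (0::real))"
  by (rule filterlim_compose[OF tendsto_power_div_exp_0 filterlim_inverse_at_top_right])
 moreover have "\<forall>\<^sub>F x in at_right 0. inverse x ^ p / exp (inverse x) = flat_exp p x"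
  by (auto simp: eventually_at_right_field flat_exp_def exp_minus field_simps intro: exI[of _ 1])
 ultimately have R: "(flat_exp p \<longlongrightarrow> 0) (at_right 0)" by (rule Lim_transform_eventually)
 have "\<forall>\<^sub>F x in at_left 0. 0 = flat_exp p x"
  by (auto simp: eventually_at_left_field flat_exp_def intro: exI[of _ "-1"])
 hence "(flat_exp p \<longlongrightarrow> 0) (at_left 0)" by (rule Lim_transform_eventually[OF tendsto_const])
 thus ?thesis using R by (simp add: filterlim_split_at)
qed

text \<open>The span of the functions \<open>flat_exp p\<close> is closed under differentiation.
  This is why the negative powers are carried along: it makes the induction in
  \<open>smooth_flat_exp\<close> go through.\<close>

lemma flat_exp_DERIV:
 "(flat_exp p has_real_derivative flat_exp (p + 2) x - real p * flat_exp (p + 1) x) (at x)"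
proof (rule linorder_cases[of x 0])
 assume x: "x < 0"
 have "(flat_exp p has_real_derivative 0) (at x)"
  by (rule has_field_derivative_transform_within_open[where f="%x. 0" and S="{..<0}"])
    (use x in \<open>auto simp: flat_exp_def\<close>)
 thus ?thesis using x by (simp add: flat_exp_def)
next
 assume x: "x > 0"
 have *: "((%x. inverse x ^ p * exp (- inverse x)) has_real_derivative
   inverse x ^ (p + 2) * exp (- inverse x) - real p * (inverse x ^ (p + 1) * exp (- inverse x))) (at x)"
 proof -
  have "((%x. inverse x ^ p) has_real_derivative - (real p * inverse x ^ (p + 1))) (at x)"
   using DERIV_power[OF DERIV_inverse, of x p] x by (cases p) (simp_all add: algebra_simps)
  moreover have "((%x. exp (- inverse x)) has_real_derivative exp (- inverse x) * inverse x ^ 2) (at x)"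
   using x by (auto intro!: derivative_eq_intros simp: power2_eq_square)
  ultimately show ?thesis using DERIV_mult by (fastforce simp: algebra_simps power2_eq_square)
 qed
 have "(flat_exp p has_real_derivative
   inverse x ^ (p + 2) * exp (- inverse x) - real p * (inverse x ^ (p + 1) * exp (- inverse x))) (at x)"
  by (rule has_field_derivative_transform_within_open[OF *, where S="{0<..}"])
    (use x in \<open>auto simp: flat_exp_def\<close>)
 thus ?thesis using x by (simp add: flat_exp_def)
next
 assume x: "x = 0"
 \<comment> \<open>At 0 the difference quotient is \<open>flat_exp (Suc p)\<close> itself, so the
   limit is already known.\<close>
 have "((%h. (flat_exp p (0 + h) - flat_exp p 0) / h) \<longlongrightarrow> 0) (at 0)"
  by (rule Lim_transform_eventually[OF flat_exp_tendsto_0[of "Suc p"]])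
    (auto simp: eventually_at_filter flat_exp_def field_simps)
 thus ?thesis using x by (simp add: DERIV_def flat_exp_def)
qed

lemma smooth_flat_exp: "smooth_on (flat_exp p) UNIV"
proof -
 have "Ck_on k (flat_exp p) UNIV" for k
 proof (induction k arbitrary: p)
  case 0
  show ?case using flat_exp_DERIV by (auto intro!: continuous_at_imp_continuous_on DERIV_isCont)
 next
  case (Suc k)
  have "Ck_on k (%x. (flat_exp (p + 2) x + (- real p) * flat_exp (p + 1) x) * v) UNIV" for v
   by (intro Ck_on_linear[OF bounded_linear_mult_left] Ck_on_linear[OF bounded_linear_mult_right]
     Ck_on_add Suc open_UNIV)
  thus ?case by (intro Ck_on_SucI[OF flat_exp_DERIV[unfolded has_field_derivative_def]]) auto
 qed
 thus ?thesis by (simp add: smooth_on_def)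
qed

definition smooth_step :: "real => real" where
 "smooth_step x = flat_exp 0 x / (flat_exp 0 x + flat_exp 0 (1 - x))"

lemma smooth_step_simps:
 "x <= 0 ==> smooth_step x = 0" "1 <= x ==> smooth_step x = 1" by (auto simp: smooth_step_def flat_exp_def)

lemma smooth_step_bounds: "0 <= smooth_step x" "smooth_step x <= 1"
 by (auto simp: smooth_step_def flat_exp_def field_simps add_pos_pos)

lemma smooth_step_smooth: "smooth_on smooth_step UNIV"
proof -
 have "smooth_on (%x. flat_exp 0 (1 - x)) UNIV"
  by (rule smooth_compose[OF smooth_flat_exp smooth_diff[OF smooth_const smooth_ident]]) auto
 moreover have "flat_exp 0 x + flat_exp 0 (1 - x) ~= 0" for x
  by (auto simp: flat_exp_def add_pos_pos add_nonneg_eq_0_iff)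
 ultimately show ?thesis unfolding smooth_step_def by (intro smooth_divide smooth_add smooth_flat_exp) auto
qed

lemma smooth_step_o:
 "smooth_on f S ==> open S ==> smooth_on (%x. smooth_step (f x)) S"
 by (rule smooth_compose[OF smooth_step_smooth]) auto

section \<open>Symmetry of second derivatives\<close>

lemma line_derivative:
 fixes g :: "'a::euclidean_space => real"
 assumes "smooth_on g S" "y + s .* w : S"
 shows "((%s. g (y + s .* w)) has_real_derivative FD g (y + s .* w) w) (at s)"
proof -
 note D = smooth_deriv[OF assms]
 have "((%s. y + s .* w) has_derivative (%h. h .* w)) (at s)" by (auto intro!: derivative_eq_intros)
 from has_derivative_compose[OF this D] show ?thesis
  by (simp add: has_field_derivative_def linear_scale[OF has_derivative_linear[OF D]] mult_commute_abs)
qed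

text \<open>The mean value theorem is applied along \<open>u\<close> to the increment in direction
  \<open>v\<close>, and then along \<open>v\<close> to the derivative obtained.\<close>

lemma mixed_difference:
 fixes f :: "'a::euclidean_space => real"
 assumes f: "smooth_on f S" and h: "h > 0" and S: "!!a b. 0 <= a ==> a <= h ==> 0 <= b ==> b <= h ==> x + a .* u + b .* v : S"
 shows "EX a b. 0 <= a & a <= h & 0 <= b & b <= h & f (x + h .* u + h .* v) - f (x + h .* u) - f (x + h .* v) + f x
  = h * (h * FD (%y. FD f y u) (x + a .* u + b .* v) v)"
proof -
 let ?D = "%y. FD f y u"
 have e: "x + a .* u + b .* v = (x + b .* v) + a .* u" for a b by simp
 have "EX a>0. a < h & (f (x + h .* v + h .* u) - f (x + 0 .* v + h .* u)) - (f (x + h .* v + 0 .* u) - f (x + 0 .* v + 0 .* u))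
   = (h - 0) * (?D (x + h .* v + a .* u) - ?D (x + 0 .* v + a .* u))"
  by (rule MVT2[OF h]) (intro DERIV_diff line_derivative[OF f]; use h S S[of _ 0] in \<open>simp flip: e\<close>)
 then obtain a where a: "0 < a" "a < h" "f (x + h .* u + h .* v) - f (x + h .* u) - f (x + h .* v) + f x
   = h * (?D (x + a .* u + h .* v) - ?D (x + a .* u + 0 .* v))" by (auto simp: algebra_simps)
 have "EX b>0. b < h & ?D (x + a .* u + h .* v) - ?D (x + a .* u + 0 .* v) = (h - 0) * FD ?D (x + a .* u + b .* v) v"
  by (rule MVT2[OF h]) (rule line_derivative[OF smooth_FD[OF f]], use a S in auto)
 then obtain b where "0 < b" "b < h" "?D (x + a .* u + h .* v) - ?D (x + a .* u + 0 .* v) = h * FD ?D (x + a .* u + b .* v) v" by auto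
 thus ?thesis using a by (intro exI[of _ a] exI[of _ b]) simp
qed

text \<open>The second difference is symmetric in \<open>u\<close> and \<open>v\<close>. So the two
  mixed derivatives agree at suitable points near \<open>x\<close>, which by continuity excludes a
  gap at \<open>x\<close> itself.\<close>

lemma symmetric_second_derivative_real:
 fixes f :: "'a::euclidean_space => real"
 assumes f: "smooth_on f S" and S: "open S" "x : S"
 shows "FD (%y. FD f y u) x v = FD (%y. FD f y v) x u"
proof (rule ccontr)
 define D where "D u v y = FD (%y. FD f y u) y v" for u v y
 assume "~ ?thesis"
 then obtain e where e: "e > 0" "e <= \<bar>D u v x - D v u x\<bar> / 2" by (intro that[of "\<bar>D u v x - D v u x\<bar> / 2"]) (simp_all add: D_def)
 have "\<forall>\<^sub>F y in nhds x. \<bar>D u v y - D u v x\<bar> < e" for u v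
 proof -
  have "isCont (D u v) x" using smooth_cont[OF smooth_FD[OF smooth_FD[OF f]]] S
   by (simp add: D_def[abs_def] continuous_on_eq_continuous_at)
  hence "(D u v \<longlongrightarrow> D u v x) (nhds x)" by (simp add: isCont_def tendsto_at_iff_tendsto_nhds)
  thus ?thesis using e(1) by (simp add: tendsto_iff dist_real_def)
 qed
 hence "\<forall>\<^sub>F y in nhds x. y : S & \<bar>D u v y - D u v x\<bar> < e & \<bar>D v u y - D v u x\<bar> < e"
  using S by (intro eventually_conj) (simp_all add: eventually_nhds_in_open)
 then obtain d where d: "d > 0" "!!y. dist y x < d ==> y : S & \<bar>D u v y - D u v x\<bar> < e & \<bar>D v u y - D v u x\<bar> < e"
  unfolding eventually_nhds_metric by blast
 \<comment> \<open>With this side length the whole parallelogram spanned by \<open>h .* u\<close>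
   and \<open>h .* v\<close> stays within distance \<open>d\<close> of \<open>x\<close>.\<close>
 define h where "h = d / (norm u + norm v + 1)"
 have n: "norm u + norm v + 1 > 0" by (simp add: add_nonneg_pos)
 have h: "h > 0" using d(1) n by (simp add: h_def)
 have near: "dist (x + a .* u + b .* v) x < d" if "0 <= a" "a <= h" "0 <= b" "b <= h" for a b
 proof -
  have "norm (a .* u + b .* v) <= a * norm u + b * norm v" using norm_triangle_ineq[of "a .* u" "b .* v"] that by simp
  also have "... <= h * norm u + h * norm v" using that by (intro add_mono mult_right_mono) auto
  also have "... < h * (norm u + norm v + 1)" using h by (simp add: algebra_simps)
  finally show ?thesis using n by (simp add: h_def dist_norm add.assoc)
 qed
 have near': "dist (x + a .* v + b .* u) x < d" if "0 <= a" "a <= h" "0 <= b" "b <= h" for a b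
  using near[of b a] that by (simp add: add.commute add.left_commute)
 obtain a b where 1: "0 <= a" "a <= h" "0 <= b" "b <= h" "f (x + h .* u + h .* v) - f (x + h .* u) - f (x + h .* v) + f x = h * (h * D u v (x + a .* u + b .* v))"
  using mixed_difference[OF f h, of x u v] near d(2) unfolding D_def by blast
 obtain a' b' where 2: "0 <= a'" "a' <= h" "0 <= b'" "b' <= h" "f (x + h .* v + h .* u) - f (x + h .* v) - f (x + h .* u) + f x = h * (h * D v u (x + a' .* v + b' .* u))"
  using mixed_difference[OF f h, of x v u] near' d(2) unfolding D_def by blast
 have e3: "x + h .* v + h .* u = x + h .* u + h .* v" by simp
 have e4: "h * (h * D u v (x + a .* u + b .* v)) = h * (h * D v u (x + a' .* v + b' .* u))" using 1(5) 2(5)[unfolded e3] by linarith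
 show False using e4 h e(2) d(2)[OF near[OF 1(1-4)]] d(2)[OF near'[OF 2(1-4)]] by (simp add: abs_if split: if_splits)
qed

lemma FD_eqI:
 "(f has_derivative f') (at x) ==> FD f x a = f' a"
 using frechet_derivative_at[of f f' x] by simp

lemma schwarz:
 fixes f :: "'a::euclidean_space => 'b::euclidean_space"
 assumes f: "smooth_on f S" and S: "open S" "x : S"
 shows "FD (%y. FD f y u) x v
    = FD (%y. FD f y v) x u"
proof (rule euclidean_eqI)
 fix b :: 'b
 have i: "FD (%y. g y \<bullet> b) y w = FD g y w \<bullet> b" if "smooth_on g S" "y : S" for g :: "'a => 'b" and y w
  by (rule FD_eqI[OF has_derivative_inner_left[OF smooth_deriv[OF that]]])
 have "FD (%y. FD (%z. f z \<bullet> b) y u) x v = FD (%y. FD f y u) x v \<bullet> b" for u v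
  using FD_cong[OF S i[OF f]] i[OF smooth_FD[OF f] S(2)] by simp
 moreover have "smooth_on (%z. f z \<bullet> b) S" by (intro smooth_inner f smooth_const S)
 ultimately show "FD (%y. FD f y u) x v \<bullet> b
    = FD (%y. FD f y v) x u \<bullet> b"
  using symmetric_second_derivative_real[OF _ S] by metis
qed

section \<open>Forms in coordinates\<close>

definition form1 :: "'e::euclidean_space set => ('e => 'e => real) => bool" where
 "form1 S m \<longleftrightarrow> (ALL x:S. linear (m x)) & (ALL v. smooth_on (%x. m x v) S)"

definition d1 :: "('e::euclidean_space => 'e => real) => 'e => 'e => 'e => real" where
 "d1 m x a b = FD (%y. m y b) x a - FD (%y. m y a) x b"

lemma form1D:
 assumes "form1 S m"
 shows "x : S ==> linear (m x)" "smooth_on (%x. m x v) S"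
  "x : S ==> ((%x. m x v) has_derivative FD (%x. m x v) x) (at x)"
proof -
 show sm: "smooth_on (%x. m x v) S" using assms unfolding form1_def by blast
 show "x : S ==> linear (m x)" using assms unfolding form1_def by blast
 show "x : S ==> ((%x. m x v) has_derivative FD (%x. m x v) x) (at x)" by (rule smooth_deriv[OF sm])
qed

lemma form1_subset: "form1 S m ==> T <= S ==> form1 T m" unfolding form1_def using smooth_subset by blast

lemma one_form_expand:
 assumes "form1 S m" "x : S"
 shows "m x v = (\<Sum>b\<in>Basis. (v \<bullet> b) * m x b)"
proof -
 interpret linear "m x" using assms form1D(1) by blast
 show ?thesis by (subst euclidean_representation[symmetric, of v]) (simp only: sum scale real_scaleR_def)
qed

lemma one_form_derivative_expand:
 assumes "form1 S m" "open S" "x : S"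
 shows "FD (%y. m y v) x a
   = (\<Sum>b\<in>Basis. (v \<bullet> b) * FD (%y. m y b) x a)"
proof -
 have "((%y. \<Sum>b\<in>Basis. (v \<bullet> b) * m y b) has_derivative
   (%a. \<Sum>b\<in>Basis. (v \<bullet> b) * FD (%y. m y b) x a)) (at x)"
  by (intro has_derivative_sum has_derivative_mult_right form1D(3)[OF assms(1,3)])
 hence "((%y. m y v) has_derivative
   (%a. \<Sum>b\<in>Basis. (v \<bullet> b) * FD (%y. m y b) x a)) (at x)"
  by (rule has_derivative_transform_within_open[OF _ assms(2,3)])
    (simp add: one_form_expand[OF assms(1), symmetric])
 thus ?thesis by (rule FD_eqI)
qed

lemma linear_FD_form:
 assumes "form1 S m" "open S" "x : S"
 shows "linear (%v. FD (%y. m y v) x a)"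
proof -
 have "linear (%v. \<Sum>b\<in>Basis. (v \<bullet> b) * FD (%y. m y b) x a)"
  by (rule linearI) (simp_all add: inner_add_left distrib_right sum.distrib sum_distrib_left mult.assoc)
 thus ?thesis by (simp only: one_form_derivative_expand[OF assms, symmetric])
qed

lemma has_derivative_one_form_pairing:
 fixes fy g :: "'d::euclidean_space => 'e::euclidean_space"
 assumes m: "form1 T m" "open T" and "fy x : T"
  and fy: "(fy has_derivative fy') (at x)" and g: "(g has_derivative g') (at x)"
 shows "((%x. m (fy x) (g x)) has_derivative
   (%a. FD (%y. m y (g x)) (fy x) (fy' a) + m (fy x) (g' a))) (at x)"
proof -
 let ?D = "%b. FD (%y. m y b) (fy x)"
 obtain U where U: "open U" "x : U" "!!y. y : U ==> fy y : T"
  using has_derivative_continuous[OF fy, unfolded continuous_at_open, rule_format, of T] assms(2,3) by blast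
 have "((%x. \<Sum>b\<in>Basis. (g x \<bullet> b) * m (fy x) b) has_derivative
   (%a. \<Sum>b\<in>Basis. (g x \<bullet> b) * ?D b (fy' a) + (g' a \<bullet> b) * m (fy x) b)) (at x)"
  by (intro has_derivative_sum has_derivative_mult has_derivative_inner_left g
    has_derivative_compose[OF fy] form1D(3)[OF m(1) assms(3)])
 hence "((%x. m (fy x) (g x)) has_derivative
   (%a. \<Sum>b\<in>Basis. (g x \<bullet> b) * ?D b (fy' a) + (g' a \<bullet> b) * m (fy x) b)) (at x)"
  by (rule has_derivative_transform_within_open[OF _ U(1,2)])
    (use U(3) in \<open>auto simp: one_form_expand[OF m(1), symmetric]\<close>)
 thus ?thesis
  by (simp add: sum.distrib flip: one_form_derivative_expand[OF m(1,2) assms(3)] one_form_expand[OF m(1) assms(3)])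
qed

text \<open>Differentiating the pullback produces a term with the second derivative of
  \<open>fy\<close>; by \<open>schwarz\<close> it is symmetric and disappears in the
  antisymmetrisation.\<close>

lemma d1_natural:
 fixes fy :: "'d::euclidean_space => 'e::euclidean_space"
 assumes m: "form1 T m" "open T" and fy: "smooth_on fy S" "open S" "fy ` S <= T" and x: "x : S"
  and m': "!!y v. y : S ==> m' y v = m (fy y) (FD fy y v)"
 shows "d1 m' x a b = d1 m (fy x) (FD fy x a) (FD fy x b)"
proof -
 let ?M = "%y. FD fy y"
 have fyx: "fy x : T" using fy x by auto
 have "((%y. m' y v) has_derivative (%a. FD (%y. m y (?M x v)) (fy x) (?M x a)
    + m (fy x) (FD (%y. ?M y v) x a))) (at x)" for v
  by (rule has_derivative_transform_within_open[OF has_derivative_one_form_pairing[OF m fyx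
     smooth_deriv[OF fy(1) x]
     smooth_deriv[OF smooth_FD[OF fy(1)] x]] fy(2) x])
    (simp add: m')
 hence "FD (%y. m' y v) x a = FD (%y. m y (?M x v)) (fy x) (?M x a)
    + m (fy x) (FD (%y. ?M y v) x a)" for v a by (rule FD_eqI)
 thus ?thesis by (simp add: d1_def schwarz[OF fy(1,2) x, of a b])
qed

lemma d1_closed:
 assumes m: "form1 S m" "open S" "x : S"
 shows "FD (%y. d1 m y b c) x a - FD (%y. d1 m y a c) x b
   + FD (%y. d1 m y a b) x c = 0"
proof -
 let ?D = "%v a. FD (%y. m y v) x a"
 let ?D2 = "%v a b. FD (%y. FD (%y. m y v) y a) x b"
 have "((%y. d1 m y a b) has_derivative (%c. ?D2 b a c - ?D2 a b c)) (at x)" for a b unfolding d1_def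
  by (intro has_derivative_diff smooth_deriv[OF smooth_FD[OF form1D(2)[OF m(1)]] m(3)])
 hence "FD (%y. d1 m y a b) x c = ?D2 b a c - ?D2 a b c" for a b c by (rule FD_eqI)
 thus ?thesis using schwarz[OF form1D(2)[OF m(1)] m(2,3)] by simp
qed

lemma d1_add_scale:
 assumes "form1 S m" "form1 S m'" "x : S"
 shows "d1 (%y v. m y v + c * m' y v) x a b = d1 m x a b + c * d1 m' x a b"
proof -
 have "((%y. m y v + c * m' y v) has_derivative (%a. FD (%y. m y v) x a
   + c * FD (%y. m' y v) x a)) (at x)" for v
  by (intro has_derivative_add has_derivative_mult_right form1D(3)[OF assms(1,3)]
    form1D(3)[OF assms(2,3)])
 hence "FD (%y. m y v + c * m' y v) x a = FD (%y. m y v) x a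
   + c * FD (%y. m' y v) x a" for v a by (rule FD_eqI)
 thus ?thesis unfolding d1_def by (simp add: algebra_simps)
qed

lemma form1_add_scale:
 "form1 S m ==> form1 S m' ==> open S ==> form1 S (%x v. m x v + c * m' x v)" unfolding form1_def
 by (auto intro!: linear_compose_add linear_compose_scale_right[where 'b=real, unfolded real_scaleR_def]
   smooth_add smooth_linear[OF bounded_linear_mult_right])

lemma smooth_d1: "form1 S m ==> open S ==> smooth_on (%x. d1 m x a b) S"
 unfolding d1_def by (intro smooth_diff smooth_FD form1D(2))

lemma d1_linear:
 assumes "form1 S m" "open S" "x : S"
 shows "linear (%a. d1 m x a b)" "linear (%b. d1 m x a b)" unfolding d1_def
 using linear_FD_form[OF assms] has_derivative_linear[OF form1D(3)[OF assms(1,3)]]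
 by (auto intro!: linear_compose_sub)

lemma d1_skew: "d1 m x a b = - d1 m x b a" by (simp add: d1_def)

lemma d1_cong:
 assumes "open S" "x : S" "!!y v. y : S ==> m y v = m' y v"
 shows "d1 m x a b = d1 m' x a b"
 unfolding d1_def using FD_cong[OF assms(1,2), of "%y. m y v" "%y. m' y v" for v] assms(3) by simp

section \<open>Alternating covectors and volume forms\<close>

lemma altD:
 assumes "alternating_form k al"
 shows "(!!i. i < k ==> v i = w i) ==> al v = al w"
  "i < k ==> linear (%x. al (v(i := x)))"
  "i ~= j ==> i < k ==> j < k ==> v i = v j ==> al v = 0"
proof -
 show "(!!i. i < k ==> v i = w i) ==> al v = al w" using assms unfolding alternating_form_def by blast
 show "i < k ==> linear (%x. al (v(i := x)))" using assms unfolding alternating_form_def by blast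
 show "i ~= j ==> i < k ==> j < k ==> v i = v j ==> al v = 0"
  using assms unfolding alternating_form_def by (metis nat_neq_iff)
qed

lemma alternating_form_swap:
 assumes al: "alternating_form k al" and ij: "i ~= j" "i < k" "j < k"
 shows "al (v \<circ> Transposition.transpose i j) = - al v"
proof -
 define f where "f x y = al (v(i := x, j := y))" for x y
 have l1: "linear (f x)" for x unfolding f_def by (rule altD(2)[OF al ij(3)])
 have "f x y = al ((v(j := y))(i := x))" for x y using ij by (simp add: f_def fun_upd_twist)
 hence l2: "linear (%x. f x y)" for y using altD(2)[OF al ij(2), of "v(j := y)"] by simp
 have d: "f x x = 0" for x unfolding f_def by (rule altD(3)[OF al ij]) (use ij in auto)
 have "f (v i + v j) (v i + v j) = f (v i) (v i) + f (v i) (v j) + (f (v j) (v i) + f (v j) (v j))"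
  by (simp add: linear_add[OF l1] linear_add[OF l2])
 hence "f (v j) (v i) = - f (v i) (v j)" by (simp add: d)
 moreover have "v \<circ> Transposition.transpose i j = v(i := v j, j := v i)" "v = v(i := v i, j := v j)"
  by (auto simp: Transposition.transpose_def)
 ultimately show ?thesis unfolding f_def by metis
qed

lemma alternating_form_permute_zero:
 assumes al: "alternating_form k al" and "p permutes {..<k}" and "al v = 0"
 shows "al (v \<circ> p) = 0" using assms(2) finite_lessThan assms(3)
proof (induction p arbitrary: v rule: permutes_induct)
 case id
 thus ?case by simp
next
 case (swap a b p)
 have "al (v \<circ> Transposition.transpose a b) = 0"
  using alternating_form_swap[OF al, of a b v] swap by simp
 thus ?case using swap.IH[of "v \<circ> Transposition.transpose a b"] by (simp add: o_def)
qed

text \<open>By linearity the arguments can be replaced one at a time by vectors of the spanning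
  list. Once all are taken from it, either two coincide or they form a permutation of
  \<open>b\<close>.\<close>

lemma alternating_form_eq_zero:
 fixes al :: "'e::real_vector covector"
 assumes al: "alternating_form m al" and span: "span (b ` {..<m}) = UNIV" and b: "al b = 0"
 shows "al v = 0"
proof -
 \<comment> \<open>The first \<open>k\<close> entries are arbitrary, the others come from
   \<open>b\<close>; the case \<open>k = m\<close> is the claim.\<close>
 have step: "ALL v. (ALL i. k <= i & i < m --> v i : b ` {..<m}) --> al v = 0" if "k <= m" for k using that
 proof (induction k)
  case 0
  show ?case
  proof (intro allI impI)
   fix v assume v: "ALL i. 0 <= i & i < m --> v i : b ` {..<m}"
   hence "ALL i. EX j. i < m --> v i = b j & j < m" by auto
   then obtain f where f: "!!i. i < m ==> v i = b (f i) & f i < m" by metis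
   define p where "p i = (if i < m then f i else i)" for i
   have eq: "al v = al (b \<circ> p)" by (rule altD(1)[OF al]) (simp add: f p_def)
   show "al v = 0"
   proof (cases "inj_on p {..<m}")
    case True
    have "p ` {..<m} <= {..<m}" using f by (auto simp: p_def)
    hence "bij_betw p {..<m} {..<m}" using True by (simp add: bij_betw_def endo_inj_surj)
    hence "p permutes {..<m}" by (rule bij_imp_permutes) (simp add: p_def)
    thus ?thesis using alternating_form_permute_zero[OF al _ b] eq by (simp add: o_def)
   next
    case False
    then obtain i j where "i < m" "j < m" "i ~= j" "p i = p j" by (auto simp: inj_on_def)
    thus ?thesis unfolding eq by (intro altD(3)[OF al, of i j]) auto
   qed
  qed
 next
  case (Suc k)
  show ?case
  proof (intro allI impI)
   fix v assume v: "ALL i. Suc k <= i & i < m --> v i : b ` {..<m}"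
   have k: "k < m" using Suc.prems by simp
   have "v k : span (b ` {..<m})" using span by simp
   moreover have "subspace {x. al (v(k := x)) = 0}" by (rule linear_subspace_kernel[OF altD(2)[OF al k]])
   moreover have "al (v(k := x)) = 0" if "x : b ` {..<m}" for x
   proof -
    have "ALL i. k <= i & i < m --> (v(k := x)) i : b ` {..<m}" using v that by auto
    thus ?thesis using Suc.IH Suc.prems by simp
   qed
   ultimately have "al (v(k := v k)) = 0"
    using span_induct[of "v k" "b ` {..<m}" "%x. al (v(k := x)) = 0"] by blast
   thus "al v = 0" by simp
  qed
 qed
 show ?thesis using step[OF order_refl] by (meson not_le)
qed

lemma alternating_form_add_scale:
 "alternating_form k al ==> alternating_form k be ==> alternating_form k (%v. al v + c * be v)"
proof -
 assume al: "alternating_form k al" and be: "alternating_form k be"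
 show ?thesis unfolding alternating_form_def
 proof (intro conjI allI impI)
  show "al v + c * be v = al w + c * be w" if "ALL i<k. v i = w i" for v w
   using altD(1)[OF al, of v w] altD(1)[OF be, of v w] that by simp
  show "linear (%x. al (v(i := x)) + c * be (v(i := x)))" if "i < k" for i v
   using linear_compose_scale_right[OF altD(2)[OF be that], of c v]
   by (intro linear_compose_add altD(2)[OF al that]) simp
  show "al v + c * be v = 0" if "i < j & j < k & v i = v j" for i j v
   using altD(3)[OF al, of i j v] altD(3)[OF be, of i j v] that by simp
 qed
qed

text \<open>Composition with the transposition of two equal arguments permutes the summands and
  changes the sign of each, so the sum equals its negative.\<close>

lemma alternating_wedge:
 fixes al be :: "'e::real_vector covector"
 assumes al: "alternating_form k al" and be: "alternating_form l be"
 shows "alternating_form (k + l) (wedge k l al be)"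
proof -
 define P where "P = {si. si permutes {..<k+l}}"
 define f where "f v si = of_int (sign si) * al (%i. v (si i)) * be (%i. v (si (k + i)))"
  for v :: "nat => 'e" and si
 have w: "wedge k l al be v = (\<Sum>si\<in>P. f v si) / (fact k * fact l)" for v
  by (simp add: wedge_def f_def P_def)
 have lin: "linear (%x. f (v(j := x)) si)" if "j < k + l" "si : P" for v j si
 proof -
  have si: "si permutes {..<k+l}" using that by (simp add: P_def)
  \<comment> \<open>The position at which \<open>si\<close> reads argument \<open>j\<close>; it
    decides whether \<open>x\<close> enters \<open>al\<close> or \<open>be\<close>.\<close>
  define p where "p = inv si j"
  have p: "p < k + l" using permutes_in_image[OF permutes_inv[OF si]] that(1) by (simp add: p_def)
  have iff: "si i = j \<longleftrightarrow> i = p" for i using permutes_inverses[OF si] by (auto simp: p_def)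
  show ?thesis
  proof (cases "p < k")
   case True
   have 1: "(%i. (v(j := x)) (si i)) = (%i. v (si i))(p := x)" for x by (auto simp: iff)
   have 2: "(%i. (v(j := x)) (si (k + i))) = (%i. v (si (k + i)))" for x using True by (auto simp: iff)
   show ?thesis unfolding f_def 1 2
    using linear_compose_scale_right[OF altD(2)[OF al True, of "%i. v (si i)"],
      of "of_int (sign si) * be (%i. v (si (k + i)))"] by (simp add: mult_ac)
  next
   case False
   have "al (%i. (v(j := x)) (si i)) = al (%i. v (si i))" for x
    by (rule altD(1)[OF al]) (use False in \<open>auto simp: iff\<close>)
   moreover have "(%i. (v(j := x)) (si (k + i))) = (%i. v (si (k + i)))(p - k := x)" for x
    using False by (auto simp: iff fun_eq_iff)
   moreover have "p - k < l" using p False by simp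
   ultimately show ?thesis unfolding f_def
    using linear_compose_scale_right[OF altD(2)[OF be \<open>p - k < l\<close>, of "%i. v (si (k + i))"],
      of "of_int (sign si) * al (%i. v (si i))"] by simp
  qed
 qed
 have cong: "f v si = f w si" if "ALL i<k+l. v i = w i" "si : P" for v w si
 proof -
  have "si i < k + l" if "i < k + l" for i
   using permutes_in_image[of si "{..<k+l}" i] `si : P` that by (simp add: P_def)
  hence "al (%i. v (si i)) = al (%i. w (si i))" "be (%i. v (si (k + i))) = be (%i. w (si (k + i)))"
   using that(1) by (auto intro!: altD(1)[OF al] altD(1)[OF be])
  thus ?thesis by (simp add: f_def)
 qed
 have alt: "(\<Sum>si\<in>P. f v si) = 0" if ij: "i < j" "j < k + l" "v i = v j" for v i j
 proof -
  let ?t = "Transposition.transpose i j"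
  have t: "?t permutes {..<k+l}" by (rule permutes_swap_id) (use ij in auto)
  have vt: "v (?t x) = v x" for x using ij by (auto simp: Transposition.transpose_def)
  have "bij_betw (%si. ?t \<circ> si) P P" by (rule bij_betwI[where g="%si. ?t \<circ> si"])
     (auto simp: P_def o_assoc intro: permutes_compose[OF _ t])
  hence "(\<Sum>si\<in>P. f v si) = (\<Sum>si\<in>P. f v (?t \<circ> si))"
   by (rule sum.reindex_bij_betw[symmetric])
  also have "... = (\<Sum>si\<in>P. - f v si)"
  proof (rule sum.cong[OF refl])
   fix si assume "si : P"
   hence "permutation si" unfolding P_def using permutes_imp_permutation by blast
   hence "sign (?t \<circ> si) = - sign si"
    using ij by (simp add: sign_compose permutation_swap_id sign_swap_id)
   thus "f v (?t \<circ> si) = - f v si" by (simp add: f_def vt)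
  qed
  finally show ?thesis by (simp add: sum_negf)
 qed
 have fin: "finite P" by (simp add: P_def finite_permutations)
 show ?thesis unfolding alternating_form_def w
 proof (intro conjI allI impI)
  show "(\<Sum>si\<in>P. f v si) / (fact k * fact l) = (\<Sum>si\<in>P. f w si) / (fact k * fact l)"
   if "ALL i<k+l. v i = w i" for v w using cong[OF that] by simp
  show "linear (%x. (\<Sum>si\<in>P. f (v(i := x)) si) / (fact k * fact l))" if "i < k + l" for i v
  proof -
   have "linear (%x. \<Sum>si\<in>P. f (v(i := x)) si)"
    using lin[OF that] fin by (intro linear_compose_sum) auto
   from linear_compose_scale_right[OF this, of "inverse (fact k * fact l)"]
   show ?thesis by (simp add: field_simps)
  qed
  show "(\<Sum>si\<in>P. f v si) / (fact k * fact l) = 0" if "i < j & j < k + l & v i = v j" for i j v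
   using alt[of i j v] that by auto
 qed
qed

lemma alternating_wedge_power:
 assumes "alternating_form 2 omg" shows "alternating_form (2 * n) (wedge_power omg n)"
proof (induction n)
 case 0
 show ?case by (simp add: alternating_form_def linear_0 flip: linear_zero)
next
 case (Suc n)
 from alternating_wedge[OF assms Suc] show ?case by simp
qed

definition cov1 :: "('e => real) => 'e covector" where "cov1 l v = l (v 0)"
definition cov2 :: "('e => 'e => real) => 'e covector" where "cov2 w v = w (v 0) (v 1)"

definition skew_form :: "('e::real_vector => 'e => real) => bool" where
 "skew_form w \<longleftrightarrow> (ALL a. linear (w a)) & (ALL b. linear (%a. w a b)) & (ALL a b. w a b = - w b a)"

definition vol_form :: "nat => ('e => real) => ('e => 'e => real) => 'e covector" where
 "vol_form n l w = wedge 1 (2 * n) (cov1 l) (wedge_power (cov2 w) n)"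

lemma alternating_cov1: "linear l ==> alternating_form 1 (cov1 l)"
 by (auto simp: alternating_form_def cov1_def)

lemma alternating_cov2:
 assumes "skew_form w" shows "alternating_form 2 (cov2 w)"
proof -
 note w = assms[unfolded skew_form_def]
 have w0: "w a a = 0" for a using w by (metis neg_equal_zero)
 show ?thesis unfolding alternating_form_def cov2_def
 proof (intro conjI allI impI)
  show "w (v 0) (v 1) = w (u 0) (u 1)" if "ALL i<2. v i = u i" for u v :: "nat => 'a" using that by simp
  show "linear (%x. w ((v(i := x)) 0) ((v(i := x)) 1))" if "i < 2" for i and v :: "nat => 'a"
  proof -
   have "linear (w (v 0))" "linear (%x. w x (v 1))" using w by blast+
   moreover have "i = 0 | i = 1" using that by auto
   ultimately show ?thesis by (elim disjE) simp_all
  qed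
  show "w (v 0) (v 1) = 0" if "i < j & j < 2 & v i = v j" for i j and v :: "nat => 'a"
  proof -
   have ij: "i = 0" "j = 1" using that by auto
   have "v i = v j" using that by simp
   hence "v 0 = v 1" unfolding ij .
   thus ?thesis using w0[of "v 1"] by simp
  qed
 qed
qed

lemma alt_vol:
 assumes "linear l" "skew_form w" shows "alternating_form (2 * n + 1) (vol_form n l w)"
 using alternating_wedge[OF alternating_cov1[OF assms(1)] alternating_wedge_power[OF alternating_cov2[OF assms(2)]]]
 by (simp add: vol_form_def)

lemma permutes_ne:
 "si permutes {..<m} ==> i < m ==> si i < (m::nat)" using permutes_in_image[of si "{..<m}" i] by simp

lemma wedge_power_kernel_arg:
 assumes "skew_form w" "!!b. w a b = 0" "i < 2 * n" "v i = a"
 shows "wedge_power (cov2 w) n v = 0" using assms(3,4)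
proof (induction n arbitrary: v i)
 case (Suc n)
 have z: "w b a = 0" for b using assms(1,2) unfolding skew_form_def by (metis neg_0_equal_iff_equal)
 have "of_int (sign si) * cov2 w (%i. v (si i)) * wedge_power (cov2 w) n (%i. v (si (2 + i))) = 0"
  if si: "si permutes {..<2 + 2 * n}" for si
 proof -
  define j where "j = inv si i"
  have j: "j < 2 + 2 * n" "si j = i"
   using permutes_ne[OF permutes_inv[OF si], of i] permutes_inverses[OF si] Suc.prems by (auto simp: j_def)
  show ?thesis
  proof (cases "j < 2")
   case True
   thus ?thesis using j Suc.prems z assms(2) by (auto simp: cov2_def less_2_cases_iff)
  next
   case False
   hence "Suc (Suc (j - 2)) = j" by simp
   with False have "wedge_power (cov2 w) n (%i. v (si (2 + i))) = 0"
    using j Suc.prems by (intro Suc.IH[of "j - 2"]) auto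
   thus ?thesis by simp
  qed
 qed
 hence "(\<Sum>si | si permutes {..<2 + 2 * n}.
   of_int (sign si) * cov2 w (%i. v (si i)) * wedge_power (cov2 w) n (%i. v (si (2 + i)))) = 0"
  by (intro sum.neutral ballI) blast
 thus ?case unfolding wedge_power.simps wedge_def by (simp only: div_0)
qed simp

lemma vol_form_kernel_arg:
 assumes "skew_form w" "!!b. w a b = 0" "l a = 0" "i < 2 * n + 1" "v i = a"
 shows "vol_form n l w v = 0"
proof -
 have "of_int (sign si) * cov1 l (%i. v (si i)) * wedge_power (cov2 w) n (%i. v (si (1 + i))) = 0"
  if si: "si permutes {..<1 + 2 * n}" for si
 proof -
  define j where "j = inv si i"
  have j: "j < 1 + 2 * n" "si j = i"
   using permutes_ne[OF permutes_inv[OF si], of i] permutes_inverses[OF si] assms by (auto simp: j_def)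
  show ?thesis
  proof (cases "j = 0")
   case True
   thus ?thesis using j assms by (auto simp: cov1_def)
  next
   case False
   hence "wedge_power (cov2 w) n (%i. v (si (1 + i))) = 0"
    using j assms by (intro wedge_power_kernel_arg[OF assms(1,2), of "j - 1"]) auto
   thus ?thesis by simp
  qed
 qed
 hence "(\<Sum>si | si permutes {..<1 + 2 * n}.
   of_int (sign si) * cov1 l (%i. v (si i)) * wedge_power (cov2 w) n (%i. v (si (1 + i)))) = 0"
  by (intro sum.neutral ballI) blast
 thus ?thesis unfolding vol_form_def wedge_def by (simp only: div_0)
qed

lemma wedge_power_restrict:
 assumes "!!a b. a : S ==> b : S ==> w' a b = g * w a b" "!!i. i < 2 * n ==> v i : S"
 shows "wedge_power (cov2 w') n v = g ^ n * wedge_power (cov2 w) n v" using assms(2)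
proof (induction n arbitrary: v)
 case (Suc n)
 have "of_int (sign si) * cov2 w' (%i. v (si i)) * wedge_power (cov2 w') n (%i. v (si (2 + i)))
   = g ^ Suc n * (of_int (sign si) * cov2 w (%i. v (si i)) * wedge_power (cov2 w) n (%i. v (si (2 + i))))"
  if si: "si permutes {..<2 + 2 * n}" for si using permutes_ne[OF si] Suc
  by (subst Suc.IH) (auto simp: cov2_def assms(1))
 hence "(\<Sum>si | si permutes {..<2 + 2 * n}.
   of_int (sign si) * cov2 w' (%i. v (si i)) * wedge_power (cov2 w') n (%i. v (si (2 + i))))
  = g ^ Suc n * (\<Sum>si | si permutes {..<2 + 2 * n}.
   of_int (sign si) * cov2 w (%i. v (si i)) * wedge_power (cov2 w) n (%i. v (si (2 + i))))"
  unfolding sum_distrib_left by (intro sum.cong refl) blast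
 thus ?case unfolding wedge_power.simps wedge_def by (simp only: times_divide_eq_right)
qed simp

lemma skew_formD:
 assumes "skew_form w"
 shows "linear (w a)" "linear (%a. w a b)" "w a b = - w b a" "w a a = 0"
proof -
 show "linear (w a)" "linear (%a. w a b)" and 1: "w a b = - w b a" for a b
  using assms unfolding skew_form_def by blast+
 from 1[of a a] show "w a a = 0" by simp
qed

lemma enumerate_basis:
 fixes B :: "'e::euclidean_space set"
 assumes "finite B" "card B = m"
 obtains b where "bij_betw b {..<m} B"
 using ex_bij_betw_nat_finite[OF assms(1)] assms(2) by (auto simp: atLeast0LessThan)

text \<open>In a basis with a single vector outside the kernel of \<open>l\<close>, that vector must
  be consumed by \<open>l\<close>, and \<open>w\<close> is evaluated on the kernel only. Hence terms
  of \<open>w'\<close> that contain \<open>l\<close> do not affect the volume, as needed for the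
  differential of a multiple of a contact form.\<close>

lemma vol_form_restrict:
 fixes l l' :: "'e::euclidean_space => real"
 assumes dim: "DIM('e) = 2 * n + 1" and l: "linear l" "!!a. l' a = c * l a"
  and w: "skew_form w" "skew_form w'" "!!a b. l a = 0 ==> l b = 0 ==> w' a b = g * w a b"
 shows "vol_form n l' w' v = c * g ^ n * vol_form n l w v"
proof (cases "EX e. l e ~= 0")
 case False
 thus ?thesis using l(2) by (simp add: vol_form_def wedge_def cov1_def)
next
 case True
 then obtain e0 where e0: "l e0 ~= 0" by blast
 have l': "linear l'"
 proof -
  have "l' = (%a. c * l a)" using l(2) by auto
  thus ?thesis using linear_compose_scale_right[OF l(1), of c] by simp
 qed
 define K where "K = {x. l x = 0}"
 have subK: "subspace K" unfolding K_def by (rule linear_subspace_kernel[OF l(1)])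
 obtain Bk where Bk: "Bk <= K" "independent Bk" "K <= span Bk" "card Bk = dim K" using basis_exists by blast
 have finBk: "finite Bk" using Bk(2) independent_imp_finite by blast
 have e0K: "e0 ~: span Bk" using Bk(1) span_minimal[OF Bk(1) subK] e0 by (auto simp: K_def)
 define B where "B = insert e0 Bk"
 have indB: "independent B" unfolding B_def using independent_insertI[OF e0K Bk(2)] .
 have "x : span B" for x
 proof -
  have "x - (l x / l e0) .* e0 : K" using e0 by (simp add: K_def linear_diff[OF l(1)] linear_scale[OF l(1)])
  hence "x - (l x / l e0) .* e0 : span B" using Bk(3) span_mono[of Bk B] by (auto simp: B_def)
  moreover have "(l x / l e0) .* e0 : span B" by (simp add: B_def span_base span_scale)
  ultimately show ?thesis using span_add by fastforce
 qed
 hence spanB: "span B = UNIV" by blast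
 have cardB: "card B = 2 * n + 1" using dim_eq_card[of B UNIV] indB spanB dim by simp
 obtain b where b: "bij_betw b {..<2 * n + 1} B" using enumerate_basis[OF _ cardB] finBk by (auto simp: B_def)
 have "e0 : b ` {..<2 * n + 1}" using b by (simp add: bij_betw_def B_def)
 then obtain p where p: "p < 2 * n + 1" "b p = e0" by blast
 have bK: "b i : K" if "i < 2 * n + 1" "i ~= p" for i
 proof -
  have "b i ~= e0" using b p that unfolding bij_betw_def inj_on_def by (metis lessThan_iff)
  moreover have "b i : B" using b that by (auto simp: bij_betw_def)
  ultimately show ?thesis using Bk(1) by (auto simp: B_def)
 qed
 have "of_int (sign si) * cov1 l' (%i. b (si i)) * wedge_power (cov2 w') n (%i. b (si (1 + i)))
   = c * g ^ n * (of_int (sign si) * cov1 l (%i. b (si i)) * wedge_power (cov2 w) n (%i. b (si (1 + i))))"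
  if si: "si permutes {..<1 + 2 * n}" for si
 proof (cases "si 0 = p")
  case False
  hence "b (si 0) : K" using permutes_ne[OF si, of 0] by (intro bK) auto
  thus ?thesis using l(2) by (simp add: K_def cov1_def)
 next
  case True
  \<comment> \<open>The slot of the one-form is taken by \<open>e0\<close>, so all remaining
    arguments lie in the kernel.\<close>
  have "b (si (1 + i)) : K" if "i < 2 * n" for i
  proof (rule bK)
   show "si (1 + i) < 2 * n + 1" using permutes_ne[OF si, of "1 + i"] that by simp
   show "si (1 + i) ~= p" using True permutes_inj[OF si] by (metis add_is_0 injD one_neq_zero)
  qed
  hence "wedge_power (cov2 w') n (%i. b (si (1 + i))) = g ^ n * wedge_power (cov2 w) n (%i. b (si (1 + i)))"
   by (intro wedge_power_restrict[where S=K]) (auto simp: K_def w(3))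
  thus ?thesis by (simp add: cov1_def l(2))
 qed
 hence "(\<Sum>si | si permutes {..<1 + 2 * n}. of_int (sign si) * cov1 l' (%i. b (si i)) * wedge_power (cov2 w') n (%i. b (si (1 + i))))
   = c * g ^ n * (\<Sum>si | si permutes {..<1 + 2 * n}. of_int (sign si) * cov1 l (%i. b (si i)) * wedge_power (cov2 w) n (%i. b (si (1 + i))))"
  unfolding sum_distrib_left by (intro sum.cong refl) blast
 hence zero: "vol_form n l' w' b + (- (c * g ^ n)) * vol_form n l w b = 0"
  unfolding vol_form_def wedge_def by simp
 have "vol_form n l' w' v + (- (c * g ^ n)) * vol_form n l w v = 0"
  by (rule alternating_form_eq_zero[OF alternating_form_add_scale[OF
     alt_vol[OF l' w(2)] alt_vol[OF l(1) w(1)]] _ zero])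
    (use b spanB in \<open>simp add: bij_betw_def\<close>)
 thus ?thesis by simp
qed

text \<open>A non-zero vector annihilated by \<open>l\<close> and \<open>w\<close> could be
  completed to a basis, on which the volume would vanish; then it would vanish identically.\<close>

lemma vol_form_nonzero_imp_kernel:
 fixes l :: "'e::euclidean_space => real"
 assumes dim: "DIM('e) = 2 * n + 1" and l: "linear l" and w: "skew_form w"
  and "vol_form n l w v ~= 0" "!!b. w a b = 0" "l a = 0"
 shows "a = 0"
proof (rule ccontr)
 assume "a ~= 0"
 hence "independent {a}" by simp
 obtain B where B: "{a} <= B" "independent B" "UNIV <= span B"
  by (rule maximal_independent_subset_extend[OF subset_UNIV `independent {a}`])
 have card: "card B = 2 * n + 1" using dim_eq_card[of B UNIV] B dim by (simp add: top.extremum_uniqueI)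
 obtain b where b: "bij_betw b {..<2 * n + 1} B"
  using enumerate_basis[OF independent_imp_finite[OF B(2)] card] by blast
 have "a : b ` {..<2 * n + 1}" using b B(1) by (simp add: bij_betw_def)
 then obtain i where i: "i < 2 * n + 1" "b i = a" by blast
 have "span (b ` {..<2 * n + 1}) = UNIV" using b B(3) by (auto simp: bij_betw_def)
 from alternating_form_eq_zero[OF alt_vol[OF l w] this vol_form_kernel_arg[where i=i and a=a]]
 show False using assms i by blast
qed

lemma vol_form_linear_comp:
 "vol_form n (%a. l (M a)) (%a b. w (M a) (M b)) v = vol_form n l w (%i. M (v i))"
proof -
 have "wedge_power (cov2 (%a b. w (M a) (M b))) n v = wedge_power (cov2 w) n (%i. M (v i))" for v
  by (induction n arbitrary: v) (simp_all add: wedge_def cov2_def)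
 thus ?thesis by (simp add: vol_form_def wedge_def cov1_def)
qed

lemma vol_form_tendsto:
 assumes "!!i. ((%x. l x (v i)) \<longlongrightarrow> l0 (v i)) F" "!!i j. ((%x. w x (v i) (v j)) \<longlongrightarrow> w0 (v i) (v j)) F"
 shows "((%x. vol_form n (l x) (w x) v) \<longlongrightarrow> vol_form n l0 w0 v) F"
proof -
 have "((%x. wedge_power (cov2 (w x)) n (%i. v (s i))) \<longlongrightarrow> wedge_power (cov2 w0) n (%i. v (s i))) F" for s
 proof (induction n arbitrary: s)
  case (Suc n)
  show ?case unfolding wedge_power.simps wedge_def cov2_def
   by (intro tendsto_intros assms Suc[unfolded cov2_def]) auto
 qed simp
 thus ?thesis unfolding vol_form_def wedge_def cov1_def by (intro tendsto_intros assms) auto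
qed

lemma std_basis_image: "std_basis ` {..<CARD('m)} = (Basis :: (real ^ 'm::{finite,linorder}) set)"
proof -
 let ?xs = "sorted_list_of_set (UNIV :: 'm set)"
 have len: "length ?xs = CARD('m)" by simp
 have "(%i. ?xs ! i) ` {..<CARD('m)} = UNIV"
 proof -
  have "(%i. ?xs ! i) ` {..<length ?xs} = set ?xs" by (auto simp: set_conv_nth)
  thus ?thesis by simp
 qed
 hence "(%i. axis i (1::real)) ` ((%i. ?xs ! i) ` {..<CARD('m)}) = range (%i::'m. axis i (1::real))" by simp
 hence "std_basis ` {..<CARD('m)} = range (%i::'m. axis i (1::real))" unfolding std_basis_def image_image .
 thus ?thesis by (auto simp: Basis_vec_def)
qed

lemma span_std_basis: "span (std_basis ` {..<CARD('m)}) = (UNIV :: (real ^ 'm::{finite,linorder}) set)"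
 by (simp only: std_basis_image span_Basis)

text \<open>A skew matrix of odd size satisfies det A = - det A, so it is singular.\<close>

lemma skew_form_odd_kernel:
 fixes w :: "real ^ 'm => real ^ 'm => real"
 assumes w: "skew_form w" and odd: "odd CARD('m::finite)"
 obtains a where "a ~= 0" "!!b. w a b = 0"
proof -
 define A :: "real ^ 'm ^ 'm" where "A = (\<chi> i j. w (axis i 1) (axis j 1))"
 have ws: "w a b = - w b a" for a b using w unfolding skew_form_def by blast
 have "Finite_Cartesian_Product.transpose A $ i $ j = (\<chi> i. (-1) *s (A $ i)) $ i $ j" for i j
  using ws[of "axis j 1" "axis i 1"] by (simp add: A_def Finite_Cartesian_Product.transpose_def)
 hence tr: "Finite_Cartesian_Product.transpose A = (\<chi> i. (-1) *s (A $ i))" unfolding vec_eq_iff by blast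
 have "det A = det (\<chi> i. (-1) *s (A $ i))" unfolding tr[symmetric] by (rule det_transpose[symmetric])
 also have "... = (\<Prod>i\<in>(UNIV::'m set). - 1) * det (\<chi> i. A $ i)" by (rule det_rows_mul)
 finally have "det A = (\<Prod>i\<in>(UNIV::'m set). - 1) * det A" by simp
 hence "det A = 0" using odd by simp
 hence "~ invertible A" by (simp add: invertible_det_nz)
 then obtain x where x: "x ~= 0" "A *v x = 0"
  using matrix_left_invertible_ker[of A] invertible_left_inverse[of A] by blast
 have lin: "linear (w b)" for b by (rule skew_formD[OF w])
 have 0: "w (axis i 1) x = 0" for i
 proof -
  have "w (axis i 1) x = w (axis i 1) (\<Sum>j\<in>UNIV. x $ j .* axis j 1)"
   by (simp add: basis_expansion scalar_mult_eq_scaleR[symmetric])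
  also have "... = (\<Sum>j\<in>UNIV. x $ j * w (axis i 1) (axis j 1))"
   by (simp add: linear_sum[OF lin] linear_scale[OF lin])
  also have "... = (A *v x) $ i" by (simp add: A_def matrix_vector_mult_def mult.commute)
  finally show ?thesis using x by simp
 qed
 have "w x b = 0" for b
 proof -
  have "linear (w x)" by (rule lin)
  moreover have "w x (axis i 1) = 0" for i using 0[of i] ws[of x "axis i 1"] by simp
  ultimately have "w x (\<Sum>j\<in>UNIV. b $ j .* axis j 1) = 0" by (simp add: linear_sum linear_scale)
  thus ?thesis by (simp add: basis_expansion scalar_mult_eq_scaleR[symmetric])
 qed
 thus ?thesis using that x(1) by blast
qed

lemma vol_form_nonzero_reeb:
 fixes w :: "real ^ 'm => real ^ 'm => real"
 assumes m: "CARD('m::finite) = 2 * n + 1" and l: "linear l" and w: "skew_form w" and v: "vol_form n l w v ~= 0"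
 obtains R where "l R = 1" "!!b. w R b = 0" "!!a. (!!b. w a b = 0) ==> a = l a .* R"
proof -
 have DIM: "DIM(real ^ 'm) = 2 * n + 1" using m by simp
 obtain a where a: "a ~= 0" "!!b. w a b = 0"
  using skew_form_odd_kernel[OF w] m by (metis even_plus_one_iff even_mult_iff even_numeral)
 have la: "l a ~= 0" using vol_form_nonzero_imp_kernel[OF DIM l w v a(2)] a(1) by blast
 define R where "R = (1 / l a) .* a"
 have lw: "linear (%a. w a b)" for b by (rule skew_formD[OF w])
 have R: "l R = 1" "!!b. w R b = 0"
  using la a(2) by (simp_all add: R_def linear_scale[OF l] linear_scale[OF lw])
 have "x = l x .* R" if "!!b. w x b = 0" for x
 proof -
  have "x - l x .* R = 0" by (rule vol_form_nonzero_imp_kernel[OF DIM l w v])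
     (simp_all add: linear_diff[OF l] linear_scale[OF l] linear_diff[OF lw] linear_scale[OF lw] R that)
  thus ?thesis by simp
 qed
 thus ?thesis using that R by blast
qed

lemma vol_form_nonzero_dim_kernel:
 fixes w :: "real ^ 'm => real ^ 'm => real"
 assumes "CARD('m::finite) = 2 * n + 1" "linear l" "skew_form w" "vol_form n l w v ~= 0"
 shows "dim {a. ALL b. w a b = 0} = 1"
proof -
 obtain R where R: "l R = 1" "!!b. w R b = 0" "!!a. (!!b. w a b = 0) ==> a = l a .* R"
  using vol_form_nonzero_reeb[OF assms] by blast
 have lw: "linear (%a. w a b)" for b by (rule skew_formD[OF assms(3)])
 have "R ~= 0" using R(1) linear_0[OF assms(2)] by auto
 have "{a. ALL b. w a b = 0} = span {R}"
 proof (intro set_eqI iffI)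
  fix a assume "a : {a. ALL b. w a b = 0}"
  hence "a = l a .* R" using R(3) by blast
  thus "a : span {R}" unfolding span_singleton by blast
 next
  fix a assume "a : span {R}"
  thus "a : {a. ALL b. w a b = 0}" unfolding span_singleton using R(2) by (auto simp: linear_scale[OF lw])
 qed
 thus ?thesis using `R ~= 0` by simp
qed

lemma skew_form_linear_comp: "skew_form w ==> linear M ==> skew_form (%a b. w (M a) (M b))"
 unfolding skew_form_def
 using linear_compose[of M "w a" for a] linear_compose[of M "%a. w a b" for b] unfolding o_def by blast

lemma vol_form_comp_nonzero:
 fixes M N :: "(real, 'm::{finite,linorder}) vec => (real, 'm) vec"
 assumes m: "CARD('m) = 2 * n + 1" and l: "linear l" and w: "skew_form w"
  and v: "vol_form n l w std_basis ~= 0" and M: "linear M" "!!x. N (M x) = x" "!!x. M (N x) = x" "linear N"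
 shows "vol_form n (%a. l (M a)) (%a b. w (M a) (M b)) std_basis ~= 0"
proof
 let ?l = "%a. l (M a)" and ?w = "%a b. w (M a) (M b)"
 assume 0: "vol_form n ?l ?w std_basis = 0"
 have "linear ?l" using linear_compose[OF M(1) l] by (simp only: o_def)
 hence alt: "alternating_form (2 * n + 1) (vol_form n ?l ?w)"
  by (rule alt_vol[OF _ skew_form_linear_comp[OF w M(1)]])
 have span: "span (std_basis ` {..<2 * n + 1}) = (UNIV :: (real, 'm) vec set)"
  unfolding m[symmetric] by (rule span_std_basis)
 have "vol_form n ?l ?w (%i. N (std_basis i)) = 0" by (rule alternating_form_eq_zero[OF alt span 0])
 thus False using v unfolding vol_form_linear_comp M(3) by blast
qed

section \<open>Stable Hamiltonian structures in charts\<close>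

locale oriented_mf =
 fixes X :: "'a topology" and A :: "('a, 'm::{finite,linorder}) chart set"
 assumes om: "oriented_manifold X A"
begin

lemma chart: "c : A ==> is_chart X c" using om by (simp add: oriented_manifold_def)

lemma open_cimg: "c : A ==> open (cimg c)" using chart by (simp add: is_chart_def)

lemma openin_cdom: "c : A ==> openin X (cdom c)" using chart by (simp add: is_chart_def)

lemma cmap_inj: "c : A ==> inj_on (cmap c) (cdom c)"
 using chart[of c] openin_subset[of X "cdom c"] unfolding is_chart_def
 by (metis homeomorphic_imp_injective_map topspace_subtopology_subset)

lemma cinv_in: "x : cimg c ==> cinv c x : cdom c" unfolding cimg_def cinv_def by (rule inv_into_into)

lemma cmap_cinv: "x : cimg c ==> cmap c (cinv c x) = x" unfolding cimg_def cinv_def by (rule f_inv_into_f)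

lemma cinv_cmap: "c : A ==> p : cdom c ==> cinv c (cmap c p) = p"
 unfolding cinv_def by (rule inv_into_f_f[OF cmap_inj])

lemma cmap_in: "p : cdom c ==> cmap c p : cimg c" by (simp add: cimg_def)

lemma overlap_iff: "c : A ==> x : overlap c d \<longleftrightarrow> x : cimg c & cinv c x : cdom d"
 unfolding overlap_def using cmap_cinv cinv_cmap cinv_in cmap_in by (smt (verit) IntE IntI image_iff)

lemma continuous_cinv:
 assumes "c : A" shows "continuous_map (top_of_set (cimg c)) X (cinv c)"
proof -
 obtain g where g: "homeomorphic_maps (subtopology X (cdom c)) (top_of_set (cimg c)) (cmap c) g"
  using chart[OF assms] unfolding is_chart_def homeomorphic_map_maps by blast
 have cdom: "topspace (subtopology X (cdom c)) = cdom c" using openin_subset[OF openin_cdom[OF assms]] by auto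
 have "g y = cinv c y" if y: "y : cimg c" for y
 proof -
  have "g (cmap c (cinv c y)) = cinv c y" using g cinv_in[OF y] cdom unfolding homeomorphic_maps_def by blast
  thus ?thesis by (simp add: cmap_cinv[OF y])
 qed
 moreover have "continuous_map (top_of_set (cimg c)) X g"
  using g unfolding homeomorphic_maps_def continuous_map_in_subtopology by blast
 ultimately show ?thesis by (rule_tac continuous_map_eq[of _ _ g]) auto
qed

lemma open_cinv_vimage:
 assumes "c : A" "openin X U" shows "open {x : cimg c. cinv c x : U}"
proof -
 have "openin (top_of_set (cimg c)) {x : topspace (top_of_set (cimg c)). cinv c x : U}"
  by (rule openin_continuous_map_preimage[OF continuous_cinv assms(2)]) (rule assms)
 thus ?thesis using openin_open_trans[OF _ open_cimg[OF assms(1)]] by simp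
qed

lemma open_overlap:
 assumes "c : A" "d : A" shows "open (overlap c d)"
proof -
 have "overlap c d = {x : cimg c. cinv c x : cdom d}" using overlap_iff[OF assms(1)] by blast
 thus ?thesis using open_cinv_vimage[OF assms(1) openin_cdom[OF assms(2)]] by simp
qed

lemma transition_in: "c : A ==> d : A ==> x : overlap c d ==> transition c d x : overlap d c"
 by (auto simp: overlap_iff transition_def cinv_cmap cmap_in cinv_in)

lemma transition_inverse: "c : A ==> d : A ==> x : overlap c d ==> transition d c (transition c d x) = x"
 by (auto simp: overlap_iff transition_def cinv_cmap cmap_cinv)

lemma transition_cocycle:
 "c : A ==> d : A ==> x : overlap c d ==> transition d e (transition c d x) = transition c e x"
 by (auto simp: overlap_iff transition_def cinv_cmap)

lemma smooth_transition: "c : A ==> d : A ==> smooth_on (transition c d) (overlap c d)"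
 using om by (simp add: oriented_manifold_def)

lemma trans_deriv:
 "c : A ==> d : A ==> x : overlap c d ==>
  (transition c d has_derivative FD (transition c d) x) (at x)" using smooth_deriv[OF smooth_transition] .

lemma linear_trans_deriv:
 "c : A ==> d : A ==> x : overlap c d ==> linear (FD (transition c d) x)"
 using has_derivative_linear[OF trans_deriv] .

lemma transition_derivative_cocycle:
 assumes c: "c : A" "d : A" "e : A" "x : overlap c d" "x : overlap c e"
 shows "FD (transition d e) (transition c d x) (FD (transition c d) x v)
   = FD (transition c e) x v"
proof -
 have "cinv d (transition c d x) = cinv c x" and "transition c d x : cimg d"
  using c by (auto simp: overlap_iff transition_def cinv_cmap cmap_in)
 hence 1: "transition c d x : overlap d e" using c by (auto simp: overlap_iff)
 have "((%y. transition d e (transition c d y)) has_derivative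
   (%v. FD (transition d e) (transition c d x) (FD (transition c d) x v))) (at x)"
  by (rule has_derivative_compose[OF trans_deriv[OF c(1,2,4)] trans_deriv[OF c(2,3) 1]])
 hence "(transition c e has_derivative
   (%v. FD (transition d e) (transition c d x) (FD (transition c d) x v))) (at x)"
  by (rule has_derivative_transform_within_open[OF _ open_overlap[OF c(1,2)] c(4)])
    (simp add: transition_cocycle[OF c(1,2)])
 thus ?thesis by (rule FD_eqI[symmetric])
qed

lemma trans_self: "c : A ==> x : cimg c ==> x : overlap c c & transition c c x = x"
 by (auto simp: overlap_iff cinv_in transition_def cmap_cinv)

lemma transition_self_derivative:
 assumes "c : A" "x : cimg c" shows "FD (transition c c) x v = v"
proof -
 have "((%y. y) has_derivative (%v. v)) (at x)" by simp
 hence "(transition c c has_derivative (%v. v)) (at x)"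
  by (rule has_derivative_transform_within_open[OF _ open_cimg[OF assms(1)] assms(2)])
    (use trans_self[OF assms(1)] in auto)
 thus ?thesis by (rule FD_eqI)
qed

lemma trans_deriv_inv:
 assumes "c : A" "d : A" "x : overlap c d"
 shows "FD (transition d c) (transition c d x) (FD (transition c d) x v) = v"
proof -
 have "x : cimg c" using assms overlap_iff by blast
 thus ?thesis using transition_derivative_cocycle[OF assms(1,2,1,3)] trans_self[OF assms(1)]
   transition_self_derivative[OF assms(1)] by simp
qed

text \<open>A compact set in a chart is closed in the Hausdorff space \<open>X\<close>, so every
  other chart sees its complement as an open set. This makes the extension by zero of a compactly
  supported form smooth.\<close>

lemma open_complement_support:
 assumes c: "c : A" "d : A" and K: "compact K" "K <= cimg c"
 shows "open {y : cimg d. ~ (y : overlap d c & transition d c y : K)}"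
proof -
 have "compactin (top_of_set (cimg c)) K" using K by (simp add: compactin_subtopology)
 hence "compactin X (cinv c ` K)" using image_compactin continuous_cinv[OF c(1)] by blast
 hence "closedin X (cinv c ` K)" using om compactin_imp_closedin unfolding oriented_manifold_def by blast
 hence "openin X (topspace X - cinv c ` K)" by blast
 from open_cinv_vimage[OF c(2) this]
 have "open {y : cimg d. cinv d y : topspace X - cinv c ` K}" .
 moreover have "cinv d y : topspace X - cinv c ` K \<longleftrightarrow> ~ (y : overlap d c & transition d c y : K)"
  if y: "y : cimg d" for y
 proof -
  have "cinv d y : topspace X" using cinv_in[OF y] openin_subset[OF openin_cdom[OF c(2)]] by blast
  moreover have "cinv d y : cinv c ` K \<longleftrightarrow> y : overlap d c & transition d c y : K"
  proof
   assume "cinv d y : cinv c ` K"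
   then obtain k where k: "k : K" "cinv d y = cinv c k" by blast
   hence "k : cimg c" using K by blast
   thus "y : overlap d c & transition d c y : K"
    using cinv_in[of k c] cmap_cinv[of k c] y c k by (simp add: overlap_iff transition_def)
  next
   assume *: "y : overlap d c & transition d c y : K"
   hence "cinv c (transition d c y) = cinv d y" using c by (simp add: overlap_iff transition_def cinv_cmap)
   thus "cinv d y : cinv c ` K" using * by (metis imageI)
  qed
  ultimately show ?thesis by blast
 qed
 hence "{y : cimg d. cinv d y : topspace X - cinv c ` K}
   = {y : cimg d. ~ (y : overlap d c & transition d c y : K)}" by blast
 ultimately show ?thesis by simp
qed

end

section \<open>Local representatives as linear and bilinear maps\<close>

definition lc1 :: "('a, 'm::finite) form => ('a, 'm) chart => real ^ 'm => real ^ 'm => real" where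
 "lc1 al c x v = al c x (%_. v)"

definition lc2 :: "('a, 'm::finite) form => ('a, 'm) chart => real ^ 'm => real ^ 'm => real ^ 'm => real" where
 "lc2 al c x a b = al c x (pair_seq a b)"

definition closed2_at :: "('e::euclidean_space => 'e => 'e => real) => 'e => bool" where
 "closed2_at w x \<longleftrightarrow> (ALL a b c. FD (%y. w y b c) x a
   - FD (%y. w y a c) x b + FD (%y. w y a b) x c = 0)"

lemma smooth_formD:
 assumes "smooth_form A k al"
 shows "c : A ==> x : cimg c ==> alternating_form k (al c x)"
  "c : A ==> smooth_on (%x. al c x v) (cimg c)"
  "c : A ==> d : A ==> x : overlap c d ==>
    al c x v = al d (transition c d x) (%i. FD (transition c d) x (v i))"
  "~ (c : A & x : cimg c) ==> al c x v = 0" using assms unfolding smooth_form_def by blast+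

lemma smooth_lc1:
 assumes "smooth_form A 1 al" "c : A"
 shows "form1 (cimg c) (lc1 al c)" "x : cimg c ==> al c x = cov1 (lc1 al c x)"
proof -
 have lin: "linear (lc1 al c x)" and eq: "al c x = cov1 (lc1 al c x)" if x: "x : cimg c" for x
 proof -
  note alt = smooth_formD(1)[OF assms x]
  show "al c x = cov1 (lc1 al c x)" by (rule ext) (auto simp: cov1_def lc1_def intro!: altD(1)[OF alt])
  have "al c x ((%_. 0)(0 := v)) = lc1 al c x v" for v unfolding lc1_def by (rule altD(1)[OF alt]) simp
  thus "linear (lc1 al c x)" using altD(2)[OF alt, of 0 "%_. 0"] by simp
 qed
 show "form1 (cimg c) (lc1 al c)"
  unfolding form1_def using lin smooth_formD(2)[OF assms] by (simp add: lc1_def)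
 show "x : cimg c ==> al c x = cov1 (lc1 al c x)" by (rule eq)
qed

lemma smooth_lc2:
 assumes "smooth_form A 2 al" "c : A"
 shows "x : cimg c ==> skew_form (lc2 al c x)" "smooth_on (%x. lc2 al c x a b) (cimg c)"
  "x : cimg c ==> al c x = cov2 (lc2 al c x)"
proof -
 show "smooth_on (%x. lc2 al c x a b) (cimg c)" using smooth_formD(2)[OF assms] by (simp add: lc2_def)
 assume x: "x : cimg c"
 note alt = smooth_formD(1)[OF assms x]
 show "al c x = cov2 (lc2 al c x)"
  by (rule ext) (auto simp: cov2_def lc2_def pair_seq_def less_2_cases_iff intro!: altD(1)[OF alt])
 show "skew_form (lc2 al c x)" unfolding skew_form_def
 proof (intro conjI allI)
  fix a b
  have 0: "al c x ((pair_seq v b)(0 := v')) = lc2 al c x v' b" for v v' b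
   unfolding lc2_def by (rule altD(1)[OF alt]) (auto simp: pair_seq_def)
  have 1: "al c x ((pair_seq a v)(1 := v')) = lc2 al c x a v'" for v v' a
   unfolding lc2_def by (rule altD(1)[OF alt]) (auto simp: pair_seq_def)
  show "linear (lc2 al c x a)" using altD(2)[OF alt, of 1 "pair_seq a a"] 1 by simp
  show "linear (%a. lc2 al c x a b)" using altD(2)[OF alt, of 0 "pair_seq a b"] 0 by simp
  have "al c x (pair_seq a b \<circ> Transposition.transpose 0 1) = - al c x (pair_seq a b)"
   by (rule alternating_form_swap[OF alt]) auto
  moreover have "al c x (pair_seq a b \<circ> Transposition.transpose 0 1) = al c x (pair_seq b a)"
   by (rule altD(1)[OF alt]) (auto simp: pair_seq_def Transposition.transpose_def less_2_cases_iff)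
  ultimately show "lc2 al c x a b = - lc2 al c x b a" by (simp add: lc2_def)
 qed
qed

lemma lc1_transition:
 assumes "smooth_form A 1 al" "c : A" "d : A" "x : overlap c d"
 shows "lc1 al c x v = lc1 al d (transition c d x) (FD (transition c d) x v)"
 using smooth_formD(3)[OF assms] by (simp add: lc1_def)

lemma lc2_transition:
 assumes "smooth_form A 2 al" "c : A" "d : A" "x : overlap c d"
 shows "lc2 al c x a b = lc2 al d (transition c d x) (FD (transition c d) x a)
   (FD (transition c d) x b)"
proof -
 have "(%i. FD (transition c d) x (pair_seq a b i))
   = pair_seq (FD (transition c d) x a) (FD (transition c d) x b)" by (auto simp: pair_seq_def)
 thus ?thesis using smooth_formD(3)[OF assms, of "pair_seq a b"] by (simp add: lc2_def)
qed

lemma smooth_form1I: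
 assumes "!!c. c : A ==> form1 (cimg c) (m c)"
  and "!!c d x v. c : A ==> d : A ==> x : overlap c d ==>
   m c x v = m d (transition c d x) (FD (transition c d) x v)"
  and "!!c d x. c : A ==> d : A ==> x : overlap c d ==> x : cimg c & transition c d x : cimg d"
  and "!!c. c : A ==> open (cimg c)"
 shows "smooth_form A 1 (%c x v. if c : A & x : cimg c then m c x (v 0) else 0)" unfolding smooth_form_def
proof (intro conjI ballI allI impI)
 fix c assume c: "c : A"
 show "alternating_form 1 (%v. if c : A & x : cimg c then m c x (v 0) else 0)" if "x : cimg c" for x
  using alternating_cov1[OF form1D(1)[OF assms(1)[OF c] that]] c that by (simp add: cov1_def[abs_def])
 show "smooth_on (%x. if c : A & x : cimg c then m c x (v 0) else 0) (cimg c)" for v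
  by (rule smooth_cong[OF form1D(2)[OF assms(1)[OF c]]]) (use c assms(4) in auto)
qed (use assms(2,3) in auto)

lemma smooth_form2I:
 assumes "!!c x. c : A ==> x : cimg c ==> skew_form (w c x)"
  and "!!c a b. c : A ==> smooth_on (%x. w c x a b) (cimg c)"
  and "!!c d x a b. c : A ==> d : A ==> x : overlap c d ==>
   w c x a b = w d (transition c d x) (FD (transition c d) x a)
    (FD (transition c d) x b)"
  and "!!c d x. c : A ==> d : A ==> x : overlap c d ==> x : cimg c & transition c d x : cimg d"
  and "!!c. c : A ==> open (cimg c)"
 shows "smooth_form A 2 (%c x v. if c : A & x : cimg c then w c x (v 0) (v 1) else 0)"
 unfolding smooth_form_def
proof (intro conjI ballI allI impI)
 fix c assume c: "c : A"
 show "alternating_form 2 (%v. if c : A & x : cimg c then w c x (v 0) (v 1) else 0)" if "x : cimg c" for x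
  using alternating_cov2[OF assms(1)[OF c that]] c that by (simp add: cov2_def[abs_def])
 show "smooth_on (%x. if c : A & x : cimg c then w c x (v 0) (v 1) else 0) (cimg c)" for v
  by (rule smooth_cong[OF assms(2)[OF c]]) (use c assms(5) in auto)
qed (use assms(3,4) in auto)

lemma ext_deriv1_cov1:
 assumes "open S" "x : S" "!!y. y : S ==> al y = cov1 (m y)"
 shows "ext_deriv 1 al x v = d1 m x (v 0) (v 1)"
proof -
 have "FD (%y. al y u) x = FD (%y. m y (u 0)) x" for u
  by (rule FD_cong[OF assms(1,2)]) (simp add: assms(3) cov1_def)
 thus ?thesis by (simp add: ext_deriv_def d1_def)
qed

lemma ext_deriv2_cov2:
 assumes "open S" "x : S" "!!y. y : S ==> al y = cov2 (w y)"
 shows "(ALL v. ext_deriv 2 al x v = 0) \<longleftrightarrow> closed2_at w x"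
proof -
 have *: "FD (%y. al y u) x = FD (%y. w y (u 0) (u 1)) x" for u
  by (rule FD_cong[OF assms(1,2)]) (simp add: assms(3) cov2_def)
 have "{..2::nat} = {0, 1, 2}" by auto
 hence eq: "ext_deriv 2 al x v = FD (%y. w y (v 1) (v 2)) x (v 0)
   - FD (%y. w y (v 0) (v 2)) x (v 1)
   + FD (%y. w y (v 0) (v 1)) x (v 2)" for v by (simp add: ext_deriv_def * numeral_2_eq_2)
 show ?thesis
 proof
  assume 0: "ALL v. ext_deriv 2 al x v = 0"
  show "closed2_at w x" unfolding closed2_at_def
  proof (intro allI)
   fix a b c
   show "FD (%y. w y b c) x a - FD (%y. w y a c) x b
     + FD (%y. w y a b) x c = 0"
    using spec[OF 0, of "%i. if i = 0 then a else if i = 1 then b else c"] unfolding eq by simp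
  qed
 next
  assume "closed2_at w x"
  thus "ALL v. ext_deriv 2 al x v = 0" unfolding closed2_at_def eq by blast
 qed
qed

definition shs_at :: "nat => ((real, 'm::{finite,linorder}) vec => (real, 'm) vec => real)
  => ((real, 'm) vec => (real, 'm) vec => (real, 'm) vec => real) => (real, 'm) vec => bool" where
 "shs_at n l w x \<longleftrightarrow> closed2_at w x & vol_form n (l x) (w x) std_basis > 0
   & (ALL a. (ALL b. w x a b = 0) --> (ALL b. d1 l x a b = 0))"

context oriented_mf
begin

lemma overlap_imp: "c : A ==> d : A ==> x : overlap c d ==> x : cimg c & transition c d x : cimg d"
 using transition_in overlap_iff by blast

lemma ext_deriv1_lc1:
 assumes "smooth_form A 1 al" "c : A" "x : cimg c"
 shows "ext_deriv 1 (al c) x = cov2 (d1 (lc1 al c) x)"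
 using ext_deriv1_cov1[OF open_cimg[OF assms(2)] assms(3) smooth_lc1(2)[OF assms(1,2)]]
 by (auto simp: cov2_def)

lemma SHS_iff:
 assumes m: "CARD('m) = 2 * n + 1"
 shows "(lam, omg) : SHS A n \<longleftrightarrow> smooth_form A 1 lam & smooth_form A 2 omg &
  (ALL c:A. ALL x:cimg c. shs_at n (lc1 lam c) (lc2 omg c) x)"
proof -
 have "(ALL v. ext_deriv 2 (omg c) x v = 0) & dim (form_kernel (omg c x)) = 1 &
    wedge 1 (2 * n) (lam c x) (wedge_power (omg c x) n) std_basis > 0 &
    form_kernel (omg c x) <= form_kernel (ext_deriv 1 (lam c) x)
   \<longleftrightarrow> shs_at n (lc1 lam c) (lc2 omg c) x"
  if sm: "smooth_form A 1 lam" "smooth_form A 2 omg" and c: "c : A" "x : cimg c" for c x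
 proof -
  have 1: "form_kernel (omg c x) = {a. ALL b. lc2 omg c x a b = 0}" by (simp add: form_kernel_def lc2_def)
  have 2: "form_kernel (ext_deriv 1 (lam c) x) = {a. ALL b. d1 (lc1 lam c) x a b = 0}"
   unfolding form_kernel_def ext_deriv1_lc1[OF sm(1) c] by (simp add: cov2_def pair_seq_def)
  have 3: "wedge 1 (2 * n) (lam c x) (wedge_power (omg c x) n) = vol_form n (lc1 lam c x) (lc2 omg c x)"
   by (simp only: vol_form_def smooth_lc1(2)[OF sm(1) c, symmetric] smooth_lc2(3)[OF sm(2) c, symmetric])
  have 4: "(ALL v. ext_deriv 2 (omg c) x v = 0) \<longleftrightarrow> closed2_at (lc2 omg c) x"
   by (rule ext_deriv2_cov2[OF open_cimg[OF c(1)] c(2) smooth_lc2(3)[OF sm(2) c(1)]])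
  have 5: "dim {a. ALL b. lc2 omg c x a b = 0} = 1" if "vol_form n (lc1 lam c x) (lc2 omg c x) std_basis > 0"
   using vol_form_nonzero_dim_kernel[OF m form1D(1)[OF smooth_lc1(1)[OF sm(1) c(1)] c(2)] smooth_lc2(1)[OF sm(2) c]] that
   by (metis less_irrefl)
  show ?thesis unfolding 1 2 3 4 shs_at_def using 5 by blast
 qed
 thus ?thesis unfolding SHS_def by blast
qed

end

lemma one_form_pullback:
 fixes fy :: "'d::euclidean_space => 'e::euclidean_space"
 assumes m: "form1 T m" "open T" and fy: "smooth_on fy S" "open S" "fy ` S <= T"
 shows "form1 S (%y v. m (fy y) (FD fy y v))" unfolding form1_def
proof (intro conjI ballI allI)
 fix y assume y: "y : S"
 hence "fy y : T" using fy by auto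
 thus "linear (%v. m (fy y) (FD fy y v))"
  using linear_compose[OF has_derivative_linear[OF smooth_deriv[OF fy(1) y]] form1D(1)[OF m(1)]]
  by (simp add: o_def)
next
 fix v
 have "smooth_on (%y. \<Sum>b\<in>Basis. (FD fy y v \<bullet> b) * m (fy y) b) S"
  by (intro smooth_sum smooth_mult smooth_inner smooth_const smooth_FD fy
    smooth_compose[OF form1D(2)[OF m(1)]] m(2))
 thus "smooth_on (%y. m (fy y) (FD fy y v)) S"
  by (rule smooth_cong[OF _ _ fy(2)]) (rule one_form_expand[OF m(1)], use fy(3) in auto)
qed

lemma form1_zero: "open S ==> form1 S (%x v. 0)" by (simp add: form1_def smooth_const linear_zero)

lemma smooth_form_add_scale:
 assumes "smooth_form A k al" "smooth_form A k be" and op: "!!c. c : A ==> open (cimg c)"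
 shows "smooth_form A k (%c x v. al c x v + t * be c x v)" unfolding smooth_form_def
proof (intro conjI ballI allI impI)
 fix c v assume c: "c : A"
 show "smooth_on (%x. al c x v + t * be c x v) (cimg c)"
  by (intro smooth_add smooth_mult smooth_const op[OF c] smooth_formD(2)[OF assms(1) c] smooth_formD(2)[OF assms(2) c])
next
 fix c d x v assume "c : A" "d : A" "x : overlap c d"
 from smooth_formD(3)[OF assms(1) this] smooth_formD(3)[OF assms(2) this]
 show "al c x v + t * be c x v = al d (transition c d x) (%i. FD (transition c d) x (v i)) +
    t * be d (transition c d x) (%i. FD (transition c d) x (v i))" by metis
next
 fix c x v assume "~ (c : A & x : cimg c)"
 from smooth_formD(4)[OF assms(1) this] smooth_formD(4)[OF assms(2) this]
 show "al c x v + t * be c x v = 0" by simp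
qed (intro alternating_form_add_scale smooth_formD(1)[OF assms(1)] smooth_formD(1)[OF assms(2)])

lemma closed2_at_add_scale:
 assumes "closed2_at w x" "closed2_at w' x" "x : S"
  "!!a b. smooth_on (%x. w x a b) S" "!!a b. smooth_on (%x. w' x a b) S"
 shows "closed2_at (%x a b. w x a b + t * w' x a b) x"
proof -
 have "((%x. w x a b + t * w' x a b) has_derivative (%c. FD (%x. w x a b) x c
   + t * FD (%x. w' x a b) x c)) (at x)" for a b by (intro has_derivative_add has_derivative_mult_right
    smooth_deriv[OF assms(4,3)] smooth_deriv[OF assms(5,3)])
 hence *: "FD (%x. w x a b + t * w' x a b) x c = FD (%x. w x a b) x c
   + t * FD (%x. w' x a b) x c" for a b c by (rule FD_eqI)
 show ?thesis unfolding closed2_at_def *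
 proof (intro allI)
  fix a b c
  from assms(1,2)[unfolded closed2_at_def, rule_format, of b c a]
  show "FD (%x. w x b c) x a + t * FD (%x. w' x b c) x a
    - (FD (%x. w x a c) x b + t * FD (%x. w' x a c) x b)
    + (FD (%x. w x a b) x c + t * FD (%x. w' x a b) x c) = 0" by algebra
 qed
qed

section \<open>Forms supported in a single chart\<close>

context oriented_mf
begin

definition ext1 :: "('a, 'm) chart => ((real, 'm) vec => (real, 'm) vec => real) => ('a, 'm) chart
  => (real, 'm) vec => (real, 'm) vec => real" where
 "ext1 c0 m d y v = (if y : overlap d c0
   then m (transition d c0 y) (FD (transition d c0) y v) else 0)"

definition ext_form :: "('a, 'm) chart => ((real, 'm) vec => (real, 'm) vec => real) => ('a, 'm) form" where
 "ext_form c0 m = (%c x v. if c : A & x : cimg c then ext1 c0 m c x (v 0) else 0)"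

definition d_form :: "('a, 'm) form => ('a, 'm) form" where
 "d_form al = (%c x v. if c : A & x : cimg c then d1 (lc1 al c) x (v 0) (v 1) else 0)"

definition supported_form :: "('a, 'm) chart => (real, 'm) vec set
  => ((real, 'm) vec => (real, 'm) vec => real) => bool" where
 "supported_form c0 K m \<longleftrightarrow> form1 (cimg c0) m & compact K & K <= cimg c0 & (ALL x v. x ~: K --> m x v = 0)"

lemma smooth_ext_form:
 assumes c0: "c0 : A" and m: "supported_form c0 K m"
 shows "smooth_form A 1 (ext_form c0 m)" unfolding ext_form_def
proof (rule smooth_form1I)
 note m' = m[unfolded supported_form_def]
 show "form1 (cimg c) (ext1 c0 m c)" if c: "c : A" for c
 proof -
  have pb: "form1 (overlap c c0) (%y v. m (transition c c0 y) (FD (transition c c0) y v))"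
   using m' overlap_imp[OF c c0]
   by (intro one_form_pullback[OF _ open_cimg[OF c0] smooth_transition[OF c c0] open_overlap[OF c c0]]) auto
  show ?thesis unfolding form1_def
  proof (intro conjI ballI allI)
   show "linear (ext1 c0 m c x)" for x
    using form1D(1)[OF pb] by (cases "x : overlap c c0") (auto simp: ext1_def[abs_def] linear_zero)
   show "smooth_on (%x. ext1 c0 m c x v) (cimg c)" for v
   proof (rule smooth_local)
    fix x assume x: "x : cimg c"
    show "EX U. open U & x : U & smooth_on (%x. ext1 c0 m c x v) U"
    proof (cases "x : overlap c c0")
     case True
     have "smooth_on (%x. ext1 c0 m c x v) (overlap c c0)"
      by (rule smooth_cong[OF form1D(2)[OF pb] _ open_overlap[OF c c0]]) (simp add: ext1_def)
     thus ?thesis using True open_overlap[OF c c0] by blast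
    next
     case False
     let ?U = "{y : cimg c. ~ (y : overlap c c0 & transition c c0 y : K)}"
     have op: "open ?U" using m' by (intro open_complement_support[OF c0 c]) auto
     have "smooth_on (%x. ext1 c0 m c x v) ?U"
      by (rule smooth_cong[OF smooth_const[OF op, of 0] _ op]) (use m' in \<open>auto simp: ext1_def\<close>)
     thus ?thesis using False x op by blast
    qed
   qed
  qed
 qed
 show "ext1 c0 m c x v = ext1 c0 m d (transition c d x) (FD (transition c d) x v)"
  if c: "c : A" "d : A" "x : overlap c d" for c d x v
 proof -
  have "cinv d (transition c d x) = cinv c x" using c by (simp add: overlap_iff transition_def cinv_cmap)
  hence "transition c d x : overlap d c0 \<longleftrightarrow> x : overlap c c0"
   using overlap_iff[OF c(2), of "transition c d x" c0] overlap_iff[OF c(1), of x c0] overlap_imp[OF c] by metis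
  thus ?thesis using transition_cocycle[OF c] transition_derivative_cocycle[OF c(1,2) c0 c(3)]
   by (simp add: ext1_def)
 qed
qed (use overlap_imp open_cimg in auto)

lemma lc1_ext_form: "c0 : A ==> x : cimg c0 ==> lc1 (ext_form c0 m) c0 x v = m x v"
 using trans_self transition_self_derivative by (simp add: lc1_def ext_form_def ext1_def)

lemma lc1_ext_form_zero:
 assumes "supported_form c0 K m" "~ (x : overlap c c0 & transition c c0 x : K)"
 shows "lc1 (ext_form c0 m) c x v = 0"
 using assms by (simp add: lc1_def ext_form_def ext1_def supported_form_def)

lemma smooth_d_form:
 assumes "smooth_form A 1 al"
 shows "smooth_form A 2 (d_form al)" unfolding d_form_def
proof (rule smooth_form2I)
 fix c x assume c: "c : A" "x : cimg c"
 show "skew_form (d1 (lc1 al c) x)" unfolding skew_form_def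
  using d1_linear[OF smooth_lc1(1)[OF assms c(1)] open_cimg[OF c(1)] c(2)] d1_skew by blast
next
 fix c a b assume c: "c : A"
 show "smooth_on (%x. d1 (lc1 al c) x a b) (cimg c)"
  by (rule smooth_d1[OF smooth_lc1(1)[OF assms c] open_cimg[OF c]])
next
 fix c d x a b assume c: "c : A" "d : A" "x : overlap c d"
 show "d1 (lc1 al c) x a b = d1 (lc1 al d) (transition c d x) (FD (transition c d) x a)
    (FD (transition c d) x b)"
  by (rule d1_natural[OF smooth_lc1(1)[OF assms c(2)] open_cimg[OF c(2)] smooth_transition[OF c(1,2)]
    open_overlap[OF c(1,2)] _ c(3) lc1_transition[OF assms c(1,2)]]) (use overlap_imp[OF c(1,2)] in auto)
qed (use overlap_imp open_cimg in auto)

lemma lc2_d_form: "c : A ==> x : cimg c ==> lc2 (d_form al) c x a b = d1 (lc1 al c) x a b"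
 by (simp add: lc2_def d_form_def pair_seq_def)

lemma closed_d_form:
 assumes "smooth_form A 1 al" "c : A" "x : cimg c"
 shows "closed2_at (lc2 (d_form al) c) x"
proof -
 have "FD (%y. lc2 (d_form al) c y a b) x = FD (%y. d1 (lc1 al c) y a b) x"
  for a b by (rule FD_cong[OF open_cimg[OF assms(2)] assms(3)]) (simp add: lc2_d_form assms)
 thus ?thesis unfolding closed2_at_def
  using d1_closed[OF smooth_lc1(1)[OF assms(1,2)] open_cimg[OF assms(2)] assms(3)] by simp
qed

end

text \<open>A volume that never vanishes along a path keeps its sign. Later deformations therefore
  only have to be checked for non-vanishing, and the orientation of auxiliary coordinates never
  enters.\<close>

lemma vol_form_path_positive:
 assumes cont: "!!i. continuous_on {0..1} (%t. l t (v i))" "!!i j. continuous_on {0..1} (%t. w t (v i) (v j))"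
  and nz: "!!t. t : {0..1::real} ==> vol_form n (l t) (w t) v ~= 0"
  and pos: "vol_form n (l 0) (w 0) v > 0" and t: "t : {0..1}"
 shows "vol_form n (l t) (w t) v > 0"
proof (rule ccontr)
 let ?f = "%t. vol_form n (l t) (w t) v"
 assume "~ ?f t > 0"
 moreover have "continuous_on {0..1} ?f"
  using cont unfolding continuous_on_def by (auto intro!: vol_form_tendsto)
 hence "continuous_on {0..t} ?f" by (rule continuous_on_subset) (use t in auto)
 ultimately have "EX x>=0. x <= t & ?f x = 0" using t pos by (intro IVT2') auto
 thus False using nz t by auto
qed

lemma d1_quadratic:
 assumes "form1 S l" "form1 S m1" "form1 S m2" "open S" "x : S"
 shows "d1 (%x v. l x v + t * m1 x v + t\<^sup>2 * m2 x v) x a b = d1 l x a b + t * d1 m1 x a b + t\<^sup>2 * d1 m2 x a b"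
 using d1_add_scale[OF form1_add_scale[OF assms(1,2,4), of t] assms(3,5)] d1_add_scale[OF assms(1,2,5)]
 by simp

section \<open>Stable homotopies supported in a single chart\<close>

context oriented_mf
begin

text \<open>Both conditions are invariant under the linear isomorphism given by a change of charts,
  so over the support they can be verified in the one chart where the deformation is
  defined.\<close>

lemma shs_at_transfer:
 assumes lam: "smooth_form A 1 lam" and omg: "smooth_form A 2 omg" and c: "c : A" "d : A" "x : overlap c d"
 shows "(vol_form n (lc1 lam d (transition c d x)) (lc2 omg d (transition c d x)) std_basis ~= 0 ==> CARD('m) = 2 * n + 1
      ==> vol_form n (lc1 lam c x) (lc2 omg c x) std_basis ~= 0)"
  and "(!!a. (!!b. lc2 omg d (transition c d x) a b = 0) ==> (!!b. d1 (lc1 lam d) (transition c d x) a b = 0))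
      ==> (!!b. lc2 omg c x a b = 0) ==> d1 (lc1 lam c) x a b = 0"
proof -
 let ?M = "FD (transition c d) x" and ?y = "transition c d x"
 let ?N = "FD (transition d c) ?y"
 have y: "?y : cimg d" and x: "x : cimg c" using overlap_imp[OF c] by auto
 have lM: "linear ?M" by (rule linear_trans_deriv[OF c])
 have c': "d : A" "c : A" "?y : overlap d c" using c transition_in by auto
 have lN: "linear ?N" by (rule linear_trans_deriv[OF c'])
 have NM: "?N (?M v) = v" for v by (rule trans_deriv_inv[OF c])
 have MN: "?M (?N v) = v" for v using trans_deriv_inv[OF c', of v] transition_inverse[OF c] by simp
 have l: "lc1 lam c x = (%v. lc1 lam d ?y (?M v))" using lc1_transition[OF lam c] by blast
 have w: "lc2 omg c x = (%a b. lc2 omg d ?y (?M a) (?M b))" using lc2_transition[OF omg c] by blast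
 have dl: "d1 (lc1 lam c) x a b = d1 (lc1 lam d) ?y (?M a) (?M b)" for a b
  by (rule d1_natural[OF smooth_lc1(1)[OF lam c(2)] open_cimg[OF c(2)] smooth_transition[OF c(1,2)]
    open_overlap[OF c(1,2)] _ c(3) lc1_transition[OF lam c(1,2)]]) (use overlap_imp[OF c(1,2)] in auto)
 show "vol_form n (lc1 lam c x) (lc2 omg c x) std_basis ~= 0"
  if "vol_form n (lc1 lam d ?y) (lc2 omg d ?y) std_basis ~= 0" "CARD('m) = 2 * n + 1" unfolding l w
  by (rule vol_form_comp_nonzero[OF that(2) form1D(1)[OF smooth_lc1(1)[OF lam c(2)] y]
    smooth_lc2(1)[OF omg c(2) y] that(1) lM NM MN lN])
 show "d1 (lc1 lam c) x a b = 0"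
  if *: "!!a. (!!b. lc2 omg d ?y a b = 0) ==> (!!b. d1 (lc1 lam d) ?y a b = 0)" and a: "!!b. lc2 omg c x a b = 0"
 proof -
  have "lc2 omg d ?y (?M a) b = 0" for b using a[of "?N b"] unfolding w MN .
  thus ?thesis unfolding dl by (rule *)
 qed
qed

text \<open>The common shape of the three deformations below: \<lambda> changes by a quadratic
  polynomial in \<open>t\<close>, \<omega> by \<open>t\<close> times an exact form, both with
  support in one chart. Closedness and the cohomology class are then automatic, and what remains is
  non-vanishing of the volume and the kernel condition on \<open>K\<close>.\<close>

lemma stable_homotopy_in_chart:
 assumes m: "CARD('m) = 2 * n + 1" and c0: "c0 : A" and s: "(lam, omg) : SHS A n"
  and sup: "supported_form c0 K m1" "supported_form c0 K m2" "supported_form c0 K m3"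
  and vol: "!!t x. t : {0..1::real} ==> x : K ==>
    vol_form n (%v. lc1 lam c0 x v + t * m1 x v + t\<^sup>2 * m2 x v) (%a b. lc2 omg c0 x a b + t * d1 m3 x a b) std_basis ~= 0"
  and ker: "!!t x a b. t : {0..1::real} ==> x : K ==> (!!b. lc2 omg c0 x a b + t * d1 m3 x a b = 0) ==>
    d1 (lc1 lam c0) x a b + t * d1 m1 x a b + t\<^sup>2 * d1 m2 x a b = 0"
 shows "EX lam' omg'. ((lam, omg), (lam', omg')) : stable_homotopy_rel A n &
   (ALL x:cimg c0. ALL v. lc1 lam' c0 x v = lc1 lam c0 x v + m1 x v + m2 x v) &
   (ALL x:cimg c0. ALL a b. lc2 omg' c0 x a b = lc2 omg c0 x a b + d1 m3 x a b)"
proof -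
 define L where "L t = (%c x v. lam c x v + t * ext_form c0 m1 c x v + t\<^sup>2 * ext_form c0 m2 c x v)" for t :: real
 define W where "W t = (%c x v. omg c x v + t * d_form (ext_form c0 m3) c x v)" for t :: real
 have lam: "smooth_form A 1 lam" and omg: "smooth_form A 2 omg"
  and at: "!!c x. c : A ==> x : cimg c ==> shs_at n (lc1 lam c) (lc2 omg c) x"
  using s unfolding SHS_iff[OF m] by blast+
 note e1 = smooth_ext_form[OF c0 sup(1)] and e2 = smooth_ext_form[OF c0 sup(2)] and e3 = smooth_ext_form[OF c0 sup(3)]
 have L: "smooth_form A 1 (L t)" for t unfolding L_def by (intro smooth_form_add_scale lam e1 e2 open_cimg)
 have W: "smooth_form A 2 (W t)" for t
  unfolding W_def by (intro smooth_form_add_scale omg smooth_d_form e3 open_cimg)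
 have lcL: "lc1 (L t) c x v = lc1 lam c x v + t * lc1 (ext_form c0 m1) c x v + t\<^sup>2 * lc1 (ext_form c0 m2) c x v" for t c x v
  by (simp add: L_def lc1_def)
 have lcW: "lc2 (W t) c x a b = lc2 omg c x a b + t * d1 (lc1 (ext_form c0 m3) c) x a b" if "c : A" "x : cimg c" for t c x a b
  using lc2_d_form[OF that, of "ext_form c0 m3" a b] by (simp add: W_def lc2_def)
 have dL: "d1 (lc1 (L t) c) x a b = d1 (lc1 lam c) x a b + t * d1 (lc1 (ext_form c0 m1) c) x a b
   + t\<^sup>2 * d1 (lc1 (ext_form c0 m2) c) x a b" if c: "c : A" "x : cimg c" for t c x a b
  unfolding lcL[abs_def]
  by (rule d1_quadratic[OF smooth_lc1(1)[OF lam c(1)] smooth_lc1(1)[OF e1 c(1)] smooth_lc1(1)[OF e2 c(1)]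
     open_cimg[OF c(1)] c(2)])
 have d0: "d1 (lc1 (ext_form c0 m) c0) x a b = d1 m x a b" if "x : cimg c0" for m x a b
  by (rule d1_cong[OF open_cimg[OF c0] that]) (simp add: lc1_ext_form[OF c0])
 have K: "compact K" "K <= cimg c0" using sup(1) by (auto simp: supported_form_def)
 have shs: "shs_at n (lc1 (L t) c) (lc2 (W t) c) x" if t: "t : {0..1}" and c: "c : A" "x : cimg c" for t c x
 proof -
  have dz: "d1 (lc1 (ext_form c0 m) c) x a b = 0"
   if "~ (x : overlap c c0 & transition c c0 x : K)" "supported_form c0 K m" for m a b
  proof -
   let ?U = "{y : cimg c. ~ (y : overlap c c0 & transition c c0 y : K)}"
   have "d1 (lc1 (ext_form c0 m) c) x a b = d1 (%x v. 0) x a b"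
    by (rule d1_cong[OF open_complement_support[OF c0 c(1) K]])
      (use that c lc1_ext_form_zero[OF that(2)] in auto)
   thus ?thesis by (simp add: d1_def)
  qed
  have vol_ker: "vol_form n (lc1 (L t) c x) (lc2 (W t) c x) std_basis ~= 0
    & (ALL a. (ALL b. lc2 (W t) c x a b = 0) --> (ALL b. d1 (lc1 (L t) c) x a b = 0))" if t: "t : {0..1}" for t
  proof (cases "x : overlap c c0 & transition c c0 x : K")
   case False
   have "lc1 (L t) c x = lc1 lam c x"
    by (rule ext) (simp add: lcL lc1_ext_form_zero[OF sup(1) False] lc1_ext_form_zero[OF sup(2) False])
   moreover have "lc2 (W t) c x = lc2 omg c x" by (intro ext) (simp add: lcW[OF c] dz[OF False sup(3)])
   moreover have "d1 (lc1 (L t) c) x a b = d1 (lc1 lam c) x a b" for a b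
    by (simp add: dL[OF c] dz[OF False sup(1)] dz[OF False sup(2)])
   ultimately show ?thesis using at[OF c] by (auto simp: shs_at_def)
  next
   case True
   let ?y = "transition c c0 x"
   have ov: "x : overlap c c0" and yK: "?y : K" and y: "?y : cimg c0" using True K by auto
   have 1: "lc1 (L t) c0 ?y = (%v. lc1 lam c0 ?y v + t * m1 ?y v + t\<^sup>2 * m2 ?y v)"
    by (rule ext) (simp add: lcL lc1_ext_form[OF c0 y])
   have 2: "lc2 (W t) c0 ?y = (%a b. lc2 omg c0 ?y a b + t * d1 m3 ?y a b)"
    by (intro ext) (simp add: lcW[OF c0 y] d0[OF y])
   have 3: "d1 (lc1 (L t) c0) ?y a b = d1 (lc1 lam c0) ?y a b + t * d1 m1 ?y a b + t\<^sup>2 * d1 m2 ?y a b" for a b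
    by (simp add: dL[OF c0 y] d0[OF y])
   have "vol_form n (lc1 (L t) c x) (lc2 (W t) c x) std_basis ~= 0"
    by (rule shs_at_transfer(1)[OF L W c(1) c0 ov _ m]) (unfold 1 2, rule vol[OF t yK])
   moreover have "d1 (lc1 (L t) c) x a b = 0" if "!!b. lc2 (W t) c x a b = 0" for a b
   proof (rule shs_at_transfer(2)[OF L W c(1) c0 ov _ that])
    fix a b assume "!!b. lc2 (W t) c0 ?y a b = 0"
    thus "d1 (lc1 (L t) c0) ?y a b = 0" unfolding 2 3 by (rule ker[OF t yK])
   qed
   ultimately show ?thesis by blast
  qed
  have "vol_form n (lc1 (L t) c x) (lc2 (W t) c x) std_basis > 0"
  proof (rule vol_form_path_positive[OF _ _ _ _ t])
   show "continuous_on {0..1} (%t. lc1 (L t) c x (std_basis i))" for i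
    unfolding lcL by (intro continuous_intros)
   show "continuous_on {0..1} (%t. lc2 (W t) c x (std_basis i) (std_basis j))" for i j
    unfolding lcW[OF c] by (intro continuous_intros)
   have "lc1 (L 0) c x = lc1 lam c x" by (rule ext) (simp add: lcL)
   moreover have "lc2 (W 0) c x = lc2 omg c x" by (intro ext) (simp add: lcW[OF c])
   ultimately show "vol_form n (lc1 (L 0) c x) (lc2 (W 0) c x) std_basis > 0"
    using at[OF c] by (simp add: shs_at_def)
  qed (use vol_ker in blast)
  moreover have "closed2_at (lc2 (W t) c) x"
  proof -
   have "lc2 (W t) c = (%x a b. lc2 omg c x a b + t * lc2 (d_form (ext_form c0 m3)) c x a b)"
    by (intro ext) (simp add: W_def lc2_def)
   moreover have "closed2_at (%x a b. lc2 omg c x a b + t * lc2 (d_form (ext_form c0 m3)) c x a b) x"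
    by (rule closed2_at_add_scale[OF _ closed_d_form[OF e3 c] c(2) smooth_lc2(2)[OF omg c(1)]
       smooth_lc2(2)[OF smooth_d_form[OF e3] c(1)]])
      (use at[OF c] in \<open>simp add: shs_at_def\<close>)
   ultimately show ?thesis by simp
  qed
  ultimately show ?thesis using vol_ker[OF t] by (simp add: shs_at_def)
 qed
 have SHS: "(L t, W t) : SHS A n" if "t : {0..1}" for t
  unfolding SHS_iff[OF m] using L W shs[OF that] by blast
 have fam: "smooth_on (%(t, x). f x) ((UNIV :: real set) \<times> cimg c)" if "smooth_on f (cimg c)" "c : A"
  for f :: "(real, 'm) vec => real" and c
 proof -
  have "smooth_on (%z::real \<times> (real, 'm) vec. f (snd z)) (UNIV \<times> cimg c)"
   by (rule smooth_compose[OF that(1)])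
     (auto intro!: smooth_blinear bounded_linear_snd open_Times open_cimg that)
  thus ?thesis by (simp add: case_prod_unfold)
 qed
 have fst: "smooth_on (%(t, x). t ^ k) ((UNIV :: real set) \<times> cimg c)" if "c : A" for k c
  unfolding case_prod_unfold
  by (intro smooth_power smooth_blinear bounded_linear_fst open_Times open_cimg that open_UNIV)
 have op: "open ((UNIV :: real set) \<times> cimg c)" if "c : A" for c
  by (intro open_Times open_cimg that open_UNIV)
 have "smooth_family A L" unfolding smooth_family_def
 proof (intro ballI allI)
  fix c v assume c: "c : A"
  have "smooth_on (%z. (case z of (t, x) => lam c x v) + (case z of (t, x) => t ^ 1) * (case z of (t, x) => ext_form c0 m1 c x v)
    + (case z of (t, x) => t ^ 2) * (case z of (t, x) => ext_form c0 m2 c x v)) ((UNIV :: real set) \<times> cimg c)"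
   by (intro smooth_add smooth_mult fam fst op c smooth_formD(2)[OF lam] smooth_formD(2)[OF e1] smooth_formD(2)[OF e2])
  thus "smooth_on (%(t, x). L t c x v) (UNIV \<times> cimg c)" by (simp add: L_def case_prod_unfold)
 qed
 moreover have "smooth_family A W" unfolding smooth_family_def
 proof (intro ballI allI)
  fix c v assume c: "c : A"
  have "smooth_on (%z. (case z of (t, x) => omg c x v) + (case z of (t, x) => t ^ 1) * (case z of (t, x) => d_form (ext_form c0 m3) c x v)) ((UNIV :: real set) \<times> cimg c)"
   by (intro smooth_add smooth_mult fam fst op c smooth_formD(2)[OF omg] smooth_formD(2)[OF smooth_d_form[OF e3]])
  thus "smooth_on (%(t, x). W t c x v) (UNIV \<times> cimg c)" by (simp add: W_def case_prod_unfold)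
 qed
 moreover have "L 0 = lam" "W 0 = omg" by (simp_all add: L_def W_def)
 moreover have "cohomologous2 A (W 0) (W t)" for t
 proof -
  \<comment> \<open>The primitive is \<open>t\<close> times \<open>ext_form c0 m3\<close>; the
    factor is split as \<open>1 + (t - 1)\<close> to fit
    \<open>smooth_form_add_scale\<close>.\<close>
  define et where "et = (%c x v. ext_form c0 m3 c x v + (t - 1) * ext_form c0 m3 c x v)"
  have et: "smooth_form A 1 et" unfolding et_def by (intro smooth_form_add_scale e3 open_cimg)
  have "W t c x v - W 0 c x v = ext_deriv 1 (et c) x v" if c: "c : A" "x : cimg c" for c x v
  proof -
   have "lc1 et c = (%x v. lc1 (ext_form c0 m3) c x v + (t - 1) * lc1 (ext_form c0 m3) c x v)"
    by (intro ext) (simp add: et_def lc1_def)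
   hence "d1 (lc1 et c) x a b = d1 (lc1 (ext_form c0 m3) c) x a b + (t - 1) * d1 (lc1 (ext_form c0 m3) c) x a b" for a b
    by (simp only: d1_add_scale[OF smooth_lc1(1)[OF e3 c(1)] smooth_lc1(1)[OF e3 c(1)] c(2)])
   hence "d1 (lc1 et c) x a b = t * d1 (lc1 (ext_form c0 m3) c) x a b" for a b by (simp add: algebra_simps)
   thus ?thesis unfolding ext_deriv1_lc1[OF et c] using c by (simp add: W_def d_form_def cov2_def)
  qed
  thus ?thesis unfolding cohomologous2_def using et by blast
 qed
 ultimately have "((lam, omg), (L 1, W 1)) : stable_homotopy_rel A n"
  unfolding stable_homotopy_rel_def using SHS by blast
 moreover have "ALL x:cimg c0. ALL v. lc1 (L 1) c0 x v = lc1 lam c0 x v + m1 x v + m2 x v"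
  by (simp add: lcL lc1_ext_form[OF c0])
 moreover have "ALL x:cimg c0. ALL a b. lc2 (W 1) c0 x a b = lc2 omg c0 x a b + d1 m3 x a b"
  by (simp add: lcW[OF c0] d0)
 ultimately show ?thesis by blast
qed

end

section \<open>Concatenation of stable homotopies\<close>

lemma smooth_family_reparam:
 assumes "smooth_family A L" "smooth_on be (UNIV :: real set)" "!!c. c : A ==> open (cimg c)"
 shows "smooth_family A (%t. L (be t))" unfolding smooth_family_def
proof (intro ballI allI)
 fix c v assume c: "c : A"
 have op: "open ((UNIV :: real set) \<times> cimg c)" by (intro open_Times assms c open_UNIV)
 have f: "smooth_on (%z. be (fst z)) ((UNIV :: real set) \<times> cimg c)"
  by (rule smooth_compose[OF assms(2) smooth_blinear[OF bounded_linear_fst op]]) (use op in auto)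
 have "smooth_on (%z. (%(t, x). L t c x v) (be (fst z), snd z)) ((UNIV :: real set) \<times> cimg c)"
  by (rule smooth_compose[OF _ smooth_Pair[OF f smooth_blinear[OF bounded_linear_snd op] op]])
    (use assms(1) c op in \<open>auto simp: smooth_family_def\<close>)
 thus "smooth_on (%(t, x). L (be t) c x v) (UNIV \<times> cimg c)" by (simp add: case_prod_unfold)
qed

lemma smooth_family_join:
 assumes "smooth_family A L" "smooth_family A L'" "a < b"
  and "!!t. t < b ==> L'' t = L t" "!!t. t > a ==> L'' t = L' t" "!!c. c : A ==> open (cimg c)"
 shows "smooth_family A L''" unfolding smooth_family_def
proof (intro ballI allI)
 fix c v assume c: "c : A"
 have op: "open (T \<times> cimg c)" if "open T" for T :: "real set" by (intro open_Times assms c that)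
 have 1: "smooth_on (%(t, x). L'' t c x v) ({..<b} \<times> cimg c)"
  by (rule smooth_cong[of "%(t, x). L t c x v"], rule smooth_subset[of _ "UNIV \<times> cimg c"])
    (use assms c op in \<open>auto simp: smooth_family_def\<close>)
 have 2: "smooth_on (%(t, x). L'' t c x v) ({a<..} \<times> cimg c)"
  by (rule smooth_cong[of "%(t, x). L' t c x v"], rule smooth_subset[of _ "UNIV \<times> cimg c"])
    (use assms c op in \<open>auto simp: smooth_family_def\<close>)
 show "smooth_on (%(t, x). L'' t c x v) (UNIV \<times> cimg c)"
 proof (rule smooth_local)
  fix z :: "real \<times> (real, 'b) vec" assume z: "z : UNIV \<times> cimg c"
  show "EX U. open U & z : U & smooth_on (%(t, x). L'' t c x v) U"
  proof (cases "fst z < b")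
   case True
   hence "z : {..<b} \<times> cimg c" using z by (auto simp: mem_Times_iff)
   thus ?thesis by (intro exI[of _ "{..<b} \<times> cimg c"] conjI op 1 open_lessThan)
  next
   case False
   hence "z : {a<..} \<times> cimg c" using z \<open>a < b\<close> by (auto simp: mem_Times_iff)
   thus ?thesis by (intro exI[of _ "{a<..} \<times> cimg c"] conjI op 2 open_greaterThan)
  qed
 qed
qed

context oriented_mf
begin

lemma cohomologous2_trans:
 assumes "cohomologous2 A omg omg'" "cohomologous2 A omg' omg''"
 shows "cohomologous2 A omg omg''"
proof -
 obtain et et' where et: "smooth_form A 1 et" "smooth_form A 1 et'"
  and eq: "!!c x v. c : A ==> x : cimg c ==> omg' c x v - omg c x v = ext_deriv 1 (et c) x v"
   "!!c x v. c : A ==> x : cimg c ==> omg'' c x v - omg' c x v = ext_deriv 1 (et' c) x v"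
  using assms unfolding cohomologous2_def by blast
 define ze where "ze = (%c x v. et c x v + 1 * et' c x v)"
 have ze: "smooth_form A 1 ze" unfolding ze_def by (intro smooth_form_add_scale et open_cimg)
 have "omg'' c x v - omg c x v = ext_deriv 1 (ze c) x v" if c: "c : A" "x : cimg c" for c x v
 proof -
  have "lc1 ze c = (%x v. lc1 et c x v + 1 * lc1 et' c x v)" by (intro ext) (simp add: ze_def lc1_def)
  hence "d1 (lc1 ze c) x a b = d1 (lc1 et c) x a b + 1 * d1 (lc1 et' c) x a b" for a b
   by (simp only: d1_add_scale[OF smooth_lc1(1)[OF et(1) c(1)] smooth_lc1(1)[OF et(2) c(1)] c(2)])
  thus ?thesis using eq(1)[OF c, of v] eq(2)[OF c, of v]
   unfolding ext_deriv1_lc1[OF ze c] ext_deriv1_lc1[OF et(1) c] ext_deriv1_lc1[OF et(2) c] by (simp add: cov2_def)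
 qed
 thus ?thesis unfolding cohomologous2_def using ze by blast
qed

lemma stable_homotopy_SHS: "(s, s') : stable_homotopy_rel A n ==> s' : SHS A n"
 unfolding stable_homotopy_rel_def by force

text \<open>Both homotopies are slowed down so as to be constant around the joining time; then the
  concatenation is smooth there.\<close>

lemma stable_homotopy_trans:
 assumes "(s0, s1) : stable_homotopy_rel A n" "(s1, s2) : stable_homotopy_rel A n"
 shows "(s0, s2) : stable_homotopy_rel A n"
proof -
 obtain L W where 1: "smooth_family A L" "smooth_family A W" "(L 0, W 0) = s0" "(L 1, W 1) = s1"
  "!!t. t : {0..1} ==> (L t, W t) : SHS A n" "!!t. t : {0..1} ==> cohomologous2 A (W 0) (W t)"
  using assms(1) unfolding stable_homotopy_rel_def by auto
 obtain L' W' where 2: "smooth_family A L'" "smooth_family A W'" "(L' 0, W' 0) = s1" "(L' 1, W' 1) = s2"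
  "!!t. t : {0..1} ==> (L' t, W' t) : SHS A n" "!!t. t : {0..1} ==> cohomologous2 A (W' 0) (W' t)"
  using assms(2) unfolding stable_homotopy_rel_def by auto
 have eq: "L 1 = L' 0" "W 1 = W' 0" using 1(4) 2(3) by auto
 \<comment> \<open>\<open>b1\<close> has reached 1 at time 3/8 and \<open>b2\<close> leaves 0 only
   at 5/8, so near 1/2 the joined family stands still at the common structure.\<close>
 define b1 where "b1 t = smooth_step (4 * t - 1/2)" for t
 define b2 where "b2 t = smooth_step (4 * t - 5/2)" for t
 have b: "b1 t : {0..1}" "b2 t : {0..1}" for t by (auto simp: b1_def b2_def smooth_step_bounds)
 have sm: "smooth_on b1 UNIV" "smooth_on b2 UNIV" unfolding b1_def b2_def
  by (intro smooth_step_o smooth_diff smooth_mult smooth_const smooth_ident open_UNIV)+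
 have b1: "b1 t = 1" if "t >= 3/8" for t using that by (simp add: b1_def smooth_step_simps)
 have b2: "b2 t = 0" if "t <= 5/8" for t using that by (simp add: b2_def smooth_step_simps)
 have b01: "b1 0 = 0" "b2 1 = 1" by (simp_all add: b1_def b2_def smooth_step_simps)
 define L'' where "L'' t = (if t < 1/2 then L (b1 t) else L' (b2 t))" for t
 define W'' where "W'' t = (if t < 1/2 then W (b1 t) else W' (b2 t))" for t
 have "smooth_family A L''"
  by (rule smooth_family_join[OF smooth_family_reparam[OF 1(1) sm(1)] smooth_family_reparam[OF 2(1) sm(2)], of "3/8" "5/8"])
    (auto simp: L''_def b1 b2 eq open_cimg)
 moreover have "smooth_family A W''"
  by (rule smooth_family_join[OF smooth_family_reparam[OF 1(2) sm(1)] smooth_family_reparam[OF 2(2) sm(2)], of "3/8" "5/8"])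
    (auto simp: W''_def b1 b2 eq open_cimg)
 moreover have "(L'' 0, W'' 0) = s0" "(L'' 1, W'' 1) = s2" using 1 2 by (simp_all add: L''_def W''_def b01)
 moreover have "(L'' t, W'' t) : SHS A n" for t
  using 1(5)[OF b(1)] 2(5)[OF b(2)] by (simp add: L''_def W''_def)
 moreover have "cohomologous2 A (W'' 0) (W'' t)" for t
 proof -
  have "cohomologous2 A (W 0) (W 1)" by (rule 1(6)) simp
  hence "cohomologous2 A (W 0) (W' (b2 t))" using 2(6)[OF b(2)] cohomologous2_trans unfolding eq by blast
  thus ?thesis using 1(6)[OF b(1)] by (simp add: W''_def b01)
 qed
 ultimately have "((L'' 0, W'' 0), (L'' 1, W'' 1)) : stable_homotopy_rel A n"
  unfolding stable_homotopy_rel_def by blast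
 thus ?thesis using `(L'' 0, W'' 0) = s0` `(L'' 1, W'' 1) = s2` by simp
qed

end

text \<open>The norm is not differentiable at the origin. It is replaced by the square root of
  \<open>x s \<bullet> x s\<close> plus \<open>e\<^sup>2\<close>, which obeys the same differential
  inequality, and then \<open>e\<close> tends to 0.\<close>

lemma norm_gronwall:
 fixes x :: "real => 'a::euclidean_space"
 assumes x: "!!t. t : {0..T} ==> (x has_vector_derivative x' t) (at t within {0..T})"
  and bnd: "!!t. t : {0..T} ==> norm (x' t) <= C * norm (x t) + d" and C: "C >= 0" "d >= 0" and t: "t : {0..T}"
 shows "norm (x t) <= (norm (x 0) + d * t) * exp (C * t)"
proof (cases "t = 0")
 case False
 hence t0: "0 < t" using t by simp
 have "norm (x t) * exp (- C * t) <= norm (x 0) + d * t + e" if e: "e > 0" for e :: real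
 proof -
  define u where "u s = sqrt (x s \<bullet> x s + e\<^sup>2)" for s
  define u' where "u' s = (x s \<bullet> x' s) / u s" for s
  have pos: "x s \<bullet> x s + e\<^sup>2 > 0" for s using e by (simp add: add_nonneg_pos)
  have u: "u s > 0" "norm (x s) <= u s" for s
  proof -
   show "u s > 0" using pos by (simp add: u_def)
   have "norm (x s) = sqrt (x s \<bullet> x s)" by (simp add: norm_eq_sqrt_inner)
   thus "norm (x s) <= u s" by (simp add: u_def)
  qed
  have du: "(u has_real_derivative u' s) (at s within {0..t})" if s: "s : {0..t}" for s
  proof -
   have "(x has_vector_derivative x' s) (at s within {0..t})"
    using has_vector_derivative_within_subset[OF x[of s]] s t by auto
   hence "((%s. x s \<bullet> x s + e\<^sup>2) has_real_derivative 2 * (x s \<bullet> x' s)) (at s within {0..t})"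
    unfolding has_vector_derivative_def has_field_derivative_def
    by (auto intro!: derivative_eq_intros simp: inner_commute)
   from DERIV_chain2[where f=sqrt and g="%s. x s \<bullet> x s + e\<^sup>2", OF DERIV_real_sqrt[OF pos] this]
   show ?thesis by (simp add: u_def[abs_def] u'_def field_simps)
  qed
  have bu: "u' s <= C * u s + d" if s: "s : {0..t}" for s
  proof -
   have "x s \<bullet> x' s <= norm (x s) * norm (x' s)" by (rule norm_cauchy_schwarz)
   also have "... <= norm (x s) * (C * norm (x s) + d)" using bnd[of s] s t by (intro mult_left_mono) auto
   also have "... <= u s * (C * u s + d)" using u[of s] C by (intro mult_mono add_mono mult_left_mono) auto
   finally show ?thesis using u(1)[of s] by (simp add: u'_def pos_divide_le_eq mult.commute)
  qed
  \<comment> \<open>With the integrating factor and the linear term removed, \<open>g\<close> has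
    non-positive derivative.\<close>
  define g where "g s = u s * exp (- C * s) - d * s" for s
  have dg: "(g has_real_derivative (u' s - C * u s) * exp (- C * s) - d) (at s within {0..t})" if "s : {0..t}" for s
   unfolding g_def using du[OF that] by (auto intro!: derivative_eq_intros simp: algebra_simps)
  have "EX s:{0<..<t}. g t - g 0 = ((u' s - C * u s) * exp (- C * s) - d) * (t - 0)"
   by (rule mvt_simple[OF t0]) (use dg in \<open>auto simp: has_field_derivative_def\<close>)
  then obtain s where s: "0 < s" "s < t" "g t - g 0 = ((u' s - C * u s) * exp (- C * s) - d) * t" by auto
  have "(u' s - C * u s) * exp (- C * s) <= d * 1" using bu[of s] s C by (intro mult_mono) auto
  hence "g t - g 0 <= 0" using s(3) t0 by (simp add: mult_nonpos_nonneg)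
  hence "u t * exp (- C * t) <= u 0 + d * t" by (simp add: g_def)
  moreover have "u 0 <= norm (x 0) + e"
   using sqrt_add_le_add_sqrt[of "x 0 \<bullet> x 0" "e\<^sup>2"] e by (simp add: u_def norm_eq_sqrt_inner)
  moreover have "norm (x t) * exp (- C * t) <= u t * exp (- C * t)" using u by simp
  ultimately show ?thesis by linarith
 qed
 hence "norm (x t) * exp (- C * t) <= norm (x 0) + d * t" by (rule field_le_epsilon)
 thus ?thesis by (simp add: exp_minus field_simps)
qed simp

section \<open>Differentiable dependence on initial values\<close>

locale lipschitz_ode =
 fixes Y :: "real => 'a::euclidean_space => 'a" and T L :: real
 assumes T: "0 <= T" and L: "0 <= L"
  and cont: "continuous_on ({0..T} \<times> UNIV) (%(t, x). Y t x)"
  and lip: "!!t x y. t : {0..T} ==> norm (Y t x - Y t y) <= L * norm (x - y)"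
begin

lemma continuous_along:
 assumes "continuous_on {0..T} x" shows "continuous_on {0..T} (%s. Y s (x s))"
proof -
 have "continuous_on {0..T} (%s. (%(t, x). Y t x) (s, x s))"
  by (rule continuous_on_compose2[OF cont]) (auto intro!: continuous_intros assms)
 thus ?thesis by simp
qed

text \<open>Picard iteration in an exponentially weighted sup norm: the unknown is \<open>w\<close>
  with solution \<open>exp (c * s) .* w s\<close>. The weight makes the contraction constant
  \<open>L / c\<close>, at most 1/2, independent of \<open>T\<close>, so the whole interval is
  covered at once.\<close>

lemma solution_exists:
 "EX x. x 0 = x0 & (ALL t:{0..T}. (x has_vector_derivative Y t (x t)) (at t within {0..T}))"
proof -
 define c where "c = 2 * L + 1"
 have c: "c > 0" "L / c <= 1/2" using L by (auto simp: c_def field_simps)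
 \<comment> \<open>Clamping the time to \<open>{0..T}\<close> turns functions on the interval into
   elements of the complete space of bounded continuous functions on the line.\<close>
 define cl where "cl t = max 0 (min T t)" for t
 have cl: "cl t : {0..T}" and cl_id: "t : {0..T} ==> cl t = t" for t using T by (auto simp: cl_def)
 have ccl: "continuous_on UNIV cl" unfolding cl_def by (intro continuous_intros)
 define J where "J w t = integral {0..t} (%s. Y s (exp (c * s) .* apply_bcontfun w s))"
  for w :: "real \<Rightarrow>\<^sub>C 'a" and t
 have cw: "continuous_on {0..T} (%s. Y s (exp (c * s) .* apply_bcontfun w s))" for w
  by (intro continuous_along continuous_intros continuous_on_subset[OF continuous_on_apply_bcontfun]) auto
 have int: "(%s. Y s (exp (c * s) .* apply_bcontfun w s)) integrable_on {0..t}" if "t : {0..T}" for w t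
  by (rule integrable_continuous_interval[OF continuous_on_subset[OF cw]]) (use that in auto)
 have dJ: "(J w has_vector_derivative Y t (exp (c * t) .* apply_bcontfun w t)) (at t within {0..T})" if "t : {0..T}" for w t
  unfolding J_def by (rule integral_has_vector_derivative[OF cw that])
 have cJ: "continuous_on {0..T} (J w)" for w
  using dJ by (meson continuous_on_eq_continuous_within has_vector_derivative_continuous)
 define G where "G w t = exp (- c * cl t) .* (x0 + J w (cl t))" for w t
 have cG: "continuous_on UNIV (G w)" for w unfolding G_def
  by (intro continuous_intros ccl continuous_on_compose2[OF cJ ccl]) (use cl in auto)
 have bG: "bounded (range (G w))" for w
 proof -
  have "continuous_on {0..T} (%t. exp (- c * t) .* (x0 + J w t))" by (intro continuous_intros cJ)
  hence "bounded ((%t. exp (- c * t) .* (x0 + J w t)) ` {0..T})"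
   using compact_imp_bounded compact_continuous_image compact_Icc by blast
  thus ?thesis by (rule bounded_subset) (use cl in \<open>auto simp: G_def\<close>)
 qed
 have GB: "G w : bcontfun" for w using cG bG by (auto simp: bcontfun_def)
 define F where "F w = Bcontfun (G w)" for w
 have appF: "apply_bcontfun (F w) = G w" for w unfolding F_def by (rule Bcontfun_inverse[OF GB])
 have "dist (F w) (F v) <= 1/2 * dist w v" for w v
 proof (rule dist_bound)
  fix t
  define s where "s = cl t"
  have s: "s : {0..T}" using cl by (simp add: s_def)
  have "norm (J w s - J v s) <= integral {0..s} (%r. L * dist w v * exp (c * r))"
  proof -
   have ie: "(%r. L * dist w v * exp (c * r)) integrable_on {0..s}"
    by (intro integrable_continuous_interval continuous_intros)
   have "J w s - J v s = integral {0..s} (%r. Y r (exp (c * r) .* apply_bcontfun w r) - Y r (exp (c * r) .* apply_bcontfun v r))"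
    unfolding J_def by (rule integral_diff[symmetric, OF int[OF s] int[OF s]])
   also have "norm ... <= integral {0..s} (%r. L * dist w v * exp (c * r))"
   proof (rule integral_norm_bound_integral[OF integrable_diff[OF int[OF s] int[OF s]] ie])
    fix r assume r: "r : {0..s}"
    have "norm (Y r (exp (c * r) .* apply_bcontfun w r) - Y r (exp (c * r) .* apply_bcontfun v r))
      <= L * norm (exp (c * r) .* apply_bcontfun w r - exp (c * r) .* apply_bcontfun v r)"
     by (rule lip) (use r s in auto)
    also have "... = L * (exp (c * r) * dist (apply_bcontfun w r) (apply_bcontfun v r))"
     by (simp add: dist_norm flip: scaleR_diff_right)
    also have "... <= L * (exp (c * r) * dist w v)" by (intro mult_left_mono dist_bounded L) auto
    finally show "norm (Y r (exp (c * r) .* apply_bcontfun w r) - Y r (exp (c * r) .* apply_bcontfun v r))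
      <= L * dist w v * exp (c * r)" by (simp add: mult_ac)
   qed
   finally show ?thesis .
  qed
  also have "integral {0..s} (%r. L * dist w v * exp (c * r)) = L * dist w v * (exp (c * s) / c - exp (c * 0) / c)"
  proof (rule integral_unique)
   have "((%r. exp (c * r)) has_integral (exp (c * s) / c - exp (c * 0) / c)) {0..s}"
    using s c by (intro fundamental_theorem_of_calculus)
     (auto intro!: derivative_eq_intros simp: has_real_derivative_iff_has_vector_derivative[symmetric])
   thus "((%r. L * dist w v * exp (c * r)) has_integral L * dist w v * (exp (c * s) / c - exp (c * 0) / c)) {0..s}"
    by (rule has_integral_mult_right)
  qed
  also have "... <= L * dist w v * (exp (c * s) / c)" using c L by (intro mult_left_mono) auto
  finally have *: "norm (J w s - J v s) <= L / c * dist w v * exp (c * s)" by (simp add: mult_ac)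
  have "dist (G w t) (G v t) = exp (- c * s) * norm (J w s - J v s)"
   by (simp add: G_def s_def dist_norm flip: scaleR_diff_right)
  also have "... <= exp (- c * s) * (L / c * dist w v * exp (c * s))" using * by (intro mult_left_mono) auto
  also have "... = L / c * dist w v" by (simp add: exp_minus field_simps)
  also have "... <= 1/2 * dist w v" using c by (intro mult_right_mono) auto
  finally show "dist (apply_bcontfun (F w) t) (apply_bcontfun (F v) t) <= 1/2 * dist w v" by (simp only: appF)
 qed
 hence "EX! w. F w = w" by (intro banach_fix_type[of "1/2"]) auto
 then obtain w where "F w = w" by blast
 hence w: "apply_bcontfun w = G w" using appF by metis
 define x where "x t = x0 + J w t" for t
 have eq: "exp (c * t) .* apply_bcontfun w t = x t" if "t : {0..T}" for t
  using that by (simp add: w G_def cl_id x_def exp_minus)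
 have "(x has_vector_derivative Y t (x t)) (at t within {0..T})" if "t : {0..T}" for t
  using dJ[OF that, of w] unfolding eq[OF that] x_def by (auto intro!: derivative_eq_intros)
 moreover have "x 0 = x0" by (simp add: x_def J_def)
 ultimately show ?thesis by blast
qed

definition sol :: "'a => real => 'a" where
 "sol x0 = (SOME x. x 0 = x0 & (ALL t:{0..T}. (x has_vector_derivative Y t (x t)) (at t within {0..T})))"

lemma sol_0 [simp]: "sol x0 0 = x0"
 and sol_deriv: "t : {0..T} ==> (sol x0 has_vector_derivative Y t (sol x0 t)) (at t within {0..T})"
 using someI_ex[OF solution_exists[of x0]] unfolding sol_def by auto

lemma sol_continuous: "continuous_on {0..T} (sol x0)"
 using sol_deriv by (meson continuous_on_eq_continuous_within has_vector_derivative_continuous)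

lemma sol_lipschitz:
 assumes t: "t : {0..T}"
 shows "norm (sol x0 t - sol y0 t) <= norm (x0 - y0) * exp (L * T)"
proof -
 have "norm (sol x0 t - sol y0 t) <= (norm (sol x0 0 - sol y0 0) + 0 * t) * exp (L * t)"
  by (rule norm_gronwall[OF has_vector_derivative_diff[OF sol_deriv sol_deriv] _ L _ t]) (use lip in auto)
 also have "... <= norm (x0 - y0) * exp (L * T)" using t L by (simp add: mult_left_mono)
 finally show ?thesis .
qed

lemma sol_unique:
 assumes "!!t. t : {0..T} ==> (y has_vector_derivative Y t (y t)) (at t within {0..T})" "t : {0..T}"
 shows "y t = sol (y 0) t"
proof -
 have "norm (y t - sol (y 0) t) <= (norm (y 0 - sol (y 0) 0) + 0 * t) * exp (L * t)"
  by (rule norm_gronwall[OF has_vector_derivative_diff[OF assms(1) sol_deriv] _ L _ assms(2)]) (use lip in auto)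
 thus ?thesis by simp
qed

end

locale differentiable_ode = lipschitz_ode Y T L for Y :: "real => 'a::euclidean_space => 'a" and T L +
 fixes Y' :: "real => 'a => 'a => 'a"
 assumes deriv: "!!t x. t : {0..T} ==> (Y t has_derivative Y' t x) (at x)"
  and cont': "!!v. continuous_on ({0..T} \<times> UNIV) (%(t, x). Y' t x v)"
begin

lemma Y'_expand: "t : {0..T} ==> Y' t x v = (\<Sum>b\<in>Basis. (v \<bullet> b) .* Y' t x b)"
proof -
 assume "t : {0..T}"
 then interpret linear "Y' t x" using deriv has_derivative_linear by blast
 show ?thesis by (subst euclidean_representation[symmetric, of v]) (simp only: sum scale)
qed

text \<open>On a compact tube around the path the partial derivatives are uniformly continuous, so
  the remainder of the linearisation is small uniformly in time.\<close>

lemma uniform_derivative: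
 assumes x: "continuous_on {0..T} x" and e: "e > 0"
 obtains d where "d > 0" "!!t z. t : {0..T} ==> norm (z - x t) < d ==>
  norm (Y t z - Y t (x t) - Y' t (x t) (z - x t)) <= e * norm (z - x t)"
proof -
 have "bounded (x ` {0..T})" by (intro compact_imp_bounded compact_continuous_image x compact_Icc)
 then obtain M where M: "!!t. t : {0..T} ==> norm (x t) <= M" unfolding bounded_iff by (metis imageI)
 let ?K = "{0..T} \<times> cball (0::'a) (M + 1)"
 have K: "compact ?K" by (intro compact_Times compact_Icc compact_cball)
 define e' where "e' = e / DIM('a)"
 have e': "e' > 0" using e by (simp add: e'_def)
 have "EX d>0. ALL p:?K. ALL q:?K. dist q p < d --> dist ((%(t, x). Y' t x b) q) ((%(t, x). Y' t x b) p) < e'" for b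
 proof -
  have "uniformly_continuous_on ?K (%(t, x). Y' t x b)"
   by (rule compact_uniformly_continuous[OF continuous_on_subset[OF cont'] K]) auto
  thus ?thesis using e' unfolding uniformly_continuous_on_def by blast
 qed
 then obtain d where d: "!!b. d b > 0"
  "!!b p q. p : ?K ==> q : ?K ==> dist q p < d b ==> dist ((%(t, x). Y' t x b) q) ((%(t, x). Y' t x b) p) < e'"
  by metis
 define D where "D = Min (insert 1 (d ` Basis))"
 have D: "D > 0" "D <= 1" unfolding D_def using d(1) by auto
 have Db: "D <= d b" if "b : Basis" for b unfolding D_def by (rule Min_le) (use that in auto)
 have close: "norm (Y' t z v - Y' t (x t) v) <= e * norm v" if t: "t : {0..T}" and z: "norm (z - x t) < D" for t z v
 proof -
  have "norm z <= norm (z - x t) + norm (x t)" using norm_triangle_sub[of z "x t"] by simp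
  hence in_K: "(t, z) : ?K" "(t, x t) : ?K" using M[OF t] z D t by auto
  have b: "norm (Y' t z b - Y' t (x t) b) <= e'" if "b : Basis" for b
   using d(2)[OF in_K(2,1), of b] z Db[OF that] by (simp add: dist_Pair_Pair dist_norm less_imp_le)
  have "Y' t z v - Y' t (x t) v = (\<Sum>b\<in>Basis. (v \<bullet> b) .* (Y' t z b - Y' t (x t) b))"
   by (simp add: Y'_expand[OF t, of _ v] scaleR_diff_right sum_subtractf)
  also have "norm ... <= (\<Sum>b\<in>(Basis::'a set). norm v * e')"
  proof (rule order_trans[OF norm_sum sum_mono])
   fix i :: 'a assume i: "i : Basis"
   have "\<bar>v \<bullet> i\<bar> * norm (Y' t z i - Y' t (x t) i) <= norm v * e'"
    by (intro mult_mono b[OF i] Basis_le_norm[OF i]) auto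
   thus "norm ((v \<bullet> i) .* (Y' t z i - Y' t (x t) i)) <= norm v * e'" by simp
  qed
  also have "... = e * norm v" by (simp add: e'_def)
  finally show ?thesis .
 qed
 show ?thesis
 proof (rule that[OF D(1)])
  fix t z assume t: "t : {0..T}" and z: "norm (z - x t) < D"
  define f where "f y = Y t y - Y' t (x t) y" for y
  have lin: "bounded_linear (Y' t (x t))" using deriv[OF t] has_derivative_bounded_linear by blast
  have "norm (f z - f (x t)) <= e * norm (z - x t)"
  proof (rule differentiable_bound[of "ball (x t) D"])
   show "(f has_derivative (%v. Y' t y v - Y' t (x t) v)) (at y within ball (x t) D)" for y unfolding f_def
    by (intro has_derivative_diff has_derivative_at_withinI[OF deriv[OF t]] bounded_linear_imp_has_derivative lin)
   show "onorm (%v. Y' t y v - Y' t (x t) v) <= e" if "y : ball (x t) D" for y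
    using that e by (intro onorm_bound close[OF t]) (auto simp: dist_norm norm_minus_commute)
  qed (use z D in \<open>auto simp: dist_norm norm_minus_commute\<close>)
  thus "norm (Y t z - Y t (x t) - Y' t (x t) (z - x t)) <= e * norm (z - x t)"
   using bounded_linear.linear[OF lin] by (simp add: f_def linear_diff algebra_simps)
 qed
qed

text \<open>The derivative is the solution operator of the linearised equation along
  \<open>x\<close>, itself an instance of \<open>lipschitz_ode\<close>. The error \<open>r\<close>
  of the linear approximation starts at 0 and satisfies a Gronwall inequality with inhomogeneity of
  smaller order than \<open>norm (y0 - x0)\<close>.\<close>

lemma sol_differentiable: "EX D. ((%x0. sol x0 T) has_derivative D) (at x0)"
proof -
 define x where "x = sol x0"
 have cx: "continuous_on {0..T} x" unfolding x_def by (rule sol_continuous)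
 define A where "A t v = Y' t (x t) v" for t v
 have cb: "continuous_on {0..T} (%t. A t b)" for b
 proof -
  have "continuous_on {0..T} (%t. (%(t, x). Y' t x b) (t, x t))"
   by (rule continuous_on_compose2[OF cont']) (auto intro!: continuous_intros cx)
  thus ?thesis by (simp add: A_def)
 qed
 have "EX M. ALL t:{0..T}. norm (A t b) <= M" for b
  using compact_imp_bounded[OF compact_continuous_image[OF cb compact_Icc]] unfolding bounded_iff by auto
 then obtain M where M: "!!b t. t : {0..T} ==> norm (A t b) <= M b" by metis
 have M0: "M b >= 0" for b using M[of 0 b] T norm_ge_zero[of "A 0 b"] by (simp add: order_trans[OF norm_ge_zero])
 define L' where "L' = (\<Sum>b\<in>Basis. M b)"
 have L': "L' >= 0" unfolding L'_def by (intro sum_nonneg M0)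
 have linA: "linear (A t)" if "t : {0..T}" for t
  unfolding A_def using deriv[OF that] has_derivative_linear by blast
 have Ab: "norm (A t v) <= L' * norm v" if t: "t : {0..T}" for t v
 proof -
  have "norm (A t v) <= (\<Sum>b\<in>Basis. M b * norm v)" unfolding A_def Y'_expand[OF t, of _ v]
  proof (rule order_trans[OF norm_sum sum_mono])
   fix i :: 'a assume i: "i : Basis"
   have "\<bar>v \<bullet> i\<bar> * norm (A t i) <= norm v * M i"
    by (intro mult_mono M[OF t] Basis_le_norm[OF i]) auto
   thus "norm ((v \<bullet> i) .* Y' t (x t) i) <= M i * norm v" by (simp add: A_def mult.commute)
  qed
  thus ?thesis by (simp add: L'_def sum_distrib_right)
 qed
 interpret A: lipschitz_ode A T L'
 proof
  show "0 <= T" "0 <= L'" by (rule T L')+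
  have "continuous_on ({0..T} \<times> UNIV) (%p. \<Sum>b\<in>Basis. (snd p \<bullet> b) .* A (fst p) b)"
   by (intro continuous_intros continuous_on_compose2[OF cb]) auto
  thus "continuous_on ({0..T} \<times> UNIV) (%(t, x). A t x)"
   by (rule continuous_on_eq) (auto simp: A_def Y'_expand[symmetric])
  show "norm (A t v - A t w) <= L' * norm (v - w)" if "t : {0..T}" for t v w
   using Ab[OF that, of "v - w"] linear_diff[OF linA[OF that]] by simp
 qed
 have T': "T : {0..T}" using T by simp
 have "linear (%v. A.sol v T)"
 proof (rule linearI)
  fix v w
  have "(%t. A.sol v t + A.sol w t) T = A.sol (A.sol v 0 + A.sol w 0) T"
  proof (rule A.sol_unique[OF _ T'])
   fix t assume t: "t : {0..T}"
   show "((%t. A.sol v t + A.sol w t) has_vector_derivative A t (A.sol v t + A.sol w t)) (at t within {0..T})"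
    unfolding linear_add[OF linA[OF t]] by (intro has_vector_derivative_add A.sol_deriv[OF t])
  qed
  thus "A.sol (v + w) T = A.sol v T + A.sol w T" by simp
 next
  fix r v
  have "(%t. r .* A.sol v t) T = A.sol (r .* A.sol v 0) T"
  proof (rule A.sol_unique[OF _ T'])
   fix t assume t: "t : {0..T}"
   show "((%t. r .* A.sol v t) has_vector_derivative A t (r .* A.sol v t)) (at t within {0..T})"
    unfolding linear_scale[OF linA[OF t]]
    by (rule bounded_linear.has_vector_derivative[OF bounded_linear_scaleR_right A.sol_deriv[OF t]])
  qed
  thus "A.sol (r .* v) T = r .* A.sol v T" by simp
 qed
 hence bl: "bounded_linear (%v. A.sol v T)" by (simp add: linear_conv_bounded_linear)
 have "EX d>0. ALL y0. norm (y0 - x0) < d -->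
   norm (sol y0 T - sol x0 T - A.sol (y0 - x0) T) <= e * norm (y0 - x0)" if e: "e > 0" for e
 proof -
  define E where "E = exp (L * T)"
  define E' where "E' = exp (L' * T)"
  have E: "E > 0" "E' > 0" by (auto simp: E_def E'_def)
  \<comment> \<open>Chosen so that Gronwall's bound becomes at most
    \<open>e * norm (y0 - x0)\<close>; \<open>T + 1\<close> keeps the denominator positive when
    \<open>T = 0\<close>.\<close>
  define e' where "e' = e / (E * (T + 1) * E')"
  have e': "e' > 0" using e E T by (simp add: e'_def)
  obtain d where d: "d > 0" "!!t z. t : {0..T} ==> norm (z - x t) < d ==>
   norm (Y t z - Y t (x t) - A t (z - x t)) <= e' * norm (z - x t)"
   using uniform_derivative[OF cx e'] unfolding A_def by blast
  show ?thesis
  proof (intro exI[of _ "d / E"] conjI allI impI)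
   show "d / E > 0" using d E by simp
   fix y0 assume y0: "norm (y0 - x0) < d / E"
   define r where "r t = sol y0 t - sol x0 t - A.sol (y0 - x0) t" for t
   have cl: "norm (sol y0 t - x t) <= norm (y0 - x0) * E" if "t : {0..T}" for t
    unfolding x_def E_def by (rule sol_lipschitz[OF that])
   have "norm (r T) <= (norm (r 0) + (e' * (norm (y0 - x0) * E)) * T) * exp (L' * T)"
   proof (rule norm_gronwall[OF _ _ L' _ T'])
    fix t assume t: "t : {0..T}"
    show "(r has_vector_derivative Y t (sol y0 t) - Y t (x t) - A t (A.sol (y0 - x0) t)) (at t within {0..T})"
     unfolding r_def x_def by (intro has_vector_derivative_diff sol_deriv[OF t] A.sol_deriv[OF t])
    have "Y t (sol y0 t) - Y t (x t) - A t (A.sol (y0 - x0) t)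
      = (Y t (sol y0 t) - Y t (x t) - A t (sol y0 t - x t)) + A t (r t)"
     by (simp add: r_def x_def linear_diff[OF linA[OF t]])
    also have "norm ... <= e' * norm (sol y0 t - x t) + L' * norm (r t)"
    proof (rule norm_triangle_le[OF add_mono[OF d(2)[OF t] Ab[OF t]]])
     show "norm (sol y0 t - x t) < d" using cl[OF t] y0 E by (simp add: field_simps)
    qed
    also have "... <= e' * (norm (y0 - x0) * E) + L' * norm (r t)"
     using cl[OF t] e' by (intro add_mono mult_left_mono order_refl) auto
    finally show "norm (Y t (sol y0 t) - Y t (x t) - A t (A.sol (y0 - x0) t))
     <= L' * norm (r t) + e' * (norm (y0 - x0) * E)" by simp
   qed (use e' E in auto)
   also have "... = e * (T / (T + 1)) * norm (y0 - x0)"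
   proof -
    have "T + 1 ~= 0" using T by simp
    hence "e' * E * E' = e / (T + 1)" using E by (simp add: e'_def)
    moreover have "r 0 = 0" by (simp add: r_def A.sol_0)
    ultimately have "(norm (r 0) + (e' * (norm (y0 - x0) * E)) * T) * exp (L' * T)
      = (e / (T + 1)) * T * norm (y0 - x0)"
     unfolding E'_def[symmetric] by (metis (no_types, opaque_lifting) add_0 mult.assoc mult.commute norm_zero)
    thus ?thesis by simp
   qed
   also have "... <= e * 1 * norm (y0 - x0)" using e T by (intro mult_right_mono mult_left_mono) auto
   finally show "norm (sol y0 T - sol x0 T - A.sol (y0 - x0) T) <= e * norm (y0 - x0)" by (simp add: r_def)
  qed
 qed
 hence "((%x0. sol x0 T) has_derivative (%v. A.sol v T)) (at x0)"
  unfolding has_derivative_at_alt using bl by blast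
 thus ?thesis by blast
qed

end

text \<open>Without a zero, the normalised field \<open>- r G / |G|\<close> would map the ball into
  itself. Its fixed point lies on the sphere and has \<open>G v\<close> pointing opposite to
  \<open>v\<close>, contradicting positivity.\<close>

lemma brouwer_zero:
 fixes G :: "'a::euclidean_space => 'a"
 assumes S: "subspace S" and r: "r > 0" and G: "continuous_on (S \<inter> cball 0 r) G"
  "!!v. v : S ==> norm v <= r ==> G v : S" and pos: "!!v. v : S ==> norm v = r ==> G v \<bullet> v > 0"
 shows "EX v:S. norm v <= r & G v = 0"
proof (rule ccontr)
 assume "~ ?thesis"
 hence nz: "G v ~= 0" if "v : S" "norm v <= r" for v using that by blast
 define f where "f v = (- r / norm (G v)) .* G v" for v
 have "compact (S \<inter> cball 0 r)" using S by (simp add: closed_Int_compact closed_subspace)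
 moreover have "convex (S \<inter> cball 0 r)" using S by (simp add: convex_Int subspace_imp_convex)
 moreover have "0 : S \<inter> cball 0 r" using subspace_0[OF S] r by simp
 hence "S \<inter> cball 0 r ~= {}" by blast
 moreover have "continuous_on (S \<inter> cball 0 r) f"
  unfolding f_def using nz by (intro continuous_intros G(1)) auto
 moreover have "f : (S \<inter> cball 0 r) \<rightarrow> (S \<inter> cball 0 r)"
  using G(2) nz S r by (auto simp: f_def subspace_scale subspace_neg)
 ultimately obtain v where v: "v : S \<inter> cball 0 r" "f v = v" using brouwer by blast
 have Gv: "G v ~= 0" using nz v by auto
 have "norm v = norm (f v)" using v by simp
 also have "... = r" using Gv r by (simp add: f_def)
 finally have "G v \<bullet> v > 0" using pos v by blast
 moreover have "G v \<bullet> v = G v \<bullet> f v" using v by simp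
 moreover have "... = - r * norm (G v)" using Gv by (simp add: f_def dot_square_norm power2_eq_square)
 ultimately show False using r Gv by (simp add: mult_less_0_iff)
qed

section \<open>Deformation to an affine contact form\<close>

lemma form1_fun_mult:
 "smooth_on f S ==> form1 S m ==> open S ==> form1 S (%x v. f x * m x v)" unfolding form1_def
 by (auto intro!: linear_compose_scale_right[where 'b=real, unfolded real_scaleR_def] smooth_mult)

lemma d1_fun_mult:
 assumes "smooth_on f S" "form1 S m" "x : S"
 shows "d1 (%x v. f x * m x v) x a b = FD f x a * m x b
   - FD f x b * m x a + f x * d1 m x a b"
proof -
 have "((%x. f x * m x v) has_derivative (%a. f x * FD (%x. m x v) x a
   + FD f x a * m x v)) (at x)" for v
  by (rule has_derivative_mult[OF smooth_deriv[OF assms(1,3)] form1D(3)[OF assms(2,3)]])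
 hence "FD (%x. f x * m x v) x a = f x * FD (%x. m x v) x a
   + FD f x a * m x v" for v a by (rule FD_eqI)
 thus ?thesis by (simp add: d1_def algebra_simps)
qed

lemma form1_differential:
 fixes f :: "'e::euclidean_space => real"
 shows "smooth_on f S ==> form1 S (%x v. FD f x v)" unfolding form1_def
 using smooth_deriv has_derivative_linear smooth_FD by blast

lemma d1_differential:
 fixes f :: "'e::euclidean_space => real"
 assumes "smooth_on f S" "open S" "x : S"
 shows "d1 (%x v. FD f x v) x a b = 0" using schwarz[OF assms, of a b] by (simp add: d1_def)

lemma form1_const:
 "linear l ==> open S ==> form1 S (%x v. l v)" by (simp add: form1_def smooth_const)

lemma d1_const [simp]: "d1 (%x v. l v) x a b = 0" by (simp add: d1_def)

lemma form1_bilinear: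
 fixes B :: "'e::euclidean_space => 'e => real"
 assumes "!!a. linear (B a)" "!!b. linear (%a. B a b)" "open S"
 shows "form1 S (%x v. B (x - x0) v)" unfolding form1_def using assms
 by (auto intro!: smooth_linear[where L="%a. B a v" for v] smooth_diff smooth_ident smooth_const
   simp: linear_conv_bounded_linear)

lemma d1_bilinear:
 fixes B :: "'e::euclidean_space => 'e => real"
 assumes "!!b. linear (%a. B a b)"
 shows "d1 (%x v. B (x - x0) v) x a b = B a b - B b a"
proof -
 have "((%x. B (x - x0) v) has_derivative (%a. B a v)) (at x)" for v
 proof -
  have "bounded_linear (%a. B a v)" using assms by (simp add: linear_conv_bounded_linear)
  moreover have "((%x. x - x0) has_derivative (%h. h)) (at x)" by (auto intro!: derivative_eq_intros)
  ultimately show ?thesis by (rule bounded_linear.has_derivative)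
 qed
 hence "FD (%x. B (x - x0) v) x a = B a v" for v a by (rule FD_eqI)
 thus ?thesis by (simp add: d1_def)
qed

lemma vol_form_nonzero_open:
 assumes "vol_form n l0 w0 v ~= 0"
 shows "EX d>0. ALL l w. (ALL i. \<bar>l (v i) - l0 (v i)\<bar> < d) & (ALL i j. \<bar>w (v i) (v j) - w0 (v i) (v j)\<bar> < d)
   --> vol_form n l w v ~= 0"
proof (rule ccontr)
 assume neg: "~ ?thesis"
 have "EX l w. (ALL i. \<bar>l (v i) - l0 (v i)\<bar> < inverse (real (Suc k))) &
   (ALL i j. \<bar>w (v i) (v j) - w0 (v i) (v j)\<bar> < inverse (real (Suc k))) & vol_form n l w v = 0" for k
 proof -
  have "inverse (real (Suc k)) > 0" by simp
  thus ?thesis using neg by blast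
 qed
 then obtain l w where lw: "!!k i. \<bar>l k (v i) - l0 (v i)\<bar> < inverse (real (Suc k))"
   "!!k i j. \<bar>w k (v i) (v j) - w0 (v i) (v j)\<bar> < inverse (real (Suc k))" "!!k. vol_form n (l k) (w k) v = 0"
  by metis
 have lim: "f ----> a" if "!!k. \<bar>f k - a\<bar> < inverse (real (Suc k))" for f and a :: real
  by (rule LIMSEQ_norm_0[of "%k. f k - a", THEN LIM_zero_cancel]) (use that in \<open>simp add: inverse_eq_divide\<close>)
 have "(%k. vol_form n (l k) (w k) v) ----> vol_form n l0 w0 v" by (intro vol_form_tendsto lim lw)
 hence "(%k. 0) ----> vol_form n l0 w0 v" using lw(3) by simp
 thus False using assms LIMSEQ_unique[OF _ tendsto_const] by blast
qed

lemma std_basis_in_Basis: "std_basis i : (Basis :: ((real, 'm::{finite,linorder}) vec) set)"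
 by (simp add: std_basis_def axis_in_Basis_iff)

context
 fixes x0 :: "'e::euclidean_space"
begin

definition radial_cutoff :: "real => 'e => real" where
 "radial_cutoff r x = smooth_step (2 - 2 / r\<^sup>2 * ((x - x0) \<bullet> (x - x0)))"

lemma smooth_radial_cutoff: "open S ==> smooth_on (radial_cutoff r) S" unfolding radial_cutoff_def
 by (intro smooth_step_o smooth_diff smooth_mult smooth_const smooth_inner smooth_ident)

lemma radial_cutoff_bounds: "0 <= radial_cutoff r x" "radial_cutoff r x <= 1"
 by (simp_all add: radial_cutoff_def smooth_step_bounds)

lemma radial_cutoff_eq_1: "norm (x - x0) <= r / 2 ==> radial_cutoff r x = 1" if "r > 0"
proof -
 assume "norm (x - x0) <= r / 2"
 hence "(norm (x - x0))\<^sup>2 <= (r / 2)\<^sup>2" by (intro power_mono) auto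
 hence "2 / r\<^sup>2 * ((x - x0) \<bullet> (x - x0)) <= 2 / r\<^sup>2 * (r / 2)\<^sup>2"
  using that by (intro mult_left_mono) (auto simp: power2_norm_eq_inner)
 also have "2 / r\<^sup>2 * (r / 2)\<^sup>2 = 1 / 2" using that by (simp add: power2_eq_square)
 finally show ?thesis unfolding radial_cutoff_def by (intro smooth_step_simps(2)) linarith
qed

lemma radial_cutoff_eq_0: "r <= norm (x - x0) ==> radial_cutoff r x = 0" if "r > 0"
proof -
 assume "r <= norm (x - x0)"
 hence "r\<^sup>2 <= (norm (x - x0))\<^sup>2" using that by (intro power_mono) auto
 hence "2 / r\<^sup>2 * r\<^sup>2 <= 2 / r\<^sup>2 * ((x - x0) \<bullet> (x - x0))"
  using that by (intro mult_left_mono) (auto simp: power2_norm_eq_inner)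
 thus ?thesis using that unfolding radial_cutoff_def by (intro smooth_step_simps(1)) simp
qed

text \<open>The growth \<open>1 / r\<close> is harmless in \<open>normalize_contact_form\<close>:
  there the differential of the cut-off is only multiplied by terms of size \<open>e * r\<close> or
  of order \<open>r\<^sup>2\<close>.\<close>

lemma radial_cutoff_derivative_bound:
 obtains C where "C >= 0" "!!r x v. r > 0 ==> norm (x - x0) <= r ==>
   \<bar>FD (radial_cutoff r) x v\<bar> <= C / r * norm v"
proof -
 define s' where "s' y = FD smooth_step y (1::real)" for y
 have "continuous_on {0..2} s'" unfolding s'_def
  by (rule continuous_on_subset[OF smooth_cont[OF smooth_FD[OF smooth_step_smooth]]]) auto
 hence "bounded (s' ` {0..2})" using compact_imp_bounded compact_continuous_image compact_Icc by blast
 then obtain M where M: "!!y. y : {0..2} ==> \<bar>s' y\<bar> <= M" unfolding bounded_iff by (metis imageI real_norm_def)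
 have M0: "M >= 0" using order_trans[OF abs_ge_zero M[of 0]] by simp
 show ?thesis
 proof (rule that[of "4 * M"])
  fix r x v assume r: "r > (0::real)" and x: "norm (x - x0) <= r"
  define y where "y = 2 - 2 / r\<^sup>2 * ((x - x0) \<bullet> (x - x0))"
  have "((%x. 2 - k * ((x - x0) \<bullet> (x - x0))) has_derivative (%v. - (2 * k * ((x - x0) \<bullet> v)))) (at x)" for k
   by (auto intro!: derivative_eq_intros simp: inner_commute algebra_simps)
  from this[of "2 / r\<^sup>2"]
  have "((%x. 2 - 2 / r\<^sup>2 * ((x - x0) \<bullet> (x - x0))) has_derivative (%v. - (4 / r\<^sup>2 * ((x - x0) \<bullet> v)))) (at x)"
   by simp
  from has_derivative_compose[OF this smooth_deriv[OF smooth_step_smooth]]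
  have "(radial_cutoff r has_derivative (%v. FD smooth_step y (- (4 / r\<^sup>2 * ((x - x0) \<bullet> v))))) (at x)"
   by (simp add: radial_cutoff_def[abs_def] y_def)
  hence "FD (radial_cutoff r) x v = FD smooth_step y (- (4 / r\<^sup>2 * ((x - x0) \<bullet> v)))"
   by (rule FD_eqI)
  also have "... = - (4 / r\<^sup>2 * ((x - x0) \<bullet> v)) * s' y"
  proof -
   have "linear (FD smooth_step y)"
    using smooth_deriv[OF smooth_step_smooth, of y] has_derivative_linear by blast
   from linear_scale[OF this, of "- (4 / r\<^sup>2 * ((x - x0) \<bullet> v))" 1] show ?thesis by (simp add: s'_def)
  qed
  finally have eq: "FD (radial_cutoff r) x v = - (4 / r\<^sup>2 * ((x - x0) \<bullet> v)) * s' y" .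
  have "(x - x0) \<bullet> (x - x0) <= r\<^sup>2" using x r power_mono[of "norm (x - x0)" r 2] by (simp add: power2_norm_eq_inner)
  hence "y : {0..2}" using r by (auto simp: y_def field_simps)
  hence "\<bar>FD (radial_cutoff r) x v\<bar> <= (4 / r\<^sup>2 * \<bar>(x - x0) \<bullet> v\<bar>) * M"
   unfolding eq abs_mult using M r by (intro mult_mono) auto
  also have "\<bar>(x - x0) \<bullet> v\<bar> <= r * norm v"
   by (rule order_trans[OF Cauchy_Schwarz_ineq2]) (use x in \<open>intro mult_right_mono, auto\<close>)
  hence "(4 / r\<^sup>2 * \<bar>(x - x0) \<bullet> v\<bar>) * M <= (4 / r\<^sup>2 * (r * norm v)) * M"
   using M0 r by (intro mult_right_mono mult_left_mono) auto
  also have "... = 4 * M / r * norm v" using r by (simp add: power2_eq_square)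
  finally show "\<bar>FD (radial_cutoff r) x v\<bar> <= 4 * M / r * norm v" .
 qed (use M0 in simp)
qed

end

context oriented_mf
begin

text \<open>Near \<open>x0\<close> the contact form is replaced by \<open>la\<close>, its value at
  \<open>x0\<close> plus the skew half of its linear part; the symmetric half is the differential of
  the quadratic function \<open>q\<close> and does not affect \<open>d\<lambda>\<close>. Since only
  \<open>d\<lambda>\<close> has to stay close, this discrepancy can be cut off separately.\<close>

lemma normalize_contact_form:
 assumes m: "CARD('m) = 2 * n + 1" and c0: "c0 : A" and s: "(lam, omg) : SHS A n"
  and V: "open V" "V <= cimg c0" "x0 : V" and a: "a ~= 0"
  and contact: "!!x u v. x : V ==> d1 (lc1 lam c0) x u v = a * lc2 omg c0 x u v"
 shows "EX lam' omg' r. ((lam, omg), (lam', omg')) : stable_homotopy_rel A n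
   & r > 0 & ball x0 r <= cimg c0
   & (ALL x:ball x0 r. ALL v. lc1 lam' c0 x v = lc1 lam c0 x0 v + lc2 omg c0 x0 (x - x0) v * a / 2)
   & (ALL x:ball x0 r. ALL u v. lc2 omg' c0 x u v = lc2 omg c0 x0 u v)"
proof -
 have lam: "smooth_form A 1 lam" and omg: "smooth_form A 2 omg"
  and at: "!!c x. c : A ==> x : cimg c ==> shs_at n (lc1 lam c) (lc2 omg c) x"
  using s unfolding SHS_iff[OF m] by blast+
 define l where "l = lc1 lam c0"
 define S where "S = cimg c0"
 have S: "open S" unfolding S_def by (rule open_cimg[OF c0])
 have l: "form1 S l" unfolding l_def S_def by (rule smooth_lc1(1)[OF lam c0])
 have x0: "x0 : S" using V by (auto simp: S_def)
 have ct: "lc2 omg c0 x u v = d1 l x u v / a" if "x : V" for x u v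
  using contact[OF that] a by (simp add: l_def)
 \<comment> \<open>The derivative of \<open>l\<close> at \<open>x0\<close>: \<open>h\<close> is the
   direction of differentiation, \<open>v\<close> the argument of the form.\<close>
 define b where "b h v = FD (%y. l y v) x0 h" for h v
 have b1: "linear (b h)" for h unfolding b_def by (rule linear_FD_form[OF l S x0])
 have b2: "linear (%h. b h v)" for v unfolding b_def using has_derivative_linear[OF form1D(3)[OF l x0]] .
 have bil: "bilinear b" using b1 b2 by (simp add: bilinear_def)
 define B where "B h v = b h v - b v h" for h v
 have dB: "d1 l x0 u v = B u v" for u v by (simp add: d1_def B_def b_def)
 have B1: "linear (B h)" "linear (%h. B h v)" for h v
  unfolding B_def using b1 b2 by (auto intro: linear_compose_sub)
 obtain Kb where Kb: "Kb > 0" "!!h v. \<bar>b h v\<bar> <= Kb * norm h * norm v"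
  using bilinear_bounded_pos[OF bil] by auto
 define q where "q x = b (x - x0) (x - x0) / 2" for x
 have dq: "(q has_derivative (%v. (b (x - x0) v + b v (x - x0)) / 2)) (at x)" for x
 proof -
  have "bounded_bilinear b" using bil by (simp add: bilinear_conv_bounded_bilinear)
  moreover have d: "((%x. x - x0) has_derivative (%h. h)) (at x)" by (auto intro!: derivative_eq_intros)
  ultimately have "((%x. b (x - x0) (x - x0)) has_derivative (%v. b (x - x0) v + b v (x - x0))) (at x)"
   using bounded_bilinear.FDERIV[OF _ d d] by blast
  from has_derivative_mult_right[OF this, of "1/2"] show ?thesis by (simp add: q_def[abs_def])
 qed
 have sq: "smooth_on q S"
 proof -
  have "smooth_on (%x. x - x0) S" by (intro smooth_diff smooth_ident smooth_const S)
  hence "smooth_on (%x. 1/2 * b (x - x0) (x - x0)) S" using bil unfolding bilinear_conv_bounded_bilinear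
   by (intro smooth_mult smooth_const smooth_bilinear[of b] S)
  thus ?thesis by (simp add: q_def[abs_def])
 qed
 define la where "la x v = l x0 v + (1/2) * B (x - x0) v" for x v
 have la: "form1 S la" unfolding la_def
  by (intro form1_add_scale form1_const form1_bilinear B1 S form1D(1)[OF l x0])
 have dla: "d1 la x u v = B u v" if "x : S" for x u v unfolding la_def
  using d1_add_scale[OF form1_const[OF form1D(1)[OF l x0] S] form1_bilinear[OF B1 S, of x0] that, of "1/2" u v]
   d1_bilinear[of B x0 x u v, OF B1(2)] by (simp add: B_def)
 obtain C where C: "C >= 0" "!!r x v. r > 0 ==> norm (x - x0) <= r ==>
   \<bar>FD (radial_cutoff x0 r) x v\<bar> <= C / r * norm v"
  using radial_cutoff_derivative_bound[of x0] by blast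
 have nz: "vol_form n (l x0) (lc2 omg c0 x0) std_basis ~= 0"
  using at[OF c0 x0[unfolded S_def]] unfolding shs_at_def l_def by simp
 obtain d where d: "d > 0" and d2: "ALL (l' :: (real, 'm) vec => real) w'. (ALL i. \<bar>l' (std_basis i) - l x0 (std_basis i)\<bar> < d) &
   (ALL i j. \<bar>w' (std_basis i) (std_basis j) - lc2 omg c0 x0 (std_basis i) (std_basis j)\<bar> < d)
   --> vol_form n l' w' std_basis ~= 0" using vol_form_nonzero_open[OF nz] by blast
 \<comment> \<open>The first bound serves for \<lambda>, the second for \<omega>, whose deviation is
   at most \<open>e * (2 + 2 * C) / \<bar>a\<bar>\<close>.\<close>
 define e where "e = min (d / 4) (d * \<bar>a\<bar> / 2 / (2 + 2 * C))"
 have e: "e > 0" using d C a by (simp add: e_def)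
 have "\<forall>\<^sub>F x in nhds x0. x : V & (ALL v:Basis. \<bar>l x v - l x0 v\<bar> < e)
   & (ALL v:Basis. ALL u:Basis. \<bar>d1 l x u v - B u v\<bar> < e)
   & (ALL v:Basis. \<bar>l x v - l x0 v - b (x - x0) v\<bar> <= e * norm (x - x0))"
 proof (intro eventually_conj eventually_ball_finite finite_Basis ballI)
  show "\<forall>\<^sub>F x in nhds x0. x : V" using V by (simp add: eventually_nhds_in_open)
  have cont: "\<forall>\<^sub>F x in nhds x0. \<bar>f x - f x0\<bar> < e" if "smooth_on f S" for f :: "_ => real"
  proof -
   have "isCont f x0" using smooth_cont[OF that] S x0 by (simp add: continuous_on_eq_continuous_at)
   hence "(f \<longlongrightarrow> f x0) (nhds x0)" by (simp add: isCont_def tendsto_at_iff_tendsto_nhds)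
   thus ?thesis using e by (simp add: tendsto_iff dist_real_def)
  qed
  show "\<forall>\<^sub>F x in nhds x0. \<bar>l x v - l x0 v\<bar> < e" for v by (rule cont[OF form1D(2)[OF l]])
  show "\<forall>\<^sub>F x in nhds x0. \<bar>d1 l x u v - B u v\<bar> < e" for u v
   using cont[OF smooth_d1[OF l S], of u v] by (simp add: dB)
  show "\<forall>\<^sub>F x in nhds x0. \<bar>l x v - l x0 v - b (x - x0) v\<bar> <= e * norm (x - x0)" for v
  proof -
   have "((%y. l y v) has_derivative (%h. b h v)) (at x0)" unfolding b_def by (rule form1D(3)[OF l x0])
   then obtain dd where "dd > 0" "ALL y. norm (y - x0) < dd --> norm (l y v - l x0 v - b (y - x0) v) <= e * norm (y - x0)"
    using e unfolding has_derivative_at_alt by meson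
   thus ?thesis unfolding eventually_nhds_metric by (auto simp: dist_norm)
  qed
 qed
 then obtain r1 where r1: "r1 > 0" "!!x. dist x x0 < r1 ==> x : V & (ALL v:Basis. \<bar>l x v - l x0 v\<bar> < e)
   & (ALL v:Basis. ALL u:Basis. \<bar>d1 l x u v - B u v\<bar> < e)
   & (ALL v:Basis. \<bar>l x v - l x0 v - b (x - x0) v\<bar> <= e * norm (x - x0))"
  unfolding eventually_nhds_metric by blast
 \<comment> \<open>The first bound makes the estimates around \<open>x0\<close> hold on
   \<open>K\<close>; the second controls the linear part of \<open>la - l\<close> and the term
   \<open>q dchi\<close>, which contribute \<open>r * Kb\<close> and
   \<open>r * (Kb * C)\<close>.\<close>
 define r where "r = min (r1 / 2) (d / 4 / (Kb + Kb * C + 1))"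
 have r: "r > 0" "r < r1" "r * (Kb + Kb * C) < d / 4"
 proof -
  have den: "Kb + Kb * C + 1 > 0" using Kb C by (simp add: add_nonneg_pos)
  show r0: "r > 0" using r1 d den by (simp add: r_def)
  show "r < r1" using r1 by (simp add: r_def)
  have "r * (Kb + Kb * C) < r * (Kb + Kb * C + 1)" using r0 by simp
  also have "... <= d / 4 / (Kb + Kb * C + 1) * (Kb + Kb * C + 1)"
   using den by (intro mult_right_mono) (auto simp: r_def)
  also have "... = d / 4" using den by (intro nonzero_eq_divide_eq[THEN iffD1]) auto
  finally show "r * (Kb + Kb * C) < d / 4" .
 qed
 define K where "K = cball x0 r"
 have KV: "K <= V" using r1(2) r by (auto simp: K_def dist_commute)
 define chi where "chi = radial_cutoff x0 r"
 let ?dchi = "%x v. FD chi x v"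
 have schi: "smooth_on chi T" if "open T" for T unfolding chi_def by (rule smooth_radial_cutoff[OF that])
 \<comment> \<open>This is \<open>chi (la + dq - l) - d (chi q)\<close>. As \<open>la + dq\<close>
   is the first-order Taylor expansion of \<open>l\<close>, the differential of the cut-off meets
   only a factor of size \<open>e * r\<close> in \<open>d m1\<close>.\<close>
 define m1 where "m1 = (%x v. (chi x * (la x v + (- 1) * l x v)) + (- 1) * (q x * ?dchi x v))"
 have lal: "form1 S (%x v. la x v + (- 1) * l x v)" by (intro form1_add_scale la l S)
 have qd: "form1 S (%x v. q x * ?dchi x v)" by (intro form1_fun_mult sq form1_differential schi S)
 have cl: "form1 S (%x v. chi x * (la x v + (- 1) * l x v))" by (intro form1_fun_mult lal schi S)
 have m1: "form1 S m1" unfolding m1_def by (intro form1_add_scale cl qd S)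
 have out: "m1 x v = 0" if "x ~: K" for x v
 proof -
  have x: "x : - K" "open (- K)" using that by (auto simp: K_def)
  have z: "chi y = 0" if "y : - K" for y
   unfolding chi_def by (rule radial_cutoff_eq_0[OF r(1)]) (use that in \<open>auto simp: K_def dist_norm norm_minus_commute\<close>)
  have "?dchi x v = FD (%_. 0) x v" using FD_cong[OF x(2,1), of chi "%_. 0"] z by simp
  thus ?thesis using z[OF x(1)] by (simp add: m1_def)
 qed
 have sup: "supported_form c0 K m1" using m1 out KV V by (auto simp: supported_form_def S_def K_def)
 have sup0: "supported_form c0 K (%x v. 0)"
  using KV V S by (auto simp: supported_form_def S_def K_def intro: form1_zero)
 \<comment> \<open>Changing \<omega> by \<open>d m1 / a\<close> preserves the relation
   \<open>d\<lambda> = a \<omega>\<close> on \<open>V\<close>, and with it the kernel condition at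
   every time.\<close>
 define m3 where "m3 = (%x v. 0 + (1 / a) * m1 x v)"
 have m3: "form1 S m3" unfolding m3_def by (intro form1_add_scale form1_zero m1 S)
 have sup3: "supported_form c0 K m3" using m3 out KV V by (auto simp: supported_form_def S_def K_def m3_def)
 have dm3: "d1 m3 x u v = d1 m1 x u v / a" if "x : S" for x u v
  unfolding m3_def using d1_add_scale[OF form1_zero[OF S] m1 that, of "1/a" u v] by simp
 have dm1: "d1 m1 x u v = chi x * (B u v - d1 l x u v)
    - ?dchi x u * (l x v - l x0 v - b (x - x0) v) + ?dchi x v * (l x u - l x0 u - b (x - x0) u)"
  if x: "x : S" for x u v
 proof -
  have q': "FD q x v = (b (x - x0) v + b v (x - x0)) / 2" for v by (rule FD_eqI[OF dq])
  have 1: "d1 (%x v. la x v + (- 1) * l x v) x u v = B u v - d1 l x u v"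
   using d1_add_scale[OF la l x, of "- 1" u v] by (simp add: dla[OF x])
  have 2: "d1 (%x v. q x * ?dchi x v) x u v = FD q x u * ?dchi x v - FD q x v * ?dchi x u"
   using d1_fun_mult[OF sq form1_differential[OF schi[OF S]] x, of u v] d1_differential[OF schi[OF S] S x, of u v] by simp
  have "d1 m1 x u v = (?dchi x u * (la x v + (- 1) * l x v) - ?dchi x v * (la x u + (- 1) * l x u)
    + chi x * (B u v - d1 l x u v)) - (FD q x u * ?dchi x v - FD q x v * ?dchi x u)"
   unfolding m1_def d1_add_scale[OF cl qd x] d1_fun_mult[OF schi[OF S] lal x] 1 2 by simp
  thus ?thesis unfolding q' la_def B_def by (simp add: field_simps)
 qed
 have mbound: "\<bar>m1 x v\<bar> <= e + r * (Kb + Kb * C)" and dbound: "\<bar>d1 m1 x u v\<bar> <= e * (1 + 2 * C)"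
  if x: "x : K" and uv: "u : Basis" "v : Basis" for x u v
 proof -
  have nx: "norm (x - x0) <= r" using x by (simp add: K_def dist_norm norm_minus_commute)
  have n1: "norm u = 1" "norm v = 1" using uv by auto
  note R = r1(2)[of x]
  have R': "\<bar>l x v - l x0 v\<bar> < e" "\<bar>d1 l x u v - B u v\<bar> < e"
   "\<bar>l x v - l x0 v - b (x - x0) v\<bar> <= e * r" "\<bar>l x u - l x0 u - b (x - x0) u\<bar> <= e * r"
  proof -
   have dx: "dist x x0 < r1" using nx r by (simp add: dist_norm)
   show "\<bar>l x v - l x0 v\<bar> < e" "\<bar>d1 l x u v - B u v\<bar> < e" using R[OF dx] uv by auto
   have "e * norm (x - x0) <= e * r" using nx e by (intro mult_left_mono) auto
   thus "\<bar>l x v - l x0 v - b (x - x0) v\<bar> <= e * r" "\<bar>l x u - l x0 u - b (x - x0) u\<bar> <= e * r"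
    using R[OF dx] uv by force+
  qed
  have chi: "0 <= chi x" "chi x <= 1" by (simp_all add: chi_def radial_cutoff_bounds)
  have dc: "\<bar>?dchi x w\<bar> <= C / r" if "norm w = 1" for w
   using C(2)[OF r(1) nx, of w] that by (simp add: chi_def)
  have bb: "\<bar>b (x - x0) v\<bar> <= Kb * r" "\<bar>b v (x - x0)\<bar> <= Kb * r"
  proof -
   have "Kb * norm (x - x0) <= Kb * r" using nx Kb by (intro mult_left_mono) auto
   thus "\<bar>b (x - x0) v\<bar> <= Kb * r" "\<bar>b v (x - x0)\<bar> <= Kb * r"
    using Kb(2)[of "x - x0" v] Kb(2)[of v "x - x0"] n1 by auto
  qed
  have qb: "\<bar>q x\<bar> <= Kb * r * r"
  proof -
   have "\<bar>q x\<bar> <= \<bar>b (x - x0) (x - x0)\<bar>" by (simp add: q_def)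
   also have "... <= Kb * norm (x - x0) * norm (x - x0)" by (rule Kb)
   also have "... <= Kb * r * r" using nx Kb r by (intro mult_mono) auto
   finally show ?thesis .
  qed
  have "\<bar>q x * ?dchi x v\<bar> <= (Kb * r * r) * (C / r)"
   unfolding abs_mult using qb dc[OF n1(2)] Kb r by (intro mult_mono) auto
  also have "... = r * (Kb * C)" using r by simp
  finally have Q: "\<bar>q x * ?dchi x v\<bar> <= r * (Kb * C)" .
  have "\<bar>b (x - x0) v - b v (x - x0)\<bar> <= 2 * (Kb * r)"
   using bb abs_triangle_ineq4[of "b (x - x0) v" "b v (x - x0)"] by linarith
  hence "\<bar>(1/2) * (b (x - x0) v - b v (x - x0))\<bar> <= Kb * r" by (simp add: abs_mult)
  hence "\<bar>la x v + (- 1) * l x v\<bar> <= e + Kb * r"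
   using R'(1) unfolding la_def B_def abs_le_iff abs_less_iff by linarith
  hence "\<bar>chi x * (la x v + (- 1) * l x v)\<bar> <= 1 * (e + Kb * r)"
   unfolding abs_mult using chi by (intro mult_mono) auto
  thus "\<bar>m1 x v\<bar> <= e + r * (Kb + Kb * C)" unfolding m1_def using Q by (simp add: algebra_simps)
  have xS: "x : S" using x KV V by (auto simp: S_def)
  have "\<bar>chi x * (B u v - d1 l x u v)\<bar> <= 1 * e"
   unfolding abs_mult using chi R'(2) by (intro mult_mono) auto
  moreover have "\<bar>?dchi x u * (l x v - l x0 v - b (x - x0) v)\<bar> <= (C / r) * (e * r)"
   unfolding abs_mult using dc[OF n1(1)] R'(3) C r by (intro mult_mono) auto
  moreover have "\<bar>?dchi x v * (l x u - l x0 u - b (x - x0) u)\<bar> <= (C / r) * (e * r)"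
   unfolding abs_mult using dc[OF n1(2)] R'(4) C r by (intro mult_mono) auto
  moreover have "(C / r) * (e * r) = e * C" using r by simp
  ultimately show "\<bar>d1 m1 x u v\<bar> <= e * (1 + 2 * C)"
   unfolding dm1[OF xS] by (simp add: algebra_simps)
 qed
 have e2: "e * (2 + 2 * C) / \<bar>a\<bar> < d"
 proof -
  have "e * (2 + 2 * C) <= d * \<bar>a\<bar> / 2 / (2 + 2 * C) * (2 + 2 * C)"
   using C by (intro mult_right_mono) (auto simp: e_def)
  also have "... = d * \<bar>a\<bar> / 2" by (rule nonzero_eq_divide_eq[THEN iffD1]) (use C(1) in auto)
  also have "... < d * \<bar>a\<bar>" using a d by simp
  finally show ?thesis using a by (simp add: pos_divide_less_eq)
 qed
 have vol: "vol_form n (%v. lc1 lam c0 x v + t * m1 x v + t\<^sup>2 * 0) (%a b. lc2 omg c0 x a b + t * d1 m3 x a b) std_basis ~= 0"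
  if t: "t : {0..1}" and x: "x : K" for t x
 proof (rule d2[rule_format], intro conjI allI)
  fix i j
  let ?u = "std_basis i :: (real, 'm) vec" and ?v = "std_basis j :: (real, 'm) vec"
  have B': "?u : Basis" "?v : Basis" by (rule std_basis_in_Basis)+
  have dx: "dist x x0 < r1" using x r by (simp add: K_def dist_commute)
  have "\<bar>t * m1 x ?u\<bar> <= 1 * (e + r * (Kb + Kb * C))"
   unfolding abs_mult using t mbound[OF x B'(1) B'(1)] by (intro mult_mono) auto
  moreover have "\<bar>l x ?u - l x0 ?u\<bar> < e" using r1(2)[OF dx] B' by auto
  moreover have "e <= d / 4" unfolding e_def by (rule min.cobounded1)
  ultimately show "\<bar>lc1 lam c0 x ?u + t * m1 x ?u + t\<^sup>2 * 0 - l x0 ?u\<bar> < d"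
   using r(3) d unfolding l_def by (simp add: abs_le_iff abs_less_iff)
  have xV: "x : V" "x : S" using x KV V by (auto simp: S_def)
  have "\<bar>t * d1 m1 x ?u ?v\<bar> <= 1 * (e * (1 + 2 * C))"
   unfolding abs_mult using t dbound[OF x B'] by (intro mult_mono) auto
  moreover have "\<bar>d1 l x ?u ?v - B ?u ?v\<bar> < e" using r1(2)[OF dx] B' by auto
  ultimately have "\<bar>d1 l x ?u ?v - B ?u ?v + t * d1 m1 x ?u ?v\<bar> <= e * (2 + 2 * C)"
   by (simp add: algebra_simps)
  hence "\<bar>(d1 l x ?u ?v - B ?u ?v + t * d1 m1 x ?u ?v) / a\<bar> < d"
   using e2 by (simp add: abs_divide) (meson a divide_right_mono abs_ge_zero le_less_trans)
  moreover have "lc2 omg c0 x ?u ?v + t * d1 m3 x ?u ?v - lc2 omg c0 x0 ?u ?v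
    = (d1 l x ?u ?v - B ?u ?v + t * d1 m1 x ?u ?v) / a"
   by (simp add: ct[OF xV(1)] ct[OF V(3)] dm3[OF xV(2)] dB field_simps add_divide_distrib diff_divide_distrib)
  ultimately show "\<bar>lc2 omg c0 x ?u ?v + t * d1 m3 x ?u ?v - lc2 omg c0 x0 ?u ?v\<bar> < d" by simp
 qed
 have ker: "d1 (lc1 lam c0) x u v + t * d1 m1 x u v + t\<^sup>2 * d1 (%x v. 0) x u v = 0"
  if x: "x : K" and *: "!!v. lc2 omg c0 x u v + t * d1 m3 x u v = 0" for x t u v
 proof -
  have xV: "x : V" "x : S" using x KV V by (auto simp: S_def)
  have "d1 l x u v + t * d1 m1 x u v = a * (lc2 omg c0 x u v + t * d1 m3 x u v)"
   using a by (simp add: ct[OF xV(1)] dm3[OF xV(2)] algebra_simps)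
  thus ?thesis using * by (simp add: l_def)
 qed
 obtain lam' omg' where H: "((lam, omg), (lam', omg')) : stable_homotopy_rel A n"
   and eq: "ALL x:cimg c0. ALL v. lc1 lam' c0 x v = lc1 lam c0 x v + m1 x v + 0"
   "ALL x:cimg c0. ALL a b. lc2 omg' c0 x a b = lc2 omg c0 x a b + d1 m3 x a b"
  using stable_homotopy_in_chart[OF m c0 s sup sup0 sup3 vol ker] by blast
 have inner: "x : S & x : V & chi x = 1 & (ALL v. ?dchi x v = 0)" if x: "x : ball x0 (r / 2)" for x
 proof -
  have one: "chi y = 1" if "y : ball x0 (r / 2)" for y
   unfolding chi_def by (rule radial_cutoff_eq_1[OF r(1)]) (use that in \<open>auto simp: dist_norm norm_minus_commute\<close>)
  have "?dchi x v = FD (%_. 1) x v" for v using FD_cong[OF open_ball x, of chi "%_. 1"] one by simp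
  moreover have "x : V" using x KV r by (auto simp: K_def)
  ultimately show ?thesis using one[OF x] V by (auto simp: S_def)
 qed
 have 1: "r / 2 > 0" "ball x0 (r / 2) <= cimg c0" using r inner by (auto simp: S_def)
 have 2: "lc1 lam' c0 x v = lc1 lam c0 x0 v + lc2 omg c0 x0 (x - x0) v * a / 2" if x: "x : ball x0 (r / 2)" for x v
 proof -
  have "lc1 lam' c0 x v = l x v + m1 x v" using eq(1) inner[OF x] by (simp add: S_def l_def)
  also have "... = la x v" using inner[OF x] by (simp add: m1_def)
  also have "... = lc1 lam c0 x0 v + lc2 omg c0 x0 (x - x0) v * a / 2"
   using a by (simp add: la_def ct[OF V(3)] dB l_def[symmetric])
  finally show ?thesis .
 qed
 have 3: "lc2 omg' c0 x u v = lc2 omg c0 x0 u v" if x: "x : ball x0 (r / 2)" for x u v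
 proof -
  have "lc2 omg' c0 x u v = lc2 omg c0 x u v + d1 m3 x u v" using eq(2) inner[OF x] by (simp add: S_def)
  also have "... = (d1 l x u v + d1 m1 x u v) / a" using inner[OF x] by (simp add: ct dm3 add_divide_distrib)
  also have "d1 m1 x u v = B u v - d1 l x u v" using inner[OF x] by (simp add: dm1)
  finally show ?thesis by (simp add: ct[OF V(3)] dB)
 qed
 show ?thesis using H 1 2 3 by blast
qed

end

section \<open>The integrable model\<close>

text \<open>Coordinates in which the contact form is \<open>dz\<close> at a point and its differential is
 \<open>dx\<^sub>1 \<and> dy\<^sub>1 + dx\<^sub>2 \<and> dy\<^sub>2 + be\<close>. On the complement of the two symplectic planes no symplectic
 basis is needed: \<open>J\<close> turns \<open>be\<close> into the positive definite form given by \<open>T\<close>.\<close>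

locale frame =
 fixes e0 e1 f1 e2 f2 :: "'e::euclidean_space" and Z X1 Y1 X2 Y2 :: "'e => real"
  and pw T J :: "'e => 'e" and be :: "'e => 'e => real" and Cw :: real
 assumes lin: "linear Z" "linear X1" "linear Y1" "linear X2" "linear Y2" "linear pw" "linear T"
  and decomp: "x = Z x .* e0 + X1 x .* e1 + Y1 x .* f1 + X2 x .* e2 + Y2 x .* f2 + pw x"
  and dual: "Z e0 = 1" "Z e1 = 0" "Z f1 = 0" "Z e2 = 0" "Z f2 = 0" "Z (pw x) = 0"
   "X1 e0 = 0" "X1 e1 = 1" "X1 f1 = 0" "X1 e2 = 0" "X1 f2 = 0" "X1 (pw x) = 0"
   "Y1 e0 = 0" "Y1 e1 = 0" "Y1 f1 = 1" "Y1 e2 = 0" "Y1 f2 = 0" "Y1 (pw x) = 0"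
   "X2 e0 = 0" "X2 e1 = 0" "X2 f1 = 0" "X2 e2 = 1" "X2 f2 = 0" "X2 (pw x) = 0"
   "Y2 e0 = 0" "Y2 e1 = 0" "Y2 f1 = 0" "Y2 e2 = 0" "Y2 f2 = 1" "Y2 (pw x) = 0"
   "pw e0 = 0" "pw e1 = 0" "pw f1 = 0" "pw e2 = 0" "pw f2 = 0" "pw (pw x) = pw x"
  and be: "skew_form be" "be x y = be (pw x) (pw y)"
  and J: "pw (J y) = J y" "be x (J y) = T x \<bullet> T y" "T (pw x) = T x"
  and Cw: "Cw >= 0" "norm (pw x) <= Cw * norm (T x)"

text \<open>This provides a vector of the kernel of \<open>l\<close> that is orthogonal to the first
  symplectic plane; here the assumption that the dimension is at least five enters.\<close>

lemma common_zero_of_three_functionals: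
 fixes g h k :: "'e::euclidean_space => real"
 assumes "linear g" "linear h" "linear k" "DIM('e) > 3"
 shows "EX x. x ~= 0 & g x = 0 & h x = 0 & k x = 0"
proof (rule ccontr)
 assume neg: "~ ?thesis"
 define F where "F x = (g x, h x, k x)" for x
 have F: "linear F" unfolding F_def using assms by (intro linearI) (simp_all add: linear_add linear_scale)
 have "inj F" unfolding linear_injective_0[OF F] using neg by (auto simp: F_def zero_prod_def)
 hence "dim (F ` UNIV) = dim (UNIV :: 'e set)" using dim_image_eq[OF F, of UNIV] by simp
 hence "DIM('e) = dim (F ` UNIV)" by simp
 also have "... <= DIM(real \<times> real \<times> real)" by (rule dim_subset_UNIV)
 finally show False using assms by simp
qed

text \<open>Two steps of the symplectic Gram-Schmidt process split off the planes of
  (\<open>e1\<close>, \<open>f1\<close>) and (\<open>e2\<close>, \<open>f2\<close>);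
  \<open>pw\<close> projects to the rest. A final rescaling makes the frame as small as prescribed
  by \<open>ro\<close>.\<close>

lemma frame_exists:
 fixes l :: "'e::euclidean_space => real" and B :: "'e => 'e => real"
 assumes dim: "DIM('e) > 3" and l: "linear l" and B: "skew_form B"
  and R: "l R = 1" "!!b. B R b = 0" and nondeg: "!!a. l a = 0 ==> (!!b. B a b = 0) ==> a = 0"
  and ro: "ro > 0"
 shows "EX e0 e1 f1 e2 f2 Z X1 Y1 X2 Y2 pw T J be Cw c. frame e0 e1 f1 e2 f2 Z X1 Y1 X2 Y2 pw T J be Cw
   & c > 0 & norm e0 + norm e1 + norm f1 + norm e2 + norm f2 + Cw <= ro & (ALL v. l v = c * Z v)
   & (ALL u v. B u v = c * (X1 u * Y1 v - Y1 u * X1 v + (X2 u * Y2 v - Y2 u * X2 v) + be u v))"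
proof -
 note sk = skew_formD[OF B]
 have lB1: "linear (B a)" and lB2: "linear (%a. B a b)" for a b by (rule sk)+
 note Bs = linear_add[OF lB1] linear_add[OF lB2] linear_diff[OF lB1] linear_diff[OF lB2]
  linear_scale[OF lB1] linear_scale[OF lB2] linear_neg[OF lB1] linear_neg[OF lB2]
 note ls = linear_add[OF l] linear_diff[OF l] linear_scale[OF l]
 have R': "B b R = 0" for b using sk(3)[of b R] R(2)[of b] by simp
 obtain e1 where e1: "e1 ~= 0" "l e1 = 0" using common_zero_of_three_functionals[OF l l l dim] by blast
 then obtain g1 where g1: "B e1 g1 ~= 0" using nondeg by blast
 define f1 where "f1 = (1 / B e1 g1) .* (g1 - l g1 .* R)"
 have f1: "l f1 = 0" "B e1 f1 = 1" using g1 by (simp_all add: f1_def ls Bs R R')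
 define X1 where "X1 v = B v f1" for v
 define Y1 where "Y1 v = B e1 v" for v
 have X1: "linear X1" and Y1: "linear Y1" unfolding X1_def Y1_def by (rule lB2 lB1)+
 obtain e2 where e2: "e2 ~= 0" "l e2 = 0" "X1 e2 = 0" "Y1 e2 = 0"
  using common_zero_of_three_functionals[OF l X1 Y1 dim] by blast
 then obtain g2 where g2: "B e2 g2 ~= 0" using nondeg by blast
 have e21: "B e2 e1 = 0" "B e1 e2 = 0" "B e2 f1 = 0" "B f1 e2 = 0"
  using e2 sk(3)[of e2 e1] sk(3)[of f1 e2] by (simp_all add: X1_def Y1_def)
 have ef: "B f1 e1 = - 1" using f1 sk(3)[of f1 e1] by simp
 define g2' where "g2' = g2 - l g2 .* R - X1 g2 .* e1 - Y1 g2 .* f1"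
 define f2 where "f2 = (1 / B e2 g2) .* g2'"
 have f2: "l f2 = 0" "B e2 f2 = 1" "X1 f2 = 0" "Y1 f2 = 0"
  using g2 by (simp_all add: f2_def g2'_def X1_def Y1_def ls Bs R R' e1 f1 e21 sk(4))
 define X2 where "X2 v = B v f2" for v
 define Y2 where "Y2 v = B e2 v" for v
 have X2: "linear X2" and Y2: "linear Y2" unfolding X2_def Y2_def by (rule lB2 lB1)+
 have f21: "B f2 f1 = 0" "B f1 f2 = 0" "B e1 f2 = 0" "B f2 e1 = 0" "B f2 e2 = - 1"
  using f2 sk(3)[of f1 f2] sk(3)[of f2 e1] sk(3)[of f2 e2] by (simp_all add: X1_def Y1_def)
 define pw where "pw v = v - l v .* R - X1 v .* e1 - Y1 v .* f1 - X2 v .* e2 - Y2 v .* f2" for v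
 have pw: "linear pw" unfolding pw_def using l X1 Y1 X2 Y2
  by (intro linearI) (simp_all add: linear_add linear_scale algebra_simps)
 note vals = e1 f1 e2 f2 e21 f21 ef R R' sk(4)
 have D: "l R = 1" "l e1 = 0" "l f1 = 0" "l e2 = 0" "l f2 = 0"
   "X1 R = 0" "X1 e1 = 1" "X1 f1 = 0" "X1 e2 = 0" "X1 f2 = 0"
   "Y1 R = 0" "Y1 e1 = 0" "Y1 f1 = 1" "Y1 e2 = 0" "Y1 f2 = 0"
   "X2 R = 0" "X2 e1 = 0" "X2 f1 = 0" "X2 e2 = 1" "X2 f2 = 0"
   "Y2 R = 0" "Y2 e1 = 0" "Y2 f1 = 0" "Y2 e2 = 0" "Y2 f2 = 1"
  using vals by (simp_all add: X1_def Y1_def X2_def Y2_def)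
 have Dp: "l (pw x) = 0" "X1 (pw x) = 0" "Y1 (pw x) = 0" "X2 (pw x) = 0" "Y2 (pw x) = 0" for x
  by (simp_all add: pw_def linear_diff[OF l] linear_diff[OF X1] linear_diff[OF Y1] linear_diff[OF X2] linear_diff[OF Y2]
    linear_scale[OF l] linear_scale[OF X1] linear_scale[OF Y1] linear_scale[OF X2] linear_scale[OF Y2] D)
 have Dq: "pw R = 0" "pw e1 = 0" "pw f1 = 0" "pw e2 = 0" "pw f2 = 0" "pw (pw x) = pw x" for x
 proof -
  show "pw (pw x) = pw x" unfolding pw_def[of "pw x"] by (simp add: Dp)
 qed (simp_all add: pw_def D)
 define be where "be u v = B (pw u) (pw v)" for u v
 have be: "skew_form be" unfolding be_def by (rule skew_form_linear_comp[OF B pw])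
 have pwB: "B (pw u) w = B (pw u) (pw w)" for u w
 proof -
  have z: "B (pw u) e1 = 0" "B (pw u) f1 = 0" "B (pw u) e2 = 0" "B (pw u) f2 = 0"
   using Dp[of u] sk(3)[of "pw u" e1] sk(3)[of "pw u" e2] by (simp_all add: X1_def Y1_def X2_def Y2_def)
  show ?thesis by (simp add: pw_def[of w] Bs z R')
 qed
 have expand: "B u v = X1 u * Y1 v - Y1 u * X1 v + (X2 u * Y2 v - Y2 u * X2 v) + be u v" for u v
 proof -
  have u: "u = pw u + l u .* R + X1 u .* e1 + Y1 u .* f1 + X2 u .* e2 + Y2 u .* f2" by (simp add: pw_def)
  have fv: "B f1 v = - X1 v" "B f2 v = - X2 v" using sk(3)[of f1 v] sk(3)[of f2 v] by (simp_all add: X1_def X2_def)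
  have "B u v = B (pw u) v + l u * B R v + X1 u * B e1 v + Y1 u * B f1 v + X2 u * B e2 v + Y2 u * B f2 v"
   by (subst u) (simp only: Bs real_scaleR_def)
  thus ?thesis by (simp add: R fv pwB[of u v] be_def Y1_def[symmetric] Y2_def[symmetric])
 qed
 define T0 where "T0 z = (\<Sum>b\<in>Basis. be b z .* b)" for z
 have T0: "linear T0" unfolding T0_def by (intro linearI)
   (simp_all add: linear_add[OF skew_formD(1)[OF be]] linear_scale[OF skew_formD(1)[OF be]]
    scaleR_add_left sum.distrib scaleR_sum_right)
 have T0i: "x \<bullet> T0 z = be x z" for x z
 proof -
  have lb: "linear (%x. be x z)" by (rule skew_formD(2)[OF be])
  have "x \<bullet> T0 z = (\<Sum>b\<in>Basis. (x \<bullet> b) * be b z)"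
   by (simp add: T0_def inner_sum_right mult.commute)
  also have "... = be (\<Sum>b\<in>Basis. (x \<bullet> b) .* b) z"
   by (simp only: linear_sum[OF lb] linear_scale[OF lb] real_scaleR_def)
  finally show ?thesis by (simp add: euclidean_representation)
 qed
 have T0p: "T0 (pw z) = T0 z" for z by (simp add: T0_def be_def Dq)
 \<comment> \<open>\<open>T0\<close> represents \<open>be\<close> through the inner product, and
   skewness of \<open>be\<close> turns the minus sign into
   \<open>be x (J y) = T0 x \<bullet> T0 y\<close>, which is positive definite on the range of
   \<open>pw\<close>.\<close>
 define J where "J y = - pw (T0 y)" for y
 have Jp: "pw (J y) = J y" for y by (simp add: J_def linear_neg[OF pw] Dq)
 have Jb: "be x (J y) = T0 x \<bullet> T0 y" for x y
 proof -
  have "be x (J y) = - be x (pw (T0 y))" by (simp add: J_def linear_neg[OF skew_formD(1)[OF be]])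
  also have "... = - be x (T0 y)" by (simp add: be_def Dq)
  also have "... = be (T0 y) x" using skew_formD(3)[OF be, of "T0 y" x] by simp
  also have "... = T0 y \<bullet> T0 x" by (simp add: T0i)
  finally show ?thesis by (simp add: inner_commute)
 qed
 have sub: "subspace (range pw)" by (rule linear_subspace_image[OF pw subspace_UNIV])
 have inj: "ALL x:range pw. T0 x = 0 --> x = 0"
 proof (intro ballI impI)
  fix x assume x: "x : range pw" "T0 x = 0"
  hence px: "pw x = x" using Dq by auto
  have "be b x = 0" for b using T0i[of b x] x by simp
  hence "be x b = 0" for b using skew_formD(3)[OF be, of x b] by simp
  hence "B x b = 0" for b using expand[of x b] Dp[of x] unfolding px by simp
  moreover have "l x = 0" using Dp(1)[of x] unfolding px .
  ultimately show "x = 0" using nondeg by blast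
 qed
 obtain k where k: "k > 0" "!!x. x : range pw ==> norm (T0 x) >= k * norm x"
  using injective_imp_isometric[OF closed_subspace[OF sub] sub _ inj] T0 linear_conv_bounded_linear by metis
 have kp: "norm (pw x) <= (1 / k) * norm (T0 x)" for x
  using k(2)[of "pw x"] k(1) by (simp add: T0p field_simps)
 define S where "S = norm R + norm e1 + norm f1 + norm e2 + norm f2 + 1 / k"
 have S: "S >= 0" using k by (simp add: S_def)
 \<comment> \<open>The planes are scaled by \<open>ka\<close> and the Reeb direction by its square,
   so \<open>l\<close> and \<open>B\<close> acquire the same factor
   \<open>c = ka\<^sup>2\<close>.\<close>
 define ka where "ka = min 1 (ro / (S + 1))"
 have ka: "ka > 0" "ka <= 1" using ro S by (auto simp: ka_def)
 have "ka * S <= ro / (S + 1) * (S + 1)" using S ro ka by (intro mult_mono) (auto simp: ka_def)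
 hence kaS: "ka * S <= ro" using S by simp
 have "frame (ka\<^sup>2 .* R) (ka .* e1) (ka .* f1) (ka .* e2) (ka .* f2)
   (%v. l v / ka\<^sup>2) (%v. X1 v / ka) (%v. Y1 v / ka) (%v. X2 v / ka) (%v. Y2 v / ka)
   pw (%x. (1 / ka) .* T0 x) J (%u v. be u v / ka\<^sup>2) (ka / k)"
 proof (rule frame.intro)
  have div: "linear (%v. h v / r)" if "linear h" for h :: "'e => real" and r
   using linear_compose_scale_right[OF that, of "1 / r"] by simp
  show "linear (%v. l v / ka\<^sup>2)" "linear (%v. X1 v / ka)" "linear (%v. Y1 v / ka)" "linear (%v. X2 v / ka)" "linear (%v. Y2 v / ka)"
   by (rule div, rule l X1 Y1 X2 Y2)+
  show "linear pw" by (rule pw)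
  show "linear (%x. (1 / ka) .* T0 x)" by (rule linear_compose_scale_right[OF T0])
  show "skew_form (%u v. be u v / ka\<^sup>2)" unfolding skew_form_def using skew_formD(1-3)[OF be] div
   by (intro conjI allI) (blast, blast, metis minus_divide_left)
  show "x = (l x / ka\<^sup>2) .* ka\<^sup>2 .* R + (X1 x / ka) .* ka .* e1 + (Y1 x / ka) .* ka .* f1 +
    (X2 x / ka) .* ka .* e2 + (Y2 x / ka) .* ka .* f2 + pw x" for x using ka by (simp add: pw_def)
  show "be x y / ka\<^sup>2 = be (pw x) (pw y) / ka\<^sup>2" for x y by (simp add: be_def Dq)
  show "be x (J y) / ka\<^sup>2 = ((1 / ka) .* T0 x) \<bullet> ((1 / ka) .* T0 y)" for x y
   by (simp add: Jb power2_eq_square)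
  show "norm (pw x) <= ka / k * norm ((1 / ka) .* T0 x)" for x using kp[of x] ka by simp
 qed (use ka k in \<open>simp_all add: linear_scale[OF l] linear_scale[OF X1] linear_scale[OF Y1] linear_scale[OF X2]
   linear_scale[OF Y2] linear_scale[OF pw] D Dp Dq Jp T0p\<close>)
 moreover have "norm (ka\<^sup>2 .* R) + norm (ka .* e1) + norm (ka .* f1) + norm (ka .* e2) + norm (ka .* f2) + ka / k <= ro"
 proof -
  have "ka\<^sup>2 * norm R <= ka * norm R"
   using ka by (intro mult_right_mono) (auto simp: power2_eq_square mult_le_one)
  thus ?thesis using kaS ka by (simp add: S_def algebra_simps)
 qed
 moreover have "ALL v. l v = ka\<^sup>2 * (l v / ka\<^sup>2)" using ka by simp
 moreover have "ALL u v. B u v = ka\<^sup>2 * (X1 u / ka * (Y1 v / ka) - Y1 u / ka * (X1 v / ka) +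
   (X2 u / ka * (Y2 v / ka) - Y2 u / ka * (X2 v / ka)) + be u v / ka\<^sup>2)"
  using ka by (simp add: expand power2_eq_square field_simps)
 moreover have "ka\<^sup>2 > 0" using ka by simp
 ultimately show ?thesis by blast
qed

lemma form1_extend_by_zero:
 assumes "form1 G m" "open G" "closed K" "K <= G" "!!x v. x ~: K ==> m x v = 0"
 shows "form1 S m" unfolding form1_def
proof (intro conjI ballI allI)
 fix x show "linear (m x)"
 proof (cases "x : K")
  case False
  hence "m x = (%_. 0)" using assms(5) by blast
  thus ?thesis by (simp add: linear_zero)
 qed (use form1D(1)[OF assms(1), of x] assms(4) in blast)
next
 fix v
 show "smooth_on (%x. m x v) S"
 proof (rule smooth_local)
  fix x assume "x : S"
  show "EX W. open W & x : W & smooth_on (%x. m x v) W"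
  proof (cases "x : K")
   case True
   thus ?thesis using form1D(2)[OF assms(1)] assms(2,4) by blast
  next
   case False
   have op: "open (- K)" using assms(3) by (simp add: open_Compl)
   have "smooth_on (%x. m x v) (- K)"
    by (rule smooth_cong[OF smooth_const[OF op] _ op]) (use assms(5) in auto)
   thus ?thesis using False op by blast
  qed
 qed
qed

lemma smooth_functional: "linear (L :: 'e::euclidean_space => real) ==> open S ==> smooth_on (%x. L (x - x0)) S"
 by (rule smooth_linear[of L]) (auto intro: smooth_diff smooth_ident smooth_const simp: linear_conv_bounded_linear)

section \<open>Coordinates in which the Reeb orbits are circles\<close>

locale frame_at = frame e0 e1 f1 e2 f2 Z X1 Y1 X2 Y2 pw T J be Cw
 for e0 e1 f1 e2 f2 :: "'a::euclidean_space" and Z X1 Y1 X2 Y2 pw T J be Cw +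
 fixes x0 :: 'a
begin

lemmas bl = lin[unfolded linear_conv_bounded_linear]
lemmas lin_simps = linear_add[OF lin(1)] linear_add[OF lin(2)] linear_add[OF lin(3)] linear_add[OF lin(4)]
 linear_add[OF lin(5)] linear_add[OF lin(6)] linear_add[OF lin(7)]
 linear_diff[OF lin(1)] linear_diff[OF lin(2)] linear_diff[OF lin(3)] linear_diff[OF lin(4)]
 linear_diff[OF lin(5)] linear_diff[OF lin(6)] linear_diff[OF lin(7)]
 linear_scale[OF lin(1)] linear_scale[OF lin(2)] linear_scale[OF lin(3)] linear_scale[OF lin(4)]
 linear_scale[OF lin(5)] linear_scale[OF lin(6)] linear_scale[OF lin(7)]

lemma be_simps:
 "be (a + b) d = be a d + be b d" "be a (b + d) = be a b + be a d"
 "be (a - b) d = be a d - be b d" "be a (b - d) = be a b - be a d"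
 "be (r .* a) d = r * be a d" "be a (r .* d) = r * be a d" "be a a = 0"
 using linear_add[OF skew_formD(1)[OF be(1)]] linear_add[OF skew_formD(2)[OF be(1)]]
  linear_diff[OF skew_formD(1)[OF be(1)]] linear_diff[OF skew_formD(2)[OF be(1)]]
  linear_scale[OF skew_formD(1)[OF be(1)]] linear_scale[OF skew_formD(2)[OF be(1)]] skew_formD(4)[OF be(1)]
 by simp_all

lemma be_basis: "be e0 a = 0" "be e1 a = 0" "be f1 a = 0" "be e2 a = 0" "be f2 a = 0"
  "be a e0 = 0" "be a e1 = 0" "be a f1 = 0" "be a e2 = 0" "be a f2 = 0" "be (pw a) b = be a b" "be a (pw b) = be a b"
proof -
 have 0: "be 0 a = 0" "be a 0 = 0" for a using linear_0[OF skew_formD(1)[OF be(1)]] linear_0[OF skew_formD(2)[OF be(1)]] by auto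
 show "be e0 a = 0" "be e1 a = 0" "be f1 a = 0" "be e2 a = 0" "be f2 a = 0"
  "be a e0 = 0" "be a e1 = 0" "be a f1 = 0" "be a e2 = 0" "be a f2 = 0"
  using be(2)[of _ a] be(2)[of a] dual 0 by metis+
 show "be (pw a) b = be a b" "be a (pw b) = be a b"
  using be(2)[of "pw a" b] be(2)[of a "pw b"] be(2)[of a b] dual by simp_all
qed

lemma T_basis: "T e0 = 0" "T e1 = 0" "T f1 = 0" "T e2 = 0" "T f2 = 0" "T (pw x) = T x"
 using J(3)[of e0] J(3)[of e1] J(3)[of f1] J(3)[of e2] J(3)[of f2] dual J(3) linear_0[OF lin(7)] by simp_all

text \<open>Polar coordinates in the first plane: \<open>Y1 q\<close> is the angle and
  \<open>X1 q\<close> the inverse square of the radius, while the coordinates of the second plane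
  and of \<open>pw\<close> are rescaled by the radius. In them the conformally changed form becomes
  \<open>lamh\<close>, with constant differential and Reeb field \<open>f1\<close>.\<close>

definition Phi :: "'a => 'a" where
 "Phi q = x0 + Z q .* e0 + (X1 q powr (- 1/2)) .*
   (cos (Y1 q) .* e1 + sin (Y1 q) .* f1 + X2 q .* e2 + Y2 q .* f2 + pw q)"

definition dPhi :: "'a => 'a => 'a" where
 "dPhi q v = Z v .* e0
   + (- (1/2) * X1 q powr (- 3/2) * X1 v) .*
     (cos (Y1 q) .* e1 + sin (Y1 q) .* f1 + X2 q .* e2 + Y2 q .* f2 + pw q)
   + (X1 q powr (- 1/2)) .*
     ((- sin (Y1 q) * Y1 v) .* e1 + (cos (Y1 q) * Y1 v) .* f1 + X2 v .* e2 + Y2 v .* f2 + pw v)"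

lemma Phi_deriv:
 assumes "X1 q > 0" shows "(Phi has_derivative dPhi q) (at q)"
proof -
 note d = bounded_linear.has_derivative[OF bl(1)] bounded_linear.has_derivative[OF bl(2)] bounded_linear.has_derivative[OF bl(3)]
  bounded_linear.has_derivative[OF bl(4)] bounded_linear.has_derivative[OF bl(5)] bounded_linear.has_derivative[OF bl(6)]
 have "((%x. x powr (- 1/2)) has_real_derivative (- 1/2 * X1 q powr (- 3/2))) (at (X1 q))"
 proof -
  have "X1 q powr (- 3/2) = X1 q powr (- 1/2) / X1 q" using assms powr_diff[of "X1 q" "- 1/2" 1] by simp
  thus ?thesis using DERIV_powr[OF DERIV_ident assms DERIV_const, of "- 1/2"] by simp
 qed
 from has_derivative_compose[OF d(2)[OF has_derivative_ident] this[unfolded has_field_derivative_def]]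
 have "((%q. X1 q powr (- 1/2)) has_derivative (%v. (- 1/2 * X1 q powr (- 3/2)) * X1 v)) (at q)" .
 note P = this
 have W: "((%q. cos (Y1 q) .* e1 + sin (Y1 q) .* f1 + X2 q .* e2 + Y2 q .* f2 + pw q) has_derivative
   (%v. (- sin (Y1 q) * Y1 v) .* e1 + (cos (Y1 q) * Y1 v) .* f1 + X2 v .* e2 + Y2 v .* f2 + pw v)) (at q)"
  by (auto intro!: derivative_eq_intros d simp: fun_eq_iff algebra_simps)
 have V: "((%q. x0 + Z q .* e0) has_derivative (%v. Z v .* e0)) (at q)"
  by (auto intro!: derivative_eq_intros d)
 have "dPhi q = (%v. Z v .* e0 + (X1 q powr (- 1/2) .*
   ((- sin (Y1 q) * Y1 v) .* e1 + (cos (Y1 q) * Y1 v) .* f1 + X2 v .* e2 + Y2 v .* f2 + pw v)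
   + (- 1/2 * X1 q powr (- 3/2) * X1 v) .*
   (cos (Y1 q) .* e1 + sin (Y1 q) .* f1 + X2 q .* e2 + Y2 q .* f2 + pw q)))"
  by (rule ext) (simp add: dPhi_def)
 thus ?thesis using has_derivative_add[OF V has_derivative_scaleR[OF P W]] by (simp only: Phi_def[abs_def])
qed

lemma smooth_Phi: "open S ==> S <= {q. X1 q > 0} ==> smooth_on Phi S" unfolding Phi_def[abs_def]
 by (intro smooth_add smooth_scaleR smooth_const smooth_blinear bl
   smooth_compose[OF smooth_powr] smooth_compose[OF smooth_cos_sin(1)] smooth_compose[OF smooth_cos_sin(2)])
   auto

lemma frechet_Phi: "X1 q > 0 ==> FD Phi q v = dPhi q v" by (rule FD_eqI[OF Phi_deriv])

lemma linear_dPhi: "X1 q > 0 ==> linear (dPhi q)" using Phi_deriv has_derivative_linear by blast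

text \<open>\<open>Phi\<close> is periodic in the angle, so functions and forms on the chart cannot
  be defined through an inverse of it. Each is given twice: \<open>U\<close>, \<open>Rr\<close>,
  \<open>Ss\<close> on the chart correspond to \<open>X1\<close>, \<open>rh\<close>,
  \<open>sh\<close> in the coordinates, and likewise for the forms.\<close>

definition U :: "'a => real" where "U y = 1 / ((X1 (y - x0))\<^sup>2 + (Y1 (y - x0))\<^sup>2)"
definition Rr :: "'a => real" where "Rr y = U y * ((X2 (y - x0))\<^sup>2 + (Y2 (y - x0))\<^sup>2) / 2"
definition Ss :: "'a => real" where
 "Ss y = ((U y - 1)\<^sup>2 + (Z (y - x0))\<^sup>2 + U y * (T (y - x0) \<bullet> T (y - x0))) / 2"
definition rh :: "'a => real" where "rh q = ((X2 q)\<^sup>2 + (Y2 q)\<^sup>2) / 2"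
definition sh :: "'a => real" where "sh q = ((X1 q - 1)\<^sup>2 + (Z q)\<^sup>2 + T q \<bullet> T q) / 2"
definition dphi :: "'a => 'a => real" where
 "dphi y v = U y * (X1 (y - x0) * Y1 v - Y1 (y - x0) * X1 v)"
definition dtheta :: "'a => 'a => real" where
 "dtheta y v = 1 / ((X2 (y - x0))\<^sup>2 + (Y2 (y - x0))\<^sup>2) * (X2 (y - x0) * Y2 v - Y2 (y - x0) * X2 v)"
definition aff :: "'a => 'a => real" where
 "aff y v = Z v + (X1 (y - x0) * Y1 v - Y1 (y - x0) * X1 v + (X2 (y - x0) * Y2 v - Y2 (y - x0) * X2 v) + be (y - x0) v) / 2"
definition lamh :: "'a => 'a => real" where
 "lamh q v = Y1 v + 2 * (X1 q * Z v) + (X2 q * Y2 v - Y2 q * X2 v) + be q v"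

lemma Phi_coords:
 "Z (Phi q - x0) = Z q" "X1 (Phi q - x0) = X1 q powr (- 1/2) * cos (Y1 q)" "Y1 (Phi q - x0) = X1 q powr (- 1/2) * sin (Y1 q)"
 "X2 (Phi q - x0) = X1 q powr (- 1/2) * X2 q" "Y2 (Phi q - x0) = X1 q powr (- 1/2) * Y2 q"
 "pw (Phi q - x0) = X1 q powr (- 1/2) .* pw q" "T (Phi q - x0) = X1 q powr (- 1/2) .* T q"
 "be (Phi q - x0) v = X1 q powr (- 1/2) * be q v"
 by (simp_all add: Phi_def lin_simps dual T_basis be_simps be_basis)

lemma dPhi_coords:
 "Z (dPhi q v) = Z v"
 "X1 (dPhi q v) = - (1/2) * X1 q powr (- 3/2) * X1 v * cos (Y1 q) - X1 q powr (- 1/2) * (sin (Y1 q) * Y1 v)"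
 "Y1 (dPhi q v) = - (1/2) * X1 q powr (- 3/2) * X1 v * sin (Y1 q) + X1 q powr (- 1/2) * (cos (Y1 q) * Y1 v)"
 "X2 (dPhi q v) = - (1/2) * X1 q powr (- 3/2) * X1 v * X2 q + X1 q powr (- 1/2) * X2 v"
 "Y2 (dPhi q v) = - (1/2) * X1 q powr (- 3/2) * X1 v * Y2 q + X1 q powr (- 1/2) * Y2 v"
 "pw (dPhi q v) = (- (1/2) * X1 q powr (- 3/2) * X1 v) .* pw q + X1 q powr (- 1/2) .* pw v"
 "be q (dPhi q v) = X1 q powr (- 1/2) * be q v" by (simp_all add: dPhi_def lin_simps dual be_simps be_basis)

lemma powr_half_square: "u > 0 ==> (u::real) powr (- 1/2) * u powr (- 1/2) = 1 / u"
 by (simp add: powr_minus field_simps flip: powr_add)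

lemma cos_sin_square: "cos a * cos a + sin a * sin a = (1::real)"
 using sin_cos_squared_add[of a] by (simp add: power2_eq_square)

context
 fixes q assumes q: "X1 q > 0"
begin

lemma U_Phi: "U (Phi q) = X1 q"
proof -
 have "(X1 (Phi q - x0))\<^sup>2 + (Y1 (Phi q - x0))\<^sup>2 = (X1 q powr (- 1/2) * X1 q powr (- 1/2)) * (cos (Y1 q) * cos (Y1 q) + sin (Y1 q) * sin (Y1 q))"
  unfolding Phi_coords power2_eq_square by algebra
 hence "(X1 (Phi q - x0))\<^sup>2 + (Y1 (Phi q - x0))\<^sup>2 = 1 / X1 q"
  unfolding powr_half_square[OF q] cos_sin_square by simp
 thus ?thesis unfolding U_def by simp
qed

lemma Rr_Phi: "Rr (Phi q) = rh q"
proof -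
 have "(X2 (Phi q - x0))\<^sup>2 + (Y2 (Phi q - x0))\<^sup>2 = (X1 q powr (- 1/2) * X1 q powr (- 1/2)) * ((X2 q)\<^sup>2 + (Y2 q)\<^sup>2)"
  unfolding Phi_coords power2_eq_square by algebra
 thus ?thesis using q unfolding Rr_def U_Phi rh_def powr_half_square[OF q] by simp
qed

lemma Ss_Phi: "Ss (Phi q) = sh q"
proof -
 have "T (Phi q - x0) \<bullet> T (Phi q - x0) = (X1 q powr (- 1/2) * X1 q powr (- 1/2)) * (T q \<bullet> T q)"
  unfolding Phi_coords by simp
 thus ?thesis using q unfolding Ss_def U_Phi sh_def powr_half_square[OF q] by (simp add: Phi_coords)
qed

lemma dphi_Phi: "dphi (Phi q) (dPhi q v) = Y1 v"
proof -
 have "X1 (Phi q - x0) * Y1 (dPhi q v) - Y1 (Phi q - x0) * X1 (dPhi q v)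
   = (X1 q powr (- 1/2) * X1 q powr (- 1/2)) * (cos (Y1 q) * cos (Y1 q) + sin (Y1 q) * sin (Y1 q)) * Y1 v"
  unfolding Phi_coords dPhi_coords by algebra
 thus ?thesis unfolding dphi_def U_Phi powr_half_square[OF q] cos_sin_square using q by simp
qed

lemma angular_Phi:
 "X2 (Phi q - x0) * Y2 (dPhi q v) - Y2 (Phi q - x0) * X2 (dPhi q v) = (X2 q * Y2 v - Y2 q * X2 v) / X1 q"
proof -
 have "X2 (Phi q - x0) * Y2 (dPhi q v) - Y2 (Phi q - x0) * X2 (dPhi q v)
   = (X1 q powr (- 1/2) * X1 q powr (- 1/2)) * (X2 q * Y2 v - Y2 q * X2 v)"
  unfolding Phi_coords dPhi_coords by algebra
 thus ?thesis unfolding powr_half_square[OF q] by simp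
qed

lemma dtheta_Phi: "dtheta (Phi q) (dPhi q v) = (X2 q * Y2 v - Y2 q * X2 v) / (2 * rh q)"
proof -
 have "(X2 (Phi q - x0))\<^sup>2 + (Y2 (Phi q - x0))\<^sup>2 = (X1 q powr (- 1/2) * X1 q powr (- 1/2)) * ((X2 q)\<^sup>2 + (Y2 q)\<^sup>2)"
  unfolding Phi_coords power2_eq_square by algebra
 moreover have "2 * rh q = (X2 q)\<^sup>2 + (Y2 q)\<^sup>2" by (simp add: rh_def)
 ultimately show ?thesis using q unfolding dtheta_def angular_Phi powr_half_square[OF q] by simp
qed

text \<open>The derivative of the radial rescaling cancels by skew symmetry, the factors
  \<open>X1 q powr (- 1/2)\<close> meet in pairs, and the conformal factor \<open>2 U\<close>
  removes the resulting \<open>1 / X1 q\<close>.\<close>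

lemma aff_Phi: "2 * U (Phi q) * aff (Phi q) (dPhi q v) = lamh q v"
proof -
 have 1: "X1 (Phi q - x0) * Y1 (dPhi q v) - Y1 (Phi q - x0) * X1 (dPhi q v) = Y1 v / X1 q"
  using dphi_Phi[of v] q unfolding dphi_def U_Phi by (simp add: field_simps)
 have 2: "be (Phi q - x0) (dPhi q v) = be q v / X1 q"
  unfolding Phi_coords dPhi_coords mult.assoc[symmetric] powr_half_square[OF q] by simp
 show ?thesis unfolding aff_def angular_Phi 1 2 U_Phi lamh_def dPhi_coords(1) using q by (simp add: field_simps)
qed

lemma dPhi_inj: "dPhi q v = 0 ==> v = 0"
proof -
 assume 0: "dPhi q v = 0"
 note lz = linear_0[OF lin(1)] linear_0[OF lin(2)] linear_0[OF lin(3)] linear_0[OF lin(4)] linear_0[OF lin(5)] linear_0[OF lin(6)]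
 have z: "Z v = 0" using dPhi_coords(1)[of q v] 0 lz by simp
 have y1: "Y1 v = 0" using dphi_Phi[of v] 0 lz by (simp add: dphi_def)
 have pos: "X1 q powr (- 3/2) > 0" "X1 q powr (- 1/2) > 0" using q by simp_all
 have "cos (Y1 q) * X1 (dPhi q v) + sin (Y1 q) * Y1 (dPhi q v) =
   - (1/2) * X1 q powr (- 3/2) * X1 v * (cos (Y1 q) * cos (Y1 q) + sin (Y1 q) * sin (Y1 q))"
  unfolding dPhi_coords y1 by algebra
 hence x1: "X1 v = 0" using pos 0 lz by (simp add: cos_sin_square)
 have x2: "X2 v = 0" "Y2 v = 0" "pw v = 0" using dPhi_coords(4,5,6)[of q v] pos unfolding 0 lz x1 by simp_all
 show "v = 0" using decomp[of v] z y1 x1 x2 by simp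
qed

lemma dPhi_bij: "EX N. linear N & (ALL v. N (dPhi q v) = v) & (ALL v. dPhi q (N v) = v)"
proof -
 have l: "linear (dPhi q)" by (rule linear_dPhi[OF q])
 have inj: "inj (dPhi q)" unfolding linear_injective_0[OF l] using dPhi_inj by blast
 have surj: "surj (dPhi q)" by (rule linear_injective_imp_surjective[OF l inj]) simp
 obtain N where N: "linear N" "N \<circ> dPhi q = id" using linear_injective_left_inverse[OF l inj] by blast
 hence 1: "N (dPhi q v) = v" for v by (metis comp_apply id_apply)
 have "dPhi q (N v) = v" for v using surj 1 by (metis surjD)
 thus ?thesis using N 1 by blast
qed

end

lemma Phi_surj:
 assumes "U y > 0"
 obtains q where "X1 q = U y" "Y1 q : {0..2 * pi}" "Phi q = y"
proof -
 define w where "w = y - x0"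
 define n where "n = sqrt ((X1 w)\<^sup>2 + (Y1 w)\<^sup>2)"
 have pos: "(X1 w)\<^sup>2 + (Y1 w)\<^sup>2 > 0" using assms unfolding U_def w_def by (simp add: zero_less_divide_iff)
 hence n: "n > 0" "n\<^sup>2 = (X1 w)\<^sup>2 + (Y1 w)\<^sup>2" by (auto simp: n_def)
 have "(X1 w / n)\<^sup>2 + (Y1 w / n)\<^sup>2 = 1"
  using n(1) unfolding power_divide add_divide_distrib[symmetric] n(2)[symmetric] by simp
 then obtain t where t: "0 <= t" "t < 2 * pi" "X1 w / n = cos t" "Y1 w / n = sin t"
  using sincos_total_2pi by metis
 have Uy: "U y = (1 / n)\<^sup>2" unfolding U_def w_def[symmetric] n(2)[symmetric] by (simp add: power_divide)
 have root: "U y powr (- 1/2) = n"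
 proof -
  have "U y powr (- 1/2) = inverse (sqrt (U y))" using assms by (simp add: powr_minus powr_half_sqrt)
  moreover have "sqrt (U y) = 1 / n" unfolding Uy real_sqrt_abs using n(1) by simp
  ultimately show ?thesis by simp
 qed
 define q where "q = Z w .* e0 + U y .* e1 + t .* f1 + (X2 w / n) .* e2 + (Y2 w / n) .* f2 + (1 / n) .* pw w"
 have c: "X1 q = U y" "Y1 q = t" "Z q = Z w" "X2 q = X2 w / n" "Y2 q = Y2 w / n" "pw q = (1 / n) .* pw w"
  by (simp_all add: q_def lin_simps dual)
 have "Phi q = x0 + (Z w .* e0 + X1 w .* e1 + Y1 w .* f1 + X2 w .* e2 + Y2 w .* f2 + pw w)"
  unfolding Phi_def c root t(3,4)[symmetric] using n by (simp add: scaleR_add_right)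
 hence "Phi q = y" using decomp[of w] by (simp add: w_def)
 thus ?thesis using that c t by auto
qed

end

text \<open>A plateau function around r = 1/2 and small s; the square of \<open>r - 1/2\<close>
  stands for its absolute value, which would not be smooth.\<close>

definition cutoff2 :: "real => real => real => real => real => real => real" where
 "cutoff2 a0 a1 b0 b1 r s = smooth_step ((a1\<^sup>2 - (r - 1/2)\<^sup>2) * inverse (a1\<^sup>2 - a0\<^sup>2)) * smooth_step ((b1 - s) * inverse (b1 - b0))"

lemma cutoff2_simps:
 assumes "0 <= a0" "a0 < a1" "b0 < b1"
 shows "\<bar>r - 1/2\<bar> <= a0 ==> s <= b0 ==> cutoff2 a0 a1 b0 b1 r s = 1"
  "~ (\<bar>r - 1/2\<bar> <= a1 & s <= b1) ==> cutoff2 a0 a1 b0 b1 r s = 0"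
  "0 <= cutoff2 a0 a1 b0 b1 r s" "cutoff2 a0 a1 b0 b1 r s <= 1"
proof -
 have "a0\<^sup>2 < a1\<^sup>2" by (rule power_strict_mono) (use assms in auto)
 hence d: "a1\<^sup>2 - a0\<^sup>2 > 0" by simp
 show "cutoff2 a0 a1 b0 b1 r s = 1" if "\<bar>r - 1/2\<bar> <= a0" "s <= b0"
 proof -
  have "(r - 1/2)\<^sup>2 <= a0\<^sup>2" using that(1) by (simp add: abs_le_square_iff[symmetric] assms)
  hence "1 <= (a1\<^sup>2 - (r - 1/2)\<^sup>2) * inverse (a1\<^sup>2 - a0\<^sup>2)" "1 <= (b1 - s) * inverse (b1 - b0)"
   using d assms that(2) by (simp_all add: divide_inverse[symmetric] pos_le_divide_eq)
  thus ?thesis by (simp add: cutoff2_def smooth_step_simps)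
 qed
 show "cutoff2 a0 a1 b0 b1 r s = 0" if *: "~ (\<bar>r - 1/2\<bar> <= a1 & s <= b1)"
 proof (cases "s <= b1")
  case True
  hence "a1 < \<bar>r - 1/2\<bar>" using * by simp
  hence "a1\<^sup>2 <= (r - 1/2)\<^sup>2" using assms abs_le_square_iff[of a1 "r - 1/2"] by simp
  hence "(a1\<^sup>2 - (r - 1/2)\<^sup>2) * inverse (a1\<^sup>2 - a0\<^sup>2) <= 0"
   using d by (intro mult_nonpos_nonneg) auto
  thus ?thesis by (simp add: cutoff2_def smooth_step_simps)
 next
  case False
  hence "(b1 - s) * inverse (b1 - b0) <= 0" using assms by (intro mult_nonpos_nonneg) auto
  thus ?thesis by (simp add: cutoff2_def smooth_step_simps)
 qed
 show "0 <= cutoff2 a0 a1 b0 b1 r s" "cutoff2 a0 a1 b0 b1 r s <= 1"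
  by (simp_all add: cutoff2_def smooth_step_bounds mult_le_one)
qed

lemma smooth_cutoff2:
 assumes "smooth_on f S" "smooth_on g S" "open S"
 shows "smooth_on (%x. cutoff2 a0 a1 b0 b1 (f x) (g x)) S" unfolding cutoff2_def
 by (intro smooth_mult smooth_step_o smooth_diff smooth_const smooth_power assms)

section \<open>Conformal deformation to circular Reeb orbits\<close>

context frame_at
begin

definition GE :: "'a set" where
 "GE = {y. (X1 (y - x0))\<^sup>2 + (Y1 (y - x0))\<^sup>2 ~= 0 & (X2 (y - x0))\<^sup>2 + (Y2 (y - x0))\<^sup>2 ~= 0}"

lemma continuous_functional: "linear (L :: 'a => real) ==> continuous_on S (%y. L (y - a))"
 by (rule continuous_on_compose2[OF linear_continuous_on[of L UNIV]])
   (auto simp: linear_conv_bounded_linear intro: continuous_intros)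

lemma open_GE: "open GE" unfolding GE_def
 by (intro open_Collect_conj open_Collect_neq continuous_intros continuous_functional lin)

lemma smooth_GE:
 assumes "open S" "S <= GE"
 shows "smooth_on U S" "smooth_on Rr S" "smooth_on Ss S"
proof -
 note f = smooth_functional[OF lin(1) assms(1), of x0] smooth_functional[OF lin(2) assms(1), of x0]
  smooth_functional[OF lin(3) assms(1), of x0] smooth_functional[OF lin(4) assms(1), of x0]
  smooth_functional[OF lin(5) assms(1), of x0]
 have t: "smooth_on (%y. T (y - x0)) S"
  by (intro smooth_linear[OF bl(7)] smooth_diff smooth_ident smooth_const assms)
 show U: "smooth_on U S" unfolding U_def[abs_def]
  using assms(2) by (intro smooth_divide smooth_add smooth_power smooth_const f assms(1)) (auto simp: GE_def)
 show "smooth_on Rr S" unfolding Rr_def[abs_def]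
  by (intro smooth_divide smooth_add smooth_mult smooth_power smooth_const U f assms(1)) auto
 show "smooth_on Ss S" unfolding Ss_def[abs_def]
  by (intro smooth_divide smooth_add smooth_mult smooth_diff smooth_power smooth_inner smooth_const U f t assms(1)) auto
qed

lemma one_form_dphi: "open S ==> S <= GE ==> form1 S dphi"
 and one_form_dtheta: "open S ==> S <= GE ==> form1 S dtheta"
 and one_form_aff: "open S ==> form1 S aff"
proof -
 note f = smooth_functional[OF lin(1), of _ x0] smooth_functional[OF lin(2), of _ x0]
  smooth_functional[OF lin(3), of _ x0] smooth_functional[OF lin(4), of _ x0]
  smooth_functional[OF lin(5), of _ x0]
 have lc: "linear (%v. k * (a * L v - b * M v))" if "linear L" "linear M" for k a b and L M :: "'a => real"
  using that by (intro linearI) (simp_all add: linear_add linear_scale algebra_simps)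
 show "open S ==> S <= GE ==> form1 S dphi" unfolding form1_def
 proof (intro conjI ballI allI)
  show "linear (dphi x)" for x unfolding dphi_def by (rule lc[OF lin(3,2)])
  show "open S ==> S <= GE ==> smooth_on (%x. dphi x v) S" for v
   unfolding dphi_def[abs_def] by (intro smooth_mult smooth_diff smooth_const f smooth_GE)
 qed
 show "open S ==> S <= GE ==> form1 S dtheta" unfolding form1_def
 proof (intro conjI ballI allI)
  show "linear (dtheta x)" for x unfolding dtheta_def by (rule lc[OF lin(5,4)])
  assume S: "open S" "S <= GE"
  show "smooth_on (%x. dtheta x v) S" for v unfolding dtheta_def[abs_def] using S
   by (intro smooth_mult smooth_diff smooth_const smooth_divide smooth_add smooth_power f) (auto simp: GE_def)
 qed
 show "open S ==> form1 S aff" unfolding form1_def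
 proof (intro conjI ballI allI)
  show "linear (aff x)" for x
   by (rule linearI) (simp_all add: aff_def lin_simps be_simps algebra_simps add_divide_distrib diff_divide_distrib)
  assume S: "open S"
  have "smooth_on (%y. be (y - x0) v) S" for v using smooth_functional[OF skew_formD(2)[OF be(1)] S] .
  thus "smooth_on (%x. aff x v) S" for v unfolding aff_def[abs_def] using S
   by (intro smooth_mult smooth_diff smooth_const smooth_divide smooth_add f) auto
 qed
qed

definition Bs :: "'a => 'a => real" where
 "Bs u v = X1 u * Y1 v - Y1 u * X1 v + (X2 u * Y2 v - Y2 u * X2 v) + be u v"

lemma Bs_linear: "linear (Bs u)" "linear (%u. Bs u v)" and Bs_skew: "Bs u v = - Bs v u"
proof -
 show "linear (Bs u)" "linear (%u. Bs u v)"
  by (rule linearI; simp add: Bs_def lin_simps be_simps algebra_simps)+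
 show "Bs u v = - Bs v u" unfolding Bs_def using skew_formD(3)[OF be(1), of u v] by simp
qed

lemma aff_eq: "aff y v = Z v + (1/2) * Bs (y - x0) v" by (simp add: aff_def Bs_def)

lemma d1_aff: "d1 aff y u v = Bs u v"
proof -
 have "d1 aff y u v = d1 (%y v. Z v + (1/2) * Bs (y - x0) v) y u v"
  by (rule d1_cong[of UNIV]) (auto simp: aff_eq)
 also have "... = (1/2) * (Bs u v - Bs v u)"
  using d1_add_scale[OF form1_const[OF lin(1) open_UNIV] form1_bilinear[OF Bs_linear open_UNIV, of x0], of y "1/2" u v]
   d1_bilinear[of Bs x0 y u v, OF Bs_linear(2)] by simp
 also have "... = Bs u v" using Bs_skew[of v u] by simp
 finally show ?thesis .
qed

text \<open>Only one period of the angle is taken, which makes the box compact while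
  \<open>Phi\<close> still maps it onto \<open>KK\<close>.\<close>

definition Box :: "real => real => 'a set" where
 "Box a b = {q. Y1 q : {0..2 * pi} & \<bar>rh q - 1/2\<bar> <= a & sh q <= b}"

definition KK :: "real => real => 'a set" where
 "KK a b = {y. \<bar>Rr y - 1/2\<bar> <= a & Ss y <= b}"

lemma sh_bounds:
 assumes "sh q <= 1/4" shows "1/4 <= X1 q" "X1 q <= 7/4" "\<bar>Z q\<bar> <= 3/4" "norm (T q) <= 3/4"
proof -
 have s: "(X1 q - 1)\<^sup>2 + (Z q)\<^sup>2 + (norm (T q))\<^sup>2 <= 1/2" using assms by (simp add: sh_def power2_norm_eq_inner)
 have *: "\<bar>t\<bar> <= 3/4" if "t\<^sup>2 <= 1/2" for t :: real
 proof -
  have "t\<^sup>2 <= (3/4)\<^sup>2" using that by (simp add: power2_eq_square)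
  thus ?thesis by (simp add: abs_le_square_iff[symmetric])
 qed
 have "(X1 q - 1)\<^sup>2 <= 1/2" "(Z q)\<^sup>2 <= 1/2" "(norm (T q))\<^sup>2 <= 1/2"
  using s zero_le_power2[of "X1 q - 1"] zero_le_power2[of "Z q"] zero_le_power2[of "norm (T q)"] by linarith+
 thus "1/4 <= X1 q" "X1 q <= 7/4" "\<bar>Z q\<bar> <= 3/4" "norm (T q) <= 3/4"
  using abs_le_D1[OF *[of "X1 q - 1"]] abs_le_D2[OF *[of "X1 q - 1"]] *[of "Z q"] *[of "norm (T q)"] by linarith+
qed

lemma rh_bounds:
 assumes "\<bar>rh q - 1/2\<bar> <= 3/8" shows "\<bar>X2 q\<bar> <= 2" "\<bar>Y2 q\<bar> <= 2" "rh q > 0"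
proof -
 have r: "rh q >= 1/8" "rh q <= 7/8" using abs_le_D1[OF assms] abs_le_D2[OF assms] by linarith+
 hence s: "(X2 q)\<^sup>2 + (Y2 q)\<^sup>2 <= 7/4" by (simp add: rh_def)
 have "(X2 q)\<^sup>2 <= 4" "(Y2 q)\<^sup>2 <= 4"
  using s zero_le_power2[of "X2 q"] zero_le_power2[of "Y2 q"] by linarith+
 thus "\<bar>X2 q\<bar> <= 2" "\<bar>Y2 q\<bar> <= 2"
  using abs_le_square_iff[of "X2 q" 2] abs_le_square_iff[of "Y2 q" 2] by simp_all
 show "rh q > 0" using r by simp
qed

lemma norm_decomp:
 "norm q <= \<bar>Z q\<bar> * norm e0 + \<bar>X1 q\<bar> * norm e1 + \<bar>Y1 q\<bar> * norm f1 + \<bar>X2 q\<bar> * norm e2 + \<bar>Y2 q\<bar> * norm f2 + Cw * norm (T q)"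
proof -
 have "norm q = norm (Z q .* e0 + X1 q .* e1 + Y1 q .* f1 + X2 q .* e2 + Y2 q .* f2 + pw q)"
  using decomp[of q] by simp
 also have "... <= norm (Z q .* e0) + norm (X1 q .* e1) + norm (Y1 q .* f1) + norm (X2 q .* e2) + norm (Y2 q .* f2) + norm (pw q)"
  by (intro order_trans[OF norm_triangle_ineq] add_mono order_refl)
 finally show ?thesis using Cw(2)[of q] by simp
qed

lemma compact_Box: assumes "a <= 3/8" "b <= 1/4" shows "compact (Box a b)"
proof -
 note cf = linear_continuous_on[OF bl(1)] linear_continuous_on[OF bl(2)] linear_continuous_on[OF bl(3)]
  linear_continuous_on[OF bl(4)] linear_continuous_on[OF bl(5)] linear_continuous_on[OF bl(7)]
 have "Box a b = {q. 0 <= Y1 q} \<inter> {q. Y1 q <= 2 * pi} \<inter> {q. \<bar>rh q - 1/2\<bar> <= a} \<inter> {q. sh q <= b}"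
  by (auto simp: Box_def)
 moreover have "closed {q. 0 <= Y1 q}" "closed {q. Y1 q <= 2 * pi}" "closed {q. \<bar>rh q - 1/2\<bar> <= a}" "closed {q. sh q <= b}"
  unfolding rh_def sh_def by (intro closed_Collect_le continuous_intros cf; simp)+
 ultimately have "closed (Box a b)" by (auto intro: closed_Int)
 moreover have "norm q <= norm e0 + 2 * norm e1 + 2 * pi * norm f1 + 2 * norm e2 + 2 * norm f2 + Cw" if "q : Box a b" for q
 proof -
  have q: "\<bar>rh q - 1/2\<bar> <= 3/8" "sh q <= 1/4" "\<bar>Y1 q\<bar> <= 2 * pi" using that assms by (auto simp: Box_def)
  note n = norm_decomp[of q] sh_bounds[OF q(2)] rh_bounds[OF q(1)]
  have c: "\<bar>Z q\<bar> <= 1" "\<bar>X1 q\<bar> <= 2" "norm (T q) <= 1" using n by (auto simp: abs_le_iff)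
  have "\<bar>Z q\<bar> * norm e0 <= 1 * norm e0" "\<bar>X1 q\<bar> * norm e1 <= 2 * norm e1" "\<bar>Y1 q\<bar> * norm f1 <= 2 * pi * norm f1"
   "\<bar>X2 q\<bar> * norm e2 <= 2 * norm e2" "\<bar>Y2 q\<bar> * norm f2 <= 2 * norm f2"
   by (rule mult_right_mono[OF _ norm_ge_zero]; rule c q n)+
  moreover have "Cw * norm (T q) <= Cw * 1" by (rule mult_left_mono[OF c(3) Cw(1)])
  ultimately show ?thesis using n(1) by linarith
 qed
 ultimately show ?thesis unfolding compact_eq_bounded_closed bounded_iff by blast
qed

lemma Box_subset: "q : Box a b ==> a <= 3/8 ==> b <= 1/4 ==> X1 q > 0 & rh q > 0"
 using sh_bounds(1)[of q] rh_bounds(3)[of q] by (auto simp: Box_def)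

text \<open>On the axis of the polar coordinates division by zero gives \<open>U y = 0\<close>, and
  then the term \<open>(U y - 1)\<^sup>2\<close> alone makes \<open>Ss y\<close> at least
  1/2.\<close>

lemma KK_U_pos: "b <= 1/4 ==> Ss y <= b ==> U y > 0"
proof (rule ccontr)
 assume b: "b <= 1/4" "Ss y <= b" and "~ U y > 0"
 moreover have "U y >= 0" by (simp add: U_def)
 ultimately have "U y = 0" by simp
 hence "Ss y >= 1/2" by (simp add: Ss_def)
 thus False using b by simp
qed

lemma KK_preimage:
 assumes "y : KK a b" "b <= 1/4"
 obtains q where "q : Box a b" "Phi q = y" "X1 q > 0"
proof -
 have U: "U y > 0" using KK_U_pos[OF assms(2), of y] assms(1) by (auto simp: KK_def)
 obtain q where q: "X1 q = U y" "Y1 q : {0..2 * pi}" "Phi q = y" using Phi_surj[OF U] by blast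
 have X: "X1 q > 0" using q U by simp
 have "q : Box a b" using assms(1) q(2) Rr_Phi[OF X] Ss_Phi[OF X] unfolding q(3) by (simp add: Box_def KK_def)
 thus ?thesis using that q(3) X by blast
qed

lemma KK_eq: "a <= 3/8 ==> b <= 1/4 ==> KK a b = Phi ` Box a b"
proof (intro set_eqI iffI)
 fix y assume "b <= 1/4" "y : KK a b"
 thus "y : Phi ` Box a b" using KK_preimage by (metis imageI)
next
 fix y assume ab: "a <= 3/8" "b <= 1/4" and "y : Phi ` Box a b"
 then obtain q where q: "q : Box a b" "y = Phi q" by blast
 have X: "X1 q > 0" using Box_subset[OF q(1) ab] by simp
 show "y : KK a b" using q Rr_Phi[OF X] Ss_Phi[OF X] by (simp add: KK_def Box_def)
qed

lemma compact_KK: assumes "a <= 3/8" "b <= 1/4" shows "compact (KK a b)"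
proof -
 have "continuous_on (Box a b) Phi" using Phi_deriv has_derivative_continuous Box_subset[OF _ assms]
  by (blast intro: continuous_at_imp_continuous_on)
 thus ?thesis unfolding KK_eq[OF assms] using compact_Box[OF assms] compact_continuous_image by blast
qed

lemma KK_subset_GE: "a <= 3/8 ==> b <= 1/4 ==> KK a b <= GE"
proof
 fix y assume "a <= 3/8" "b <= 1/4" "y : KK a b"
 hence "U y > 0" "Rr y > 0" using KK_U_pos[of b y] by (auto simp: KK_def abs_le_iff)
 thus "y : GE" by (auto simp: GE_def U_def Rr_def)
qed

text \<open>Over the box the factor \<open>X1 q powr (- 1/2)\<close> and the rescaled coordinates
  are at most 2, so every coordinate of a point of \<open>KK\<close> is at most 4; this explains the
  bound \<open>r / 5\<close> on the size of the frame.\<close>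

lemma KK_small:
 assumes "norm e0 + norm e1 + norm f1 + norm e2 + norm f2 + Cw <= r / 5" "r > 0"
 shows "KK (3/8) (1/4) <= ball x0 r"
proof
 fix y assume "y : KK (3/8) (1/4)"
 then obtain q where q: "q : Box (3/8) (1/4)" "Phi q = y" "X1 q > 0" by (rule KK_preimage) simp
 hence q': "\<bar>rh q - 1/2\<bar> <= 3/8" "sh q <= 1/4" by (auto simp: Box_def)
 note b = sh_bounds[OF q'(2)] rh_bounds[OF q'(1)]
 have p2: "X1 q powr (- 1/2) <= 2"
 proof -
  have "X1 q powr (- 1/2) <= (1/4) powr (- 1/2)" using b(1) by (intro powr_mono2') auto
  also have "(1/4::real) powr (- 1/2) = 2"
  proof -
   have "(1/4::real) powr (- 1/2) = inverse (sqrt (1/4))" by (simp add: powr_minus powr_half_sqrt)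
   also have "sqrt (1/4::real) = 1/2" using real_sqrt_abs[of "1/2::real"] by (simp add: power2_eq_square)
   finally show ?thesis by simp
  qed
  finally show ?thesis .
 qed
 have p0: "0 <= X1 q powr (- 1/2)" by simp
 have "norm (y - x0) <= \<bar>Z (y - x0)\<bar> * norm e0 + \<bar>X1 (y - x0)\<bar> * norm e1 + \<bar>Y1 (y - x0)\<bar> * norm f1
   + \<bar>X2 (y - x0)\<bar> * norm e2 + \<bar>Y2 (y - x0)\<bar> * norm f2 + Cw * norm (T (y - x0))" by (rule norm_decomp)
 also have "... <= 4 * norm e0 + 4 * norm e1 + 4 * norm f1 + 4 * norm e2 + 4 * norm f2 + Cw * 4"
 proof (intro add_mono mult_right_mono mult_left_mono norm_ge_zero Cw(1))
  have *: "X1 q powr (- 1/2) * t <= 4" if "t <= 2" "t >= 0" for t using mult_mono[OF p2 that(1)] that by simp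
  show "\<bar>Z (y - x0)\<bar> <= 4" "\<bar>X1 (y - x0)\<bar> <= 4" "\<bar>Y1 (y - x0)\<bar> <= 4" "\<bar>X2 (y - x0)\<bar> <= 4" "\<bar>Y2 (y - x0)\<bar> <= 4"
   "norm (T (y - x0)) <= 4" unfolding q(2)[symmetric] Phi_coords
   using b order_trans[OF abs_cos_le_one, of 2 "Y1 q"] order_trans[OF abs_sin_le_one, of 2 "Y1 q"] *[of "\<bar>cos (Y1 q)\<bar>"] *[of "\<bar>sin (Y1 q)\<bar>"] *[of "\<bar>X2 q\<bar>"] *[of "\<bar>Y2 q\<bar>"] *[of "norm (T q)"]
   by (auto simp: abs_mult)
 qed
 also have "... < r" using assms by simp
 finally show "y : ball x0 r" by (simp add: dist_norm norm_minus_commute)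
qed

definition L0 :: "'a => 'a => real" where "L0 y v = 2 * U y * aff y v"
text \<open>Here the conformal factor has already reached its final value. The set contains the
  support \<open>KK (1/5) (1/6)\<close> of the next deformation.\<close>

definition plateau :: "'a set" where "plateau = {y. \<bar>Rr y - 1/2\<bar> < 1/4 & Ss y < 1/5}"

lemma open_plateau: "open plateau"
proof -
 have cR: "continuous_on GE Rr" and cS: "continuous_on GE Ss" by (intro smooth_cont smooth_GE open_GE; simp)+
 have op: "open (GE \<inter> (%y. (Rr y, Ss y)) -` ({1/4<..<3/4} \<times> {..<1/5}))"
  by (rule continuous_open_preimage[OF continuous_on_Pair[OF cR cS] open_GE]) (intro open_Times; simp)
 have "plateau <= KK (3/8) (1/4)" by (auto simp: plateau_def KK_def)
 hence GE: "plateau <= GE" using KK_subset_GE[of "3/8" "1/4"] by auto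
 have abs: "\<bar>t - 1/2\<bar> < 1/4 \<longleftrightarrow> 1/4 < t & t < 3/4" for t :: real by linarith
 have "plateau = GE \<inter> (%y. (Rr y, Ss y)) -` ({1/4<..<3/4} \<times> {..<1/5})" using GE unfolding plateau_def abs by auto
 thus ?thesis using op by simp
qed

end

locale framed_mf = oriented_mf X A + frame_at e0 e1 f1 e2 f2 Z X1 Y1 X2 Y2 pw T J be Cw x0
 for X :: "'a topology" and A :: "('a, 'm::{finite,linorder}) chart set"
  and e0 e1 f1 e2 f2 :: "(real, 'm) vec" and Z X1 Y1 X2 Y2 pw T J be Cw x0 +
 fixes n :: nat and c0
 assumes m: "CARD('m) = 2 * n + 1" and c0: "c0 : A"
begin

definition agrees where
 "agrees lam omg l w \<longleftrightarrow> (ALL y:plateau. y : cimg c0 & lc1 lam c0 y = l y & lc2 omg c0 y = w y)"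

text \<open>A positive multiple of a contact form is a contact form, so interpolating the factor
  between 1 and \<open>2 U / c\<close> keeps \<lambda> contact, with \<omega> changed by the
  matching exact form divided by \<open>a\<close>.\<close>

lemma conformal_step:
 assumes s: "(lam, omg) : SHS A n" and ball: "r > 0" "ball x0 r <= cimg c0" "norm e0 + norm e1 + norm f1 + norm e2 + norm f2 + Cw <= r / 5"
  and c: "c > 0" and a: "a ~= 0"
  and lam0: "!!y v. y : ball x0 r ==> lc1 lam c0 y v = c * aff y v"
  and om0: "!!y u v. y : ball x0 r ==> lc2 omg c0 y u v = c / a * Bs u v"
 shows "EX lam' omg'. ((lam, omg), (lam', omg')) : stable_homotopy_rel A n &
   agrees lam' omg' L0 (%y u v. d1 L0 y u v / a)"
proof -
 have lam: "smooth_form A 1 lam" and omg: "smooth_form A 2 omg"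
  and at: "!!c x. c : A ==> x : cimg c ==> shs_at n (lc1 lam c) (lc2 omg c) x"
  using s unfolding SHS_iff[OF m] by blast+
 define S where "S = cimg c0"
 have S: "open S" unfolding S_def by (rule open_cimg[OF c0])
 define l where "l = lc1 lam c0"
 have l: "form1 S l" unfolding l_def S_def by (rule smooth_lc1(1)[OF lam c0])
 have ballS: "ball x0 r <= S" using ball by (simp add: S_def)
 have dl: "d1 l y u v = c * Bs u v" if y: "y : ball x0 r" for y u v
 proof -
  have "d1 l y u v = d1 (%y v. aff y v + (c - 1) * aff y v) y u v"
   by (rule d1_cong[OF open_ball y]) (simp add: l_def lam0 algebra_simps)
  also have "... = Bs u v + (c - 1) * Bs u v"
   using d1_add_scale[OF one_form_aff[OF open_ball] one_form_aff[OF open_ball] y] by (simp add: d1_aff)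
  finally show ?thesis by (simp add: algebra_simps)
 qed
 have ct: "d1 l y u v = a * lc2 omg c0 y u v" if y: "y : ball x0 r" for y u v
  using a by (simp add: dl[OF y] om0[OF y])
 define K where "K = KK (3/8) (1/4)"
 have K: "compact K" "K <= GE" "K <= ball x0 r"
  unfolding K_def using compact_KK KK_subset_GE KK_small[OF ball(3,1)] by auto
 define chi where "chi y = cutoff2 (1/4) (3/8) (1/5) (1/4) (Rr y) (Ss y)" for y
 have chi: "0 <= chi y" "chi y <= 1" and chi0: "y ~: K ==> chi y = 0"
  and chi1: "\<bar>Rr y - 1/2\<bar> <= 1/4 ==> Ss y <= 1/5 ==> chi y = 1" for y
  unfolding chi_def K_def KK_def by (rule cutoff2_simps; simp)+
 \<comment> \<open>\<open>1 + t * g y\<close> is a convex combination of 1 and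
   \<open>2 / c * U y\<close>, hence positive.\<close>
 define g where "g y = chi y * (2 / c * U y - 1)" for y
 define G where "G = GE \<inter> S"
 have G: "open G" "G <= GE" "K <= G" using K ballS S open_GE by (auto simp: G_def)
 have sg: "smooth_on g G" unfolding g_def chi_def
  by (intro smooth_mult smooth_cutoff2 smooth_diff smooth_const smooth_GE G(1,2))
 define m1 where "m1 y v = g y * l y v" for y v
 have m1G: "form1 G m1" unfolding m1_def by (intro form1_fun_mult sg form1_subset[OF l] G) (simp add: G_def)
 have out: "m1 y v = 0" if "y ~: K" for y v using chi0[OF that] by (simp add: m1_def g_def)
 have m1: "form1 S m1" by (rule form1_extend_by_zero[OF m1G G(1) compact_imp_closed[OF K(1)] G(3) out])
 define m3 where "m3 = (%y v. (%x v. 0) y v + (1 / a) * m1 y v)"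
 have m3: "form1 S m3" unfolding m3_def by (intro form1_add_scale form1_zero m1 S)
 have sup: "supported_form c0 K m1" "supported_form c0 K (%x v. 0)" "supported_form c0 K m3"
  using m1 m3 out K ballS S by (auto simp: supported_form_def S_def m3_def intro: form1_zero)
 have dm3: "d1 m3 y u v = d1 m1 y u v / a" if "y : S" for y u v
  unfolding m3_def using d1_add_scale[OF form1_zero[OF S] m1 that, of "1/a" u v] by simp
 have dm1: "d1 m1 y u v = FD g y u * l y v - FD g y v * l y u + g y * d1 l y u v"
  if "y : G" for y u v unfolding m1_def using d1_fun_mult[OF sg form1_subset[OF l] that] by (simp add: G_def)
 have vol: "vol_form n (%v. lc1 lam c0 y v + t * m1 y v + t\<^sup>2 * 0) (%a b. lc2 omg c0 y a b + t * d1 m3 y a b) std_basis ~= 0"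
  if t: "t : {0..1}" and y: "y : K" for t y
 proof -
  have yS: "y : S" "y : G" "y : ball x0 r" using y K ballS G by auto
  have lin: "linear (l y)" using form1D(1)[OF l yS(1)] .
  have sk: "skew_form (lc2 omg c0 y)" using smooth_lc2(1)[OF omg c0] yS by (simp add: S_def)
  have sk': "skew_form (%u v. lc2 omg c0 y u v + t * d1 m3 y u v)"
  proof -
   note d = d1_linear[OF m3 S yS(1)]
   show ?thesis unfolding skew_form_def
   proof (intro conjI allI)
    show "linear (%v. lc2 omg c0 y u v + t * d1 m3 y u v)" for u
     using linear_compose_add[OF skew_formD(1)[OF sk] linear_compose_scale_right[OF d(2)]] by simp
    show "linear (%u. lc2 omg c0 y u v + t * d1 m3 y u v)" for v
     using linear_compose_add[OF skew_formD(2)[OF sk] linear_compose_scale_right[OF d(1)]] by simp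
    show "lc2 omg c0 y u v + t * d1 m3 y u v = - (lc2 omg c0 y v u + t * d1 m3 y v u)" for u v
     using skew_formD(3)[OF sk, of u v] d1_skew[of m3 y u v] by simp
   qed
  qed
  have g0: "1 + t * g y > 0"
  proof -
   have U: "U y > 0" using y KK_U_pos[of "1/4" y] by (auto simp: K_def KK_def)
   have tc: "0 <= t * chi y" "t * chi y <= 1" using t chi[of y] by (auto simp: mult_le_one)
   have eq: "1 + t * g y = (1 - t * chi y) + (t * chi y) * (2 / c * U y)" by (simp add: g_def algebra_simps)
   show ?thesis
   proof (cases "t * chi y = 1")
    case True
    thus ?thesis unfolding eq using U c by simp
   next
    case False
    have "(t * chi y) * (2 / c * U y) >= 0" using tc U c by simp
    thus ?thesis unfolding eq using tc False by linarith
   qed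
  qed
  \<comment> \<open>On the kernel of the one-form the differential of the factor drops out, so
    \<open>vol_form_restrict\<close> applies with one factor for the one-form and the same factor
    for the two-form.\<close>
  have "vol_form n (%v. lc1 lam c0 y v + t * m1 y v + t\<^sup>2 * 0) (%u v. lc2 omg c0 y u v + t * d1 m3 y u v) std_basis
   = (1 + t * g y) * (1 + t * g y) ^ n * vol_form n (l y) (lc2 omg c0 y) std_basis"
  proof (rule vol_form_restrict[OF _ lin _ sk sk'])
   show "DIM((real, 'm) vec) = 2 * n + 1" using m by simp
   show "lc1 lam c0 y v + t * m1 y v + t\<^sup>2 * 0 = (1 + t * g y) * l y v" for v
    by (simp add: m1_def l_def algebra_simps)
   show "lc2 omg c0 y u v + t * d1 m3 y u v = (1 + t * g y) * lc2 omg c0 y u v" if "l y u = 0" "l y v = 0" for u v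
    using a by (simp add: dm3[OF yS(1)] dm1[OF yS(2)] that ct[OF yS(3)] algebra_simps)
  qed
  moreover have "vol_form n (l y) (lc2 omg c0 y) std_basis ~= 0"
   using at[OF c0] yS(1) unfolding shs_at_def S_def l_def by force
  ultimately show ?thesis using g0 by simp
 qed
 have ker: "d1 (lc1 lam c0) y u v + t * d1 m1 y u v + t\<^sup>2 * d1 (%x v. 0) y u v = 0"
  if y: "y : K" and *: "!!v. lc2 omg c0 y u v + t * d1 m3 y u v = 0" for y t u v
 proof -
  have yS: "y : S" "y : ball x0 r" using y K ballS by auto
  have "d1 l y u v + t * d1 m1 y u v = a * (lc2 omg c0 y u v + t * d1 m3 y u v)"
   using a by (simp add: ct[OF yS(2)] dm3[OF yS(1)] algebra_simps)
  thus ?thesis using * by (simp add: l_def)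
 qed
 obtain lam' omg' where H: "((lam, omg), (lam', omg')) : stable_homotopy_rel A n"
   and eq: "ALL x:cimg c0. ALL v. lc1 lam' c0 x v = lc1 lam c0 x v + m1 x v + 0"
   "ALL x:cimg c0. ALL a b. lc2 omg' c0 x a b = lc2 omg c0 x a b + d1 m3 x a b"
  using stable_homotopy_in_chart[OF m c0 s sup vol ker] by blast
 have "y : cimg c0 & lc1 lam' c0 y = L0 y & lc2 omg' c0 y = (%u v. d1 L0 y u v / a)" if y: "y : plateau" for y
 proof -
  have yK: "y : K" using y by (auto simp: plateau_def K_def KK_def)
  have yS: "y : S" "y : G" "y : ball x0 r" using yK K ballS G by auto
  have yO: "y : plateau \<inter> ball x0 r" using y yS by simp
  have eqm: "l z v + m1 z v = L0 z v" if z: "z : plateau \<inter> ball x0 r" for z v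
  proof -
   have "chi z = 1" using z by (intro chi1) (auto simp: plateau_def)
   thus ?thesis using lam0[of z v] z c by (simp add: m1_def g_def l_def L0_def algebra_simps)
  qed
  have 1: "lc1 lam' c0 y v = L0 y v" for v
   using eq(1) yS(1) eqm[OF yO, of v] by (simp add: S_def l_def)
  have "d1 l y u v + d1 m1 y u v = d1 L0 y u v" for u v
  proof -
   have "d1 l y u v + 1 * d1 m1 y u v = d1 (%y v. l y v + 1 * m1 y v) y u v"
    by (rule d1_add_scale[OF l m1 yS(1), symmetric])
   also have "... = d1 L0 y u v"
    by (rule d1_cong[OF open_Int[OF open_plateau open_ball] yO]) (use eqm in simp)
   finally show ?thesis by simp
  qed
  hence 2: "lc2 omg' c0 y u v = d1 L0 y u v / a" for u v
   using eq(2) yS(1) a by (simp add: S_def[symmetric] dm3 ct[OF yS(3)] field_simps)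
  show ?thesis using yS(1) 1 2 by (auto simp: S_def fun_eq_iff)
 qed
 thus ?thesis using H unfolding agrees_def by blast
qed

end

text \<open>The quadratic part makes the circle r = 1/2 a non-degenerate minimum in the radial
  direction. The cubic part makes the second derivative \<open>1/2 + r\<close> non-constant; up to
  constants it is the invariant function of the model.\<close>

definition gg :: "real => real" where "gg r = (r - 1/2)\<^sup>2 / 2 + (r - 1/2) ^ 3 / 6"

definition FF :: "real \<times> real => real" where
 "FF z = cutoff2 (1/8) (1/5) (1/10) (1/6) (fst z) (snd z) * (gg (fst z) + snd z)"

definition FFr :: "real \<times> real => real" where "FFr z = FD FF z (1, 0)"
definition FFs :: "real \<times> real => real" where "FFs z = FD FF z (0, 1)"

lemma smooth_FF: "smooth_on FF UNIV" and smooth_FFr: "smooth_on FFr UNIV"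
proof -
 have f: "smooth_on (fst :: real \<times> real => real) UNIV" "smooth_on (snd :: real \<times> real => real) UNIV"
  by (intro smooth_blinear bounded_linear_fst bounded_linear_snd open_UNIV)+
 show "smooth_on FF UNIV" unfolding FF_def[abs_def] gg_def
  by (intro smooth_mult smooth_cutoff2 smooth_add smooth_divide smooth_power smooth_diff smooth_const f open_UNIV) auto
 thus "smooth_on FFr UNIV" unfolding FFr_def[abs_def] by (rule smooth_FD)
qed

lemma FF_derivative: "(FF has_derivative (%v. fst v * FFr z + snd v * FFs z)) (at z)"
proof -
 have d: "(FF has_derivative FD FF z) (at z)" by (rule smooth_deriv[OF smooth_FF]) simp
 have "FD FF z v = fst v * FFr z + snd v * FFs z" for v
 proof -
  interpret linear "FD FF z" using d has_derivative_linear by blast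
  have "v = fst v .* (1, 0) + snd v .* (0, 1)" by (simp add: prod_eq_iff)
  hence "FD FF z v = FD FF z (fst v .* (1, 0) + snd v .* (0, 1))" by simp
  also have "... = fst v * FFr z + snd v * FFs z" unfolding add scale by (simp add: FFr_def FFs_def)
  finally show ?thesis .
 qed
 hence "FD FF z = (%v. fst v * FFr z + snd v * FFs z)" by blast
 thus ?thesis using d by simp
qed

lemma FF_outside:
 assumes "~ (\<bar>fst z - 1/2\<bar> <= 1/5 & snd z <= 1/6)" shows "FF z = 0" "FFr z = 0"
proof -
 have z: "FF z = 0" if "~ (\<bar>fst z - 1/2\<bar> <= 1/5 & snd z <= 1/6)" for z
  using cutoff2_simps(2)[of "1/8" "1/5" "1/10" "1/6" "fst z" "snd z"] that by (simp add: FF_def)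
 show "FF z = 0" by (rule z[OF assms])
 have "closed {z :: real \<times> real. \<bar>fst z - 1/2\<bar> <= 1/5 & snd z <= 1/6}"
  by (intro closed_Collect_conj closed_Collect_le continuous_intros)
 hence op: "open (- {z :: real \<times> real. \<bar>fst z - 1/2\<bar> <= 1/5 & snd z <= 1/6})" by (simp add: open_Compl)
 have "FD FF z = FD (%_. 0) z" by (rule FD_cong[OF op]) (use assms z in auto)
 thus "FFr z = 0" by (simp add: FFr_def)
qed

lemma FF_inside:
 assumes "\<bar>fst z - 1/2\<bar> < 1/8" "snd z < 1/10"
 shows "FF z = gg (fst z) + snd z" "FFr z = (fst z - 1/2) + (fst z - 1/2)\<^sup>2 / 2" "FFs z = 1"
proof -
 have z: "FF z = gg (fst z) + snd z" if "\<bar>fst z - 1/2\<bar> < 1/8 & snd z < 1/10" for z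
  using cutoff2_simps(1)[of "1/8" "1/5" "1/10" "1/6" "fst z" "snd z"] that by (simp add: FF_def)
 show "FF z = gg (fst z) + snd z" using z assms by blast
 have op: "open {z :: real \<times> real. \<bar>fst z - 1/2\<bar> < 1/8 & snd z < 1/10}"
  by (intro open_Collect_conj open_Collect_less continuous_intros)
 have "((%z. gg (fst z) + snd z) has_derivative (%v. ((fst z - 1/2) + (fst z - 1/2)\<^sup>2 / 2) * fst v + snd v)) (at z)"
  unfolding gg_def by (auto intro!: derivative_eq_intros simp: fun_eq_iff power2_eq_square field_simps)
 hence "(FF has_derivative (%v. ((fst z - 1/2) + (fst z - 1/2)\<^sup>2 / 2) * fst v + snd v)) (at z)"
  by (rule has_derivative_transform_within_open[OF _ op]) (use assms z in auto)
 thus "FFr z = (fst z - 1/2) + (fst z - 1/2)\<^sup>2 / 2" "FFs z = 1"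
  unfolding FFr_def FFs_def by (simp_all add: FD_eqI)
qed

section \<open>The deformed forms and their common kernel\<close>

context frame_at
begin

text \<open>Half the differential of \<open>lamh\<close> (see \<open>d1_lamh\<close>): a constant
  form whose kernel is the angular direction \<open>f1\<close>, symplectic on the quotient.\<close>

definition sg :: "'a => 'a => real" where
 "sg u v = X1 u * Z v - Z u * X1 v + (X2 u * Y2 v - Y2 u * X2 v) + be u v"
definition dr :: "'a => 'a => real" where "dr q v = X2 q * X2 v + Y2 q * Y2 v"
definition ds :: "'a => 'a => real" where "ds q v = (X1 q - 1) * X1 v + Z q * Z v + T q \<bullet> T v"
definition dth :: "'a => 'a => real" where "dth q v = (X2 q * Y2 v - Y2 q * X2 v) / (2 * rh q)"
definition hh :: "'a => real" where "hh q = FF (rh q, sh q)"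
definition kh :: "'a => real" where "kh q = FFr (rh q, sh q)"
definition dhh :: "'a => 'a => real" where "dhh q v = FFr (rh q, sh q) * dr q v + FFs (rh q, sh q) * ds q v"

lemma frame_derivs:
 "(Z has_derivative Z) (at q)" "(X1 has_derivative X1) (at q)" "(Y1 has_derivative Y1) (at q)"
 "(X2 has_derivative X2) (at q)" "(Y2 has_derivative Y2) (at q)" "(T has_derivative T) (at q)"
 by (rule bounded_linear_imp_has_derivative, rule bl)+

lemma rh_derivative: "(rh has_derivative dr q) (at q)" unfolding rh_def[abs_def] dr_def[abs_def]
 by (auto intro!: derivative_eq_intros frame_derivs simp: fun_eq_iff field_simps)

lemma sh_derivative: "(sh has_derivative ds q) (at q)" unfolding sh_def[abs_def] ds_def[abs_def]
 by (auto intro!: derivative_eq_intros frame_derivs simp: fun_eq_iff field_simps inner_commute)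

lemma smooth_rh: "open S ==> smooth_on rh S" and smooth_sh: "open S ==> smooth_on sh S"
 unfolding rh_def[abs_def] sh_def[abs_def]
 by (intro smooth_divide smooth_add smooth_diff smooth_power smooth_inner smooth_const smooth_blinear bl; simp)+

lemma smooth_rs_compose: "smooth_on f UNIV ==> open S ==> smooth_on (%q. f (rh q, sh q)) S" for f :: "real \<times> real => real"
 by (rule smooth_compose[of f UNIV]) (auto intro: smooth_Pair smooth_rh smooth_sh)

lemma rs_compose_derivative:
 assumes "(f has_derivative f') (at (rh q, sh q))"
 shows "((%q. f (rh q, sh q)) has_derivative (%v. f' (dr q v, ds q v))) (at q)"
 by (rule has_derivative_compose[OF has_derivative_Pair[OF rh_derivative sh_derivative] assms])

lemma hh_derivative: "(hh has_derivative dhh q) (at q)"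
 using rs_compose_derivative[OF FF_derivative, of q] by (simp add: hh_def[abs_def] dhh_def[abs_def] mult.commute)

lemma kh_derivative_kernel:
 assumes "dr q R = 0" "ds q R = 0" shows "FD kh q R = 0"
proof -
 have d: "(FFr has_derivative FD FFr (rh q, sh q)) (at (rh q, sh q))"
  by (rule smooth_deriv[OF smooth_FFr]) simp
 from rs_compose_derivative[OF d] have "FD kh q R = FD FFr (rh q, sh q) (0, 0)"
  using FD_eqI assms by (fastforce simp: kh_def[abs_def])
 moreover have "FD FFr (rh q, sh q) 0 = 0" using linear_0[OF has_derivative_linear[OF d]] .
 ultimately show ?thesis by (simp add: zero_prod_def)
qed

lemma sg_linear: "linear (sg u)" "linear (%u. sg u v)"
 by (rule linearI; simp add: sg_def lin_simps be_simps algebra_simps)+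

text \<open>The kernel is the lift of a Hamiltonian direction of \<open>h\<close>, and
  \<open>rh\<close> and \<open>sh\<close> depend on complementary variables, so they Poisson commute
  and are preserved. Each claim comes from one test vector: the rotation \<open>T2\<close> and the
  field \<open>Vs\<close> annihilate \<open>dr\<close> and \<open>ds\<close> and give the first two,
  the radial vector \<open>Tr\<close> gives the relation for the angle.\<close>

lemma hat_kernel:
 assumes q: "rh q > 0" and R: "!!v. 2 * sg R v + t * (dhh q R * Y1 v - dhh q v * Y1 R) = 0"
 shows "dr q R = 0" "ds q R = 0" "2 * dth q R + t * kh q * Y1 R = 0" "dhh q R = 0"
  "!!v. 2 * sg R v = t * dhh q v * Y1 R"
proof -
 define T2 where "T2 = - Y2 q .* e2 + X2 q .* f2"
 define Tr where "Tr = X2 q .* e2 + Y2 q .* f2"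
 define Vs where "Vs = (X1 q - 1) .* e0 - Z q .* e1 + J q"
 have Jz: "Z (J q) = 0" "X1 (J q) = 0" "Y1 (J q) = 0" "X2 (J q) = 0" "Y2 (J q) = 0"
  using dual(6,12,18,24,30)[of "J q"] unfolding J(1) by auto
 have cT2: "Y1 T2 = 0" "sg R T2 = dr q R" "dr q T2 = 0" "ds q T2 = 0"
  by (simp_all add: T2_def lin_simps dual sg_def dr_def ds_def be_simps be_basis T_basis)
 have "dr q R = 0" using R[of T2] by (simp add: cT2 dhh_def)
 thus dr: "dr q R = 0" .
 have JJ: "T q \<bullet> T (J q) = 0"
  using J(2)[of "J q" q] be_simps(7)[of "J q"] by (simp add: inner_commute)
 have cVs: "Y1 Vs = 0" "sg R Vs = ds q R" "dr q Vs = 0" "ds q Vs = 0"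
  using JJ by (simp_all add: Vs_def lin_simps dual sg_def dr_def ds_def be_simps be_basis T_basis Jz J(2) inner_commute algebra_simps)
 show ds: "ds q R = 0" using R[of Vs] by (simp add: cVs dhh_def)
 show dh: "dhh q R = 0" by (simp add: dhh_def dr ds)
 show eq: "2 * sg R v = t * dhh q v * Y1 R" for v using R[of v] by (simp add: dh)
 have r2: "(X2 q)\<^sup>2 + (Y2 q)\<^sup>2 = 2 * rh q" by (simp add: rh_def)
 have th: "2 * rh q * dth q R = X2 q * Y2 R - Y2 q * X2 R" using q by (simp add: dth_def)
 have "sg R Tr = X2 R * Y2 q - Y2 R * X2 q" by (simp add: Tr_def lin_simps dual sg_def be_simps be_basis)
 hence "sg R Tr = - (2 * rh q) * dth q R" using th by (simp add: algebra_simps)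
 moreover have "dr q Tr = 2 * rh q" "ds q Tr = 0"
  by (simp_all add: Tr_def lin_simps dual sg_def dr_def ds_def be_simps be_basis T_basis r2[symmetric] power2_eq_square)
 ultimately have cTr: "sg R Tr = - (2 * rh q) * dth q R" "dr q Tr = 2 * rh q" "ds q Tr = 0" by auto
 have "(2 * rh q) * (2 * dth q R + t * kh q * Y1 R) = 0"
  using eq[of Tr] by (simp add: cTr dhh_def kh_def algebra_simps)
 thus "2 * dth q R + t * kh q * Y1 R = 0" using q by simp
qed

definition nuE :: "'a => 'a => real" where "nuE y v = FF (Rr y, Ss y) * dphi y v"
definition thE :: "'a => 'a => real" where "thE y v = FFr (Rr y, Ss y) * dtheta y v"
definition kkE :: "'a => 'a => real" where "kkE y v = (FFr (Rr y, Ss y))\<^sup>2 * dphi y v"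
text \<open>With \<kappa> = \<open>FFr\<close>, the differential is \<open>a\<close> times
  \<open>wM t a\<close> plus \<open>t d\<kappa> \<and> (2 d\<theta> + t \<kappa> d\<phi>)\<close>.
  The quadratic term contributes the part with d\<phi>: only the completed second factor vanishes on
  the kernel of \<open>wM\<close>.\<close>

definition lM :: "real => 'a => 'a => real" where
 "lM t y v = L0 y v + t * (nuE y v + 2 * thE y v) + t\<^sup>2 / 2 * kkE y v"
definition wM :: "real => real => 'a => 'a => 'a => real" where
 "wM t a y u v = (d1 L0 y u v + t * d1 nuE y u v) / a"

lemma smooth_RS_compose: "smooth_on f UNIV ==> open S ==> S <= GE ==> smooth_on (%y. f (Rr y, Ss y)) S"
 for f :: "real \<times> real => real" by (rule smooth_compose[of f UNIV]) (auto intro: smooth_Pair smooth_GE)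

lemma forms_GE:
 "form1 GE L0" "form1 GE nuE" "form1 GE thE" "form1 GE kkE"
proof -
 note S = open_GE subset_refl[of GE]
 show "form1 GE L0" unfolding L0_def[abs_def]
  by (intro form1_fun_mult smooth_mult smooth_const smooth_GE one_form_aff S)
 show "form1 GE nuE" unfolding nuE_def[abs_def]
  by (intro form1_fun_mult smooth_RS_compose smooth_FF one_form_dphi S)
 show "form1 GE thE" unfolding thE_def[abs_def]
  by (intro form1_fun_mult smooth_RS_compose smooth_FFr one_form_dtheta S)
 show "form1 GE kkE" unfolding kkE_def[abs_def]
  by (intro form1_fun_mult smooth_power smooth_RS_compose smooth_FFr one_form_dphi S)
qed

lemma forms_outside: "y ~: KK (1/5) (1/6) ==> nuE y v = 0 & thE y v = 0 & kkE y v = 0"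
 using FF_outside[of "(Rr y, Ss y)"] by (simp add: KK_def nuE_def thE_def kkE_def)

definition HQ :: "'a set" where "HQ = {q. X1 q > 0 & rh q > 0}"

lemma open_HQ: "open HQ" unfolding HQ_def rh_def
 using bl by (intro open_Collect_conj open_Collect_less continuous_intros linear_continuous_on; simp)

lemma Phi_HQ: "Phi ` HQ <= GE"
proof
 fix y assume "y : Phi ` HQ"
 then obtain q where "X1 q > 0" "rh q > 0" "y = Phi q" by (auto simp: HQ_def)
 hence "U y > 0" "Rr y > 0" by (simp_all add: U_Phi Rr_Phi)
 thus "y : GE" by (auto simp: GE_def U_def Rr_def)
qed

lemma d1_Phi:
 assumes "form1 GE m" "!!q v. q : HQ ==> m (Phi q) (dPhi q v) = mh q v" "q : HQ"
 shows "d1 m (Phi q) (dPhi q u) (dPhi q v) = d1 mh q u v"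
proof -
 have sub: "HQ <= {q. 0 < X1 q}" by (auto simp: HQ_def)
 have "d1 mh q u v = d1 m (Phi q) (FD Phi q u) (FD Phi q v)"
  by (rule d1_natural[OF assms(1) open_GE smooth_Phi[OF open_HQ sub] open_HQ Phi_HQ assms(3)])
    (use assms(2) sub frechet_Phi in auto)
 thus ?thesis using frechet_Phi sub assms(3) by auto
qed

lemma one_form_const_Y1: "form1 HQ (%q v. Y1 v)" by (rule form1_const[OF lin(3) open_HQ])

lemma d1_lamh: "d1 lamh q u v = 2 * sg u v"
proof -
 have d: "((%q. lamh q v) has_derivative (%u. 2 * (X1 u * Z v) + (X2 u * Y2 v - Y2 u * X2 v) + be u v)) (at q)" for v
  unfolding lamh_def by (auto intro!: derivative_eq_intros frame_derivs bounded_linear_imp_has_derivative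
    simp: linear_conv_bounded_linear[symmetric] skew_formD(2)[OF be(1)])
 have "FD (%q. lamh q v) q u = 2 * (X1 u * Z v) + (X2 u * Y2 v - Y2 u * X2 v) + be u v" for u v
  by (rule FD_eqI[OF d])
 thus ?thesis unfolding d1_def sg_def using skew_formD(3)[OF be(1), of v u] by simp
qed

lemma d1_L0_Phi: "q : HQ ==> d1 L0 (Phi q) (dPhi q u) (dPhi q v) = 2 * sg u v"
 by (subst d1_Phi[OF forms_GE(1), of lamh]) (auto simp: L0_def aff_Phi HQ_def d1_lamh)

lemma d1_nuE_Phi:
 assumes q: "q : HQ"
 shows "d1 nuE (Phi q) (dPhi q u) (dPhi q v) = dhh q u * Y1 v - dhh q v * Y1 u"
proof -
 have sm: "smooth_on hh HQ" unfolding hh_def[abs_def] by (rule smooth_rs_compose[OF smooth_FF open_HQ])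
 have "d1 nuE (Phi q) (dPhi q u) (dPhi q v) = d1 (%q v. hh q * Y1 v) q u v"
  by (rule d1_Phi[OF forms_GE(2) _ q]) (auto simp: nuE_def hh_def HQ_def Rr_Phi Ss_Phi dphi_Phi)
 also have "... = dhh q u * Y1 v - dhh q v * Y1 u"
  unfolding d1_fun_mult[OF sm one_form_const_Y1 q] FD_eqI[OF hh_derivative] by simp
 finally show ?thesis .
qed

lemma smooth_kh: "smooth_on kh HQ"
 unfolding kh_def[abs_def] by (rule smooth_rs_compose[OF smooth_FFr open_HQ])

lemma d1_kkE_Phi:
 assumes q: "q : HQ"
 shows "d1 kkE (Phi q) (dPhi q u) (dPhi q v) = 2 * kh q * (FD kh q u * Y1 v - FD kh q v * Y1 u)"
proof -
 have sm: "smooth_on (%q. (kh q)\<^sup>2) HQ" by (intro smooth_power smooth_kh open_HQ)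
 have "((%q. (kh q)\<^sup>2) has_derivative (%u. 2 * kh q * FD kh q u)) (at q)"
  using smooth_deriv[OF smooth_kh q] by (auto intro!: derivative_eq_intros)
 hence fd: "FD (%q. (kh q)\<^sup>2) q u = 2 * kh q * FD kh q u" for u by (rule FD_eqI)
 have "d1 kkE (Phi q) (dPhi q u) (dPhi q v) = d1 (%q v. (kh q)\<^sup>2 * Y1 v) q u v"
  by (rule d1_Phi[OF forms_GE(4) _ q]) (auto simp: kkE_def kh_def HQ_def Rr_Phi Ss_Phi dphi_Phi)
 also have "... = 2 * kh q * (FD kh q u * Y1 v - FD kh q v * Y1 u)"
  unfolding d1_fun_mult[OF sm one_form_const_Y1 q] fd by (simp add: algebra_simps)
 finally show ?thesis .
qed

text \<open>Away from the axis the angular form is closed: differentiating the factor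
  \<open>1 / (2 rh)\<close> cancels the differential of \<open>x2 dy2 - y2 dx2\<close>. So only the
  differential of \<kappa> contributes.\<close>

lemma d1_thE_Phi:
 assumes q: "q : HQ"
 shows "d1 thE (Phi q) (dPhi q u) (dPhi q v) = FD kh q u * dth q v - FD kh q v * dth q u"
proof -
 define ang where "ang q v = X2 q * Y2 v - Y2 q * X2 v" for q v
 have ang: "form1 HQ ang" unfolding form1_def ang_def
  by (intro conjI ballI allI linearI smooth_diff smooth_mult smooth_const smooth_blinear bl open_HQ)
    (simp_all add: lin_simps algebra_simps)
 have dang: "d1 ang q u v = 2 * (X2 u * Y2 v - Y2 u * X2 v)"
 proof -
  have "((%q. ang q v) has_derivative (%u. X2 u * Y2 v - Y2 u * X2 v)) (at q)" for v
   unfolding ang_def by (auto intro!: derivative_eq_intros frame_derivs)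
  hence "FD (%q. ang q v) q u = X2 u * Y2 v - Y2 u * X2 v" for u v by (rule FD_eqI)
  thus ?thesis by (simp add: d1_def)
 qed
 define w where "w q = inverse (2 * rh q)" for q
 have sw: "smooth_on w HQ" unfolding w_def
  by (intro smooth_inverse smooth_mult smooth_const smooth_rh open_HQ) (auto simp: HQ_def)
 have rq: "rh q > 0" using q by (simp add: HQ_def)
 have dw: "FD w q u = - (w q * w q * (2 * dr q u))" for u
 proof -
  have "((%q. 2 * rh q) has_derivative (%u. 2 * dr q u)) (at q)"
   by (rule has_derivative_mult_right[OF rh_derivative])
  from Deriv.has_derivative_inverse[OF _ this] have "(w has_derivative (%u. - (w q * (2 * dr q u) * w q))) (at q)"
   using rq by (simp add: w_def[abs_def])
  thus ?thesis using FD_eqI by (metis mult.assoc mult.commute)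
 qed
 have dthw: "dth q v = w q * ang q v" for q v
  unfolding dth_def w_def ang_def divide_inverse by (rule mult.commute)
 have of: "form1 HQ dth" unfolding dthw[abs_def] by (rule form1_fun_mult[OF sw ang open_HQ])
 have closed: "d1 dth q u v = 0"
 proof -
  have "d1 dth q u v = FD w q u * ang q v - FD w q v * ang q u + w q * d1 ang q u v"
   unfolding dthw[abs_def] by (rule d1_fun_mult[OF sw ang q])
  also have "... = 2 * w q * (X2 u * Y2 v - Y2 u * X2 v) * (1 - w q * ((X2 q)\<^sup>2 + (Y2 q)\<^sup>2))"
   unfolding dw dang ang_def dr_def power2_eq_square by algebra
  also have "(X2 q)\<^sup>2 + (Y2 q)\<^sup>2 = 2 * rh q" by (simp add: rh_def)
  finally show ?thesis using rq by (simp add: w_def)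
 qed
 have "d1 thE (Phi q) (dPhi q u) (dPhi q v) = d1 (%q v. kh q * dth q v) q u v"
  by (rule d1_Phi[OF forms_GE(3) _ q]) (auto simp: thE_def kh_def HQ_def Rr_Phi Ss_Phi dtheta_Phi dth_def)
 also have "... = FD kh q u * dth q v - FD kh q v * dth q u"
  unfolding d1_fun_mult[OF smooth_kh of q] closed by simp
 finally show ?thesis .
qed

end

text \<open>The zero set is compact, so its projection to the time axis attains its minimum, which
  is positive by assumption.\<close>

lemma compact_nonzero_near_zero:
 fixes f :: "real \<times> 'b::metric_space => real"
 assumes f: "continuous_on ({0..1} \<times> K) f" and K: "compact K" and nz: "!!y. y : K ==> f (0, y) ~= 0"
 shows "EX t0>0. ALL t y. 0 <= t & t <= t0 & y : K --> f (t, y) ~= 0"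
proof -
 define W where "W = ({0..1} \<times> K) \<inter> f -` {0}"
 have c: "compact ({0..1::real} \<times> K)" by (intro compact_Times compact_Icc K)
 have "closed W" unfolding W_def
  by (rule continuous_closed_preimage[OF f compact_imp_closed[OF c] closed_singleton])
 hence W: "compact W" unfolding W_def using compact_Int_closed[OF c, of W] by (simp add: W_def Int_assoc[symmetric])
 show ?thesis
 proof (cases "W = {}")
  case True
  have "f (t, y) ~= 0" if "0 <= t & t <= 1 & y : K" for t y
  proof
   assume "f (t, y) = 0"
   hence "(t, y) : W" using that by (auto simp: W_def)
   thus False using True by simp
  qed
  thus ?thesis by (intro exI[of _ 1]) auto
 next
  case False
  have "compact (fst ` W)" by (intro compact_continuous_image W continuous_intros)
  then obtain t1 where t1: "t1 : fst ` W" "!!t. t : fst ` W ==> t1 <= t"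
   using compact_attains_inf[of "fst ` W"] False by auto
  hence "t1 > 0" using nz by (auto simp: W_def less_le)
  have "f (t, y) ~= 0" if "0 <= t & t <= min (t1 / 2) 1 & y : K" for t y
  proof
   assume "f (t, y) = 0"
   hence "(t, y) : W" using that by (auto simp: W_def)
   hence "t1 <= t" using t1(2) by force
   thus False using that \<open>t1 > 0\<close> by simp
  qed
  thus ?thesis using \<open>t1 > 0\<close> by (intro exI[of _ "min (t1 / 2) 1"]) auto
 qed
qed

section \<open>The integrable deformation as a stable homotopy\<close>

context framed_mf
begin

text \<open>The kernel condition is an identity valid for every \<open>t\<close>, by
  \<open>hat_kernel\<close>. The restriction to small \<open>t\<close> comes from the volume alone,
  which is controlled near \<open>t = 0\<close> by compactness.\<close>

lemma integrable_step:
 assumes s: "(lam, omg) : SHS A n" and a: "a ~= 0" and P: "agrees lam omg L0 (%y u v. d1 L0 y u v / a)"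
 shows "EX t0>0. ALL t. 0 < t & t <= t0 -->
   (EX lam' omg'. ((lam, omg), (lam', omg')) : stable_homotopy_rel A n & agrees lam' omg' (lM t) (wM t a))"
proof -
 have lam: "smooth_form A 1 lam" and omg: "smooth_form A 2 omg"
  and at: "!!c x. c : A ==> x : cimg c ==> shs_at n (lc1 lam c) (lc2 omg c) x"
  using s unfolding SHS_iff[OF m] by blast+
 define S where "S = cimg c0"
 have S: "open S" unfolding S_def by (rule open_cimg[OF c0])
 define K where "K = KK (1/5) (1/6)"
 have KPL: "K <= plateau" by (auto simp: K_def plateau_def KK_def)
 have PLS: "plateau <= S" using P by (auto simp: agrees_def S_def)
 have PLL: "lc1 lam c0 y v = L0 y v" "lc2 omg c0 y u v = d1 L0 y u v / a" if "y : plateau" for y u v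
  using P that by (auto simp: agrees_def)
 have K: "compact K" "K <= GE" unfolding K_def by (intro compact_KK KK_subset_GE; simp)+
 have out: "nuE y v = 0" "thE y v = 0" "kkE y v = 0" if "y ~: K" for y v
  using forms_outside[of y v] that by (auto simp: K_def)
 note extz = form1_extend_by_zero[OF _ open_GE compact_imp_closed[OF K(1)] K(2)]
 have fS: "form1 S nuE" "form1 S thE" "form1 S kkE"
  by (rule extz[OF forms_GE(2) out(1)] extz[OF forms_GE(3) out(2)] extz[OF forms_GE(4) out(3)]; assumption)+
 define f where "f = (%(t, y). vol_form n (lM t y) (wM t a y) std_basis)"
 have fc: "continuous_on ({0..1} \<times> K) f"
 proof -
  have c1: "continuous_on ({0..1::real} \<times> K) (%p. h (snd p))" if "smooth_on h GE" for h :: "_ => real"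
   by (rule continuous_on_compose2[OF smooth_cont[OF that]]) (use K in \<open>auto intro: continuous_intros\<close>)
  note cc = c1[OF form1D(2)[OF forms_GE(1)]] c1[OF form1D(2)[OF forms_GE(2)]]
   c1[OF form1D(2)[OF forms_GE(3)]] c1[OF form1D(2)[OF forms_GE(4)]]
   c1[OF smooth_d1[OF forms_GE(1) open_GE]] c1[OF smooth_d1[OF forms_GE(2) open_GE]]
  have A1: "continuous_on ({0..1} \<times> K) (%p. lM (fst p) (snd p) v)" for v unfolding lM_def
   by (intro continuous_intros cc) auto
  have A2: "continuous_on ({0..1} \<times> K) (%p. wM (fst p) a (snd p) u v)" for u v unfolding wM_def
   by (intro continuous_intros cc) (use a in auto)
  show ?thesis unfolding continuous_on_def f_def case_prod_unfold
   using A1 A2 unfolding continuous_on_def by (auto intro!: vol_form_tendsto)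
 qed
 have f0: "f (0, y) ~= 0" if y: "y : K" for y
 proof -
  have "vol_form n (lc1 lam c0 y) (lc2 omg c0 y) std_basis ~= 0"
   using at[OF c0, of y] y KPL PLS unfolding shs_at_def S_def by force
  moreover have "lc1 lam c0 y = lM 0 y" using PLL(1)[of y] y KPL by (auto simp: fun_eq_iff lM_def)
  moreover have "lc2 omg c0 y = wM 0 a y"
   by (intro ext) (simp add: wM_def PLL(2)[OF subsetD[OF KPL y]])
  ultimately show ?thesis by (simp add: f_def)
 qed
 obtain t0 where t0: "t0 > 0" "!!t y. 0 <= t & t <= t0 & y : K ==> f (t, y) ~= 0"
  using compact_nonzero_near_zero[OF fc K(1) f0] by blast
 have "EX lam' omg'. ((lam, omg), (lam', omg')) : stable_homotopy_rel A n & agrees lam' omg' (lM t) (wM t a)"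
  if t: "0 < t" "t <= t0" for t
 proof -
  define z where "z = (%(x :: (real, 'm) vec) (v :: (real, 'm) vec). 0 :: real)"
  have z: "form1 T z" "d1 z x u v = 0" if "open T" for T x u v
   using that by (auto simp: z_def form1_zero d1_def)
  define m1 where "m1 = (%y v. (z y v + t * nuE y v) + (2 * t) * thE y v)"
  define m2 where "m2 = (%y v. z y v + (t\<^sup>2 / 2) * kkE y v)"
  define m3 where "m3 = (%y v. z y v + (t / a) * nuE y v)"
  have mS: "form1 S m1" "form1 S m2" "form1 S m3"
   unfolding m1_def m2_def m3_def by (intro form1_add_scale z fS S)+
  have sup: "supported_form c0 K m1" "supported_form c0 K m2" "supported_form c0 K m3"
   using mS K KPL PLS out by (auto simp: supported_form_def S_def m1_def m2_def m3_def z_def)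
  have dm: "d1 m1 y u v = t * d1 nuE y u v + 2 * t * d1 thE y u v" "d1 m2 y u v = t\<^sup>2 / 2 * d1 kkE y u v"
   "d1 m3 y u v = t / a * d1 nuE y u v" if "y : S" for y u v unfolding m1_def m2_def m3_def
    d1_add_scale[OF form1_add_scale[OF z(1)[OF S] fS(1) S] fS(2) that]
    d1_add_scale[OF z(1)[OF S] fS(1) that] d1_add_scale[OF z(1)[OF S] fS(3) that] z(2)[OF S] by simp_all
  have vol: "vol_form n (%v. lc1 lam c0 y v + r * m1 y v + r\<^sup>2 * m2 y v) (%a b. lc2 omg c0 y a b + r * d1 m3 y a b) std_basis ~= 0"
   if r: "r : {0..1}" and y: "y : K" for r y
  proof -
   have yP: "y : plateau" "y : S" using y KPL PLS by auto
   have "r * t <= 1 * t0" using r t by (intro mult_mono) auto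
   hence "f (r * t, y) ~= 0" using r t y by (intro t0(2)) auto
   moreover have "(%v. lc1 lam c0 y v + r * m1 y v + r\<^sup>2 * m2 y v) = lM (r * t) y"
    by (rule ext) (simp add: lM_def PLL(1)[OF yP(1)] m1_def m2_def z_def algebra_simps power_mult_distrib)
   moreover have "(%u v. lc2 omg c0 y u v + r * d1 m3 y u v) = wM (r * t) a y"
    by (intro ext) (simp add: wM_def PLL(2)[OF yP(1)] dm[OF yP(2)] add_divide_distrib)
   ultimately show ?thesis by (simp add: f_def)
  qed
  have ker: "d1 (lc1 lam c0) y u v + r * d1 m1 y u v + r\<^sup>2 * d1 m2 y u v = 0"
   if r: "r : {0..1}" and y: "y : K" and *: "!!v. lc2 omg c0 y u v + r * d1 m3 y u v = 0" for y r u v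
  proof -
   have yP: "y : plateau" "y : S" using y KPL PLS by auto
   obtain q where q: "q : Box (1/5) (1/6)" "Phi q = y" "X1 q > 0"
    using KK_preimage[of y "1/5" "1/6"] y unfolding K_def by auto
   have qH: "q : HQ" using Box_subset[OF q(1)] by (simp add: HQ_def)
   hence rq: "rh q > 0" by (simp add: HQ_def)
   obtain N where N: "!!v. dPhi q (N v) = v" using dPhi_bij[OF q(3)] by blast
   define R where "R = N u"
   have dlam: "d1 (lc1 lam c0) y u v = d1 L0 y u v" for u v
    by (rule d1_cong[OF open_plateau yP(1)]) (rule PLL(1))
   have e1: "d1 L0 y u (dPhi q v) = 2 * sg R v" for v
    using d1_L0_Phi[OF qH, of R v] unfolding q(2) R_def N .
   have e2: "d1 nuE y u (dPhi q v) = dhh q R * Y1 v - dhh q v * Y1 R" for v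
    using d1_nuE_Phi[OF qH, of R v] unfolding q(2) R_def N .
   have e3: "d1 thE y u (dPhi q v) = FD kh q R * dth q v - FD kh q v * dth q R" for v
    using d1_thE_Phi[OF qH, of R v] unfolding q(2) R_def N .
   have e4: "d1 kkE y u (dPhi q v) = 2 * kh q * (FD kh q R * Y1 v - FD kh q v * Y1 R)" for v
    using d1_kkE_Phi[OF qH, of R v] unfolding q(2) R_def N .
   have H: "2 * sg R v + (r * t) * (dhh q R * Y1 v - dhh q v * Y1 R) = 0" for v
   proof -
    have "(d1 L0 y u (dPhi q v) + (r * t) * d1 nuE y u (dPhi q v)) / a = 0"
     using *[of "dPhi q v"] by (simp add: PLL(2)[OF yP(1)] dm[OF yP(2)] add_divide_distrib)
    thus ?thesis using a by (simp add: e1 e2)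
   qed
   note hk = hat_kernel[OF rq H]
   have dk: "FD kh q R = 0" by (rule kh_derivative_kernel[OF hk(1,2)])
   define w where "w = N v"
   \<comment> \<open>The first summand is the contraction of \<open>a \<omega>\<close>, the second
     that of the correction; the last factor is the relation for the angle in
     \<open>hat_kernel\<close>.\<close>
   have "d1 (lc1 lam c0) y u v + r * d1 m1 y u v + r\<^sup>2 * d1 m2 y u v
    = (2 * sg R w + (r * t) * (dhh q R * Y1 w - dhh q w * Y1 R))
     - (r * t) * FD kh q w * (2 * dth q R + (r * t) * kh q * Y1 R)"
    unfolding dlam dm[OF yP(2)] e1[of w, unfolded w_def N, folded w_def] e2[of w, unfolded w_def N, folded w_def]
     e3[of w, unfolded w_def N, folded w_def] e4[of w, unfolded w_def N, folded w_def]
    by (simp add: dk algebra_simps power2_eq_square)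
   thus ?thesis using H[of w] hk(3) by simp
  qed
  obtain lam' omg' where H: "((lam, omg), (lam', omg')) : stable_homotopy_rel A n"
    and eq: "ALL x:cimg c0. ALL v. lc1 lam' c0 x v = lc1 lam c0 x v + m1 x v + m2 x v"
    "ALL x:cimg c0. ALL a b. lc2 omg' c0 x a b = lc2 omg c0 x a b + d1 m3 x a b"
   using stable_homotopy_in_chart[OF m c0 s sup vol ker] by blast
  have "y : cimg c0 & lc1 lam' c0 y = lM t y & lc2 omg' c0 y = wM t a y" if y: "y : plateau" for y
  proof -
   have yS: "y : S" using y PLS by auto
   thus ?thesis
    using eq PLL[OF y] by (simp add: fun_eq_iff lM_def wM_def S_def[symmetric] dm m1_def m2_def z_def algebra_simps add_divide_distrib)
  qed
  thus ?thesis using H unfolding agrees_def by blast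
 qed
 thus ?thesis using t0(1) by blast
qed

end

text \<open>By Cramer's rule the solution is a quotient of polynomials in smooth coefficients with
  non-vanishing denominator.\<close>

lemma smooth_linear_solve:
 fixes L :: "real ^ 'm => real ^ 'm => real ^ 'm::finite" and x g :: "real ^ 'm => real ^ 'm"
 assumes S: "open S" and lin: "!!q. q : S ==> linear (L q)" and inj: "!!q v. q : S ==> L q v = 0 ==> v = 0"
  and L: "!!v. smooth_on (%q. L q v) S" and g: "smooth_on g S" and x: "!!q. q : S ==> L q (x q) = g q"
 shows "smooth_on x S"
proof -
 define A where "A q = matrix (L q)" for q
 have det: "det (A q) ~= 0" if "q : S" for q
 proof -
  have "inj (L q)" using inj[OF that] linear_injective_0[OF lin[OF that]] by blast
  thus ?thesis unfolding A_def using lin[OF that] det_nz_iff_inj by blast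
 qed
 have comp: "smooth_on (%q. h q $ i) S" if "smooth_on h S" for h :: "real ^ 'm => real ^ 'm" and i
  by (rule smooth_linear[OF bounded_linear_vec_nth that S])
 have dets: "smooth_on (%q. det (B q)) S" if "!!i j. smooth_on (%q. B q $ i $ j) S" for B :: "real ^ 'm => real ^ 'm ^ 'm"
  unfolding det_def by (intro smooth_sum smooth_mult smooth_const smooth_prod S that)
 have A: "smooth_on (%q. A q $ i $ j) S" for i j unfolding A_def matrix_def by (simp add: comp L)
 have eq: "x q = (\<chi> k. det (\<chi> i j. if j = k then g q $ i else A q $ i $ j) / det (A q))" if "q : S" for q
  using cramer[OF det[OF that], of "x q" "g q"] x[OF that] lin[OF that] by (simp add: A_def matrix_works)
 have "smooth_on (%q. \<chi> k. det (\<chi> i j. if j = k then g q $ i else A q $ i $ j) / det (A q)) S"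
 proof (intro smooth_vec_lambda smooth_divide dets A S)
  show "smooth_on (%q. (\<chi> i j. if j = k then g q $ i else A q $ i $ j) $ i' $ j') S" for k i' j'
   by (cases "j' = k") (simp_all add: A comp g)
 qed (use det in auto)
 thus ?thesis by (rule smooth_cong[OF _ eq S])
qed

text \<open>An injective linear map is bounded below by some \<open>c\<close>. Once the deviation
  \<open>ep k\<close> is less than \<open>c / 2\<close>, it can be absorbed into this bound.\<close>

lemma linear_solve_tendsto:
 fixes L :: "'e::euclidean_space => 'e" and Lk :: "nat => 'e => 'e"
 assumes lin: "linear L" "!!k. linear (Lk k)" and inj: "!!v. L v = 0 ==> v = 0"
  and Lk: "!!v. (%k. Lk k v) ----> L v" and g: "(%k. Lk k (x k)) ----> L x0"
 shows "x ----> x0"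
proof -
 have "inj L" using linear_injective_0[OF lin(1)] inj by blast
 then obtain c where c: "c > 0" "!!v. c * norm v <= norm (L v)" using linear_inj_bounded_below_pos[OF lin(1)] by blast
 define ep where "ep k = (\<Sum>b\<in>Basis. norm (Lk k b - L b))" for k
 have ep: "ep ----> 0"
 proof -
  have "(%k. \<Sum>b\<in>Basis. norm (Lk k b - L b)) ----> (\<Sum>b\<in>(Basis::'e set). norm (L b - L b))"
   by (intro tendsto_sum tendsto_norm tendsto_diff Lk tendsto_const)
  thus ?thesis by (simp add: ep_def[abs_def])
 qed
 have bnd: "norm (Lk k v - L v) <= ep k * norm v" for k v
 proof -
  have "Lk k v - L v = (\<Sum>b\<in>Basis. (v \<bullet> b) .* (Lk k b - L b))"
   by (subst (1 2) euclidean_representation[of v, symmetric])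
     (simp only: linear_sum[OF lin(1)] linear_sum[OF lin(2)] linear_scale[OF lin(1)] linear_scale[OF lin(2)]
      sum_subtractf scaleR_diff_right)
  also have "norm ... <= (\<Sum>b\<in>Basis. norm v * norm (Lk k b - L b))"
   by (rule sum_norm_le) (use Basis_le_norm in \<open>auto intro!: mult_right_mono\<close>)
  finally show ?thesis by (simp add: ep_def sum_distrib_left mult.commute)
 qed
 define et where "et k = norm (Lk k (x k) - L x0)" for k
 have et: "et ----> 0" unfolding et_def[abs_def] using tendsto_norm[OF LIM_zero[OF g]] by simp
 have key: "norm (x k - x0) <= 2 / c * (et k + ep k * norm x0)" if "ep k < c / 2" for k
 proof -
  have "c * norm (x k - x0) <= norm (L (x k) - L x0)" using c(2)[of "x k - x0"] by (simp add: linear_diff[OF lin(1)])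
  also have "... <= et k + norm (Lk k (x k) - L (x k))"
   unfolding et_def using norm_triangle_ineq4[of "Lk k (x k) - L x0" "Lk k (x k) - L (x k)"] by simp
  also have "... <= et k + ep k * norm (x k)" using bnd by simp
  also have "... <= et k + ep k * (norm (x k - x0) + norm x0)"
   using norm_triangle_ineq[of "x k - x0" x0] by (intro add_left_mono mult_left_mono) (auto simp: ep_def sum_nonneg)
  also have "... <= et k + ep k * norm x0 + c / 2 * norm (x k - x0)"
   using mult_right_mono[of "ep k" "c / 2" "norm (x k - x0)"] that by (simp add: algebra_simps)
  finally have "c / 2 * norm (x k - x0) <= et k + ep k * norm x0" by (simp add: algebra_simps)
  thus ?thesis using c(1) by (simp add: field_simps)
 qed
 have z: "(%k. 2 / c * (et k + ep k * norm x0)) ----> 0"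
  using tendsto_mult_left[OF tendsto_add[OF et tendsto_mult_right[OF ep]], of "2 / c" "norm x0"] by simp
 have "\<forall>\<^sub>F k in sequentially. norm (x k - x0) <= 2 / c * (et k + ep k * norm x0)"
 proof (rule eventually_mono[OF _ key])
  show "\<forall>\<^sub>F k in sequentially. ep k < c / 2" by (rule order_tendstoD(2)[OF ep]) (use c(1) in simp)
 qed
 from Lim_null_comparison[OF this z] show ?thesis by (rule LIM_zero_cancel)
qed

section \<open>The invariant function\<close>

definition nd_pair :: "('e::euclidean_space => real) => ('e => 'e => real) => bool" where
 "nd_pair l w \<longleftrightarrow> linear l & skew_form w &
   (EX R. l R = 1 & (ALL b. w R b = 0) & (ALL a. (ALL b. w a b = 0) --> a = l a .* R))"

text \<open>Adding the square of \<open>l\<close> makes the degenerate form \<open>w\<close>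
  non-degenerate. The Reeb vector and the endomorphism behind the trace then both arise by solving
  one invertible linear system, so their smoothness and continuity follow from the same
  lemmas.\<close>

definition bform :: "('e => real) => ('e => 'e => real) => 'e => 'e => real" where
 "bform l w u v = w u v + l u * l v"

definition bvec :: "('e::euclidean_space => real) => ('e => 'e => real) => 'e => 'e" where
 "bvec l w u = (\<Sum>b\<in>Basis. bform l w u b .* b)"

definition sharp :: "('e::euclidean_space => real) => ('e => 'e => real) => ('e => real) => 'e" where
 "sharp l w al = (SOME z. ALL v. bform l w z v = al v)"

context
 fixes l :: "'e::euclidean_space => real" and w
 assumes nd: "nd_pair l w"
begin

lemma nd_lin: "linear l" "linear (w u)" "linear (%u. w u v)" "linear (bform l w u)" "linear (%u. bform l w u v)"
proof -
 show 1: "linear l" "linear (w u)" "linear (%u. w u v)" for u v using nd skew_formD unfolding nd_pair_def by blast+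
 show "linear (bform l w u)" "linear (%u. bform l w u v)"
  unfolding bform_def by (auto intro!: linearI simp: linear_add[OF 1(1)] linear_add[OF 1(2)] linear_add[OF 1(3)]
    linear_scale[OF 1(1)] linear_scale[OF 1(2)] linear_scale[OF 1(3)] algebra_simps)
qed

lemma nd_skew: "w u v = - w v u" using nd skew_formD unfolding nd_pair_def by blast

lemma bform_nondegenerate: assumes "!!v. bform l w u v = 0" shows "u = 0"
proof -
 obtain R where R: "l R = 1" "!!b. w R b = 0" "!!a. (ALL b. w a b = 0) ==> a = l a .* R"
  using nd unfolding nd_pair_def by blast
 have "w u R = 0" using R(2)[of u] nd_skew[of u R] by simp
 hence lu: "l u = 0" using assms[of R] R(1) by (simp add: bform_def)
 have "ALL b. w u b = 0" using assms lu by (simp add: bform_def)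
 thus ?thesis using R(3)[of u] lu by simp
qed

lemma bvec_inner: "bvec l w u \<bullet> v = bform l w u v"
proof -
 have "bform l w u v = (\<Sum>b\<in>Basis. (v \<bullet> b) * bform l w u b)"
  by (subst euclidean_representation[of v, symmetric], subst linear_sum[OF nd_lin(4)])
    (simp add: linear_scale[OF nd_lin(4)])
 thus ?thesis by (simp add: bvec_def inner_sum_left inner_sum_right inner_commute mult.commute)
qed

lemma linear_bvec: "linear (bvec l w)"
 by (rule linearI) (simp_all add: bvec_def linear_add[OF nd_lin(5)] linear_scale[OF nd_lin(5)]
  scaleR_add_left sum.distrib scaleR_sum_right)

lemma bvec_inj: "bvec l w u = 0 ==> u = 0" using bvec_inner[of u] bform_nondegenerate[of u] by simp

lemma bform_sharp: assumes "linear al" shows "bform l w (sharp l w al) v = al v"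
proof -
 have "surj (bvec l w)"
  using linear_injective_imp_surjective[OF linear_bvec] linear_injective_0[OF linear_bvec] bvec_inj by blast
 then obtain z where z: "bvec l w z = (\<Sum>b\<in>Basis. al b .* b)" by (metis surjD)
 have "bform l w z v = al v" for v
 proof -
  have "bform l w z v = (\<Sum>b\<in>Basis. al b .* b) \<bullet> v" by (simp only: bvec_inner[symmetric] z)
  also have "... = (\<Sum>b\<in>Basis. (v \<bullet> b) .* al b)" by (simp add: inner_sum_left inner_sum_right inner_commute mult.commute)
  also have "... = al v"
   by (subst (2) euclidean_representation[of v, symmetric], subst linear_sum[OF assms]) (simp add: linear_scale[OF assms])
  finally show ?thesis .
 qed
 hence "EX z. ALL v. bform l w z v = al v" by blast
 thus ?thesis unfolding sharp_def by (rule someI2_ex) blast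
qed

lemma sharp_eqI: assumes "linear al" "!!v. bform l w z v = al v" shows "sharp l w al = z"
proof -
 have "bform l w (sharp l w al - z) v = 0" for v
  by (simp add: linear_diff[OF nd_lin(5)] bform_sharp[OF assms(1)] assms(2))
 thus ?thesis using bform_nondegenerate by fastforce
qed

lemma sharp_reeb: "l (sharp l w l) = 1" "w (sharp l w l) v = 0"
 and reeb_eqI: "l R = 1 ==> (!!b. w R b = 0) ==> R = sharp l w l"
proof -
 show *: "l R = 1 ==> (!!b. w R b = 0) ==> R = sharp l w l" for R
  using sharp_eqI[OF nd_lin(1), of R] by (simp add: bform_def)
 obtain R where R: "l R = 1" "!!b. w R b = 0" using nd unfolding nd_pair_def by blast
 thus "l (sharp l w l) = 1" "w (sharp l w l) v = 0" using *[OF R] by auto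
qed

end

text \<open>If \<open>La\<close> annihilates the Reeb vector, the endomorphism
  \<open>sharp l w \<circ> La\<close> kills that vector and takes values in the kernel of
  \<open>l\<close>, so this is the trace of the transversal endomorphism.\<close>

definition trace_inv :: "('e::euclidean_space => real) => ('e => 'e => real) => ('e => 'e => real) => real" where
 "trace_inv l w La = (\<Sum>b\<in>Basis. sharp l w (La b) \<bullet> b)"

lemma smooth_sharp:
 fixes l al :: "real ^ 'm => real ^ 'm::finite => real" and w :: "real ^ 'm => real ^ 'm => real ^ 'm => real"
 assumes S: "open S" and nd: "!!x. x : S ==> nd_pair (l x) (w x)" and l: "!!v. smooth_on (%x. l x v) S"
  and w: "!!u v. smooth_on (%x. w x u v) S" and al: "!!v. smooth_on (%x. al x v) S" "!!x. x : S ==> linear (al x)"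
 shows "smooth_on (%x. sharp (l x) (w x) (al x)) S"
proof (rule smooth_linear_solve[where L = "%x. bvec (l x) (w x)" and g = "%x. \<Sum>b\<in>Basis. al x b .* b", OF S])
 show "linear (bvec (l x) (w x))" if "x : S" for x by (rule linear_bvec[OF nd[OF that]])
 show "v = 0" if "x : S" "bvec (l x) (w x) v = 0" for x v by (rule bvec_inj[OF nd[OF that(1)] that(2)])
 show "smooth_on (%x. bvec (l x) (w x) v) S" for v
  unfolding bvec_def bform_def by (intro smooth_sum smooth_scaleR smooth_add smooth_mult l w S smooth_const)
 show "smooth_on (%x. \<Sum>b\<in>Basis. al x b .* b) S" by (intro smooth_sum smooth_scaleR al S smooth_const)
 show "bvec (l x) (w x) (sharp (l x) (w x) (al x)) = (\<Sum>b\<in>Basis. al x b .* b)" if "x : S" for x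
  unfolding bvec_def by (simp add: bform_sharp[OF nd[OF that] al(2)[OF that]])
qed

lemma linear_expand: "linear al ==> al v = (\<Sum>b\<in>Basis. (v \<bullet> b) .* al b)"
 by (subst euclidean_representation[of v, symmetric], subst linear_sum) (simp_all add: linear_scale)

lemma sharp_tendsto:
 fixes l :: "'e::euclidean_space => real" and lk :: "nat => 'e => real"
 assumes nd: "nd_pair l w" "!!k. nd_pair (lk k) (wk k)" and al: "linear al" "!!k. linear (alk k)"
  and l: "!!b. b : Basis ==> (%k. lk k b) ----> l b"
  and w: "!!a b. a : Basis ==> b : Basis ==> (%k. wk k a b) ----> w a b"
  and alk: "!!b. b : Basis ==> (%k. alk k b) ----> al b"
 shows "(%k. sharp (lk k) (wk k) (alk k)) ----> sharp l w al"
proof (rule linear_solve_tendsto[where L = "bvec l w" and Lk = "%k. bvec (lk k) (wk k)"])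
 show "linear (bvec l w)" "linear (bvec (lk k) (wk k))" for k by (rule linear_bvec[OF nd(1)] linear_bvec[OF nd(2)])+
 show "bvec l w v = 0 ==> v = 0" for v by (rule bvec_inj[OF nd(1)])
 show "(%k. bvec (lk k) (wk k) v) ----> bvec l w v" for v
 proof -
  have 1: "(%k. lk k v) ----> l v"
   unfolding linear_expand[OF nd_lin(1)[OF nd(1)], of v] linear_expand[OF nd_lin(1)[OF nd(2)], of _ v]
   by (intro tendsto_intros l) auto
  have 2: "(%k. wk k v b) ----> w v b" if "b : Basis" for b
   unfolding linear_expand[OF nd_lin(3)[OF nd(1)], of v] linear_expand[OF nd_lin(3)[OF nd(2)], of _ v]
   by (intro tendsto_intros w that) auto
  show ?thesis unfolding bvec_def bform_def by (intro tendsto_intros 1 2 l) auto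
 qed
 show "(%k. bvec (lk k) (wk k) (sharp (lk k) (wk k) (alk k))) ----> bvec l w (sharp l w al)"
  unfolding bvec_def by (simp add: bform_sharp[OF nd(1) al(1)] bform_sharp[OF nd(2) al(2)])
   (intro tendsto_intros alk)
qed

lemma trace_commute:
 fixes P J :: "'e::euclidean_space => 'e"
 assumes "linear P" "linear J"
 shows "(\<Sum>b\<in>Basis. P (J b) \<bullet> b) = (\<Sum>b\<in>Basis. J (P b) \<bullet> b)"
proof -
 have *: "P (J b) \<bullet> b = (\<Sum>c\<in>Basis. (J b \<bullet> c) * (P c \<bullet> b))" if "linear P" for P J :: "'e => 'e" and b
  by (subst euclidean_representation[of "J b", symmetric], subst linear_sum[OF that])
    (simp add: linear_scale[OF that] inner_sum_left)
 have "(\<Sum>b\<in>Basis. P (J b) \<bullet> b) = (\<Sum>b\<in>Basis. \<Sum>c\<in>Basis. (J b \<bullet> c) * (P c \<bullet> b))"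
  by (rule sum.cong[OF refl *[OF assms(1)]])
 also have "... = (\<Sum>c\<in>Basis. \<Sum>b\<in>Basis. (P c \<bullet> b) * (J b \<bullet> c))"
  by (subst sum.swap) (simp only: mult.commute)
 also have "... = (\<Sum>c\<in>Basis. J (P c) \<bullet> c)"
  by (rule sum.cong[OF refl *[OF assms(2), symmetric]])
 finally show ?thesis .
qed

lemma FD_pairing:
 fixes g :: "'e::euclidean_space => 'e"
 assumes m: "form1 S m" "open S" "x : S" and g: "smooth_on g S"
 shows "((%y. m y (g y)) has_derivative
   (%a. FD (%y. m y (g x)) x a + m x (FD g x a))) (at x)"
 using has_derivative_one_form_pairing[OF m(1,2) _ has_derivative_ident smooth_deriv[OF g m(3)]] m(3) by simp

text \<open>Cartan's formula in coordinates: a closed form annihilated by \<open>R\<close> has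
  vanishing Lie derivative along \<open>R\<close>, and the terms with the derivative of
  \<open>R\<close> are brought to the right.\<close>

lemma closed_form_lie_derivative:
 fixes Om :: "'e::euclidean_space => 'e => 'e => real" and R :: "'e => 'e"
 assumes S: "open S" "x : S" and Om: "!!v. form1 S (%y u. Om y u v)" "!!y u v. y : S ==> Om y u v = - Om y v u"
  and cl: "closed2_at Om x" and R: "smooth_on R S" "!!y v. y : S ==> Om y (R y) v = 0"
 shows "FD (%y. Om y u v) x (R x)
  = - Om x (FD R x u) v - Om x u (FD R x v)"
proof -
 have 1: "FD (%y. Om y (R x) v) x a + Om x (FD R x a) v = 0" for a v
 proof -
  have "((%y. 0) has_derivative (%a. FD (%y. Om y (R x) v) x a + Om x (FD R x a) v)) (at x)"
   by (rule has_derivative_transform_within_open[OF FD_pairing[OF Om(1) S R(1)] S]) (simp add: R(2))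
  hence "(%a. FD (%y. Om y (R x) v) x a + Om x (FD R x a) v) = (%a. 0)" by (rule has_derivative_unique) simp
  thus ?thesis by (rule fun_cong)
 qed
 have "FD (%y. Om y u v) x (R x) - FD (%y. Om y (R x) v) x u
   + FD (%y. Om y (R x) u) x v = 0" using cl unfolding closed2_at_def by blast
 thus ?thesis using 1[of v u] 1[of u v] Om(2)[OF S(2), of u "FD R x v"] by linarith
qed

lemma smooth_reeb:
 fixes l :: "real ^ 'm => real ^ 'm::finite => real"
 assumes S: "open S" and nd: "!!y. y : S ==> nd_pair (l y) (w y)" and l: "form1 S l"
  and w: "!!u v. smooth_on (%y. w y u v) S"
 shows "smooth_on (%y. sharp (l y) (w y) (l y)) S" "smooth_on (%y. sharp (l y) (w y) (d1 l y u)) S"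
  "smooth_on (%y. trace_inv (l y) (w y) (d1 l y)) S"
proof -
 show "smooth_on (%y. sharp (l y) (w y) (l y)) S"
  by (rule smooth_sharp[OF S nd form1D(2)[OF l] w form1D(2)[OF l] form1D(1)[OF l]])
 show *: "smooth_on (%y. sharp (l y) (w y) (d1 l y u)) S" for u
  by (rule smooth_sharp[OF S nd form1D(2)[OF l] w smooth_d1[OF l S] d1_linear(2)[OF l S]])
 show "smooth_on (%y. trace_inv (l y) (w y) (d1 l y)) S"
  unfolding trace_inv_def by (intro smooth_sum smooth_inner * S smooth_const)
qed

text \<open>The Reeb flow preserves \<open>l\<close>, \<open>w\<close> and \<open>dl\<close>, hence
  the endomorphism \<open>J\<close> defined by them. In coordinates this says that the derivative of
  \<open>J\<close> along \<open>R\<close> is the commutator of \<open>P\<close>, the derivative of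
  \<open>R\<close>, with \<open>J\<close>; its trace is zero.\<close>

theorem trace_inv_reeb_invariant:
 fixes l :: "real ^ 'm => real ^ 'm::finite => real"
 assumes S: "open S" "x : S" and nd: "!!y. y : S ==> nd_pair (l y) (w y)" and l: "form1 S l"
  and w: "!!u v. smooth_on (%y. w y u v) S" and cl: "closed2_at w x"
  and ker: "!!y a b. y : S ==> (!!b. w y a b = 0) ==> d1 l y a b = 0"
 shows "FD (%y. trace_inv (l y) (w y) (d1 l y)) x (sharp (l x) (w x) (l x)) = 0"
proof -
 define R where "R y = sharp (l y) (w y) (l y)" for y
 define La where "La = d1 l"
 define P where "P = FD R x"
 define J where "J y u = sharp (l y) (w y) (La y u)" for y u
 note ndx = nd[OF S(2)]
 have R: "smooth_on R S" and J: "smooth_on (%y. J y u) S" for u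
  unfolding R_def[abs_def] J_def La_def using smooth_reeb[OF S(1) nd l w] by auto
 have lR: "l y (R y) = 1" and wR: "w y (R y) v = 0" if "y : S" for y v
  unfolding R_def using sharp_reeb[OF nd[OF that]] by auto
 have LaR: "La y (R y) v = 0" if "y : S" for y v unfolding La_def by (rule ker[OF that wR[OF that]])
 have w1: "form1 S (%y u. w y u v)" for v unfolding form1_def using nd_lin(3)[OF nd] w by blast
 have La1: "form1 S (%y u. La y u v)" for v
  unfolding form1_def La_def using d1_linear(1)[OF l S(1)] smooth_d1[OF l S(1)] by blast
 have Lacl: "closed2_at La x" unfolding closed2_at_def La_def using d1_closed[OF l S] by blast
 have Dw: "FD (%y. w y u v) x (R x) = - w x (P u) v - w x u (P v)" for u v
  unfolding P_def by (rule closed_form_lie_derivative[OF S w1 nd_skew[OF nd] cl R wR])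
 have DLa: "FD (%y. La y u v) x (R x) = - La x (P u) v - La x u (P v)" for u v
  unfolding P_def by (rule closed_form_lie_derivative[OF S La1 _ Lacl R LaR]) (auto simp: La_def intro: d1_skew)
 \<comment> \<open>Cartan's formula for the one-form: \<open>l R\<close> is constant and
   \<open>dl\<close> annihilates \<open>R\<close>.\<close>
 have Dl: "FD (%y. l y v) x (R x) = - l x (P v)" for v
 proof -
  have "((%y. 1) has_derivative (%a. FD (%y. l y (R x)) x a + l x (P a))) (at x)"
   unfolding P_def by (rule has_derivative_transform_within_open[OF FD_pairing[OF l S R] S]) (simp add: lR)
  hence "(%a. FD (%y. l y (R x)) x a + l x (P a)) = (%a. 0)" by (rule has_derivative_unique) simp
  hence "FD (%y. l y (R x)) x v + l x (P v) = 0" by (rule fun_cong)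
  moreover have "FD (%y. l y v) x (R x) - FD (%y. l y (R x)) x v = 0"
   using LaR[OF S(2), of v] by (simp add: La_def d1_def)
  ultimately show ?thesis by simp
 qed
 note lD = form1D(3)[OF l S(2)]
 have bD: "((%y. bform (l y) (w y) u v) has_derivative (%a. FD (%y. w y u v) x a
   + (l x u * FD (%y. l y v) x a + FD (%y. l y u) x a * l x v))) (at x)" for u v
  unfolding bform_def by (intro has_derivative_add has_derivative_mult lD form1D(3)[OF w1 S(2)])
 have Db: "FD (%y. bform (l y) (w y) u v) x (R x) = - bform (l x) (w x) (P u) v - bform (l x) (w x) u (P v)" for u v
  unfolding FD_eqI[OF bD] Dw Dl by (simp add: bform_def)
 have b1: "form1 S (%y u. bform (l y) (w y) u v)" for v unfolding form1_def using nd_lin(5)[OF nd]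
  by (auto simp: bform_def intro!: smooth_add smooth_mult w form1D(2)[OF l] S)
 have bJ: "bform (l y) (w y) (J y u) v = La y u v" if "y : S" for y u v
  unfolding J_def by (rule bform_sharp[OF nd[OF that]]) (simp add: La_def d1_linear(2)[OF l S(1) that])
 have linP: "linear P" unfolding P_def using smooth_deriv[OF R S(2)] has_derivative_linear by blast
 have linJ: "linear (J x)"
 proof (rule linearI)
  have Lalin: "linear (La x u)" "linear (%u. La x u v)" for u v unfolding La_def by (rule d1_linear[OF l S])+
  show "J x (u + v) = J x u + J x v" for u v unfolding J_def[of x "u + v"]
   by (rule sharp_eqI[OF ndx Lalin(1)]) (simp add: linear_add[OF nd_lin(5)[OF ndx]] bJ[OF S(2)] linear_add[OF Lalin(2)])
  show "J x (c .* u) = c .* J x u" for u c unfolding J_def[of x "c .* u"]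
   by (rule sharp_eqI[OF ndx Lalin(1)]) (simp add: linear_scale[OF nd_lin(5)[OF ndx]] bJ[OF S(2)] linear_scale[OF Lalin(2)])
 qed
 have DJ: "FD (%y. J y u) x (R x) = P (J x u) - J x (P u)" for u
 proof -
  let ?D = "FD (%y. J y u) x (R x)"
  have "bform (l x) (w x) (?D - (P (J x u) - J x (P u))) v = 0" for v
  proof -
   have "((%y. La y u v) has_derivative (%a. FD (%y. bform (l y) (w y) (J x u) v) x a
     + bform (l x) (w x) (FD (%y. J y u) x a) v)) (at x)"
    by (rule has_derivative_transform_within_open[OF FD_pairing[OF b1 S J] S]) (simp add: bJ)
   from FD_eqI[OF this, of "R x"]
   have "- La x (P u) v - La x u (P v) = - bform (l x) (w x) (P (J x u)) v - bform (l x) (w x) (J x u) (P v) + bform (l x) (w x) ?D v"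
    unfolding DLa Db .
   thus ?thesis using bJ[OF S(2), of "P u" v] bJ[OF S(2), of u "P v"]
    by (simp add: linear_diff[OF nd_lin(5)[OF ndx]])
  qed
  hence "?D - (P (J x u) - J x (P u)) = 0" by (rule bform_nondegenerate[OF ndx])
  thus ?thesis by simp
 qed
 have "((%y. \<Sum>b\<in>Basis. J y b \<bullet> b) has_derivative (%a. \<Sum>b\<in>Basis. FD (%y. J y b) x a \<bullet> b)) (at x)"
  by (intro has_derivative_sum has_derivative_inner_left smooth_deriv[OF J S(2)])
 hence "FD (%y. \<Sum>b\<in>Basis. J y b \<bullet> b) x (R x) = (\<Sum>b\<in>Basis. (P (J x b) - J x (P b)) \<bullet> b)"
  by (simp add: FD_eqI DJ)
 also have "... = 0" using trace_commute[OF linP linJ] by (simp add: inner_diff_left sum_subtractf)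
 finally show ?thesis unfolding trace_inv_def J_def La_def R_def .
qed

section \<open>The Reeb field and the invariant function on a manifold\<close>

context oriented_mf
begin

definition reeb :: "('a, 'm) form => ('a, 'm) form => ('a, 'm) vfield" where
 "reeb lam omg c x = sharp (lc1 lam c x) (lc2 omg c x) (lc1 lam c x)"

definition finv :: "('a, 'm) form => ('a, 'm) form => ('a, 'm) chart => (real, 'm) vec => real" where
 "finv lam omg c x = trace_inv (lc1 lam c x) (lc2 omg c x) (d1 (lc1 lam c) x)"

context
 fixes lam omg n
 assumes m: "CARD('m) = 2 * n + 1" and s: "(lam, omg) : SHS A n"
begin

lemma SHS_forms: "smooth_form A 1 lam" "smooth_form A 2 omg"
 and SHS_at: "c : A ==> x : cimg c ==> shs_at n (lc1 lam c) (lc2 omg c) x"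
 using s unfolding SHS_iff[OF m] by blast+

lemma SHS_lc1: "c : A ==> form1 (cimg c) (lc1 lam c)" by (rule smooth_lc1(1)[OF SHS_forms(1)])

lemma SHS_nd_pair: assumes "c : A" "x : cimg c" shows "nd_pair (lc1 lam c x) (lc2 omg c x)"
proof -
 have l: "linear (lc1 lam c x)" and w: "skew_form (lc2 omg c x)"
  using form1D(1)[OF SHS_lc1[OF assms(1)] assms(2)] smooth_lc2(1)[OF SHS_forms(2) assms] by auto
 have "vol_form n (lc1 lam c x) (lc2 omg c x) std_basis ~= 0"
  using SHS_at[OF assms] unfolding shs_at_def by simp
 from vol_form_nonzero_reeb[OF m l w this] obtain R where "lc1 lam c x R = 1" "!!b. lc2 omg c x R b = 0"
   "!!a. (!!b. lc2 omg c x a b = 0) ==> a = lc1 lam c x a .* R" by blast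
 thus ?thesis unfolding nd_pair_def using l w by blast
qed

lemma reeb_smooth:
 assumes "c : A" shows "smooth_on (reeb lam omg c) (cimg c)" "smooth_on (finv lam omg c) (cimg c)"
 using smooth_reeb(1,3)[OF open_cimg[OF assms] SHS_nd_pair[OF assms] SHS_lc1[OF assms] smooth_lc2(2)[OF SHS_forms(2) assms]]
 by (simp_all add: reeb_def[abs_def] finv_def[abs_def])

lemma reeb_field_reeb: "reeb_field A lam omg (reeb lam omg)"
proof -
 have eqs: "lc1 lam c x (reeb lam omg c x) = 1" "lc2 omg c x (reeb lam omg c x) v = 0" if "c : A" "x : cimg c" for c x v
  unfolding reeb_def using sharp_reeb[OF SHS_nd_pair[OF that]] by auto
 have "reeb lam omg d (transition c d x) = FD (transition c d) x (reeb lam omg c x)"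
  if cd: "c : A" "d : A" "x : overlap c d" for c d x
 proof -
  let ?D = "FD (transition c d) x"
  let ?D' = "FD (transition d c) (transition c d x)"
  have inv: "?D (?D' b) = b" for b
   using trans_deriv_inv[OF cd(2,1) transition_in[OF cd], of b] transition_inverse[OF cd] by simp
  have x: "x : cimg c" "transition c d x : cimg d" using overlap_imp[OF cd] by auto
  have "lc1 lam d (transition c d x) (?D (reeb lam omg c x)) = 1"
   using lc1_transition[OF SHS_forms(1) cd, of "reeb lam omg c x"] eqs(1)[OF cd(1) x(1)] by simp
  moreover have "lc2 omg d (transition c d x) (?D (reeb lam omg c x)) b = 0" for b
   using lc2_transition[OF SHS_forms(2) cd, of "reeb lam omg c x" "?D' b"] eqs(2)[OF cd(1) x(1)] by (simp add: inv)
  ultimately have "?D (reeb lam omg c x) = reeb lam omg d (transition c d x)"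
   unfolding reeb_def[of lam omg d] by (rule reeb_eqI[OF SHS_nd_pair[OF cd(2) x(2)]])
  thus ?thesis by simp
 qed
 hence "smooth_vfield A (reeb lam omg)" unfolding smooth_vfield_def using reeb_smooth(1) by blast
 moreover have "lam c x (%i. v) = lc1 lam c x v" "omg c x (pair_seq v v') = lc2 omg c x v v'" for c x v v'
  by (simp_all add: lc1_def lc2_def)
 ultimately show ?thesis unfolding reeb_field_def using eqs by simp
qed

lemma finv_reeb_invariant:
 assumes "c : A" "x : cimg c"
 shows "FD (finv lam omg c) x (reeb lam omg c x) = 0"
proof -
 have cl: "closed2_at (lc2 omg c) x" using SHS_at[OF assms] by (simp add: shs_at_def)
 have ker: "d1 (lc1 lam c) y a b = 0" if "y : cimg c" "!!b. lc2 omg c y a b = 0" for y a b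
  using SHS_at[OF assms(1) that(1)] that(2) unfolding shs_at_def by blast
 show ?thesis unfolding reeb_def finv_def[abs_def]
  by (rule trace_inv_reeb_invariant[OF open_cimg[OF assms(1)] assms(2) SHS_nd_pair[OF assms(1)] SHS_lc1[OF assms(1)]
    smooth_lc2(2)[OF SHS_forms(2) assms(1)] cl ker])
qed

end

lemma integral_curve_in_chart:
 assumes R: "smooth_vfield A R" and c: "c : A" and g: "!!t. t : I ==> g t : cimg c"
  and d: "!!t. t : I ==> (g has_vector_derivative R c (g t)) (at t within I)"
 shows "integral_curve X A R (%t. cinv c (g t)) I" unfolding integral_curve_def
proof (intro conjI ballI impI)
 have gc: "continuous_on I g"
  using d has_vector_derivative_continuous unfolding continuous_on_eq_continuous_within by blast
 have "continuous_map (top_of_set I) (top_of_set (cimg c)) g"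
  using gc g by (auto simp: continuous_map_in_subtopology)
 from continuous_map_compose[OF this continuous_cinv[OF c]]
 show cont: "continuous_map (top_of_set I) X (%t. cinv c (g t))" by (simp add: o_def)
 fix t e assume t: "t : I" and e: "e : A" "cinv c (g t) : cdom e"
 have ov: "g t : overlap c e" using overlap_iff[OF c] g[OF t] e(2) by blast
 have gd: "(g has_derivative (%h. h .* R c (g t))) (at t within I)" using d[OF t] unfolding has_vector_derivative_def .
 have "((%s. transition c e (g s)) has_derivative (%h. FD (transition c e) (g t) (h .* R c (g t)))) (at t within I)"
  by (rule has_derivative_compose[OF gd trans_deriv[OF c e(1) ov]])
 moreover have "FD (transition c e) (g t) (h .* R c (g t)) = h .* R e (cmap e (cinv c (g t)))" for h
 proof -
  have "R e (transition c e (g t)) = FD (transition c e) (g t) (R c (g t))"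
   using R c e(1) ov unfolding smooth_vfield_def by blast
  thus ?thesis unfolding linear_scale[OF linear_trans_deriv[OF c e(1) ov]] by (simp add: transition_def)
 qed
 ultimately show "((%s. cmap e (cinv c (g s))) has_vector_derivative R e (cmap e (cinv c (g t)))) (at t within I)"
  unfolding has_vector_derivative_def by (simp add: transition_def)
qed

end

section \<open>The Reeb field and the invariant function of the model\<close>

context frame_at
begin

text \<open>The Hamiltonian field of \<open>hh\<close> for \<open>2 * sg\<close>, written out where
  the cut-off in \<open>FF\<close> equals 1; \<open>J\<close> plays the part of the complex
  structure on the range of \<open>pw\<close>. The Reeb direction of the model is
  \<open>f1 + t .* XX q\<close>.\<close>

definition XX :: "'a => 'a" where
 "XX q = (Z q / 2) .* e1 - ((X1 q - 1) / 2) .* e0 + (kh q / 2) .* (Y2 q .* e2 - X2 q .* f2) - (1/2) .* J q"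
definition RQ :: "'a set" where "RQ = {q. \<bar>rh q - 1/2\<bar> < 1/8 & sh q < 1/10}"
definition mm :: "real => 'a => real" where "mm t q = lM t (Phi q) (dPhi q (f1 + t .* XX q))"

lemma T_J: "T q \<bullet> T (J q) = 0"
proof -
 have "T (J q) \<bullet> T q = be (J q) (J q)" using J(2)[of "J q" q] by simp
 thus ?thesis by (simp add: be_simps inner_commute)
qed

lemma J_dual: "Z (J q) = 0" "X1 (J q) = 0" "Y1 (J q) = 0" "X2 (J q) = 0" "Y2 (J q) = 0"
 using dual(6,12,18,24,30)[of "J q"] by (simp_all only: J(1))

lemma be_J: "be (J q) v = - (T v \<bullet> T q)"
 using J(2)[of v q] skew_formD(3)[OF be(1), of "J q" v] by simp

lemma XX_coords: "Z (XX q) = (1 - X1 q) / 2" "X1 (XX q) = Z q / 2" "Y1 (XX q) = 0"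
 "X2 (XX q) = kh q * Y2 q / 2" "Y2 (XX q) = - (kh q * X2 q) / 2" "T (XX q) = - (1/2) .* T (J q)"
 "be (XX q) v = (T v \<bullet> T q) / 2" "be q (XX q) = - (T q \<bullet> T q) / 2"
 using be_J[of q v] J(2)[of q q]
 by (simp_all add: XX_def lin_simps dual J_dual T_basis be_simps be_basis field_simps)

lemma RQ_imp: assumes "q : RQ" shows "q : HQ" "X1 q > 0" "rh q > 0" "kh q = (rh q - 1/2) + (rh q - 1/2)\<^sup>2 / 2"
  "FFr (rh q, sh q) = kh q" "FFs (rh q, sh q) = 1" "hh q = gg (rh q) + sh q"
proof -
 have q: "\<bar>rh q - 1/2\<bar> < 1/8" "sh q < 1/10" using assms by (auto simp: RQ_def)
 show 1: "X1 q > 0" using sh_bounds(1)[of q] q by simp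
 show 2: "rh q > 0" using rh_bounds(3)[of q] q by simp
 show "q : HQ" using 1 2 by (simp add: HQ_def)
 show "kh q = (rh q - 1/2) + (rh q - 1/2)\<^sup>2 / 2" "FFr (rh q, sh q) = kh q" "FFs (rh q, sh q) = 1" "hh q = gg (rh q) + sh q"
  using FF_inside[of "(rh q, sh q)"] q by (auto simp: kh_def hh_def)
qed

lemma dr_add: "dr q (a + c .* b) = dr q a + c * dr q b" and ds_add: "ds q (a + c .* b) = ds q a + c * ds q b"
 by (simp_all add: dr_def ds_def lin_simps inner_add_right algebra_simps)

lemma open_RQ: "open RQ"
proof -
 have "continuous_on UNIV rh" "continuous_on UNIV sh" by (auto intro!: smooth_cont smooth_rh smooth_sh)
 hence "open ({q. \<bar>rh q - 1/2\<bar> < 1/8} \<inter> {q. sh q < 1/10})"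
  by (intro open_Int open_Collect_less continuous_intros)
 thus ?thesis by (simp add: RQ_def Collect_conj_eq)
qed

context
 fixes q assumes q: "q : RQ"
begin

lemma dhh_inside: "dhh q v = kh q * dr q v + ds q v" using RQ_imp[OF q] by (simp add: dhh_def)

lemma sg_XX: "2 * sg (XX q) v = dhh q v"
 by (simp add: sg_def XX_coords dhh_inside dr_def ds_def field_simps inner_commute)

lemma dr_XX: "dr q (XX q) = 0" "ds q (XX q) = 0" "dr q f1 = 0" "ds q f1 = 0"
 using T_J[of q] by (simp_all add: dr_def ds_def XX_coords dual T_basis field_simps)

lemma lM_Phi: "lM t (Phi q) (dPhi q v) = lamh q v + t * (hh q * Y1 v + 2 * (kh q * dth q v)) + t\<^sup>2 / 2 * ((kh q)\<^sup>2 * Y1 v)"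
 using RQ_imp(2)[OF q]
 by (simp add: lM_def L0_def nuE_def thE_def kkE_def aff_Phi dphi_Phi dtheta_Phi Rr_Phi Ss_Phi hh_def kh_def dth_def)

lemma wM_Phi: "wM t a (Phi q) (dPhi q u) (dPhi q v) = (2 * sg u v + t * (dhh q u * Y1 v - dhh q v * Y1 u)) / a"
 using RQ_imp(1)[OF q] by (simp add: wM_def d1_L0_Phi d1_nuE_Phi)

lemma wM_kernel: "wM t a (Phi q) (dPhi q (f1 + t .* XX q)) (dPhi q v) = 0"
proof -
 have 1: "sg (f1 + t .* XX q) v = t * sg (XX q) v"
  by (simp add: sg_def lin_simps dual be_simps be_basis algebra_simps)
 have 2: "dhh q (f1 + t .* XX q) = 0" using dr_XX by (simp add: dhh_inside dr_add ds_add)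
 show ?thesis using sg_XX[of v] by (simp add: wM_Phi 1 2 lin_simps dual XX_coords)
qed

text \<open>On \<open>RQ\<close> the coefficient of \<open>t\<close> in \<open>mm t q\<close> lies
  between -1 and 1 and the quadratic term is tiny, so for \<open>t <= 1/2\<close> they cannot cancel
  the leading 1.\<close>

lemma mm_pos: assumes "0 <= t" "t <= 1/2" shows "mm t q > 0" and mm_le: "mm t q <= 2"
proof -
 have q': "\<bar>rh q - 1/2\<bar> < 1/8" "sh q < 1/10" using q by (auto simp: RQ_def)
 let ?k = "kh q" and ?u = "X1 q" and ?T = "T q \<bullet> T q"
 have d: "dth q (f1 + t .* XX q) = - (t * ?k / 2)"
 proof -
  have "X2 q * Y2 (XX q) - Y2 q * X2 (XX q) = - (?k * rh q)"
   by (simp add: XX_coords rh_def field_simps power2_eq_square)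
  moreover have "dth q (f1 + t .* XX q) = t * (X2 q * Y2 (XX q) - Y2 q * X2 (XX q)) / (2 * rh q)"
   by (simp add: dth_def lin_simps dual algebra_simps)
  ultimately have "dth q (f1 + t .* XX q) = t * (- (?k * rh q)) / (2 * rh q)" by simp
  thus ?thesis using RQ_imp(3)[OF q] by simp
 qed
 have "lamh q (f1 + t .* XX q) = 1 + t * (- ?u * (?u - 1) - ?k * rh q - ?T / 2)"
  by (simp add: lamh_def lin_simps dual be_simps be_basis XX_coords rh_def field_simps power2_eq_square)
 hence m: "mm t q = 1 + t * (- ?u * (?u - 1) - ?k * rh q - ?T / 2 + hh q) - t\<^sup>2 * ?k\<^sup>2 / 2"
  by (simp add: mm_def lM_Phi d lin_simps dual XX_coords algebra_simps power2_eq_square)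
 have s: "(?u - 1)\<^sup>2 + (Z q)\<^sup>2 + ?T < 1/5" using q'(2) by (simp add: sh_def)
 have nn: "(Z q)\<^sup>2 >= 0" "?T >= 0" "(?u - 1)\<^sup>2 >= 0" by auto
 have "(1/2::real)\<^sup>2 = 1/4" by (simp add: power2_eq_square)
 hence "\<bar>?u - 1\<bar>\<^sup>2 < (1/2)\<^sup>2" using s nn unfolding power2_abs by linarith
 hence u: "\<bar>?u - 1\<bar> < 1/2" by (rule power2_less_imp_less) simp
 have T: "0 <= ?T" "?T < 1/5" using s nn by linarith+
 have uu: "?u * (?u - 1) <= 3/4"
 proof (cases "?u >= 1")
  case True thus ?thesis using u mult_mono[of ?u "3/2" "?u - 1" "1/2"] by (simp add: abs_if)
 next
  case False thus ?thesis using u mult_nonneg_nonpos[of ?u "?u - 1"] by (simp add: abs_if split: if_splits)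
 qed
 have e: "\<bar>(rh q - 1/2)\<^sup>2\<bar> <= 1/64" using mult_mono[of "\<bar>rh q - 1/2\<bar>" "1/8" "\<bar>rh q - 1/2\<bar>" "1/8"] q'(1) by (simp add: power2_eq_square abs_mult)
 have k: "\<bar>?k\<bar> <= 3/20" using RQ_imp(4)[OF q] q'(1) e by linarith
 have kr: "\<bar>?k * rh q\<bar> <= 1/10"
 proof -
  have "\<bar>rh q\<bar> <= 5/8" using q'(1) by linarith
  hence "\<bar>?k\<bar> * \<bar>rh q\<bar> <= 3/20 * (5/8)" using k by (intro mult_mono) auto
  thus ?thesis by (simp add: abs_mult)
 qed
 have g: "hh q >= - (1/100)" "hh q <= 1/8"
 proof -
  have "(rh q - 1/2) ^ 3 = (rh q - 1/2) * (rh q - 1/2)\<^sup>2" by (simp only: power3_eq_cube power2_eq_square mult.assoc)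
  hence "\<bar>(rh q - 1/2) ^ 3\<bar> = \<bar>rh q - 1/2\<bar> * \<bar>(rh q - 1/2)\<^sup>2\<bar>" by (simp only: abs_mult)
  moreover have "\<bar>rh q - 1/2\<bar> * \<bar>(rh q - 1/2)\<^sup>2\<bar> <= 1 * (1/64)" using e q'(1) by (intro mult_mono) auto
  ultimately have "\<bar>(rh q - 1/2) ^ 3\<bar> <= 1/64" by simp
  moreover have "sh q >= 0" by (simp add: sh_def)
  moreover have "(rh q - 1/2)\<^sup>2 / 2 >= 0" by simp
  ultimately show "hh q >= - (1/100)" "hh q <= 1/8" unfolding RQ_imp(7)[OF q] gg_def using e q'(2) by linarith+
 qed
 have "- ?u * (?u - 1) - ?k * rh q - ?T / 2 + hh q >= - 1" using uu kr T g by (simp add: abs_if split: if_splits)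
 hence "t * (- ?u * (?u - 1) - ?k * rh q - ?T / 2 + hh q) >= t * - 1" using assms by (intro mult_left_mono)
 moreover have "t\<^sup>2 * \<bar>?k\<bar>\<^sup>2 <= (1/2)\<^sup>2 * (3/20)\<^sup>2"
  using assms k by (intro mult_mono power_mono) auto
 ultimately show "mm t q > 0" unfolding m using assms by (simp add: power2_eq_square)
 have "(?u - 1/2)\<^sup>2 >= 0" by simp
 hence "- ?u * (?u - 1) <= 1/4" by (simp add: power2_eq_square algebra_simps)
 hence "- ?u * (?u - 1) - ?k * rh q - ?T / 2 + hh q <= 1" using kr T g abs_ge_minus_self[of "?k * rh q"] by linarith
 hence "t * (- ?u * (?u - 1) - ?k * rh q - ?T / 2 + hh q) <= t * 1" using assms by (intro mult_left_mono)
 moreover have "t\<^sup>2 * ?k\<^sup>2 >= 0" by simp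
 ultimately show "mm t q <= 2" unfolding m using assms by linarith
qed

end

end

context frame_at
begin

lemma one_form_lM: "form1 GE (lM t)" unfolding lM_def[abs_def] by (intro form1_add_scale forms_GE open_GE)

lemma kh_derivative: assumes "q : RQ" shows "(kh has_derivative (%v. (1/2 + rh q) * dr q v)) (at q)"
proof (rule has_derivative_transform_within_open[OF _ open_RQ assms])
 show "((%q. (rh q - 1/2) + (rh q - 1/2)\<^sup>2 / 2) has_derivative (%v. (1/2 + rh q) * dr q v)) (at q)"
  by (auto intro!: derivative_eq_intros rh_derivative ext simp: field_simps)
 show "rh x - 1/2 + (rh x - 1/2)\<^sup>2 / 2 = kh x" if "x : RQ" for x using RQ_imp(4)[OF that] by simp
qed

text \<open>\<open>dk\<close> and \<open>zt\<close> are the two factors of the difference between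
  the differential of \<open>lM\<close> and \<open>a\<close> times \<open>wM\<close>; both vanish on
  the Reeb vector.\<close>

definition zt :: "real => 'a => 'a => real" where "zt t q v = 2 * dth q v + t * kh q * Y1 v"
definition dk :: "'a => 'a => real" where "dk q v = (1/2 + rh q) * dr q v"

lemma linear_zt: "linear (zt t q)" and linear_dk: "linear (dk q)"
 by (rule linearI; simp add: zt_def dth_def dk_def dr_def lin_simps algebra_simps add_divide_distrib diff_divide_distrib)+

context
 fixes q t a assumes q: "q : RQ" and t: "0 <= t" "t <= 1/2" and a: "a ~= 0"
  and nd: "nd_pair (lM t (Phi q)) (wM t a (Phi q))"
begin

lemma model_reeb: "sharp (lM t (Phi q)) (wM t a (Phi q)) (lM t (Phi q)) = dPhi q ((1 / mm t q) .* (f1 + t .* XX q))"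
proof (rule reeb_eqI[OF nd, symmetric])
 note Xp = RQ_imp(2)[OF q]
 note sc = linear_scale[OF linear_dPhi[OF Xp]]
 show "lM t (Phi q) (dPhi q ((1 / mm t q) .* (f1 + t .* XX q))) = 1"
  using mm_pos[OF q t] by (simp add: sc linear_scale[OF nd_lin(1)[OF nd]] flip: mm_def)
 show "wM t a (Phi q) (dPhi q ((1 / mm t q) .* (f1 + t .* XX q))) b = 0" for b
 proof -
  obtain N where N: "!!v. dPhi q (N v) = v" using dPhi_bij[OF Xp] by blast
  show ?thesis using wM_kernel[OF q, of t a "N b"] by (simp add: sc N linear_scale[OF nd_lin(3)[OF nd]])
 qed
qed

lemma d1_lM: "d1 (lM t) (Phi q) (dPhi q u) (dPhi q v) = a * wM t a (Phi q) (dPhi q u) (dPhi q v)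
  + t * (dk q u * zt t q v - dk q v * zt t q u)"
proof -
 have qH: "q : HQ" by (rule RQ_imp(1)[OF q])
 have y: "Phi q : GE" using Phi_HQ qH by auto
 have "d1 (lM t) (Phi q) x z = d1 L0 (Phi q) x z + t * (d1 nuE (Phi q) x z + 2 * d1 thE (Phi q) x z) + t\<^sup>2 / 2 * d1 kkE (Phi q) x z" for x z
  unfolding lM_def[abs_def]
  by (simp only: d1_add_scale[OF form1_add_scale[OF forms_GE(1) form1_add_scale[OF forms_GE(2,3) open_GE] open_GE] forms_GE(4) y]
   d1_add_scale[OF forms_GE(1) form1_add_scale[OF forms_GE(2,3) open_GE] y] d1_add_scale[OF forms_GE(2,3) y])
 moreover have "FD kh q v = dk q v" for v using FD_eqI[OF kh_derivative[OF q]] by (simp add: dk_def)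
 moreover have "a * wM t a (Phi q) x z = d1 L0 (Phi q) x z + t * d1 nuE (Phi q) x z" for x z
  using a by (simp add: wM_def)
 ultimately show ?thesis
  by (simp add: d1_thE_Phi[OF qH] d1_kkE_Phi[OF qH] zt_def algebra_simps power2_eq_square diff_divide_distrib)
qed

text \<open>The part \<open>a \<omega>\<close> contributes \<open>a\<close> times the transversal
  dimension. The rank-two part contributes \<open>- 2 * t\<close> times the value of
  \<open>ze\<close> on the vector dual to \<open>ka\<close>; this dual is, modulo the Reeb vector, a
  multiple of the rotation of the second plane.\<close>

lemma model_trace: "trace_inv (lM t (Phi q)) (wM t a (Phi q)) (d1 (lM t) (Phi q)) = a * (real (DIM('a)) - 1) + 2 * t * a * (1/2 + rh q)"
proof -
 let ?l = "lM t (Phi q)" and ?w = "wM t a (Phi q)"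
 note Xp = RQ_imp(2)[OF q]
 obtain N where N: "linear N" "!!v. N (dPhi q v) = v" "!!v. dPhi q (N v) = v" using dPhi_bij[OF Xp] by blast
 define R where "R = sharp ?l ?w ?l"
 have R: "?l R = 1" "!!v. ?w R v = 0" unfolding R_def using sharp_reeb[OF nd] by auto
 have wR: "?w v R = 0" for v using R(2)[of v] nd_skew[OF nd, of v R] by simp
 have NR: "N R = (1 / mm t q) .* (f1 + t .* XX q)" unfolding R_def model_reeb N ..
 define ze where "ze v = zt t q (N v)" for v
 define ka where "ka v = dk q (N v)" for v
 have lin: "linear ze" "linear ka"
  using linear_compose[OF N(1) linear_zt] linear_compose[OF N(1) linear_dk] by (simp_all add: ze_def[abs_def] ka_def[abs_def] o_def)
 have r: "rh q > 0" by (rule RQ_imp(3)[OF q])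
 have kaR: "ka R = 0" unfolding ka_def NR linear_scale[OF linear_dk] using dr_XX[OF q] by (simp add: dk_def dr_add)
 have zeR: "ze R = 0"
 proof -
  have "X2 q * Y2 (XX q) - Y2 q * X2 (XX q) = - (kh q * rh q)"
   by (simp add: XX_coords rh_def field_simps power2_eq_square)
  moreover have "dth q (f1 + t .* XX q) = t * (X2 q * Y2 (XX q) - Y2 q * X2 (XX q)) / (2 * rh q)"
   by (simp add: dth_def lin_simps dual algebra_simps)
  ultimately have "dth q (f1 + t .* XX q) = - (t * kh q / 2)" using r by simp
  hence "zt t q (f1 + t .* XX q) = 0" by (simp add: zt_def lin_simps dual XX_coords)
  thus ?thesis unfolding ze_def NR linear_scale[OF linear_zt] by simp
 qed
 define zs where "zs = sharp ?l ?w ze"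
 define ks where "ks = sharp ?l ?w ka"
 note zs = bform_sharp[OF nd lin(1), folded zs_def] and ks = bform_sharp[OF nd lin(2), folded ks_def]
 have lks: "?l ks = 0" "?l zs = 0" using zs[of R] ks[of R] kaR zeR wR R(1) by (auto simp: bform_def)
 \<comment> \<open>The angular field of the second plane: it is dual to \<open>dr\<close> under
   \<open>sg\<close>, up to sign, and \<open>zt t q\<close> takes the value 2 on it.\<close>
 define E2 where "E2 = X2 q .* f2 - Y2 q .* e2"
 define v0 where "v0 = dPhi q ((- (a / 2) * (1/2 + rh q)) .* E2)"
 have wv0: "?w v0 z = ka z" for z
 proof -
  have E: "sg E2 (N z) = - dr q (N z)" "dr q E2 = 0" "ds q E2 = 0" "Y1 E2 = 0"
   by (simp_all add: E2_def sg_def dr_def ds_def lin_simps dual T_basis be_simps be_basis algebra_simps)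
  hence "dhh q E2 = 0" by (simp add: dhh_inside[OF q])
  hence "?w (dPhi q E2) (dPhi q (N z)) = - 2 * dr q (N z) / a" by (simp add: wM_Phi[OF q] E)
  thus ?thesis using a unfolding v0_def linear_scale[OF linear_dPhi[OF Xp]] linear_scale[OF nd_lin(3)[OF nd]] ka_def N
   by (simp add: dk_def)
 qed
 have "ks = v0 - ?l v0 .* R" unfolding ks_def
 proof (rule sharp_eqI[OF nd lin(2)])
  show "bform ?l ?w (v0 - ?l v0 .* R) z = ka z" for z
   using wv0[of z] R by (simp add: bform_def linear_diff[OF nd_lin(1)[OF nd]] linear_diff[OF nd_lin(3)[OF nd]]
     linear_scale[OF nd_lin(1)[OF nd]] linear_scale[OF nd_lin(3)[OF nd]])
 qed
 hence "ze ks = ze v0" by (simp add: linear_diff[OF lin(1)] linear_scale[OF lin(1)] zeR)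
 also have "... = - a * (1/2 + rh q)"
 proof -
  have "dth q E2 = 1" using r by (simp add: E2_def dth_def lin_simps dual rh_def add_eq_0_iff power2_eq_square)
  hence "zt t q E2 = 2" by (simp add: zt_def E2_def lin_simps dual)
  thus ?thesis unfolding ze_def v0_def N(2) linear_scale[OF linear_zt] by simp
 qed
 finally have zeks: "ze ks = - a * (1/2 + rh q)" .
 have kazs: "ka zs = - ze ks" using zs[of ks] ks[of zs] nd_skew[OF nd, of zs ks] lks by (simp add: bform_def)
 have sh: "sharp ?l ?w (d1 (lM t) (Phi q) b) = a .* (b - ?l b .* R) + t .* (ka b .* zs - ze b .* ks)" for b
 proof (rule sharp_eqI[OF nd])
  have y: "Phi q : GE" using Phi_HQ RQ_imp(1)[OF q] by auto
  show "linear (d1 (lM t) (Phi q) b)" by (rule d1_linear(2)[OF one_form_lM open_GE y])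
  fix v
  have "d1 (lM t) (Phi q) b v = a * ?w b v + t * (ka b * ze v - ka v * ze b)"
   using d1_lM[of "N b" "N v"] by (simp add: N ze_def ka_def)
  moreover have "bform ?l ?w R v = ?l v" using R by (simp add: bform_def)
  ultimately show "bform ?l ?w (a .* (b - ?l b .* R) + t .* (ka b .* zs - ze b .* ks)) v = d1 (lM t) (Phi q) b v"
   using zs[of v] ks[of v] bform_def[of ?l ?w b v]
   by (simp add: linear_add[OF nd_lin(5)[OF nd]] linear_diff[OF nd_lin(5)[OF nd]] linear_scale[OF nd_lin(5)[OF nd]] algebra_simps)
 qed
 have tr: "(\<Sum>b\<in>Basis. al b * (w \<bullet> b)) = al w" if "linear al" for al :: "'a => real" and w
  using linear_expand[OF that, of w] by (simp add: mult.commute)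
 have "trace_inv ?l ?w (d1 (lM t) (Phi q)) = (\<Sum>b\<in>Basis. a * (b \<bullet> b) - a * (?l b * (R \<bullet> b)) + t * (ka b * (zs \<bullet> b)) - t * (ze b * (ks \<bullet> b)))"
  unfolding trace_inv_def sh by (simp add: inner_simps algebra_simps)
 also have "... = a * (\<Sum>b\<in>(Basis::'a set). b \<bullet> b) - a * (\<Sum>b\<in>Basis. ?l b * (R \<bullet> b)) + t * (\<Sum>b\<in>Basis. ka b * (zs \<bullet> b)) - t * (\<Sum>b\<in>Basis. ze b * (ks \<bullet> b))"
  by (simp only: sum.distrib sum_subtractf sum_distrib_left)
 also have "... = a * real (DIM('a)) - a + t * ka zs - t * ze ks"
  unfolding tr[OF nd_lin(1)[OF nd]] tr[OF lin(1)] tr[OF lin(2)] R(1) by simp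
 finally show ?thesis unfolding kazs zeks by (simp add: algebra_simps)
qed

end

end

section \<open>Perturbed Reeb flows\<close>

context frame_at
begin

text \<open>All coordinates except the angle, so \<open>Ns\<close> measures displacements across the
  flow. It is a norm on the vectors without angular component (\<open>Ns_definite\<close>).\<close>

definition Wv :: "'a => real \<times> real \<times> real \<times> real \<times> 'a" where "Wv v = (Z v, X1 v, X2 v, Y2 v, T v)"
definition Ns :: "'a => real" where "Ns v = norm (Wv v)"
definition Q0 :: "'a set" where "Q0 = {q. \<bar>rh q - 1/2\<bar> <= 1/9 & sh q <= 1/11}"
text \<open>A point of the circle \<open>rh = 1/2\<close>, \<open>sh = 0\<close> of critical points
  of \<open>hh\<close>; around it the closed orbit will be found.\<close>

definition ph :: 'a where "ph = e1 + e2"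

lemma linear_Wv: "linear Wv" by (rule linearI) (simp_all add: Wv_def lin_simps)

lemma Ns_ge: "\<bar>Z v\<bar> <= Ns v" "\<bar>X1 v\<bar> <= Ns v" "\<bar>X2 v\<bar> <= Ns v" "\<bar>Y2 v\<bar> <= Ns v" "norm (T v) <= Ns v" "Ns v >= 0"
proof -
 have le: "norm a <= norm (a, b)" "norm b <= norm (a, b)" for a :: "'x::real_normed_vector" and b :: "'y::real_normed_vector"
  using norm_fst_le[of a b] norm_snd_le[of b a] by auto
 note t = le(2)[of "(X1 v, X2 v, Y2 v, T v)" "Z v"] le(2)[of "(X2 v, Y2 v, T v)" "X1 v"] le(2)[of "(Y2 v, T v)" "X2 v"]
 show "\<bar>Z v\<bar> <= Ns v" using le(1)[of "Z v"] by (simp add: Ns_def Wv_def)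
 show "\<bar>X1 v\<bar> <= Ns v" using le(1)[of "X1 v" "(X2 v, Y2 v, T v)"] t by (simp add: Ns_def Wv_def)
 show "\<bar>X2 v\<bar> <= Ns v" using le(1)[of "X2 v" "(Y2 v, T v)"] t by (simp add: Ns_def Wv_def)
 show "\<bar>Y2 v\<bar> <= Ns v" using le(1)[of "Y2 v" "T v"] t by (simp add: Ns_def Wv_def)
 show "norm (T v) <= Ns v" using le(2)[of "T v" "Y2 v"] t by (simp add: Ns_def Wv_def)
qed (simp add: Ns_def)

lemma Ns_le: "Ns v <= \<bar>Z v\<bar> + \<bar>X1 v\<bar> + \<bar>X2 v\<bar> + \<bar>Y2 v\<bar> + norm (T v)"
 using norm_Pair_le[of "Z v" "(X1 v, X2 v, Y2 v, T v)"] norm_Pair_le[of "X1 v" "(X2 v, Y2 v, T v)"]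
  norm_Pair_le[of "X2 v" "(Y2 v, T v)"] norm_Pair_le[of "Y2 v" "T v"] by (simp add: Ns_def Wv_def)

lemma Ns_power2: "(Ns v)\<^sup>2 = (Z v)\<^sup>2 + (X1 v)\<^sup>2 + (X2 v)\<^sup>2 + (Y2 v)\<^sup>2 + T v \<bullet> T v"
 by (simp add: Ns_def Wv_def power2_norm_eq_inner) (simp add: power2_eq_square)

lemma Ns_triangle: "Ns (a + b) <= Ns a + Ns b" and Ns_scale: "Ns (c .* a) = \<bar>c\<bar> * Ns a"
 by (simp_all add: Ns_def linear_add[OF linear_Wv] linear_scale[OF linear_Wv] norm_triangle_ineq)

lemma Ns_definite: "Y1 v = 0 ==> Ns v = 0 ==> v = 0" using decomp[of v] Cw(2)[of v] Ns_ge[of v] by simp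

text \<open>Linearity of \<open>J\<close> is not among the axioms of \<open>frame\<close>; it is
  derived from the fact that \<open>be\<close> is non-degenerate on the range of \<open>pw\<close>.
  The bound then follows in finite dimension.\<close>

lemma T_J_bound: "EX C>=0. ALL q. norm (T (J q)) <= C * norm (T q)"
proof -
 have nd: "d = 0" if "pw d = d" "!!x. be x d = 0" for d
 proof -
  have "be d (J d) = 0" using that(2)[of "J d"] skew_formD(3)[OF be(1), of d "J d"] by simp
  hence "T d = 0" using J(2)[of d d] by simp
  thus ?thesis using Cw(2)[of d] that(1) by simp
 qed
 have lJ: "linear J"
 proof (rule linearI)
  show "J (x + y) = J x + J y" for x y
   using nd[of "J (x + y) - (J x + J y)"] by (simp add: lin_simps be_simps J inner_add_right)
  show "J (c .* x) = c .* J x" for c x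
   using nd[of "J (c .* x) - c .* J x"] by (simp add: lin_simps be_simps J)
 qed
 have Jp: "J (pw q) = J q" for q using nd[of "J (pw q) - J q"] by (simp add: lin_simps be_simps J)
 obtain B where B: "B > 0" "!!q. norm (T (J q)) <= B * norm q"
  using linear_bounded_pos[OF linear_compose[OF lJ lin(7)]] by (auto simp: o_def)
 have "norm (T (J q)) <= (B * Cw) * norm (T q)" for q
 proof -
  have "norm (T (J q)) <= B * norm (pw q)" using B(2)[of "pw q"] by (simp add: Jp)
  also have "... <= B * (Cw * norm (T q))" using B(1) Cw(2)[of q] by (intro mult_left_mono) auto
  finally show ?thesis by simp
 qed
 thus ?thesis using B Cw(1) by (intro exI[of _ "B * Cw"]) auto
qed

lemma sg_bound: "EX C>0. ALL u v. \<bar>sg u v\<bar> <= C * Ns u * Ns v"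
proof -
 have "bilinear be" unfolding bilinear_def using skew_formD[OF be(1)] by blast
 then obtain B where B: "B > 0" "!!u v. norm (be u v) <= B * norm u * norm v" using bilinear_bounded_pos by blast
 have "\<bar>sg u v\<bar> <= (4 + B * Cw * Cw) * Ns u * Ns v" for u v
 proof -
  have 1: "\<bar>a * b\<bar> <= Ns u * Ns v" if "\<bar>a\<bar> <= Ns u" "\<bar>b\<bar> <= Ns v" for a b
   unfolding abs_mult using that by (intro mult_mono) (auto simp: Ns_ge)
  have p: "norm (pw w) <= Cw * Ns w" for w
   using Cw(2)[of w] mult_left_mono[OF Ns_ge(5)[of w] Cw(1)] by linarith
  have "\<bar>be u v\<bar> <= B * norm (pw u) * norm (pw v)" using B(2)[of "pw u" "pw v"] by (simp add: be_basis)
  also have "... <= B * (Cw * Ns u) * (Cw * Ns v)" using B(1) Cw(1) Ns_ge(6) by (intro mult_mono p) auto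
  finally have "\<bar>be u v\<bar> <= B * Cw * Cw * (Ns u * Ns v)" by (simp add: mult_ac)
  hence "\<bar>sg u v\<bar> <= 4 * (Ns u * Ns v) + B * Cw * Cw * (Ns u * Ns v)"
   unfolding sg_def using 1[OF Ns_ge(2)[of u] Ns_ge(1)[of v]] 1[OF Ns_ge(1)[of u] Ns_ge(2)[of v]]
    1[OF Ns_ge(3)[of u] Ns_ge(4)[of v]] 1[OF Ns_ge(4)[of u] Ns_ge(3)[of v]] by linarith
  thus ?thesis by (simp add: algebra_simps)
 qed
 thus ?thesis using B Cw(1) by (intro exI[of _ "4 + B * Cw * Cw"]) (auto intro: add_pos_nonneg)
qed

lemma Q0_RQ: "Q0 <= RQ" by (auto simp: Q0_def RQ_def)

lemma dr_ds_bound: assumes "q : Q0" shows "\<bar>dr q w\<bar> <= 4 * Ns w" "\<bar>ds q w\<bar> <= 3 * Ns w"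
proof -
 have q: "\<bar>rh q - 1/2\<bar> <= 3/8" "sh q <= 1/4" using assms by (auto simp: Q0_def)
 have 1: "\<bar>a * b\<bar> <= c * Ns w" if "\<bar>a\<bar> <= c" "\<bar>b\<bar> <= Ns w" for a b c
  unfolding abs_mult using that by (intro mult_mono) (auto simp: Ns_ge)
 show "\<bar>dr q w\<bar> <= 4 * Ns w" unfolding dr_def
  using 1[OF rh_bounds(1)[OF q(1)] Ns_ge(3)[of w]] 1[OF rh_bounds(2)[OF q(1)] Ns_ge(4)[of w]] by linarith
 have x: "\<bar>X1 q - 1\<bar> <= 1" "\<bar>Z q\<bar> <= 1" "norm (T q) <= 1" using sh_bounds[OF q(2)] by (auto simp: abs_if)
 have "\<bar>T q \<bullet> T w\<bar> <= 1 * Ns w"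
  using Cauchy_Schwarz_ineq2[of "T q" "T w"] mult_mono[OF x(3) Ns_ge(5)[of w]] by simp
 thus "\<bar>ds q w\<bar> <= 3 * Ns w" unfolding ds_def
  using 1[OF x(1) Ns_ge(2)[of w]] 1[OF x(2) Ns_ge(1)[of w]] by linarith
qed

text \<open>\<open>XX\<close> vanishes on the critical circle, so near it its size is linear in the
  distance \<open>nv\<close>.\<close>

lemma Ns_XX:
 assumes C: "C >= 0" "!!q. norm (T (J q)) <= C * norm (T q)" and q: "q : RQ" "sh q <= nv\<^sup>2" "\<bar>rh q - 1/2\<bar> <= 3 * nv" "nv >= 0"
 shows "Ns (XX q) <= (16 + 2 * C) * nv"
proof -
 have s: "(X1 q - 1)\<^sup>2 + (Z q)\<^sup>2 + (norm (T q))\<^sup>2 <= 2 * nv\<^sup>2" using q(2) by (simp add: sh_def power2_norm_eq_inner)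
 have le: "\<bar>a\<bar> <= 2 * nv" if "a\<^sup>2 <= 2 * nv\<^sup>2" for a
 proof -
  have "a\<^sup>2 <= 4 * nv\<^sup>2" using that zero_le_power2[of nv] by linarith
  hence "\<bar>a\<bar>\<^sup>2 <= (2 * nv)\<^sup>2" by (simp add: power_mult_distrib)
  thus ?thesis by (rule power2_le_imp_le) (use q in simp)
 qed
 have b: "\<bar>X1 q - 1\<bar> <= 2 * nv" "\<bar>Z q\<bar> <= 2 * nv" "norm (T q) <= 2 * nv"
  using s le[of "X1 q - 1"] le[of "Z q"] le[of "norm (T q)"] by (smt (verit) zero_le_power2 abs_norm_cancel)+
 have x: "\<bar>X2 q\<bar> <= 2" "\<bar>Y2 q\<bar> <= 2" using rh_bounds[of q] q(1) by (auto simp: RQ_def)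
 have k: "\<bar>kh q\<bar> <= 6 * nv"
 proof -
  have m: "\<bar>rh q - 1/2\<bar> <= 1" using q(1) by (auto simp: RQ_def)
  have "\<bar>(rh q - 1/2)\<^sup>2\<bar> <= 1 * (3 * nv)" unfolding power2_eq_square abs_mult using m q by (intro mult_mono) auto
  thus ?thesis unfolding RQ_imp(4)[OF q(1)] using q(3,4) by linarith
 qed
 have k2: "\<bar>kh q * a\<bar> <= 12 * nv" if "\<bar>a\<bar> <= 2" for a
  using mult_mono[OF k that] q(4) by (simp add: abs_mult)
 have "norm (T (XX q)) = norm (T (J q)) / 2" by (simp add: XX_coords)
 hence "norm (T (XX q)) <= C * nv" using C(2)[of q] mult_left_mono[OF b(3) C(1)] by simp
 moreover have "\<bar>Z (XX q)\<bar> <= nv" "\<bar>X1 (XX q)\<bar> <= nv" using b(1,2) by (simp_all add: XX_coords abs_le_iff field_simps)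
 moreover have "\<bar>X2 (XX q)\<bar> <= 6 * nv" "\<bar>Y2 (XX q)\<bar> <= 6 * nv"
  using k2[OF x(1)] k2[OF x(2)] by (simp_all add: XX_coords)
 ultimately have "Ns (XX q) <= 14 * nv + C * nv" using Ns_le[of "XX q"] by linarith
 moreover have "C * nv >= 0" using C q by simp
 ultimately show ?thesis using q(4) by (simp add: algebra_simps)
qed

end

lemma hvd_field:
 assumes "(f has_derivative f') (at (q s))" "(q has_vector_derivative w) (at s within S)"
 shows "((%s. f (q s)) has_vector_derivative f' w) (at s within S)"
 using has_derivative_compose[OF assms(2)[unfolded has_vector_derivative_def] assms(1)]
  linear_scale[OF has_derivative_linear[OF assms(1)]] by (simp add: has_vector_derivative_def)

lemma displacement_bound:
 fixes x :: "real => 'a::euclidean_space"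
 assumes "!!t. t : {0..T} ==> (x has_vector_derivative x' t) (at t within {0..T})"
  and "!!t. t : {0..T} ==> norm (x' t) <= d" "d >= 0" "t : {0..T}"
 shows "norm (x t - x 0) <= d * t"
proof -
 have "((%t. x t - x 0) has_vector_derivative x' t) (at t within {0..T})" if "t : {0..T}" for t
  using has_vector_derivative_diff[OF assms(1)[OF that] has_vector_derivative_const[of "x 0"]] by simp
 thus ?thesis using norm_gronwall[of T "%t. x t - x 0" x' 0 d t] assms by simp
qed

section \<open>One turn of a perturbed path near the critical circle\<close>

context frame_at
begin

context
 fixes C t nv de :: real and xv and q v :: "real => 'a" and c :: "real => real"
 assumes C: "C >= 0" "!!q. norm (T (J q)) <= C * norm (T q)" and t: "0 <= t" "t * (16 + 2 * C) <= 1/200"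
  and nv: "0 <= nv" "nv <= 1/100" and de: "0 <= de" "de <= nv\<^sup>2 / 1000" and xv: "Ns xv <= nv" and q0: "q 0 = ph + xv"
  and qd: "!!s. s : {0..2 * pi} ==> (q has_vector_derivative f1 + c s .* v s) (at s within {0..2 * pi})"
  and c: "!!s. 0 <= c s & c s <= 1"
  and v: "!!s. s : {0..2 * pi} ==> c s ~= 0 ==> q s : Q0 & Ns (v s - t .* XX (q s)) <= de"
begin

text \<open>\<open>rh\<close> and \<open>sh\<close> are constants of motion of
  \<open>f1 + t .* XX\<close>, so they drift only by the error \<open>de\<close> during a turn of
  length \<open>2 * pi <= 8\<close>. Since \<open>de\<close> is quadratic in \<open>nv\<close>, this
  drift is of lower size than the path's distance from the critical circle.\<close>

lemma path_drift:
 assumes s: "s : {0..2 * pi}"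
 shows "\<bar>rh (q s) - rh (q 0)\<bar> <= 32 * de" "\<bar>sh (q s) - sh (q 0)\<bar> <= 24 * de"
proof -
 have s8: "s <= 8" "0 <= s" using s pi_less_4 by auto
 have vs: "\<bar>L (f1 + c s .* v s)\<bar> <= k * de"
  if s: "s : {0..2 * pi}" and L: "L = dr (q s) & k = 4 | L = ds (q s) & k = 3" for s L and k :: real
 proof (cases "c s = 0")
  case True
  thus ?thesis using L de by (auto simp: dr_def ds_def dual T_basis)
 next
  case False
  have q: "q s : Q0" "q s : RQ" and n: "Ns (v s - t .* XX (q s)) <= de" using v[OF s False] Q0_RQ by auto
  have "L (a + b .* d) = L a + b * L d" for a b d using L dr_add ds_add by auto
  from this[of f1] this[of "v s - t .* XX (q s)" t "XX (q s)"]
  have "L (f1 + c s .* v s) = c s * L (v s - t .* XX (q s))" using L dr_XX[OF q(2)] by auto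
  moreover have "\<bar>L (v s - t .* XX (q s))\<bar> <= k * de"
   using L dr_ds_bound[OF q(1), of "v s - t .* XX (q s)"] n by auto
  ultimately show ?thesis using c[of s] mult_mono[of "c s" 1 "\<bar>L (v s - t .* XX (q s))\<bar>" "k * de"]
   by (simp add: abs_mult)
 qed
 have "norm (rh (q s) - rh (q 0)) <= (4 * de) * s"
  by (rule displacement_bound[OF hvd_field[OF rh_derivative qd] _ _ s]) (use vs de in auto)
 also have "... <= (4 * de) * 8" using s8 de by (intro mult_left_mono) auto
 finally show "\<bar>rh (q s) - rh (q 0)\<bar> <= 32 * de" by simp
 have "norm (sh (q s) - sh (q 0)) <= (3 * de) * s"
  by (rule displacement_bound[OF hvd_field[OF sh_derivative qd] _ _ s]) (use vs de in auto)
 also have "... <= (3 * de) * 8" using s8 de by (intro mult_left_mono) auto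
 finally show "\<bar>sh (q s) - sh (q 0)\<bar> <= 24 * de" by simp
qed

lemma path_start: "rh (q 0) - 1/2 = X2 xv + ((X2 xv)\<^sup>2 + (Y2 xv)\<^sup>2) / 2" "sh (q 0) <= nv\<^sup>2 / 2"
proof -
 show "rh (q 0) - 1/2 = X2 xv + ((X2 xv)\<^sup>2 + (Y2 xv)\<^sup>2) / 2"
  unfolding q0 rh_def ph_def by (simp add: lin_simps dual power2_eq_square field_simps)
 have "sh (q 0) = ((X1 xv)\<^sup>2 + (Z xv)\<^sup>2 + T xv \<bullet> T xv) / 2"
  unfolding q0 sh_def ph_def by (simp add: lin_simps dual T_basis)
 also have "... <= (Ns xv)\<^sup>2 / 2" unfolding Ns_power2 by simp
 also have "... <= nv\<^sup>2 / 2" using xv Ns_ge(6)[of xv] by (simp add: power_mono)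
 finally show "sh (q 0) <= nv\<^sup>2 / 2" .
qed

lemma path_region:
 assumes s: "s : {0..2 * pi}"
 shows "\<bar>rh (q s) - 1/2\<bar> <= 3 * nv" "sh (q s) <= nv\<^sup>2" "q s : RQ" "\<bar>rh (q s) - 1/2\<bar> <= 1/20" "sh (q s) <= 1/40"
proof -
 have n2: "nv\<^sup>2 <= nv / 100" using mult_left_mono[OF nv(2,1)] by (simp add: power2_eq_square)
 have y: "\<bar>X2 xv\<bar> <= nv" "\<bar>Y2 xv\<bar> <= nv" using Ns_ge(3,4)[of xv] xv by linarith+
 have y2: "(X2 xv)\<^sup>2 <= nv\<^sup>2" "(Y2 xv)\<^sup>2 <= nv\<^sup>2" using power_mono[OF y(1), of 2] power_mono[OF y(2), of 2] by auto
 have "\<bar>X2 xv + ((X2 xv)\<^sup>2 + (Y2 xv)\<^sup>2) / 2\<bar> <= nv + nv\<^sup>2"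
 proof -
  have *: "\<bar>x + (a + b) / 2\<bar> <= n + m" if "\<bar>x\<bar> <= n" "a <= m" "b <= m" "0 <= a" "0 <= b" for x a b n m :: real
   using that by (simp add: abs_le_iff field_simps)
  show ?thesis by (rule *[OF y(1) y2]) auto
 qed
 thus 1: "\<bar>rh (q s) - 1/2\<bar> <= 3 * nv" using path_drift(1)[OF s] path_start(1) de n2 nv by linarith
 show 2: "sh (q s) <= nv\<^sup>2" using path_drift(2)[OF s] path_start(2) de by linarith
 show 3: "\<bar>rh (q s) - 1/2\<bar> <= 1/20" "sh (q s) <= 1/40" using 1 2 n2 nv by linarith+
 thus "q s : RQ" by (auto simp: RQ_def)
qed

text \<open>The speed across the flow is at most \<open>t\<close> times the bound of
  \<open>Ns_XX\<close> plus the error, so for small \<open>t\<close> the whole turn stays close to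
  its initial point relative to \<open>nv\<close>.\<close>

lemma path_close:
 assumes s: "s : {0..2 * pi}"
 shows "Ns (q s - q 0) <= nv / 20"
proof -
 let ?d = "t * ((16 + 2 * C) * nv) + de"
 have s8: "s <= 8" "0 <= s" using s pi_less_4 by auto
 have d: "?d >= 0" using t C nv de by simp
 have "((%s. Wv (q s)) has_vector_derivative Wv (f1 + c s .* v s)) (at s within {0..2 * pi})" if "s : {0..2 * pi}" for s
  by (rule hvd_field[OF _ qd[OF that]])
    (rule bounded_linear_imp_has_derivative[OF linear_Wv[unfolded linear_conv_bounded_linear]])
 moreover have "norm (Wv (f1 + c s .* v s)) <= ?d" if s: "s : {0..2 * pi}" for s
 proof (cases "c s = 0")
  case True
  thus ?thesis using d by (simp add: Wv_def dual T_basis)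
 next
  case False
  have "norm (Wv (f1 + c s .* v s)) = c s * Ns (v s)"
  proof -
   have "Wv f1 = 0" by (simp add: Wv_def dual T_basis zero_prod_def)
   thus ?thesis using c[of s] by (simp add: linear_add[OF linear_Wv] linear_scale[OF linear_Wv] Ns_def)
  qed
  also have "... <= 1 * Ns (v s)" using c[of s] Ns_ge(6) by (intro mult_right_mono) auto
  also have "... <= Ns (v s - t .* XX (q s)) + t * Ns (XX (q s))"
   using Ns_triangle[of "v s - t .* XX (q s)" "t .* XX (q s)"] t by (simp add: Ns_scale)
  also have "... <= de + t * ((16 + 2 * C) * nv)"
   using v[OF s False] Ns_XX[OF C path_region(3)[OF s] path_region(2)[OF s] path_region(1)[OF s] nv(1)] t
   by (intro add_mono mult_left_mono) auto
  finally show ?thesis by simp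
 qed
 ultimately have "norm (Wv (q s) - Wv (q 0)) <= ?d * s" by (rule displacement_bound[OF _ _ d s])
 also have "... <= ?d * 8" using s8 d by (intro mult_left_mono) auto
 \<comment> \<open>The first term gives \<open>8 / 200 = 1/25\<close> of \<open>nv\<close>; the rest
   is left for the much smaller error \<open>de\<close>.\<close>
 also have "... <= nv / 20"
 proof -
  have "t * (16 + 2 * C) * nv <= 1/200 * nv" using t(2) nv(1) by (rule mult_right_mono)
  moreover have "nv\<^sup>2 <= nv / 100" using mult_left_mono[OF nv(2,1)] by (simp add: power2_eq_square)
  ultimately show ?thesis using de nv by (simp add: mult.assoc)
 qed
 finally show ?thesis by (simp add: Ns_def linear_diff[OF linear_Wv])
qed

text \<open>The pairing approximates the Hessian of \<open>hh\<close> at \<open>ph\<close>, whose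
  value on \<open>xv\<close> is exactly \<open>nv\<^sup>2\<close> when the \<open>Y2\<close>
  component vanishes, that is, when \<open>xv\<close> is transverse to the critical circle. Half of
  it is kept and the rest absorbs the cubic terms and the displacement along the turn.\<close>

lemma path_dhh:
 assumes s: "s : {0..2 * pi}" and Y: "Y2 xv = 0" and N: "Ns xv = nv"
 shows "dhh (q s) xv >= nv\<^sup>2 / 2"
proof -
 define D where "D = q s - q 0"
 have ND: "Ns D <= nv / 20" unfolding D_def by (rule path_close[OF s])
 have qs: "q s = ph + xv + D" by (simp add: D_def q0)
 have n2: "nv\<^sup>2 <= nv / 100" using mult_left_mono[OF nv(2,1)] by (simp add: power2_eq_square)
 define y where "y = X2 xv"
 have y: "\<bar>y\<bar> <= nv" using Ns_ge(3)[of xv] N by (simp add: y_def)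
 have y2: "y\<^sup>2 <= nv\<^sup>2" using power_mono[OF y, of 2] by simp
 have p: "\<bar>a * b\<bar> <= nv\<^sup>2 / 20" if "\<bar>a\<bar> <= Ns D" "\<bar>b\<bar> <= Ns xv" for a b
  using mult_mono[of "\<bar>a\<bar>" "nv / 20" "\<bar>b\<bar>" nv] that ND N nv by (simp add: abs_mult power2_eq_square)
 have "\<bar>T D \<bullet> T xv\<bar> <= nv\<^sup>2 / 20"
  using Cauchy_Schwarz_ineq2[of "T D" "T xv"] p[of "norm (T D)" "norm (T xv)"] Ns_ge(5)[of D] Ns_ge(5)[of xv] by simp
 moreover have "ds (q s) xv = (X1 xv)\<^sup>2 + (Z xv)\<^sup>2 + T xv \<bullet> T xv + X1 D * X1 xv + Z D * Z xv + T D \<bullet> T xv"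
  unfolding qs ds_def ph_def by (simp add: lin_simps dual T_basis inner_add_left algebra_simps power2_eq_square)
 ultimately have ds: "ds (q s) xv >= (X1 xv)\<^sup>2 + (Z xv)\<^sup>2 + T xv \<bullet> T xv - 3 * nv\<^sup>2 / 20"
  using p[OF Ns_ge(2)[of D] Ns_ge(2)[of xv]] p[OF Ns_ge(1)[of D] Ns_ge(1)[of xv]] by linarith
 \<comment> \<open>\<open>m\<close> and \<open>kh (q s)\<close> both equal \<open>y\<close> up to
   quadratic errors, because \<open>kh\<close> is \<open>m + m\<^sup>2 / 2\<close>.\<close>
 define m where "m = rh (q s) - 1/2"
 have m: "\<bar>m\<bar> <= 3 * nv" unfolding m_def by (rule path_region(1)[OF s])
 have m2: "m\<^sup>2 <= 9 * nv\<^sup>2" using power_mono[OF m, of 2] by (simp add: power_mult_distrib)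
 have "\<bar>m - y - y\<^sup>2 / 2\<bar> <= 32 * de" using path_drift(1)[OF s] path_start(1) by (simp add: m_def y_def Y)
 hence k: "\<bar>kh (q s) - y\<bar> <= 6 * nv\<^sup>2" unfolding RQ_imp(4)[OF path_region(3)[OF s]] m_def[symmetric]
  using y2 m2 de zero_le_power2[of m] zero_le_power2[of y] zero_le_power2[of nv] by linarith
 have x: "X2 (q s) = 1 + (y + X2 D)" unfolding qs by (simp add: lin_simps ph_def dual y_def)
 have xb: "\<bar>y + X2 D\<bar> <= 2 * nv" using y Ns_ge(3)[of D] ND nv by linarith
 have "kh (q s) * X2 (q s) - y = (kh (q s) - y) * X2 (q s) + y * (y + X2 D)" unfolding x by (simp add: algebra_simps)
 moreover have "\<bar>(kh (q s) - y) * X2 (q s)\<bar> <= (6 * nv\<^sup>2) * 2"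
  unfolding abs_mult using k xb nv by (intro mult_mono) (auto simp: x)
 moreover have "\<bar>y * (y + X2 D)\<bar> <= nv * (2 * nv)"
  unfolding abs_mult using y xb nv by (intro mult_mono) auto
 ultimately have e: "\<bar>kh (q s) * X2 (q s) - y\<bar> <= 14 * nv\<^sup>2" by (simp add: power2_eq_square)
 have "\<bar>(kh (q s) * X2 (q s) - y) * y\<bar> <= (14 * nv\<^sup>2) * (1/100)"
  unfolding abs_mult using e y nv by (intro mult_mono) auto
 moreover have "kh (q s) * dr (q s) xv = y\<^sup>2 + (kh (q s) * X2 (q s) - y) * y"
  by (simp add: dr_def Y y_def[symmetric] algebra_simps power2_eq_square)
 moreover have "nv\<^sup>2 = (Z xv)\<^sup>2 + (X1 xv)\<^sup>2 + y\<^sup>2 + T xv \<bullet> T xv" using Ns_power2[of xv] by (simp add: N Y y_def)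
 ultimately show ?thesis unfolding dhh_inside[OF path_region(3)[OF s]] using ds zero_le_power2[of nv] by linarith
qed

text \<open>Where the cut-off equals 1, the pairing grows at the rate \<open>sg (v s) xv\<close>,
  which is \<open>t / 2\<close> times \<open>dhh (q s) xv\<close> up to an error at most
  \<open>K * de * nv\<close>. The third assumption on \<open>K\<close> makes the gain
  \<open>t * nv\<^sup>2 / 4\<close> prevail.\<close>

lemma path_positive:
 assumes Y: "Y2 xv = 0" and N: "Ns xv = nv" "nv > 0" and K: "!!u v. \<bar>sg u v\<bar> <= K * Ns u * Ns v" "K > 0" "K * de < t * nv / 4"
  and c1: "!!s. s : {0..2 * pi} ==> \<bar>rh (q s) - 1/2\<bar> <= 1/20 ==> sh (q s) <= 1/40 ==> c s = 1"
 shows "sg (q (2 * pi) - q 0) xv > 0"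
proof -
 have d: "((%s. sg (q s) xv) has_derivative (%h. h * sg (v s) xv)) (at s within {0..2 * pi})" if s: "s : {0..2 * pi}" for s
 proof -
  have "((%u. sg u xv) has_derivative (%u. sg u xv)) (at (q s))"
   by (rule bounded_linear_imp_has_derivative[OF sg_linear(2)[unfolded linear_conv_bounded_linear]])
  from hvd_field[OF this qd[OF s]]
  have "((%s. sg (q s) xv) has_vector_derivative sg (f1 + c s .* v s) xv) (at s within {0..2 * pi})" .
  moreover have "c s = 1" by (rule c1[OF s path_region(4,5)[OF s]])
  moreover have "sg f1 xv = 0" by (simp add: sg_def dual be_basis)
  ultimately show ?thesis by (simp add: has_vector_derivative_def linear_add[OF sg_linear(2)])
 qed
 have pos: "sg (v s) xv > 0" if s: "s : {0..2 * pi}" for s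
 proof -
  have "c s = 1" by (rule c1[OF s path_region(4,5)[OF s]])
  hence n: "Ns (v s - t .* XX (q s)) <= de" using v[OF s] by simp
  have "sg (v s) xv = sg (v s - t .* XX (q s)) xv + t * sg (XX (q s)) xv"
   by (simp add: linear_diff[OF sg_linear(2)] linear_scale[OF sg_linear(2)])
  moreover have "\<bar>sg (v s - t .* XX (q s)) xv\<bar> <= K * de * nv"
  proof -
   have "K * Ns (v s - t .* XX (q s)) * Ns xv <= K * de * nv" using n K N(2) unfolding N(1) by (intro mult_right_mono mult_left_mono) auto
   thus ?thesis using K(1)[of "v s - t .* XX (q s)" xv] by linarith
  qed
  moreover have "t * sg (XX (q s)) xv >= t * (nv\<^sup>2 / 4)"
   using sg_XX[OF path_region(3)[OF s], of xv] path_dhh[OF s Y N(1)] t by (intro mult_left_mono) auto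
  moreover have "K * de * nv < t * nv / 4 * nv" by (rule mult_strict_right_mono[OF K(3) N(2)])
  ultimately show ?thesis by (simp add: power2_eq_square)
 qed
 have "EX x:{0<..<2 * pi}. sg (q (2 * pi)) xv - sg (q 0) xv = (2 * pi - 0) * sg (v x) xv"
  by (rule mvt_simple[OF _ d]) auto
 then obtain x where "x : {0<..<2 * pi}" "sg (q (2 * pi)) xv - sg (q 0) xv = (2 * pi - 0) * sg (v x) xv" by blast
 moreover from this have "sg (v x) xv > 0" by (intro pos) auto
 ultimately show ?thesis by (simp add: linear_diff[OF sg_linear(2)])
qed

end

end

lemma smooth_extend_by_zero:
 assumes f: "smooth_on f G" and G: "open G" and K: "closed K" "K <= G" "!!x. x ~: K ==> f x = 0"
 shows "smooth_on f UNIV"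
proof (rule smooth_local)
 fix x
 show "EX U. open U & x : U & smooth_on f U"
 proof (cases "x : K")
  case True
  thus ?thesis using f G K by blast
 next
  case False
  have o: "open (- K)" using K(1) by (rule open_Compl)
  have "smooth_on f (- K)" by (rule smooth_cong[OF smooth_const[OF o, of 0] _ o]) (use K in auto)
  thus ?thesis using o False by blast
 qed
qed

section \<open>The perturbed flow with the angle as time\<close>

context frame_at
begin

definition hp :: "'a => 'a" where "hp x = x - Y1 x .* f1"
definition chi :: "'a => real" where "chi q = cutoff2 (1/20) (1/9) (1/40) (1/11) (rh q) (sh q)"

lemma hp_simps: "Y1 (hp x) = 0" "Y1 x = 0 ==> hp x = x" "linear hp"
 by (simp_all add: hp_def lin_simps dual linear_iff algebra_simps)

lemma chi_simps: "\<bar>rh q - 1/2\<bar> <= 1/20 ==> sh q <= 1/40 ==> chi q = 1" "q ~: Q0 ==> chi q = 0"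
 "0 <= chi q & chi q <= 1"
 using cutoff2_simps[of "1/20" "1/9" "1/40" "1/11" "rh q" "sh q"] by (auto simp: chi_def Q0_def)

lemma smooth_chi: "smooth_on chi UNIV"
 unfolding chi_def[abs_def] by (intro smooth_cutoff2 smooth_rh smooth_sh) auto

lemma closed_Q0: "closed Q0"
proof -
 have "continuous_on UNIV rh" "continuous_on UNIV sh" by (auto intro!: smooth_cont smooth_rh smooth_sh)
 hence "closed ({q. \<bar>rh q - 1/2\<bar> <= 1/9} \<inter> {q. sh q <= 1/11})"
  by (intro closed_Int closed_Collect_le continuous_intros)
 thus ?thesis by (simp add: Q0_def Collect_conj_eq)
qed

text \<open>The angle is the independent variable, so the state consists of a point without angular
  component and a real number in which the elapsed Reeb time accumulates; the field does not depend
  on the latter. The cut-off makes it globally Lipschitz.\<close>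

lemma hat_ode:
 fixes WW :: "'a => 'a \<times> real"
 assumes W: "smooth_on WW UNIV" and 0: "!!q. q ~: Q0 ==> WW q = 0"
 shows "EX L. differentiable_ode (%s z. WW (s .* f1 + hp (fst z))) (2 * pi) L
   (%s z v. FD WW (s .* f1 + hp (fst z)) (hp (fst v)))"
proof -
 define DW where "DW q = FD WW q" for q
 have DWd: "(WW has_derivative DW q) (at q)" for q unfolding DW_def by (rule smooth_deriv[OF W]) simp
 have lDW: "linear (DW q)" for q by (rule has_derivative_linear[OF DWd])
 have DWc: "continuous_on UNIV (%q. DW q v)" for v unfolding DW_def by (rule smooth_cont[OF smooth_FD[OF W]])
 \<comment> \<open>\<open>Q0\<close> is unbounded in the angle, but for angles in
   \<open>{0..2 * pi}\<close> only this compact part of it occurs; outside \<open>Q0\<close> the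
   field vanishes.\<close>
 define BX where "BX = Box (1/9) (1/11)"
 have BX: "compact BX" unfolding BX_def by (rule compact_Box) auto
 have "EX M. ALL q:BX. norm (DW q b) <= M" for b
  using compact_imp_bounded[OF compact_continuous_image[OF continuous_on_subset[OF DWc[of b]] BX]] by (auto simp: bounded_iff)
 then obtain M where M: "!!b q. q : BX ==> norm (DW q b) <= M b" by metis
 define L0 where "L0 = (\<Sum>b\<in>(Basis::'a set). \<bar>M b\<bar>)"
 have L0: "L0 >= 0" unfolding L0_def by (rule sum_nonneg) simp
 have bd: "norm (DW q v) <= L0 * norm v" if Y: "Y1 q : {0..2 * pi}" for q v
 proof (cases "q : Q0")
  case True
  hence q: "q : BX" using Y by (auto simp: BX_def Box_def Q0_def)
  have "DW q v = (\<Sum>b\<in>Basis. (v \<bullet> b) .* DW q b)"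
   by (subst euclidean_representation[of v, symmetric], subst linear_sum[OF lDW]) (simp add: linear_scale[OF lDW])
  also have "norm ... <= (\<Sum>b\<in>Basis. norm v * \<bar>M b\<bar>)"
  proof (rule sum_norm_le)
   fix b :: 'a assume b: "b : Basis"
   have "norm (DW q b) <= \<bar>M b\<bar>" using M[OF q, of b] by linarith
   thus "norm ((v \<bullet> b) .* DW q b) <= norm v * \<bar>M b\<bar>"
    using Basis_le_norm[OF b, of v] by (auto intro!: mult_mono)
  qed
  finally show ?thesis by (simp add: L0_def sum_distrib_left mult.commute)
 next
  case False
  have "(WW has_derivative (%v. 0)) (at q)"
   by (rule has_derivative_transform_within_open[OF has_derivative_const[of 0] open_Compl[OF closed_Q0]])
     (use False 0 in auto)
  hence "DW q v = 0" unfolding DW_def by (rule FD_eqI)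
  thus ?thesis using L0 by simp
 qed
 obtain B where B: "B > 0" "!!v. norm (hp v) <= B * norm v" using linear_bounded_pos[OF hp_simps(3)] by blast
 have lhf: "linear (%v :: 'a \<times> real. hp (fst v))" using linear_compose[OF linear_fst hp_simps(3)] by (simp add: o_def)
 have Y: "Y1 (s .* f1 + hp x) = s" for s x by (simp add: lin_simps dual hp_simps)
 have der: "((%z :: 'a \<times> real. WW (s .* f1 + hp (fst z))) has_derivative (%v. DW (s .* f1 + hp (fst z)) (hp (fst v)))) (at z)" for s z
 proof -
  have "((%z :: 'a \<times> real. s .* f1 + hp (fst z)) has_derivative (%v. hp (fst v))) (at z)"
   using has_derivative_add[OF has_derivative_const[of "s .* f1"] bounded_linear_imp_has_derivative[OF lhf[unfolded linear_conv_bounded_linear]]] by simp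
  from has_derivative_compose[OF this DWd] show ?thesis .
 qed
 have bd2: "norm (DW (s .* f1 + hp (fst z)) (hp (fst v))) <= L0 * B * norm v" if "s : {0..2 * pi}" for s and z v :: "'a \<times> real"
 proof -
  have "norm (hp (fst v)) <= B * norm v"
  proof -
   have "norm (fst v) <= norm v" using norm_fst_le[of "fst v" "snd v"] by simp
   hence "B * norm (fst v) <= B * norm v" using B(1) by (intro mult_left_mono) auto
   thus ?thesis using B(2)[of "fst v"] by linarith
  qed
  hence "L0 * norm (hp (fst v)) <= L0 * (B * norm v)" using L0 by (rule mult_left_mono)
  thus ?thesis using bd[of "s .* f1 + hp (fst z)" "hp (fst v)"] that unfolding Y by (simp add: mult.assoc)
 qed
 have chp: "continuous_on S (%x :: real \<times> 'a \<times> real. fst x .* f1 + hp (fst (snd x)))" for S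
  by (intro continuous_intros continuous_on_compose2[OF linear_continuous_on[OF hp_simps(3)[unfolded linear_conv_bounded_linear]]]) auto
 have "differentiable_ode (%s z. WW (s .* f1 + hp (fst z))) (2 * pi) (L0 * B) (%s z v. DW (s .* f1 + hp (fst z)) (hp (fst v)))"
 proof
  show "continuous_on ({0..2 * pi} \<times> UNIV) (%(s, z :: 'a \<times> real). WW (s .* f1 + hp (fst z)))"
   unfolding case_prod_unfold by (rule continuous_on_compose2[OF smooth_cont[OF W] chp]) simp
  show "continuous_on ({0..2 * pi} \<times> UNIV) (%(s, z :: 'a \<times> real). DW (s .* f1 + hp (fst z)) (hp (fst v)))" for v :: "'a \<times> real"
   unfolding case_prod_unfold by (rule continuous_on_compose2[OF DWc chp]) simp
  show "norm (WW (s .* f1 + hp (fst x)) - WW (s .* f1 + hp (fst y))) <= L0 * B * norm (x - y)"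
   if "s : {0..2 * pi}" for s and x y :: "'a \<times> real"
  proof (rule differentiable_bound[OF convex_UNIV])
   show "((%z. WW (s .* f1 + hp (fst z))) has_derivative (%v. DW (s .* f1 + hp (fst z)) (hp (fst v)))) (at z within UNIV)" for z :: "'a \<times> real"
    using der by simp
   show "onorm (%v :: 'a \<times> real. DW (s .* f1 + hp (fst z)) (hp (fst v))) <= L0 * B" for z :: "'a \<times> real"
    by (rule onorm_bound) (use L0 B bd2[OF that] in auto)
  qed auto
 qed (use L0 B der in auto)
 thus ?thesis unfolding DW_def by blast
qed

end

context frame_at
begin

text \<open>The starting points from which one full turn stays in the region where the cut-off is
  1.\<close>

definition near_ph :: "'a => bool" where "near_ph p \<longleftrightarrow> Y1 p = 0 & Ns (p - ph) <= 1/100"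

definition hat_curve :: "('a => 'a) => 'a => (real => 'a) => (real => real) => bool" where
 "hat_curve Rh p x te \<longleftrightarrow> x 0 = p & te 0 = 0 & (ALL s:{0..2 * pi}. Y1 (x s) = s & x s : RQ & Ns (x s - p) <= 1/2000 &
   (x has_vector_derivative (1 / Y1 (Rh (x s))) .* Rh (x s)) (at s within {0..2 * pi}) &
   (te has_vector_derivative 1 / Y1 (Rh (x s))) (at s within {0..2 * pi}))"

definition flow_data where
 "flow_data Rh t de x te \<longleftrightarrow> (ALL p. near_ph p --> hat_curve Rh p (x p) (te p)) &
   (ALL p. EX D. ((%p. x p (2 * pi)) has_derivative D) (at p)) & continuous_on UNIV (%p. te p (2 * pi)) &
   (ALL xv K. Y1 xv = 0 & Y2 xv = 0 & 0 < Ns xv & Ns xv <= 1/100 & de <= (Ns xv)\<^sup>2 / 1000 &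
    (ALL u v. \<bar>sg u v\<bar> <= K * Ns u * Ns v) & 0 < K & K * de < t * Ns xv / 4 --> sg (x (ph + xv) (2 * pi) - (ph + xv)) xv > 0)"

text \<open>The Reeb field is rescaled to unit angular speed and cut off outside \<open>Q0\<close>
  in order to have global solutions. By \<open>path_region\<close>, trajectories starting near
  \<open>ph\<close> stay where the cut-off equals 1, so they are genuine Reeb trajectories up to
  parametrisation.\<close>

lemma hat_flow:
 assumes C: "C >= 0" "!!q. norm (T (J q)) <= C * norm (T q)" and t: "0 <= t" "t * (16 + 2 * C) <= 1/200"
  and de: "0 <= de" "de <= (1/100)\<^sup>2 / 1000"
  and Rh: "smooth_on Rh RQ" "!!q. q : RQ ==> Y1 (Rh q) > 0"
   "!!q. q : RQ ==> Ns ((1 / Y1 (Rh q)) .* Rh q - (f1 + t .* XX q)) <= de"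
 shows "EX x te. flow_data Rh t de x te"
proof -
 define mh where "mh q = 1 / Y1 (Rh q)" for q
 define Vh where "Vh q = mh q .* Rh q - f1" for q
 define WW where "WW q = (if q : RQ then chi q .* (Vh q, mh q) else 0)" for q
 have W0: "WW q = 0" if "q ~: Q0" for q using chi_simps(2)[OF that] by (simp add: WW_def zero_prod_def)
 have W: "smooth_on WW UNIV"
 proof (rule smooth_extend_by_zero[OF _ open_RQ closed_Q0 Q0_RQ W0])
  have Y: "smooth_on (%q. Y1 (Rh q)) RQ" by (rule smooth_linear[OF bl(3) Rh(1) open_RQ])
  have m: "smooth_on mh RQ" unfolding mh_def
   by (rule smooth_divide[OF smooth_const[OF open_RQ] Y _ open_RQ]) (use Rh(2) in force)
  have "smooth_on (%q. chi q .* (Vh q, mh q)) RQ" unfolding Vh_def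
   by (intro smooth_scaleR smooth_Pair smooth_diff m Rh(1) smooth_const open_RQ smooth_subset[OF smooth_chi]) simp
  thus "smooth_on WW RQ" by (rule smooth_cong[OF _ _ open_RQ]) (simp add: WW_def)
 qed
 obtain L where "differentiable_ode (%s z. WW (s .* f1 + hp (fst z))) (2 * pi) L
   (%s z v. FD WW (s .* f1 + hp (fst z)) (hp (fst v)))" using hat_ode[OF W W0] by blast
 then interpret O: differentiable_ode "%s z. WW (s .* f1 + hp (fst z))" "2 * pi" L
   "%s z v. FD WW (s .* f1 + hp (fst z)) (hp (fst v))" .
 define x where "x p s = s .* f1 + fst (O.sol (p, 0) s)" for p s
 define te where "te p s = snd (O.sol (p, 0) s)" for p s
 define c where "c p s = (if x p s : RQ then chi (x p s) else 0)" for p s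
 have Wc: "WW (x p s) = c p s .* (Vh (x p s), mh (x p s))" for p s by (simp add: WW_def c_def zero_prod_def)
 have YV: "Y1 (fst (WW q)) = 0" for q
  using Rh(2)[of q] by (auto simp: WW_def Vh_def mh_def lin_simps dual linear_0[OF lin(3)])
 \<comment> \<open>The right-hand side has no angular component, so the \<open>Y1\<close> component
   of the state remains 0 and the projection \<open>hp\<close> acts trivially along the
   solution.\<close>
 have hpx: "s .* f1 + hp (fst (O.sol (p, 0) s)) = x p s" if p: "Y1 p = 0" and s: "s : {0..2 * pi}" for p s
 proof -
  have "((%s. Y1 (fst (O.sol (p, 0) s))) has_vector_derivative 0) (at r within {0..2 * pi})" if "r : {0..2 * pi}" for r
  proof -
   have "((%z. Y1 (fst z)) has_derivative (%v. Y1 (fst v))) (at (O.sol (p, 0) r))"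
    by (intro has_derivative_compose[OF has_derivative_fst[OF has_derivative_ident]] frame_derivs)
   from hvd_field[OF this O.sol_deriv[OF that]] show ?thesis unfolding YV .
  qed
  from displacement_bound[OF this, of 0 s] have "Y1 (fst (O.sol (p, 0) s)) = 0" using p s by simp
  thus ?thesis using hp_simps(2) by (simp add: x_def)
 qed
 have dx: "(x p has_vector_derivative f1 + c p s .* Vh (x p s)) (at s within {0..2 * pi})"
  and dte: "(te p has_vector_derivative c p s * mh (x p s)) (at s within {0..2 * pi})"
  if p: "Y1 p = 0" and s: "s : {0..2 * pi}" for p s
 proof -
  note d = O.sol_deriv[OF s, of "(p, 0)", unfolded hpx[OF p s] Wc]
  have "((%s. fst (O.sol (p, 0) s)) has_vector_derivative c p s .* Vh (x p s)) (at s within {0..2 * pi})"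
   using hvd_field[OF has_derivative_fst[OF has_derivative_ident] d] by simp
  moreover have "((%s. s .* f1) has_vector_derivative f1) (at s within {0..2 * pi})"
   by (auto intro!: derivative_eq_intros)
  ultimately show "(x p has_vector_derivative f1 + c p s .* Vh (x p s)) (at s within {0..2 * pi})"
   unfolding x_def[abs_def] by (rule has_vector_derivative_add[rotated])
  show "(te p has_vector_derivative c p s * mh (x p s)) (at s within {0..2 * pi})"
   using hvd_field[OF has_derivative_snd[OF has_derivative_ident] d] by (simp add: te_def[abs_def])
 qed
 have x0: "x p 0 = p" for p by (simp add: x_def)
 have c01: "0 <= c p s & c p s <= 1" for p s using chi_simps(3) by (simp add: c_def)
 have cv: "x p s : Q0 & Ns (Vh (x p s) - t .* XX (x p s)) <= de" if "c p s ~= 0" for p s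
 proof -
  have "x p s : Q0" "x p s : RQ" using that chi_simps(2)[of "x p s"] by (auto simp: c_def split: if_splits)
  thus ?thesis using Rh(3)[of "x p s"] by (simp add: Vh_def mh_def algebra_simps)
 qed
 have c1: "c p s = 1" if "\<bar>rh (x p s) - 1/2\<bar> <= 1/20" "sh (x p s) <= 1/40" for p s
  using chi_simps(1)[OF that] that by (auto simp: c_def RQ_def)
 have Yph: "Y1 ph = 0" by (simp add: ph_def lin_simps dual)
 have curve: "hat_curve Rh p (x p) (te p)" if p: "near_ph p" for p
 proof -
  have Yp: "Y1 p = 0" and n: "Ns (p - ph) <= 1/100" using p by (auto simp: near_ph_def)
  have p0: "x p 0 = ph + (p - ph)" by (simp add: x0)
  have *: "Y1 (x p s) = s & x p s : RQ & Ns (x p s - p) <= 1/2000 &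
   (x p has_vector_derivative (1 / Y1 (Rh (x p s))) .* Rh (x p s)) (at s within {0..2 * pi}) &
   (te p has_vector_derivative 1 / Y1 (Rh (x p s))) (at s within {0..2 * pi})" if s: "s : {0..2 * pi}" for s
  proof -
   note reg = path_region[where q = "x p" and v = "%s. Vh (x p s)" and c = "c p" and nv = "1/100",
     OF C t _ _ de n p0 dx[OF Yp] c01 cv s]
   have cc: "c p s = 1" by (rule c1) (use reg(4,5) in auto)
   have "Ns (x p s - x p 0) <= 1/100 / 20"
    by (rule path_close[where q = "x p" and v = "%s. Vh (x p s)" and c = "c p" and nv = "1/100",
     OF C t _ _ de n p0 dx[OF Yp] c01 cv s]) auto
   hence 1: "Ns (x p s - p) <= 1/2000" by (simp add: x0)
   have 2: "Y1 (x p s) = s" using hpx[OF Yp s, symmetric] by (simp add: lin_simps dual hp_simps)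
   have 3: "x p s : RQ" by (rule reg(3)) auto
   show ?thesis using 1 2 3 dx[OF Yp s] dte[OF Yp s] unfolding cc by (simp add: Vh_def mh_def)
  qed
  thus ?thesis unfolding hat_curve_def by (simp add: x0 te_def)
 qed
 have "EX D. ((%p. x p (2 * pi)) has_derivative D) (at p)" for p
 proof -
  obtain D where D: "((%z. O.sol z (2 * pi)) has_derivative D) (at (p, 0))" using O.sol_differentiable by blast
  have "((%p. (p, 0)) has_derivative (%v. (v, 0))) (at p)"
   by (intro has_derivative_Pair has_derivative_ident has_derivative_const)
  from has_derivative_fst[OF has_derivative_compose[OF this D]]
  have "((%p. fst (O.sol (p, 0) (2 * pi))) has_derivative (%v. fst (D (v, 0)))) (at p)" .
  from has_derivative_add[OF has_derivative_const[of "(2 * pi) .* f1"] this]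
  show ?thesis unfolding x_def by blast
 qed
 moreover have "continuous_on UNIV (%p. te p (2 * pi))"
 proof -
  have "continuous_on UNIV (%z. O.sol z (2 * pi))"
   unfolding continuous_on_eq_continuous_at[OF open_UNIV] using O.sol_differentiable has_derivative_continuous by blast
  moreover have "continuous_on UNIV (%p :: 'a. (p, 0 :: real))" by (intro continuous_intros)
  ultimately have "continuous_on UNIV (%p. O.sol (p, 0) (2 * pi))" by (rule continuous_on_compose2) simp
  thus ?thesis unfolding te_def by (rule continuous_on_snd)
 qed
 moreover have "sg (x (ph + xv) (2 * pi) - (ph + xv)) xv > 0"
  if "Y1 xv = 0" "Y2 xv = 0" "0 < Ns xv" "Ns xv <= 1/100" "de <= (Ns xv)\<^sup>2 / 1000"
   "!!u v. \<bar>sg u v\<bar> <= K * Ns u * Ns v" "0 < K" "K * de < t * Ns xv / 4" for xv K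
 proof -
  have Yp: "Y1 (ph + xv) = 0" using that(1) by (simp add: lin_simps Yph)
  have p0: "x (ph + xv) 0 = ph + xv" by (rule x0)
  show ?thesis
   using path_positive[where q = "x (ph + xv)" and v = "%s. Vh (x (ph + xv) s)" and c = "c (ph + xv)" and nv = "Ns xv" and K = K,
     OF C t _ that(4) de(1) that(5) order.refl p0 dx[OF Yp] c01 cv that(2) refl that(3,6,7,8) c1]
   unfolding x0 using that(3) by auto
 qed
 ultimately show ?thesis unfolding flow_data_def using curve by (intro exI[of _ x] exI[of _ te]) blast
qed

end

section \<open>Finding a displacement in the characteristic direction\<close>

context frame_at
begin

text \<open>The directions of the slice. On this space of odd dimension the kernel of
  \<open>sg\<close> is spanned by \<open>e2\<close>.\<close>

definition Sl :: "'a set" where "Sl = {v. Y1 v = 0 & Y2 v = 0}"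

lemma subspace_Sl: "subspace Sl"
 by (rule subspaceI) (auto simp: Sl_def lin_simps linear_0[OF lin(3)] linear_0[OF lin(5)])

lemma Ns_norm_equiv: "EX B>0. ALL v. Ns v <= B * norm v" "EX c>0. ALL v. Y1 v = 0 --> c * norm v <= Ns v"
proof -
 show "EX B>0. ALL v. Ns v <= B * norm v" using linear_bounded_pos[OF linear_Wv] unfolding Ns_def by metis
 let ?f = "%v. (Wv v, Y1 v)"
 have l: "linear ?f" by (rule linearI) (simp_all add: linear_add[OF linear_Wv] linear_scale[OF linear_Wv] lin_simps)
 have "inj ?f" unfolding linear_injective_0[OF l] using Ns_definite by (auto simp: Ns_def zero_prod_def)
 then obtain c where c: "c > 0" "!!v. c * norm v <= norm (?f v)" using linear_inj_bounded_below_pos[OF l] by blast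
 have "c * norm v <= Ns v" if "Y1 v = 0" for v using c(2)[of v] that by (simp add: Ns_def)
 thus "EX c>0. ALL v. Y1 v = 0 --> c * norm v <= Ns v" using c(1) by blast
qed

text \<open>Brouwer's theorem is applied on a Euclidean sphere whereas the path estimates use
  \<open>Ns\<close>; on vectors without angular component the two norms are comparable.\<close>

lemma sphere_radius: "EX r>0. EX m>0. ALL v. Y1 v = 0 --> (norm v <= r --> Ns v <= 1/200) & (norm v = r --> m <= Ns v)"
proof -
 obtain B c where B: "B > 0" "!!v. Ns v <= B * norm v" and c: "c > 0" "!!v. Y1 v = 0 ==> c * norm v <= Ns v"
  using Ns_norm_equiv by blast
 define r where "r = 1 / (200 * B)"
 have r: "r > 0" "B * r = 1/200" using B(1) by (auto simp: r_def)
 have "Ns v <= 1/200" if "norm v <= r" for v using B(2)[of v] mult_left_mono[OF that, of B] B(1) r by simp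
 thus ?thesis using r(1) c by (intro exI[of _ r] conjI exI[of _ "c * r"]) auto
qed

text \<open>\<open>G v\<close> represents the functional \<open>sg (E v)\<close> on
  \<open>Sl\<close>. At a zero of \<open>G\<close> the displacement is \<open>sg\<close>-orthogonal
  to \<open>Sl\<close>; testing with \<open>e0\<close>, \<open>e1\<close>, \<open>e2\<close> and
  \<open>J\<close> leaves only its components along \<open>f1\<close> and \<open>e2\<close>.\<close>

lemma disp_in_characteristic_direction:
 assumes r: "r > 0" and E: "continuous_on (Sl \<inter> cball 0 r) E"
  and pos: "!!v. v : Sl ==> norm v = r ==> sg (E v) v > 0"
  and Y: "!!v. v : Sl ==> norm v <= r ==> Y1 (E v) = l"
 shows "EX v k. v : Sl & norm v <= r & E v = l .* f1 + k .* e2"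
proof -
 obtain B where B: "B <= Sl" "pairwise orthogonal B" "!!x. x : B ==> norm x = 1" "independent B" "span B = Sl"
  using orthonormal_basis_subspace[OF subspace_Sl] by metis
 have fB: "finite B" using B(4) independent_imp_finite by blast
 define G where "G v = (\<Sum>b\<in>B. sg (E v) b .* b)" for v
 have GS: "G v : Sl" for v unfolding G_def by (intro subspace_sum subspace_scale subspace_Sl) (use B(1) in auto)
 have Gi: "G v \<bullet> w = sg (E v) w" if "w : Sl" for v w
 proof -
  have "w = (\<Sum>b\<in>B. (b \<bullet> w) .* b)" using orthonormal_basis_expand[OF B(2,3) _ fB, of w] that B(5) by (simp add: inner_commute)
  hence "sg (E v) w = (\<Sum>b\<in>B. (b \<bullet> w) * sg (E v) b)"
   using linear_sum[OF sg_linear(1), of "E v" "%b. (b \<bullet> w) .* b" B] by (simp add: linear_scale[OF sg_linear(1)])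
  thus ?thesis by (simp add: G_def inner_sum_left mult.commute)
 qed
 have "continuous_on (Sl \<inter> cball 0 r) G" unfolding G_def
  by (intro continuous_intros continuous_on_compose2[OF linear_continuous_on[OF sg_linear(2)[unfolded linear_conv_bounded_linear]] E]) auto
 then obtain v where v: "v : Sl" "norm v <= r" "G v = 0"
  using brouwer_zero[OF subspace_Sl r, of G] GS Gi pos by metis
 define d where "d = E v"
 have z: "sg d w = 0" if "w : Sl" for w using Gi[OF that, of v] v(3) by (simp add: d_def)
 have "X1 d = 0" using z[of e0] by (simp add: Sl_def sg_def dual be_basis)
 moreover have "Z d = 0" using z[of e1] by (simp add: Sl_def sg_def dual be_basis)
 moreover have "Y2 d = 0" using z[of e2] by (simp add: Sl_def sg_def dual be_basis)
 moreover have "pw d = 0"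
 proof -
  \<comment> \<open>With this test vector the pairing becomes the square of the norm of
    \<open>T d\<close>.\<close>
  have "sg d (J d) = 0" by (rule z) (simp add: Sl_def J_dual)
  hence "T d = 0" using J(2)[of d d] by (simp add: sg_def J_dual)
  thus ?thesis using Cw(2)[of d] by simp
 qed
 moreover have "Y1 d = l" unfolding d_def by (rule Y[OF v(1,2)])
 ultimately have "d = l .* f1 + X2 d .* e2" using decomp[of d] by simp
 thus ?thesis using v unfolding d_def by blast
qed

lemma near_ph_convex_direction:
 assumes "near_ph p" "\<bar>k\<bar> <= 1/2000" shows "Ns (p + k .* e2 - ph) <= 1/50" "Y1 (p + k .* e2) = 0"
proof -
 have "Ns e2 <= 1" using Ns_le[of e2] by (simp add: dual T_basis)
 hence "\<bar>k\<bar> * Ns e2 <= 1/2000 * 1" using assms Ns_ge(6)[of e2] by (intro mult_mono) auto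
 moreover have "Ns (p + k .* e2 - ph) <= Ns (p - ph) + \<bar>k\<bar> * Ns e2"
  using Ns_triangle[of "p - ph" "k .* e2"] by (simp add: Ns_scale algebra_simps)
 ultimately show "Ns (p + k .* e2 - ph) <= 1/50" using assms(1) by (simp add: near_ph_def)
 show "Y1 (p + k .* e2) = 0" using assms(1) by (simp add: near_ph_def lin_simps dual)
qed

text \<open>Equal values of \<open>fh\<close> at both ends of a non-trivial segment in direction
  \<open>e2\<close> would, by the mean value theorem, force its derivative in that direction to
  vanish in between.\<close>

lemma characteristic_displacement_zero:
 fixes fh :: "'a => real"
 assumes p: "near_ph p" and k: "\<bar>k\<bar> <= 1/2000" and eq: "fh (p + k .* e2) = fh p"
  and d: "!!q. Y1 q = 0 ==> Ns (q - ph) <= 1/50 ==> (fh has_derivative fh' q) (at q) & fh' q e2 ~= 0"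
 shows "k = 0"
proof (rule ccontr)
 assume k0: "k ~= 0"
 define g where "g s = fh (p + (s * k) .* e2)" for s :: real
 have gd: "(g has_derivative (%h. fh' (p + (s * k) .* e2) ((h * k) .* e2))) (at s)" if "s : {0..1}" for s
 proof -
  have "\<bar>s * k\<bar> <= 1/2000" using that k mult_mono[of "\<bar>s\<bar>" 1 "\<bar>k\<bar>" "1/2000"] by (simp add: abs_mult)
  note near = near_ph_convex_direction[OF p this]
  have "((%s. p + (s * k) .* e2) has_derivative (%h. (h * k) .* e2)) (at s)"
   by (auto intro!: derivative_eq_intros)
  from has_derivative_compose[OF this] d[OF near(2,1)] show ?thesis unfolding g_def by blast
 qed
 have "EX s:{0<..<1}. g 1 - g 0 = fh' (p + (s * k) .* e2) (((1 - 0) * k) .* e2)"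
  by (rule mvt_simple[where f = g and f' = "%s h. fh' (p + (s * k) .* e2) ((h * k) .* e2)"])
   (auto intro!: has_derivative_at_withinI gd)
 then obtain s where s: "s : {0<..<1}" "g 1 - g 0 = fh' (p + (s * k) .* e2) (k .* e2)" by auto
 have "\<bar>s * k\<bar> <= 1/2000" using s(1) k mult_mono[of "\<bar>s\<bar>" 1 "\<bar>k\<bar>" "1/2000"] by (simp add: abs_mult)
 note near = near_ph_convex_direction[OF p this]
 have "linear (fh' (p + (s * k) .* e2))" using d[OF near(2,1)] has_derivative_linear by blast
 thus False using s(2) eq d[OF near(2,1)] k0 by (simp add: g_def linear_scale)
qed

end

text \<open>A failing estimate yields structures and points converging along a subsequence. Thus
  uniform closeness on a compact set is reduced to limits of sequences, for which the limit rules
  are available.\<close>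

lemma uniform_from_sequences:
 fixes Q :: "'b => 'e::metric_space => 'f::real_normed_vector"
 assumes K: "compact K" and Q0: "continuous_on K Q0" and mono: "!!e e' s. close e s ==> e <= e' ==> close e' s"
  and seq: "!!s y y0. (!!k. close (inverse (real (Suc k))) (s k)) ==> (!!k. y k : K) ==> y ----> y0 ==> y0 : K
    ==> (%k. Q (s k) (y k)) ----> Q0 y0" and et: "et > 0"
 shows "EX e>0. ALL s. close e s --> (ALL y:K. norm (Q s y - Q0 y) < et)"
proof (rule ccontr)
 assume neg: "~ ?thesis"
 have "EX s y. close (inverse (real (Suc k))) s & y : K & ~ norm (Q s y - Q0 y) < et" for k
  using neg by (metis inverse_positive_iff_positive of_nat_0_less_iff zero_less_Suc)
 then obtain s y where sy: "!!k. close (inverse (real (Suc k))) (s k)" "!!k. y k : K" "!!k. ~ norm (Q (s k) (y k) - Q0 (y k)) < et"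
  by metis
 obtain y0 r where r: "y0 : K" "strict_mono r" "(y \<circ> r) ----> y0"
  using K sy(2) unfolding compact_def by metis
 have 1: "close (inverse (real (Suc k))) (s (r k))" for k
  by (rule mono[OF sy(1)]) (use seq_suble[OF r(2), of k] in \<open>simp add: field_simps\<close>)
 have A: "(%k. Q (s (r k)) (y (r k))) ----> Q0 y0"
  using seq[of "%k. s (r k)" "%k. y (r k)" y0] 1 sy(2) r by (simp add: o_def)
 have B: "(%k. Q0 (y (r k))) ----> Q0 y0"
  using continuous_on_tendsto_compose[OF Q0 r(3) r(1)] sy(2) by (simp add: o_def)
 have "(%k. norm (Q (s (r k)) (y (r k)) - Q0 (y (r k)))) ----> norm (Q0 y0 - Q0 y0)"
  by (intro tendsto_norm tendsto_diff A B)
 hence "\<forall>\<^sub>F k in sequentially. norm (Q (s (r k)) (y (r k)) - Q0 (y (r k))) < et"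
  using order_tendstoD(2)[of _ 0 sequentially et] et by simp
 thus False using sy(3) by (auto simp: eventually_sequentially)
qed

lemma tendsto_of_close:
 fixes f :: "nat => real"
 assumes "!!k. \<bar>f k - g k\<bar> < inverse (real (Suc k))" "g ----> L" shows "f ----> L"
proof -
 have "(%k. f k - g k) ----> 0"
  by (rule Lim_null_comparison[OF _ LIMSEQ_inverse_real_of_nat]) (use assms(1) less_imp_le in \<open>auto simp: eventually_sequentially\<close>)
 from tendsto_add[OF this assms(2)] show ?thesis by simp
qed

lemma jets_tendsto:
 fixes g :: "nat => 'e::euclidean_space => real"
 assumes S: "open S" "!!k. y k : S" and g: "!!k. smooth_on (g k) S" "smooth_on g0 S" and y: "y ----> y0" "y0 : S"
  and cl: "!!k. \<bar>g k (y k) - g0 (y k)\<bar> < inverse (real (Suc k))"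
   "!!k a. a : Basis ==> \<bar>FD (%z. g k z - g0 z) (y k) a\<bar> < inverse (real (Suc k))"
   "!!k a b. a : Basis ==> b : Basis ==>
     \<bar>FD (%z. FD (%z. g k z - g0 z) z a) (y k) b\<bar> < inverse (real (Suc k))"
 shows "(%k. g k (y k)) ----> g0 y0"
  "a : Basis ==> (%k. FD (g k) (y k) a) ----> FD g0 y0 a"
  "a : Basis ==> b : Basis ==> (%k. FD (%z. FD (g k) z a) (y k) b)
    ----> FD (%z. FD g0 z a) y0 b"
proof -
 have c: "(%k. f (y k)) ----> f y0" if "smooth_on f S" for f :: "'e => real"
  by (rule continuous_on_tendsto_compose[OF smooth_cont[OF that] y]) (simp add: S)
 have d: "FD (%z. f z - h z) x a = FD f x a - FD h x a"
  if "smooth_on f S" "smooth_on h S" "x : S" for f h :: "'e => real" and x a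
  by (rule FD_eqI[OF has_derivative_diff[OF smooth_deriv[OF that(1,3)] smooth_deriv[OF that(2,3)]]])
 show "(%k. g k (y k)) ----> g0 y0" by (rule tendsto_of_close[OF cl(1) c[OF g(2)]])
 show "(%k. FD (g k) (y k) a) ----> FD g0 y0 a" if a: "a : Basis" for a
  by (rule tendsto_of_close[OF _ c[OF smooth_FD[OF g(2)]]])
    (use cl(2)[OF a] in \<open>simp add: d[OF g S(2)]\<close>)
 show "(%k. FD (%z. FD (g k) z a) (y k) b)
    ----> FD (%z. FD g0 z a) y0 b" if a: "a : Basis" "b : Basis" for a b
 proof (rule tendsto_of_close[OF _ c[OF smooth_FD[OF smooth_FD[OF g(2)]]]])
  show "\<bar>FD (%z. FD (g k) z a) (y k) b
    - FD (%z. FD g0 z a) (y k) b\<bar> < inverse (real (Suc k))" for k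
  proof -
   have "FD (%z. FD (%z. g k z - g0 z) z a) (y k)
     = FD (%z. FD (g k) z a - FD g0 z a) (y k)" by (rule FD_cong[OF S(1) S(2)]) (rule d[OF g])
   thus ?thesis using cl(3)[OF a, of k] by (simp add: d[OF smooth_FD[OF g(1)] smooth_FD[OF g(2)] S(2)])
  qed
 qed
qed

text \<open>Differentiating the equation that defines \<open>J\<close> shows that its derivative
  solves the same linear system with right-hand side \<open>al\<close>. The derivative of the trace
  is thereby expressed by second derivatives of \<open>l\<close> and first derivatives of
  \<open>w\<close>, in a form to which \<open>sharp_tendsto\<close> applies.\<close>

lemma trace_inv_derivative:
 fixes l :: "real ^ 'm => real ^ 'm::finite => real"
 assumes S: "open S" "x : S" and nd: "!!y. y : S ==> nd_pair (l y) (w y)" and l: "form1 S l"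
  and w: "!!u v. smooth_on (%y. w y u v) S"
 defines "D \<equiv> (%f :: real ^ 'm => real. FD f x)"
 defines "J \<equiv> (%u. sharp (l x) (w x) (d1 l x u))"
 defines "al \<equiv> (%v u z. D (%y. d1 l y u z) v
   - (D (%y. w y (J u) z) v + (l x (J u) * D (%y. l y z) v + D (%y. l y (J u)) v * l x z)))"
 shows "linear (al v u)" "D (%y. trace_inv (l y) (w y) (d1 l y)) v = (\<Sum>b\<in>Basis. sharp (l x) (w x) (al v b) \<bullet> b)"
proof -
 define JJ where "JJ y u = sharp (l y) (w y) (d1 l y u)" for y u
 have J: "smooth_on (%y. JJ y u) S" for u unfolding JJ_def by (rule smooth_reeb(2)[OF S(1) nd l w])
 have Jx: "JJ x u = J u" for u by (simp add: JJ_def J_def)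
 have w1: "form1 S (%y u. w y u v)" and w2: "form1 S (%y v. w y u v)" for u v
  unfolding form1_def using nd_lin(2,3)[OF nd] w by blast+
 have b1: "form1 S (%y u. bform (l y) (w y) u v)" for v unfolding form1_def using nd_lin(5)[OF nd]
  by (auto simp: bform_def intro!: smooth_add smooth_mult w form1D(2)[OF l] S)
 have La: "form1 S (%y z. d1 l y u z)" for u
  unfolding form1_def using d1_linear(2)[OF l S(1)] smooth_d1[OF l S(1)] by blast
 have bJ: "bform (l y) (w y) (JJ y u) v = d1 l y u v" if "y : S" for y u v
  unfolding JJ_def by (rule bform_sharp[OF nd[OF that] d1_linear(2)[OF l S(1) that]])
 have bD: "D (%y. bform (l y) (w y) u z) v = D (%y. w y u z) v + (l x u * D (%y. l y z) v + D (%y. l y u) v * l x z)" for u z v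
  unfolding bform_def D_def
  by (rule FD_eqI) (intro has_derivative_add has_derivative_mult form1D(3)[OF l S(2)] form1D(3)[OF w1 S(2)])
 have lins: "linear (%z. D (%y. d1 l y u z) v)" "linear (%z. D (%y. w y u z) v)" "linear (%z. D (%y. l y z) v)" for u v
  unfolding D_def by (rule linear_FD_form[OF La S] linear_FD_form[OF w2 S] linear_FD_form[OF l S])+
 show linal: "linear (al v u)" for v u unfolding al_def
  by (rule linearI) (simp_all add: linear_add[OF lins(1)] linear_add[OF lins(2)] linear_add[OF lins(3)] linear_add[OF form1D(1)[OF l S(2)]]
   linear_scale[OF lins(1)] linear_scale[OF lins(2)] linear_scale[OF lins(3)] linear_scale[OF form1D(1)[OF l S(2)]] algebra_simps)
 have DJ: "sharp (l x) (w x) (al v u) = FD (%y. JJ y u) x v" for u v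
 proof (rule sharp_eqI[OF nd[OF S(2)] linal])
  fix z
  have "((%y. d1 l y u z) has_derivative (%a. FD (%y. bform (l y) (w y) (JJ x u) z) x a
     + bform (l x) (w x) (FD (%y. JJ y u) x a) z)) (at x)"
   by (rule has_derivative_transform_within_open[OF FD_pairing[OF b1 S J] S]) (simp add: bJ)
  from FD_eqI[OF this, of v]
  have "D (%y. d1 l y u z) v = D (%y. bform (l y) (w y) (J u) z) v + bform (l x) (w x) (FD (%y. JJ y u) x v) z"
   by (simp add: D_def Jx)
  thus "bform (l x) (w x) (FD (%y. JJ y u) x v) z = al v u z" unfolding bD al_def by simp
 qed
 have "((%y. \<Sum>b\<in>Basis. JJ y b \<bullet> b) has_derivative (%a. \<Sum>b\<in>Basis. FD (%y. JJ y b) x a \<bullet> b)) (at x)"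
  by (intro has_derivative_sum has_derivative_inner_left smooth_deriv[OF J S(2)])
 from FD_eqI[OF this, of v]
 show "D (%y. trace_inv (l y) (w y) (d1 l y)) v = (\<Sum>b\<in>Basis. sharp (l x) (w x) (al v b) \<bullet> b)"
  unfolding D_def trace_inv_def JJ_def[symmetric] DJ .
qed

lemma C2_close_onD:
 assumes "C2_close_on K e al be" "x : K" "range v <= Basis"
 shows "\<bar>al x v - be x v\<bar> < e" "a : Basis ==> \<bar>FD (%y. al y v - be y v) x a\<bar> < e"
  "a : Basis ==> b : Basis ==> \<bar>FD (%y. FD (%y. al y v - be y v) y a) x b\<bar> < e"
 using assms unfolding C2_close_on_def Let_def by blast+

lemma C2_close_on_mono: "C2_close_on K e al be ==> e <= e' ==> C2_close_on K e' al be"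
 unfolding C2_close_on_def Let_def by (meson less_le_trans)

lemma C2_close_on_refl: "0 < e ==> C2_close_on K e al al"
 unfolding C2_close_on_def Let_def by (simp add: FD_eqI[OF has_derivative_const])

section \<open>Convergence on \<open>C\<^sup>2\<close>-neighbourhoods\<close>

context oriented_mf
begin

definition nhd :: "nat => ('a, 'm) form \<times> ('a, 'm) form => ('a, 'm) chart => (real, 'm) vec set => real => (('a, 'm) form \<times> ('a, 'm) form) set" where
 "nhd n s0 c K e = {s : SHS A n. C2_close_on K e (fst s c) (fst s0 c) & C2_close_on K e (snd s c) (snd s0 c)}"

context
 fixes n s0 c K
 assumes m: "CARD('m) = 2 * n + 1" and s0: "s0 : SHS A n" and c: "c : A" and K: "compact K" "K <= cimg c"
begin

context
 fixes s y y0
 assumes s: "!!k. s k : nhd n s0 c K (inverse (real (Suc k)))" and y: "!!k. y k : K" "y ----> y0" "y0 : K"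
begin

private lemma S: "s k : SHS A n" using s[of k] by (simp add: nhd_def)

private lemmas pc = prod.collapse
private lemmas f0 = SHS_forms[OF m, of "fst s0" "snd s0", unfolded pc, OF s0]
private lemmas fk = SHS_forms[OF m, of "fst (s k)" "snd (s k)" for k, unfolded pc, OF S]

private lemma jets1:
 assumes "b : Basis"
 shows "(%k. lc1 (fst (s k)) c (y k) b) ----> lc1 (fst s0) c y0 b"
  "a : Basis ==> (%k. FD (%z. lc1 (fst (s k)) c z b) (y k) a) ----> FD (%z. lc1 (fst s0) c z b) y0 a"
  "a : Basis ==> a' : Basis ==> (%k. FD (%z. FD (%z. lc1 (fst (s k)) c z b) z a) (y k) a')
   ----> FD (%z. FD (%z. lc1 (fst s0) c z b) z a) y0 a'"
proof -
 have C: "C2_close_on K (inverse (real (Suc k))) (fst (s k) c) (fst s0 c)" for k using s[of k] by (simp add: nhd_def)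
 have r: "range (%_::nat. b) <= Basis" using assms by auto
 have yk: "y k : cimg c" for k using y(1) K(2) by blast
 have y0: "y0 : cimg c" using y(3) K(2) by blast
 note j = jets_tendsto[where g = "%k z. lc1 (fst (s k)) c z b", OF open_cimg[OF c] yk form1D(2)[OF smooth_lc1(1)[OF fk(1) c]]
  form1D(2)[OF smooth_lc1(1)[OF f0(1) c]] y(2) y0, unfolded lc1_def, OF C2_close_onD[OF C y(1) r], folded lc1_def]
 show "(%k. lc1 (fst (s k)) c (y k) b) ----> lc1 (fst s0) c y0 b"
  "a : Basis ==> (%k. FD (%z. lc1 (fst (s k)) c z b) (y k) a) ----> FD (%z. lc1 (fst s0) c z b) y0 a"
  "a : Basis ==> a' : Basis ==> (%k. FD (%z. FD (%z. lc1 (fst (s k)) c z b) z a) (y k) a')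
   ----> FD (%z. FD (%z. lc1 (fst s0) c z b) z a) y0 a'" by (rule j; assumption)+
qed

private lemma jets2:
 assumes "b : Basis" "b' : Basis"
 shows "(%k. lc2 (snd (s k)) c (y k) b b') ----> lc2 (snd s0) c y0 b b'"
  "a : Basis ==> (%k. FD (%z. lc2 (snd (s k)) c z b b') (y k) a) ----> FD (%z. lc2 (snd s0) c z b b') y0 a"
proof -
 have C: "C2_close_on K (inverse (real (Suc k))) (snd (s k) c) (snd s0 c)" for k using s[of k] by (simp add: nhd_def)
 have r: "range (pair_seq b b') <= Basis" using assms by (auto simp: pair_seq_def)
 have yk: "y k : cimg c" for k using y(1) K(2) by blast
 have y0: "y0 : cimg c" using y(3) K(2) by blast
 note j = jets_tendsto[where g = "%k z. lc2 (snd (s k)) c z b b'", OF open_cimg[OF c] yk smooth_lc2(2)[OF fk(2) c]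
  smooth_lc2(2)[OF f0(2) c] y(2) y0, unfolded lc2_def, OF C2_close_onD[OF C y(1) r], folded lc2_def]
 show "(%k. lc2 (snd (s k)) c (y k) b b') ----> lc2 (snd s0) c y0 b b'"
  "a : Basis ==> (%k. FD (%z. lc2 (snd (s k)) c z b b') (y k) a) ----> FD (%z. lc2 (snd s0) c z b b') y0 a"
  by (rule j; assumption)+
qed

private lemma nd: "nd_pair (lc1 (fst (s k)) c (y k)) (lc2 (snd (s k)) c (y k))" "nd_pair (lc1 (fst s0) c y0) (lc2 (snd s0) c y0)"
 using SHS_nd_pair[OF m, of "fst (s k)" "snd (s k)" c "y k"] SHS_nd_pair[OF m, of "fst s0" "snd s0" c y0] S[of k] s0 c y K by auto

lemma reeb_tendsto: "(%k. reeb (fst (s k)) (snd (s k)) c (y k)) ----> reeb (fst s0) (snd s0) c y0"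
 unfolding reeb_def
 by (rule sharp_tendsto[OF nd(2,1) nd_lin(1)[OF nd(2)] nd_lin(1)[OF nd(1)] jets1(1) jets2(1) jets1(1)])

text \<open>Through the derivative of \<open>d1\<close> the functional \<open>alk\<close> contains
  second derivatives of \<lambda>. This is the place where closeness of order two is used.\<close>

lemma finv_derivative_tendsto:
 assumes v: "v : Basis"
 shows "(%k. FD (finv (fst (s k)) (snd (s k)) c) (y k) v) ----> FD (finv (fst s0) (snd s0) c) y0 v"
proof -
 have yk: "y k : cimg c" for k using y(1) K(2) by blast
 have y0: "y0 : cimg c" using y(3) K(2) by blast
 note oc = open_cimg[OF c]
 have nds: "z : cimg c ==> nd_pair (lc1 (fst (s k)) c z) (lc2 (snd (s k)) c z)" for k z
  using SHS_nd_pair[OF m, of "fst (s k)" "snd (s k)" c] S[of k] c by simp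
 have nds0: "z : cimg c ==> nd_pair (lc1 (fst s0) c z) (lc2 (snd s0) c z)" for z
  using SHS_nd_pair[OF m, of "fst s0" "snd s0" c] s0 c by simp
 note l = smooth_lc1(1)[OF fk(1) c] and l0 = smooth_lc1(1)[OF f0(1) c]
 note w = smooth_lc2(2)[OF fk(2) c] and w0 = smooth_lc2(2)[OF f0(2) c]
 define Jk where "Jk k u = sharp (lc1 (fst (s k)) c (y k)) (lc2 (snd (s k)) c (y k)) (d1 (lc1 (fst (s k)) c) (y k) u)" for k u
 define J where "J u = sharp (lc1 (fst s0) c y0) (lc2 (snd s0) c y0) (d1 (lc1 (fst s0) c) y0 u)" for u
 have La: "(%k. d1 (lc1 (fst (s k)) c) (y k) u b) ----> d1 (lc1 (fst s0) c) y0 u b" if "u : Basis" "b : Basis" for u b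
  unfolding d1_def by (intro tendsto_diff jets1 that)
 have J: "(%k. Jk k u) ----> J u" if "u : Basis" for u unfolding Jk_def J_def
  by (rule sharp_tendsto[OF nd(2,1) d1_linear(2)[OF l0 oc y0] d1_linear(2)[OF l oc yk] jets1(1) jets2(1) La[OF that]])
 have w1: "form1 (cimg c) (%y u. lc2 (snd (s k)) c y u z)" "form1 (cimg c) (%y u. lc2 (snd s0) c y u z)" for k z
  unfolding form1_def using nd_lin(3)[OF nds] nd_lin(3)[OF nds0] w w0 by blast+
 have lJ: "(%k. g k (Jk k u)) ----> g0 (J u)"
  if "u : Basis" "!!k. linear (g k)" "linear g0" "!!b. b : Basis ==> (%k. g k b) ----> g0 b"
  for u and g :: "nat => (real, 'm) vec => real" and g0
  unfolding linear_expand[OF that(2), of _ "Jk _ u"] linear_expand[OF that(3), of "J u"]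
  by (intro tendsto_sum tendsto_scaleR tendsto_inner tendsto_const J that)
 have dLa: "(%k. FD (%z. d1 (lc1 (fst (s k)) c) z u b) (y k) v)
   ----> FD (%z. d1 (lc1 (fst s0) c) z u b) y0 v" if "u : Basis" "b : Basis" for u b
 proof -
  have e: "FD (%z. d1 m z u b) x v = FD (%z. FD (%z. m z b) z u) x v
     - FD (%z. FD (%z. m z u) z b) x v"
   if m: "form1 (cimg c) m" "x : cimg c" for m x unfolding d1_def
   by (rule FD_eqI[OF has_derivative_diff[OF smooth_deriv[OF smooth_FD[OF form1D(2)[OF m(1)]] m(2)]
     smooth_deriv[OF smooth_FD[OF form1D(2)[OF m(1)]] m(2)]]])
  show ?thesis unfolding e[OF l yk] e[OF l0 y0] by (intro tendsto_diff jets1 that v)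
 qed
 define alk where "alk k u z = FD (%x. d1 (lc1 (fst (s k)) c) x u z) (y k) v
   - (FD (%x. lc2 (snd (s k)) c x (Jk k u) z) (y k) v
    + (lc1 (fst (s k)) c (y k) (Jk k u) * FD (%x. lc1 (fst (s k)) c x z) (y k) v
     + FD (%x. lc1 (fst (s k)) c x (Jk k u)) (y k) v * lc1 (fst (s k)) c (y k) z))" for k u z
 define al where "al u z = FD (%x. d1 (lc1 (fst s0) c) x u z) y0 v
   - (FD (%x. lc2 (snd s0) c x (J u) z) y0 v
    + (lc1 (fst s0) c y0 (J u) * FD (%x. lc1 (fst s0) c x z) y0 v
     + FD (%x. lc1 (fst s0) c x (J u)) y0 v * lc1 (fst s0) c y0 z))" for u z
 have linal: "linear (alk k u)" "linear (al u)" for k u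
  unfolding alk_def[abs_def] al_def[abs_def] Jk_def J_def
  by (rule trace_inv_derivative(1)[OF oc yk nds l w] trace_inv_derivative(1)[OF oc y0 nds0 l0 w0]; assumption)+
 have D: "FD (finv (fst (s k)) (snd (s k)) c) (y k) v
   = (\<Sum>b\<in>Basis. sharp (lc1 (fst (s k)) c (y k)) (lc2 (snd (s k)) c (y k)) (alk k b) \<bullet> b)"
  "FD (finv (fst s0) (snd s0) c) y0 v = (\<Sum>b\<in>Basis. sharp (lc1 (fst s0) c y0) (lc2 (snd s0) c y0) (al b) \<bullet> b)" for k
  unfolding alk_def[abs_def] al_def[abs_def] Jk_def J_def finv_def[abs_def]
  by (rule trace_inv_derivative(2)[OF oc yk nds l w] trace_inv_derivative(2)[OF oc y0 nds0 l0 w0]; assumption)+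
 show ?thesis unfolding D
 proof (intro tendsto_sum tendsto_inner tendsto_const sharp_tendsto[OF nd(2,1) linal(2,1) jets1(1) jets2(1)])
  fix u z :: "(real, 'm) vec" assume u: "u : Basis" and z: "z : Basis"
  have 1: "(%k. FD (%x. lc2 (snd (s k)) c x (Jk k u) z) (y k) v)
    ----> FD (%x. lc2 (snd s0) c x (J u) z) y0 v"
   by (rule lJ[OF u linear_FD_form[OF w1(1) oc yk] linear_FD_form[OF w1(2) oc y0]]) (rule jets2(2)[OF _ z v])
  have 2: "(%k. lc1 (fst (s k)) c (y k) (Jk k u)) ----> lc1 (fst s0) c y0 (J u)"
   by (rule lJ[OF u form1D(1)[OF l yk] form1D(1)[OF l0 y0] jets1(1)])
  have 3: "(%k. FD (%x. lc1 (fst (s k)) c x (Jk k u)) (y k) v)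
    ----> FD (%x. lc1 (fst s0) c x (J u)) y0 v"
   by (rule lJ[OF u linear_FD_form[OF l oc yk] linear_FD_form[OF l0 oc y0]]) (rule jets1(2)[OF _ v])
  show "(%k. alk k u z) ----> al u z" unfolding alk_def al_def
   by (intro tendsto_diff tendsto_add tendsto_mult dLa u z 1 2 3 jets1(1,2) v)
 qed
qed

end

lemma nhd_mono: "s : nhd n s0 c K e ==> e <= e' ==> s : nhd n s0 c K e'"
 using C2_close_on_mono by (auto simp: nhd_def)

lemma reeb_uniform:
 assumes "et > 0"
 shows "EX e>0. ALL s:nhd n s0 c K e. ALL y:K. norm (reeb (fst s) (snd s) c y - reeb (fst s0) (snd s0) c y) < et"
proof -
 have "EX e>0. ALL s. s : nhd n s0 c K e --> (ALL y:K. norm (reeb (fst s) (snd s) c y - reeb (fst s0) (snd s0) c y) < et)"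
 proof (rule uniform_from_sequences[OF K(1) _ nhd_mono reeb_tendsto assms])
  show "continuous_on K (reeb (fst s0) (snd s0) c)"
   using reeb_smooth(1)[OF m, of "fst s0" "snd s0" c] s0 c continuous_on_subset[OF smooth_cont K(2)] by simp
 qed
 thus ?thesis by blast
qed

lemma finv_derivative_uniform:
 assumes "et > 0"
 shows "EX e>0. ALL s:nhd n s0 c K e. ALL y:K. ALL b:Basis.
  \<bar>FD (finv (fst s) (snd s) c) y b - FD (finv (fst s0) (snd s0) c) y b\<bar> < et"
proof -
 have "EX e>0. ALL s. s : nhd n s0 c K e --> (ALL y:K.
   norm (FD (finv (fst s) (snd s) c) y b - FD (finv (fst s0) (snd s0) c) y b) < et)"
  if "b : Basis" for b
 proof (rule uniform_from_sequences[OF K(1) _ nhd_mono finv_derivative_tendsto[OF _ _ _ _ that] assms])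
  show "continuous_on K (%y. FD (finv (fst s0) (snd s0) c) y b)"
   using reeb_smooth(2)[OF m, of "fst s0" "snd s0" c] s0 c continuous_on_subset[OF smooth_cont[OF smooth_FD] K(2)] by simp
 qed
 then obtain e where e: "!!b. b : Basis ==> e b > 0 & (ALL s. s : nhd n s0 c K (e b) --> (ALL y:K.
   norm (FD (finv (fst s) (snd s) c) y b - FD (finv (fst s0) (snd s0) c) y b) < et))" by metis
 define e1 where "e1 = Min (e ` Basis)"
 have "e1 > 0" unfolding e1_def using e by (subst Min_gr_iff) auto
 moreover have "e1 <= e b" if "b : Basis" for b unfolding e1_def using that by (intro Min_le) auto
 moreover have "\<bar>FD (finv (fst s) (snd s) c) y b - FD (finv (fst s0) (snd s0) c) y b\<bar> < et"
  if "s : nhd n s0 c K e1" "y : K" "b : Basis" for s y b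
 proof -
  have "s : nhd n s0 c K (e b)" by (rule nhd_mono[OF that(1)]) (rule \<open>!!b. b : Basis ==> e1 <= e b\<close>[OF that(3)])
  thus ?thesis using e[OF that(3)] that(2) by simp
 qed
 ultimately show ?thesis by blast
qed

end

end

section \<open>Closeness of Reeb fields in the coordinates\<close>

context frame_at
begin

text \<open>\<open>RQ\<close> is unbounded in the angle while all data of the model are periodic in
  it; a shift by full turns carries estimates from the compact box to all of
  \<open>RQ\<close>.\<close>

lemma angle_reduce:
 obtains q' where "Y1 q' : {0..2 * pi}" "Phi q' = Phi q" "dPhi q' = dPhi q" "rh q' = rh q" "sh q' = sh q"
  "XX q' = XX q" "mm t q' = mm t q"
proof -
 define k where "k = \<lfloor>Y1 q / (2 * pi)\<rfloor>"
 define q' where "q' = q - (2 * pi * of_int k) .* f1"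
 have co: "Z q' = Z q" "X1 q' = X1 q" "X2 q' = X2 q" "Y2 q' = Y2 q" "pw q' = pw q" "T q' = T q" "Y1 q' = Y1 q - 2 * pi * of_int k"
  by (simp_all add: q'_def lin_simps dual T_basis)
 have tr: "cos (Y1 q') = cos (Y1 q)" "sin (Y1 q') = sin (Y1 q)"
  unfolding co(7) by (simp_all add: cos_diff sin_diff)
 have 1: "Phi q' = Phi q" "dPhi q' = dPhi q" by (simp_all add: Phi_def dPhi_def fun_eq_iff co(1-6) tr)
 have 2: "rh q' = rh q" "sh q' = sh q" by (simp_all add: rh_def sh_def co)
 \<comment> \<open>\<open>J q\<close> is determined by \<open>be x (J q) = T x \<bullet> T q\<close>
   within the range of \<open>pw\<close>, where \<open>be\<close> is non-degenerate, and
   \<open>T\<close> ignores the angle.\<close>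
 have "J q' = J q"
 proof -
  have d: "pw (J q' - J q) = J q' - J q" by (simp add: lin_simps J)
  have b: "be x (J q' - J q) = 0" for x by (simp add: be_simps J co)
  have "T (J q' - J q) \<bullet> T (J q' - J q) = be (J q' - J q) (J (J q' - J q))" by (simp add: J)
  also have "... = 0" using b[of "J (J q' - J q)"] skew_formD(3)[OF be(1), of "J q' - J q" "J (J q' - J q)"] by simp
  finally have "T (J q' - J q) = 0" by simp
  thus ?thesis using Cw(2)[of "J q' - J q"] d by simp
 qed
 hence 3: "XX q' = XX q" by (simp add: XX_def co kh_def 2)
 have "of_int k <= Y1 q / (2 * pi)" "Y1 q / (2 * pi) < of_int k + 1" unfolding k_def by linarith+
 hence "Y1 q' : {0..2 * pi}" unfolding co(7) by (simp add: field_simps)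
 thus ?thesis using 1 2 3 by (intro that[of q']) (simp_all add: mm_def)
qed

lemma dPhi_lower_bound: "EX c>0. ALL q:RQ. ALL v. c * norm v <= norm (dPhi q v)"
proof -
 define BX where "BX = Box (1/8) (1/10)"
 have BX: "compact BX" unfolding BX_def by (rule compact_Box) auto
 have X: "X1 q > 0" if "q : BX" for q using Box_subset[of q] that by (simp add: BX_def)
 define f where "f = (%x. norm (dPhi (fst x) (snd x)))"
 have cl: "continuous_on S (%x. L (g x))" if "linear L" "continuous_on S g" for S and g :: "'a \<times> 'a => 'a" and L :: "'a => 'b::real_normed_vector"
  by (rule continuous_on_compose2[OF linear_continuous_on[OF that(1)[unfolded linear_conv_bounded_linear]] that(2)]) auto
 have "continuous_on (BX \<times> sphere 0 1) f" unfolding f_def dPhi_def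
  by (intro continuous_intros cl[OF lin(1)] cl[OF lin(2)] cl[OF lin(3)] cl[OF lin(4)] cl[OF lin(5)] cl[OF lin(6)])
    (auto dest: X)
 moreover have "compact (BX \<times> sphere (0::'a) 1)" by (intro compact_Times BX compact_sphere)
 ultimately have at: "BX \<times> sphere (0::'a) 1 ~= {} ==> EX x:BX \<times> sphere 0 1. ALL y:BX \<times> sphere 0 1. f x <= f y"
  using continuous_attains_inf by blast
 have "EX c>0. ALL q:BX. ALL v. norm v = 1 --> c <= norm (dPhi q v)"
 proof (cases "BX \<times> sphere (0::'a) 1 = {}")
  case True
  thus ?thesis by (intro exI[of _ 1]) auto
 next
  case False
  then obtain x where x: "x : BX \<times> sphere 0 1" "!!y. y : BX \<times> sphere 0 1 ==> f x <= f y" using at by blast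
  have "f x > 0" using dPhi_inj[OF X, of "fst x" "snd x"] x(1) by (auto simp: f_def)
  thus ?thesis using x(2) by (intro exI[of _ "f x"]) (force simp: f_def)
 qed
 then obtain c where c: "c > 0" "!!q v. q : BX ==> norm v = 1 ==> c <= norm (dPhi q v)" by blast
 have "c * norm v <= norm (dPhi q v)" if q: "q : RQ" for q v
 proof (cases "v = 0")
  case True
  thus ?thesis by simp
 next
  case False
  obtain q' where q': "Y1 q' : {0..2 * pi}" "dPhi q' = dPhi q" "rh q' = rh q" "sh q' = sh q"
   using angle_reduce[of q] by metis
  have "q' : BX" using q q' by (auto simp: BX_def Box_def RQ_def)
  moreover have "norm ((1 / norm v) .* v) = 1" using False by simp
  ultimately have "c <= norm (dPhi q' ((1 / norm v) .* v))" by (rule c(2))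
  also have "... = norm (dPhi q v) / norm v"
   unfolding q'(2) linear_scale[OF linear_dPhi[OF RQ_imp(2)[OF q]]] by simp
  finally show ?thesis using False by (simp add: field_simps)
 qed
 thus ?thesis using c(1) by blast
qed

text \<open>A uniform lower bound for \<open>dPhi\<close> transports closeness from the chart to the
  coordinates. Because \<open>mm <= 2\<close>, the angular speed of the model is at least 1/2, so
  normalising it to 1 enlarges errors by a bounded factor only.\<close>

lemma hat_close:
 assumes C: "C >= 0" "!!q. norm (T (J q)) <= C * norm (T q)" and t: "0 <= t" "t * (16 + 2 * C) <= 1/200" and de: "de > 0"
 shows "EX et>0. ALL q:RQ. ALL R. norm (dPhi q R - dPhi q ((1 / mm t q) .* (f1 + t .* XX q))) <= et -->
   Y1 R > 0 & Ns ((1 / Y1 R) .* R - (f1 + t .* XX q)) <= de"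
proof -
 obtain c where c: "c > 0" "!!q v. q : RQ ==> c * norm v <= norm (dPhi q v)" using dPhi_lower_bound by blast
 obtain B where B: "B > 0" "!!v. Ns v <= B * norm v" using Ns_norm_equiv(1) by blast
 obtain B1 where B1: "B1 > 0" "!!v. \<bar>Y1 v\<bar> <= B1 * norm v" using linear_bounded_pos[OF lin(3)] by (metis real_norm_def)
 \<comment> \<open>The first bound keeps \<open>Y1 R >= 1/4\<close>; the second leaves room for the
   resulting factor 4 from \<open>1 / Y1 R\<close>.\<close>
 define h where "h = min (1 / (4 * B1)) (de / (4 * (B + B1)))"
 have h: "h > 0" "B1 * h <= 1/4" "(B + B1) * h <= de / 4"
 proof -
  show "h > 0" using B B1 de by (simp add: h_def)
  have "B1 * h <= B1 * (1 / (4 * B1))" unfolding h_def using B1 by (intro mult_left_mono) auto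
  thus "B1 * h <= 1/4" using B1 by simp
  have "(B + B1) * h <= (B + B1) * (de / (4 * (B + B1)))" unfolding h_def using B B1 by (intro mult_left_mono) auto
  moreover have "b * (de / (4 * b)) = de / 4" if "b > 0" for b :: real using that by simp
  moreover have "B + B1 > 0" using B(1) B1(1) by simp
  ultimately show "(B + B1) * h <= de / 4" by metis
 qed
 have "16 * t <= t * (16 + 2 * C)" using t(1) C(1) by (simp add: algebra_simps)
 hence t2: "t <= 1/2" using t by linarith
 have "Y1 R > 0 & Ns ((1 / Y1 R) .* R - (f1 + t .* XX q)) <= de"
  if q: "q : RQ" and R: "norm (dPhi q R - dPhi q ((1 / mm t q) .* (f1 + t .* XX q))) <= c * h" for q R
 proof -
  define z where "z = f1 + t .* XX q"
  define mo where "mo = mm t q"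
  have mo: "mo > 0" "mo <= 2" unfolding mo_def using mm_pos[OF q t(1) t2] mm_le[OF q t(1) t2] by auto
  define d where "d = R - (1 / mo) .* z"
  have "c * norm d <= c * h" using c(2)[OF q, of d] R
   by (simp add: d_def mo_def z_def linear_diff[OF linear_dPhi[OF RQ_imp(2)[OF q]]])
  hence d: "norm d <= h" using c(1) by simp
  have Nd: "Ns d <= B * h" using B(2)[of d] mult_left_mono[OF d, of B] B(1) by linarith
  have Yd: "\<bar>Y1 d\<bar> <= B1 * h" using B1(2)[of d] mult_left_mono[OF d, of B1] B1(1) by linarith
  have Yz: "Y1 z = 1" by (simp add: z_def lin_simps dual XX_coords)
  have R1: "R = d + (1 / mo) .* z" by (simp add: d_def)
  hence YR: "Y1 R = Y1 d + 1 / mo" by (simp add: lin_simps Yz)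
  have "1 / mo >= 1/2" using mo by (simp add: field_simps)
  hence YR4: "Y1 R >= 1/4" using Yd h(2) unfolding YR by linarith
  have Nz: "Ns z <= 1"
  proof -
   have q': "\<bar>rh q - 1/2\<bar> < 1/8" "sh q < 1/10" using q by (auto simp: RQ_def)
   have "Ns (XX q) <= (16 + 2 * C) * 1" by (rule Ns_XX[OF C q]) (use q' in auto)
   hence "t * Ns (XX q) <= t * (16 + 2 * C)" using t(1) by (simp add: mult_left_mono)
   moreover have "Ns f1 = 0" using Ns_le[of f1] Ns_ge(6)[of f1] by (simp add: dual T_basis)
   ultimately show ?thesis using Ns_triangle[of f1 "t .* XX q"] t by (simp add: z_def Ns_scale)
  qed
  have "(1 / Y1 R) .* R - z = (1 / Y1 R) .* (d + (- Y1 d) .* z)"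
  proof -
   have "Y1 R .* z = Y1 d .* z + (1 / mo) .* z" unfolding YR by (rule scaleR_add_left)
   hence "d + (- Y1 d) .* z = R - Y1 R .* z" by (simp add: R1)
   thus ?thesis using YR4 by (simp add: scaleR_diff_right)
  qed
  hence "Ns ((1 / Y1 R) .* R - z) = \<bar>1 / Y1 R\<bar> * Ns (d + (- Y1 d) .* z)" by (simp only: Ns_scale)
  also have "... <= 4 * (Ns d + \<bar>Y1 d\<bar> * Ns z)"
  proof (rule mult_mono)
   show "\<bar>1 / Y1 R\<bar> <= 4" using YR4 by (simp add: field_simps)
   show "Ns (d + (- Y1 d) .* z) <= Ns d + \<bar>Y1 d\<bar> * Ns z" using Ns_triangle[of d "(- Y1 d) .* z"] unfolding Ns_scale by simp
  qed (use Ns_ge(6) in auto)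
  also have "... <= 4 * (B * h + B1 * h * 1)"
   using Nd Yd Nz Ns_ge(6)[of z] B1(1) h(1) by (intro mult_left_mono add_mono mult_mono) auto
  also have "... <= de" using h(3) by (simp add: algebra_simps)
  finally show ?thesis using YR4 by (simp add: z_def)
 qed
 thus ?thesis using c(1) h(1) by (intro exI[of _ "c * h"]) auto
qed

end

text \<open>The elapsed time is strictly increasing in the angle; its inverse \<open>si\<close>
  returns from the angle to the Reeb time as parameter.\<close>

lemma time_change:
 fixes te m :: "real => real"
 assumes b: "b > 0" and te0: "te 0 = 0"
  and d: "!!s. s : {0..b} ==> (te has_vector_derivative m s) (at s within {0..b})" and m: "!!s. s : {0..b} ==> m s > 0"
 shows "te b > 0 & (EX si. si 0 = 0 & si (te b) = b & (ALL t:{0..te b}. si t : {0..b} &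
   (si has_vector_derivative 1 / m (si t)) (at t within {0..te b})) & (ALL t. 0 < t & t < te b --> 0 < si t & si t < b))"
proof -
 have mono: "te s < te t" if st: "0 <= s" "s < t" "t <= b" for s t
 proof -
  have "EX x:{s<..<t}. te t - te s = (t - s) .* m x"
  proof (rule mvt_simple[OF st(2)])
   show "(te has_derivative (%a. a .* m x)) (at x within {s..t})" if "s <= x" "x <= t" for x
    by (rule has_derivative_subset[OF d[unfolded has_vector_derivative_def]]) (use st that in auto)
  qed
  then obtain x where "x : {s<..<t}" "te t - te s = (t - s) .* m x" by blast
  moreover from this have "(t - s) * m x > 0" using st by (intro mult_pos_pos m) auto
  ultimately show ?thesis by simp
 qed
 have inj: "inj_on te {0..b}" by (rule linorder_inj_onI) (use mono in force)+
 have c: "continuous_on {0..b} te"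
  using d has_vector_derivative_continuous unfolding continuous_on_eq_continuous_within by blast
 have pos: "te b > 0" using mono[of 0 b] b te0 by simp
 have le: "te s <= te t" if "0 <= s" "s <= t" "t <= b" for s t using mono[of s t] that by (cases "s = t") auto
 have img: "te ` {0..b} = {0..te b}"
 proof
  show "te ` {0..b} <= {0..te b}" using le[of 0] le[of _ b] te0 by auto
  show "{0..te b} <= te ` {0..b}"
  proof
   fix t assume "t : {0..te b}"
   thus "t : te ` {0..b}" using IVT'[of te 0 t b] c b te0 by auto
  qed
 qed
 define si where "si = inv_into {0..b} te"
 have site: "si (te s) = s" if "s : {0..b}" for s unfolding si_def by (rule inv_into_f_f[OF inj that])
 have tesi: "te (si t) = t" and si_in: "si t : {0..b}" if "t : {0..te b}" for t
 proof -
  have "t : te ` {0..b}" using that img by simp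
  thus "te (si t) = t" "si t : {0..b}" unfolding si_def by (rule f_inv_into_f inv_into_into)+
 qed
 have csi: "continuous_on {0..te b} si" using continuous_on_inv[OF c compact_Icc, of si] site img by simp
 have der: "(si has_vector_derivative 1 / m (si t)) (at t within {0..te b})" if t: "t : {0..te b}" for t
 proof -
  let ?s = "si t"
  have "(te has_field_derivative m ?s) (at ?s within {0..b})"
   using d[OF si_in[OF t]] by (simp add: has_real_derivative_iff_has_vector_derivative)
  hence lim: "((%y. (te y - te ?s) / (y - ?s)) \<longlongrightarrow> m ?s) (at ?s within {0..b})"
   unfolding has_field_derivative_iff .
  have "filterlim si (at ?s within {0..b}) (at t within {0..te b})" unfolding filterlim_at
  proof
   show "(si \<longlongrightarrow> ?s) (at t within {0..te b})" using csi t unfolding continuous_on_def by blast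
   show "\<forall>\<^sub>F x in at t within {0..te b}. si x : {0..b} & si x ~= ?s"
    unfolding eventually_at_filter using si_in tesi t by (intro always_eventually) metis
  qed
  from filterlim_compose[OF lim this]
  have "((%u. (te (si u) - te ?s) / (si u - ?s)) \<longlongrightarrow> m ?s) (at t within {0..te b})" .
  hence "((%u. inverse ((te (si u) - te ?s) / (si u - ?s))) \<longlongrightarrow> inverse (m ?s)) (at t within {0..te b})"
   by (rule tendsto_inverse) (use m[OF si_in[OF t]] in simp)
  moreover have "\<forall>\<^sub>F u in at t within {0..te b}. inverse ((te (si u) - te ?s) / (si u - ?s)) = (si u - si t) / (u - t)"
   unfolding eventually_at_filter by (intro always_eventually) (simp add: tesi t[simplified])
  ultimately have "((%u. (si u - si t) / (u - t)) \<longlongrightarrow> inverse (m ?s)) (at t within {0..te b})"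
   by (rule Lim_transform_eventually)
  hence "(si has_field_derivative inverse (m ?s)) (at t within {0..te b})" unfolding has_field_derivative_iff .
  thus ?thesis by (simp add: has_real_derivative_iff_has_vector_derivative inverse_eq_divide)
 qed
 have ends: "si 0 = 0" "si (te b) = b" using site[of 0] site[of b] b te0 by auto
 have int: "0 < si t & si t < b" if "0 < t" "t < te b" for t
 proof -
  have t: "t : {0..te b}" using that by simp
  have "si t ~= 0" "si t ~= b" using tesi[OF t] that te0 by auto
  thus ?thesis using si_in[OF t] by auto
 qed
 show ?thesis using pos ends der si_in int by blast
qed

text \<open>The field is autonomous and the end points agree, so the one-sided derivatives at
  multiples of the period coincide.\<close>

lemma periodic_extension:
 fixes g :: "real => 'a::real_normed_vector"
 assumes ta: "ta > 0" and per: "g ta = g 0" and d: "!!t. t : {0..ta} ==> (g has_vector_derivative X (g t)) (at t within {0..ta})"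
 defines "ga \<equiv> (%t. g (t - ta * of_int \<lfloor>t / ta\<rfloor>))"
 shows "ga (t + ta) = ga t" "t : {0..<ta} ==> ga t = g t" "(ga has_vector_derivative X (ga t)) (at t)"
  "EX s:{0..<ta}. ga t = g s"
proof -
 have fl: "\<lfloor>t / ta\<rfloor> = k \<longleftrightarrow> ta * of_int k <= t & t < ta * (of_int k + 1)" for t k
  using ta by (simp add: floor_eq_iff field_simps)
 show "ga (t + ta) = ga t" unfolding ga_def using ta by (simp add: add_divide_distrib algebra_simps)
 show "ga t = g t" if "t : {0..<ta}" for t
 proof -
  have "\<lfloor>t / ta\<rfloor> = 0" unfolding fl using that by simp
  thus ?thesis by (simp add: ga_def)
 qed
 define k where "k = \<lfloor>t / ta\<rfloor>"
 have k: "ta * of_int k <= t" "t < ta * (of_int k + 1)" using fl[of t k] by (auto simp: k_def)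
 show "EX s:{0..<ta}. ga t = g s"
  unfolding ga_def k_def[symmetric] using k by (intro bexI[of _ "t - ta * of_int k"]) (auto simp: algebra_simps)
 let ?I = "%j::int. {ta * of_int j..ta * of_int j + ta}"
 have eq: "ga s = g (s - ta * of_int j)" if "s : ?I j" for s j
 proof (cases "s = ta * of_int j + ta")
  case True
  hence "\<lfloor>s / ta\<rfloor> = j + 1" unfolding fl using ta by (simp add: algebra_simps)
  thus ?thesis using per True by (simp add: ga_def algebra_simps)
 next
  case False
  hence "\<lfloor>s / ta\<rfloor> = j" unfolding fl using that by (simp add: algebra_simps)
  thus ?thesis by (simp add: ga_def)
 qed
 have dj: "(ga has_vector_derivative X (ga s)) (at s within ?I j)" if s: "s : ?I j" for s j
 proof -
  have im: "(%s. s - ta * of_int j) ` ?I j <= {0..ta}" by auto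
  have "((%s. s - ta * of_int j) has_derivative (%h. h)) (at s within ?I j)"
   by (auto intro!: derivative_eq_intros)
  moreover have "(g has_derivative (%h. h .* X (g (s - ta * of_int j)))) (at (s - ta * of_int j) within (%s. s - ta * of_int j) ` ?I j)"
   by (rule has_derivative_subset[OF _ im]) (use d[of "s - ta * of_int j"] s in \<open>auto simp: has_vector_derivative_def\<close>)
  ultimately have "((%s. g (s - ta * of_int j)) has_derivative (%h. h .* X (ga s))) (at s within ?I j)"
   unfolding eq[OF s] by (rule has_derivative_in_compose)
  thus ?thesis unfolding has_vector_derivative_def by (rule has_derivative_transform[OF s, rotated]) (rule eq)
 qed
 have tk: "t : ?I k" using k by (simp add: algebra_simps)
 show "(ga has_vector_derivative X (ga t)) (at t)"
 proof (cases "t = ta * of_int k")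
  case False
  hence "t : interior (?I k)" using k ta by (simp add: algebra_simps)
  thus ?thesis using dj[OF tk] at_within_interior by metis
 next
  case True
  \<comment> \<open>At a multiple of the period the derivatives within the two adjacent intervals
    combine to one within their union, which is a neighbourhood.\<close>
  have t1: "t : ?I (k - 1)" using True ta by (simp add: algebra_simps)
  have "(ga has_derivative (%h. h .* X (ga t))) (at t within ?I (k - 1) \<union> ?I k)"
   using dj[OF t1] dj[OF tk] unfolding has_vector_derivative_def has_derivative_within Lim_within_Un by blast
  moreover have "?I (k - 1) \<union> ?I k = {t - ta..t + ta}" using True ta by (auto simp: algebra_simps)
  moreover have "t : interior {t - ta..t + ta}" using ta by simp
  ultimately show ?thesis unfolding has_vector_derivative_def using at_within_interior by metis
 qed
qed

section \<open>Closed orbits and return maps\<close>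

context frame_at
begin

text \<open>A half-hyperplane: the full hyperplane is also met at angle \<open>pi\<close>, which
  would spoil the first return after a full turn.\<close>

definition in_section :: "'a => bool" where "in_section y \<longleftrightarrow> Y1 (y - x0) = 0 & X1 (y - x0) > 0"

lemma in_section_Phi: assumes "X1 q > 0" "0 < Y1 q" "Y1 q < 2 * pi" shows "~ in_section (Phi q)"
proof
 assume s: "in_section (Phi q)"
 have X: "X1 q powr (- 1/2) > 0" using assms(1) by simp
 have 0: "sin (Y1 q) = 0" and c: "cos (Y1 q) > 0"
  using s X unfolding in_section_def Phi_coords by (auto simp: zero_less_mult_iff)
 have "Y1 q = pi" using sin_gt_zero[of "Y1 q"] sin_lt_zero[of "Y1 q"] 0 assms by (cases "Y1 q" pi rule: linorder_cases) auto
 thus False using c by simp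
qed

lemma in_section_Phi0: "X1 q > 0 ==> Y1 q = 0 ==> in_section (Phi q)"
 unfolding in_section_def Phi_coords by simp

lemma hat_curve_orbit:
 assumes h: "hat_curve Rh p x te" and pos: "!!q. q : RQ ==> Y1 (Rh q) > 0"
 shows "te (2 * pi) > 0 & (EX g. g 0 = Phi p & g (te (2 * pi)) = Phi (x (2 * pi)) &
  (ALL t:{0..te (2 * pi)}. EX q:RQ. g t = Phi q & (g has_vector_derivative dPhi q (Rh q)) (at t within {0..te (2 * pi)})) &
  (ALL t. 0 < t & t < te (2 * pi) --> ~ in_section (g t)))"
proof -
 have x: "x 0 = p" "te 0 = 0" and xs: "!!s. s : {0..2 * pi} ==> Y1 (x s) = s & x s : RQ"
  and dx: "!!s. s : {0..2 * pi} ==> (x has_vector_derivative (1 / Y1 (Rh (x s))) .* Rh (x s)) (at s within {0..2 * pi})"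
  and dte: "!!s. s : {0..2 * pi} ==> (te has_vector_derivative 1 / Y1 (Rh (x s))) (at s within {0..2 * pi})"
  using h unfolding hat_curve_def by blast+
 have m: "1 / Y1 (Rh (x s)) > 0" if "s : {0..2 * pi}" for s using xs[OF that] pos by simp
 obtain si where te: "te (2 * pi) > 0" and si: "si 0 = 0" "si (te (2 * pi)) = 2 * pi"
  and siin: "!!t. t : {0..te (2 * pi)} ==> si t : {0..2 * pi}"
  and dsi: "!!t. t : {0..te (2 * pi)} ==> (si has_vector_derivative 1 / (1 / Y1 (Rh (x (si t))))) (at t within {0..te (2 * pi)})"
  and int: "!!t. 0 < t ==> t < te (2 * pi) ==> 0 < si t & si t < 2 * pi"
  using time_change[OF _ x(2) dte m] by auto
 define g where "g t = Phi (x (si t))" for t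
 have "EX q:RQ. g t = Phi q & (g has_vector_derivative dPhi q (Rh q)) (at t within {0..te (2 * pi)})" if t: "t : {0..te (2 * pi)}" for t
 proof (intro bexI conjI)
  let ?q = "x (si t)"
  show q: "?q : RQ" using xs[OF siin[OF t]] by simp
  show "g t = Phi ?q" by (simp add: g_def)
  have "(x has_vector_derivative (1 / Y1 (Rh ?q)) .* Rh ?q) (at (si t) within si ` {0..te (2 * pi)})"
   by (rule has_vector_derivative_within_subset[OF dx[OF siin[OF t]]]) (use siin in auto)
  from vector_diff_chain_within[OF dsi[OF t] this]
  have "((%t. x (si t)) has_vector_derivative Rh ?q) (at t within {0..te (2 * pi)})"
   using pos[OF q] by (simp add: o_def)
  from hvd_field[OF Phi_deriv[OF RQ_imp(2)[OF q]] this]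
  show "(g has_vector_derivative dPhi ?q (Rh ?q)) (at t within {0..te (2 * pi)})" by (simp add: g_def[abs_def])
 qed
 moreover have "~ in_section (g t)" if "0 < t" "t < te (2 * pi)" for t
 proof -
  have s: "si t : {0..2 * pi}" "0 < si t" "si t < 2 * pi" using int[OF that] by auto
  have "x (si t) : RQ" "Y1 (x (si t)) = si t" using xs[OF s(1)] by auto
  thus ?thesis unfolding g_def using s(2,3) RQ_imp(2) by (intro in_section_Phi) auto
 qed
 ultimately show ?thesis using te x si by (intro conjI exI[of _ g]) (auto simp: g_def)
qed

text \<open>The inverse of \<open>Phi\<close> at angle zero. The formula is smooth on all of
  \<open>GE\<close>, where it also forgets the angle, so it can be differentiated at points of the
  section without restricting to it.\<close>

definition Psi :: "'a => 'a" where
 "Psi y = Z (y - x0) .* e0 + U y .* e1 + (U y powr (1/2)) .* (X2 (y - x0) .* e2 + Y2 (y - x0) .* f2 + pw (y - x0))"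

lemma GE_U_pos: "y : GE ==> U y > 0"
 unfolding GE_def U_def using sum_power2_gt_zero_iff[of "X1 (y - x0)" "Y1 (y - x0)"] by auto

lemma smooth_Psi: "smooth_on Psi GE"
proof -
 have f: "smooth_on (%y. L (y - x0)) GE" if "bounded_linear L" for L :: "'a => 'b::real_normed_vector"
  by (intro smooth_linear[OF that] smooth_diff smooth_ident smooth_const open_GE)
 have "smooth_on (%y. U y powr (1/2)) GE"
  by (rule smooth_compose[OF smooth_powr smooth_GE(1)[OF open_GE order.refl]]) (use GE_U_pos open_GE in auto)
 thus ?thesis unfolding Psi_def[abs_def]
  by (intro smooth_add smooth_scaleR f bl smooth_GE(1) smooth_const open_GE order.refl)
qed

lemma Psi_coords: "Z (Psi y) = Z (y - x0)" "X1 (Psi y) = U y" "Y1 (Psi y) = 0" "X2 (Psi y) = U y powr (1/2) * X2 (y - x0)"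
  "Y2 (Psi y) = U y powr (1/2) * Y2 (y - x0)" "pw (Psi y) = U y powr (1/2) .* pw (y - x0)"
 unfolding Psi_def lin_simps by (simp_all add: dual)

lemma powr_half_inverse: "(u::real) > 0 ==> u powr (- 1/2) * u powr (1/2) = 1"
 by (simp add: powr_minus flip: powr_add)

lemma Phi_Psi: assumes "in_section y" shows "Phi (Psi y) = y"
proof -
 have s: "Y1 (y - x0) = 0" "X1 (y - x0) > 0" using assms by (auto simp: in_section_def)
 have U: "U y = 1 / (X1 (y - x0))\<^sup>2" by (simp add: U_def s)
 hence Up: "U y > 0" using s by simp
 have "U y powr (- 1/2) = X1 (y - x0)" unfolding U using s(2)
  by (simp add: powr_minus powr_half_sqrt real_sqrt_divide inverse_eq_divide)
 moreover have "U y powr (- 1/2) .* (c .* v) = (U y powr (- 1/2) * c) .* v" for c and v :: 'a by simp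
 ultimately have "Phi (Psi y) = x0 + (Z (y - x0) .* e0 + X1 (y - x0) .* e1 + Y1 (y - x0) .* f1 + X2 (y - x0) .* e2 + Y2 (y - x0) .* f2 + pw (y - x0))"
  unfolding Phi_def Psi_coords using powr_half_inverse[OF Up] s(1)
  by (simp add: scaleR_add_right mult.assoc[symmetric])
 thus ?thesis unfolding decomp[of "y - x0", symmetric] by simp
qed

lemma Psi_Phi: assumes "X1 q > 0" "Y1 q = 0" shows "Psi (Phi q) = q"
proof -
 have i: "X1 q powr (1/2) * X1 q powr (- 1/2) = 1" using powr_half_inverse[OF assms(1)] by (simp add: mult.commute)
 have "Psi (Phi q) = Z q .* e0 + X1 q .* e1 + Y1 q .* f1 + X2 q .* e2 + Y2 q .* f2 + pw q"
  unfolding Psi_def U_Phi[OF assms(1)] Phi_coords using i assms(2) by (simp add: scaleR_add_right mult.assoc[symmetric])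
 thus ?thesis using decomp[of q] by simp
qed

definition return_data where
 "return_data Rh p W P ta \<longleftrightarrow> openin (top_of_set {v. Y1 v = 0}) W & 0 : W & continuous_on W ta & P 0 = 0 &
  (ALL h:W. in_section (Phi p + h) & (EX q:RQ. Y1 q = 0 & Phi p + h = Phi q) & Y1 (P h) = 0 & (EX q:RQ. Phi p + P h = Phi q) & ta h > 0 &
   (EX g. g 0 = Phi p + h & g (ta h) = Phi p + P h &
    (ALL t:{0..ta h}. EX q:RQ. g t = Phi q & (g has_vector_derivative dPhi q (Rh q)) (at t within {0..ta h})) &
    (ALL t. 0 < t & t < ta h --> ~ in_section (g t))))"

text \<open>In the coordinates the return map is the flow over the angle \<open>2 * pi\<close>;
  conjugation with \<open>Psi\<close> and \<open>Phi\<close> makes it a map of displacements in the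
  chart and keeps its differentiability. The return time is the accumulated Reeb time.\<close>

lemma section_return:
 assumes Rh: "!!q. q : RQ ==> Y1 (Rh q) > 0"
  and curve: "!!p. near_ph p ==> hat_curve Rh p (x p) (te p)"
  and diff: "!!p. EX D. ((%p. x p (2 * pi)) has_derivative D) (at p)" and cont: "continuous_on UNIV (%p. te p (2 * pi))"
  and p: "Y1 p = 0" "Ns (p - ph) < 1/100" "x p (2 * pi) = p + (2 * pi) .* f1"
 shows "EX W P ta L. return_data Rh p W P ta & (P has_derivative L) (at 0)"
proof -
 define H where "H = {v. Y1 v = 0}"
 have np: "near_ph p" using p by (simp add: near_ph_def)
 have ends: "x p 0 = p & (ALL s:{0..2 * pi}. Y1 (x p s) = s & x p s : RQ)" if "near_ph p" for p
  using curve[OF that] unfolding hat_curve_def by blast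
 have e0: "p : RQ" if "near_ph p" for p using ends[OF that] by (metis atLeastAtMost_iff mult_nonneg_nonneg order.refl pi_ge_zero zero_le_numeral)
 have e1: "Y1 (x p (2 * pi)) = 2 * pi" "x p (2 * pi) : RQ" if "near_ph p" for p using ends[OF that] by auto
 have pRQ: "p : RQ" by (rule e0[OF np])
 have GEp: "Phi q : GE" if "q : RQ" for q using Phi_HQ RQ_imp(1)[OF that] by auto
 have Psip: "Psi (Phi p) = p" by (rule Psi_Phi[OF RQ_imp(2)[OF pRQ] p(1)])
 have secp: "in_section (Phi p)" by (rule in_section_Phi0[OF RQ_imp(2)[OF pRQ] p(1)])
 \<comment> \<open>An open set of points whose coordinates are near \<open>ph\<close>, so that
   trajectories starting from its points of the section are controlled over a full turn.\<close>
 define Ob where "Ob = (GE \<inter> {y. X1 (y - x0) > 0}) \<inter> (%y. Ns (Psi y - ph)) -` {..<1/100}"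
 have cX: "continuous_on S (%y. X1 (y - x0))" for S by (rule continuous_functional[OF lin(2)])
 have oV: "open (GE \<inter> {y. X1 (y - x0) > 0})"
  by (intro open_Int open_GE open_Collect_less continuous_on_const cX)
 have cPsi: "continuous_on (GE \<inter> {y. X1 (y - x0) > 0}) Psi"
  by (rule continuous_on_subset[OF smooth_cont[OF smooth_Psi]]) simp
 have cW: "continuous_on S Wv" for S by (rule linear_continuous_on[OF linear_Wv[unfolded linear_conv_bounded_linear]])
 have oO: "open Ob"
  unfolding Ob_def Ns_def by (intro continuous_open_preimage oV continuous_intros continuous_on_compose2[OF cW] cPsi) auto
 have pO: "Phi p : Ob" using GEp[OF pRQ] secp Psip p(2) by (simp add: Ob_def in_section_def)
 define W where "W = H \<inter> {h. Phi p + h : Ob}"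
 have "open {h. Phi p + h : Ob}"
 proof -
  have "continuous_on UNIV (%h. Phi p + h)" by (intro continuous_intros)
  from continuous_open_preimage[OF this open_UNIV oO] show ?thesis by (simp add: vimage_def)
 qed
 hence oW: "openin (top_of_set H) W" unfolding W_def by (auto simp: openin_open)
 have W0: "0 : W" using pO linear_0[OF lin(3)] by (simp add: W_def H_def)
 have secW: "in_section (Phi p + h)" "near_ph (Psi (Phi p + h))" "Phi p + h : GE" if "h : W" for h
 proof -
  have "Y1 (Phi p + h - x0) = Y1 (Phi p - x0) + Y1 h" using linear_add[OF lin(3), of "Phi p - x0" h] by (simp add: algebra_simps)
  thus "in_section (Phi p + h)" using that secp by (auto simp: W_def H_def Ob_def in_section_def)
  show "near_ph (Psi (Phi p + h))" "Phi p + h : GE" using that by (auto simp: W_def Ob_def near_ph_def Psi_coords)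
 qed
 define P where "P h = Phi (x (Psi (Phi p + h)) (2 * pi)) - Phi p" for h
 define ta where "ta h = te (Psi (Phi p + h)) (2 * pi)" for h
 have "Phi (p + (2 * pi) .* f1) = Phi p" unfolding Phi_def lin_simps by (simp add: dual p(1))
 hence P0: "P 0 = 0" unfolding P_def by (simp add: Psip p(3))
 have "EX L. (P has_derivative L) (at 0)"
 proof -
  have "((%h. Phi p + h) has_derivative (%h. h)) (at 0)" by (auto intro!: derivative_eq_intros)
  moreover have "(Psi has_derivative FD Psi (Phi p)) (at (Phi p + 0))"
   using smooth_deriv[OF smooth_Psi GEp[OF pRQ]] by simp
  ultimately have 1: "((%h. Psi (Phi p + h)) has_derivative FD Psi (Phi p)) (at 0)"
   by (rule has_derivative_compose)
  obtain D where "((%p. x p (2 * pi)) has_derivative D) (at p)" using diff by blast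
  hence "((%p. x p (2 * pi)) has_derivative D) (at (Psi (Phi p + 0)))" by (simp add: Psip)
  from has_derivative_compose[OF 1 this]
  have 2: "((%h. x (Psi (Phi p + h)) (2 * pi)) has_derivative (%h. D (FD Psi (Phi p) h))) (at 0)" .
  have "(Phi has_derivative dPhi (p + (2 * pi) .* f1)) (at (x (Psi (Phi p + 0)) (2 * pi)))"
   using Phi_deriv[of "p + (2 * pi) .* f1"] RQ_imp(2)[OF pRQ] by (simp add: Psip p(3) lin_simps dual)
  from has_derivative_diff[OF has_derivative_compose[OF 2 this] has_derivative_const[of "Phi p"]]
  show ?thesis unfolding P_def by blast
 qed
 then obtain L where L: "(P has_derivative L) (at 0)" by blast
 have cta: "continuous_on W ta" unfolding ta_def
 proof (rule continuous_on_compose2[OF cont])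
  have "continuous_on W (%h. Phi p + h)" by (intro continuous_intros)
  thus "continuous_on W (%h. Psi (Phi p + h))"
   by (rule continuous_on_compose2[OF smooth_cont[OF smooth_Psi]]) (use secW(3) in auto)
 qed simp
 have "in_section (Phi p + h) & (EX q:RQ. Y1 q = 0 & Phi p + h = Phi q) & Y1 (P h) = 0 & (EX q:RQ. Phi p + P h = Phi q) & ta h > 0 &
   (EX g. g 0 = Phi p + h & g (ta h) = Phi p + P h &
    (ALL t:{0..ta h}. EX q:RQ. g t = Phi q & (g has_vector_derivative dPhi q (Rh q)) (at t within {0..ta h})) &
    (ALL t. 0 < t & t < ta h --> ~ in_section (g t)))" if h: "h : W" for h
 proof -
  let ?p = "Psi (Phi p + h)"
  have PhP: "Phi ?p = Phi p + h" by (rule Phi_Psi[OF secW(1)[OF h]])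
  have PP: "Phi p + P h = Phi (x ?p (2 * pi))" by (simp add: P_def)
  have "Y1 (Phi (x ?p (2 * pi)) - x0) = 0" unfolding Phi_coords e1(1)[OF secW(2)[OF h]] by simp
  moreover have "P h = (Phi (x ?p (2 * pi)) - x0) - (Phi p - x0)" by (simp add: P_def)
  ultimately have "Y1 (P h) = 0" using secp by (simp add: linear_diff[OF lin(3)] in_section_def)
  moreover have "EX q:RQ. Y1 q = 0 & Phi p + h = Phi q"
   using e0[OF secW(2)[OF h]] by (intro bexI[of _ ?p]) (auto simp: PhP Psi_coords)
  moreover have "EX q:RQ. Phi p + P h = Phi q" using PP e1(2)[OF secW(2)[OF h]] by blast
  moreover note hat_curve_orbit[OF curve[OF secW(2)[OF h]] Rh, folded ta_def, unfolded PhP PP[symmetric]]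
  ultimately show ?thesis using secW(1)[OF h] by blast
 qed
 thus ?thesis using oW W0 cta P0 L unfolding return_data_def H_def by blast
qed

end

text \<open>Otherwise \<open>L - 1\<close> would be injective on \<open>H\<close>, but its image
  lies in the kernel of \<open>al\<close>, a proper subspace of \<open>H\<close>.\<close>

lemma fixed_vector_of_invariant_functional:
 fixes L :: "'e::euclidean_space => 'e"
 assumes H: "subspace H" and L: "linear L" "!!u. u : H ==> L u : H"
  and al: "linear al" "!!u. u : H ==> al (L u) = (al u :: real)" "v : H" "al v ~= 0"
 shows "EX u:H. u ~= 0 & L u = u"
proof (rule ccontr)
 assume neg: "~ ?thesis"
 define M where "M u = L u - u" for u
 have lM: "linear M" unfolding M_def by (intro linear_compose_sub L linear_ident)
 have "inj_on M (span H)"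
 proof (rule inj_onI)
  fix u w assume u: "u : span H" "w : span H" "M u = M w"
  have sp: "span H = H" using H by (simp only: span_eq_iff)
  have "u - w : H" using u H unfolding sp by (simp add: subspace_diff)
  moreover have "L (u - w) = u - w" using u(3) by (simp add: M_def linear_diff[OF L(1)] algebra_simps)
  ultimately show "u = w" using neg by auto
 qed
 hence d: "dim (M ` H) = dim H" by (rule dim_image_eq[OF lM])
 define H0 where "H0 = {u : H. al u = 0}"
 have sH0: "subspace H0" unfolding H0_def using H
  by (auto intro!: subspaceI simp: subspace_0 subspace_add subspace_scale linear_0[OF al(1)] linear_add[OF al(1)] linear_scale[OF al(1)])
 have "M ` H <= H0" using L(2) H al(2) by (auto simp: M_def H0_def subspace_diff linear_diff[OF al(1)])
 hence "dim H <= dim H0" using dim_subset[of "M ` H" H0] d by simp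
 hence "H0 = H" by (intro subspace_dim_equal sH0 H) (auto simp: H0_def)
 thus False using al(3,4) by (auto simp: H0_def)
qed

context oriented_mf
begin

end

section \<open>Degeneracy of all small perturbations\<close>

context frame_at
begin

lemma near_ph_region:
 assumes "Ns (q - ph) <= 1/50" shows "q : RQ" "X2 q >= 49/50" "X1 q >= 1/4"
proof -
 have co: "Z (q - ph) = Z q" "X1 (q - ph) = X1 q - 1" "X2 (q - ph) = X2 q - 1" "Y2 (q - ph) = Y2 q" "T (q - ph) = T q"
  by (simp_all add: ph_def lin_simps dual T_basis)
 have b: "\<bar>X1 q - 1\<bar> <= 1/50" "\<bar>X2 q - 1\<bar> <= 1/50" "\<bar>Y2 q\<bar> <= 1/50"
  using Ns_ge[of "q - ph"] assms unfolding co by linarith+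
 show x: "X2 q >= 49/50" "X1 q >= 1/4" using b by linarith+
 have "(Ns (q - ph))\<^sup>2 <= (1/50)\<^sup>2" by (rule power_mono[OF assms Ns_ge(6)])
 hence n: "(Z q)\<^sup>2 + (X1 q - 1)\<^sup>2 + (X2 q - 1)\<^sup>2 + (Y2 q)\<^sup>2 + T q \<bullet> T q <= 1/2500"
  unfolding Ns_power2 co by (simp add: power2_eq_square)
 have "2 * sh q = (X1 q - 1)\<^sup>2 + (Z q)\<^sup>2 + T q \<bullet> T q" by (simp add: sh_def)
 hence "sh q <= 1/5000" using n zero_le_power2[of "X2 q - 1"] zero_le_power2[of "Y2 q"] by linarith
 moreover have "\<bar>rh q - 1/2\<bar> < 1/8"
 proof -
  have e: "rh q - 1/2 = (X2 q - 1) + ((X2 q - 1)\<^sup>2 + (Y2 q)\<^sup>2) / 2" by (simp add: rh_def power2_eq_square field_simps)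
  have *: "\<bar>x + s / 2\<bar> < 1/8" if "\<bar>x\<bar> <= 1/50" "0 <= s" "s <= 1/2500" for x s :: real
  proof -
   have "x <= 1/50" "- x <= 1/50" using abs_le_D1[OF that(1)] abs_le_D2[OF that(1)] by auto
   thus ?thesis unfolding abs_less_iff using that(2,3) by auto
  qed
  show ?thesis unfolding e by (rule *[OF b(2)]) (use n zero_le_power2[of "Z q"] zero_le_power2[of "X1 q - 1"] zero_le_power2[of "X2 q - 1"] zero_le_power2[of "Y2 q"] inner_ge_zero[of "T q"] in linarith)+
 qed
 ultimately show "q : RQ" by (auto simp: RQ_def)
qed

lemma dPhi_e2: "dPhi q e2 = (X1 q powr (- 1/2)) .* e2" by (simp add: dPhi_def dual)

lemma Phi_periodic: "Phi (q + (2 * pi) .* f1) = Phi q" by (simp add: Phi_def lin_simps dual)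

end

context framed_mf
begin

text \<open>The invariant function takes the same value at the two ends of each return trajectory.
  Differentiating this at the fixed point shows that its differential is an invariant functional of
  \<open>L\<close> on \<open>H\<close>, non-zero at \<open>v\<close>, so \<open>L\<close> has a
  fixed vector.\<close>

lemma degenerate_of_return:
 assumes s: "(lam, omg) : SHS A n"
  and QP: "!!q. q : RQ ==> Phi q : cimg c0 & dPhi q (Rh q) = reeb lam omg c0 (Phi q)"
  and Rh: "!!q. q : RQ ==> Y1 q = 0 ==> Y1 (dPhi q (Rh q)) ~= 0"
  and RD: "return_data Rh p W P ta" and L: "(P has_derivative L) (at 0)"
  and al: "Y1 v = 0" "FD (finv lam omg c0) (Phi p) v ~= 0"
 shows "~ nondegenerate X A (lam, omg)"
proof -
 define H where "H = {v. Y1 v = 0}"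
 have W: "openin (top_of_set {v. Y1 v = 0}) W" "0 : W" "continuous_on W ta"
  and P: "P 0 = 0" "(P has_derivative L) (at 0)" using RD L unfolding return_data_def by blast+
 note ret = RD[unfolded return_data_def, THEN conjunct2, THEN conjunct2, THEN conjunct2, THEN conjunct2, rule_format]
 define R where "R = reeb lam omg"
 define f where "f = finv lam omg c0"
 define ys where "ys = Phi p"
 note lY = lin(3)
 have Reeb: "reeb_field A lam omg R" unfolding R_def by (rule reeb_field_reeb[OF m s])
 hence vf: "smooth_vfield A R" by (simp add: reeb_field_def)
 have cur: "EX g. g 0 = ys + h & g (ta h) = ys + P h & (ALL t:{0..ta h}. g t : cimg c0 &
    (g has_vector_derivative R c0 (g t)) (at t within {0..ta h})) & (ALL t. 0 < t & t < ta h --> ~ in_section (g t))" if h: "h : W" for h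
 proof -
  obtain g where g: "g 0 = ys + h" "g (ta h) = ys + P h"
   "!!t. t : {0..ta h} ==> EX q:RQ. g t = Phi q & (g has_vector_derivative dPhi q (Rh q)) (at t within {0..ta h})"
   "!!t. 0 < t & t < ta h ==> ~ in_section (g t)" using ret[OF h] unfolding ys_def by blast
  have "g t : cimg c0 & (g has_vector_derivative R c0 (g t)) (at t within {0..ta h})" if "t : {0..ta h}" for t
   using g(3)[OF that] QP unfolding R_def by auto
  thus ?thesis using g by blast
 qed
 have ysc: "ys + h : cimg c0" and PhH: "P h : H" and PhC: "ys + P h : cimg c0" and tap: "ta h > 0" and secW: "in_section (ys + h)"
  and RH: "R c0 (ys + h) ~: H" if h: "h : W" for h
 proof -
  obtain q q' where q: "q : RQ" "Y1 q = 0" "ys + h = Phi q" and q': "q' : RQ" "ys + P h = Phi q'" using ret[OF h] unfolding ys_def by blast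
  show "ys + h : cimg c0" "ys + P h : cimg c0" using QP q q' by auto
  show "P h : H" "ta h > 0" "in_section (ys + h)" using ret[OF h] by (auto simp: H_def ys_def)
  show "R c0 (ys + h) ~: H" using QP[OF q(1)] Rh[OF q(1,2)] by (simp add: R_def q(3) H_def)
 qed
 have y0: "ys : cimg c0" using ysc[OF W(2)] by simp
 have WH: "W <= H" using openin_subset[OF W(1)] by (simp add: H_def)
 have sH: "subspace H" unfolding H_def by (auto intro!: subspaceI simp: linear_0[OF lY] linear_add[OF lY] linear_scale[OF lY])
 have dH: "dim H = CARD('m) - 1"
 proof -
  define w where "w = (\<Sum>b\<in>Basis. Y1 b .* b)"
  have Yw: "Y1 x = w \<bullet> x" for x
  proof -
   have "w \<bullet> x = (\<Sum>b\<in>Basis. Y1 b * (b \<bullet> x))" by (simp add: w_def inner_sum_left)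
   also have "... = (\<Sum>b\<in>Basis. (x \<bullet> b) .* Y1 b)" by (rule sum.cong) (simp_all add: inner_commute)
   finally show ?thesis using linear_expand[OF lY, of x] by simp
  qed
  have "w ~= 0" using Yw[of f1] dual(15) by auto
  thus ?thesis using dim_hyperplane[of w] by (simp add: H_def Yw)
 qed
 obtain g0 where g0: "g0 0 = ys" "g0 (ta 0) = ys" "!!t. t : {0..ta 0} ==> g0 t : cimg c0 & (g0 has_vector_derivative R c0 (g0 t)) (at t within {0..ta 0})"
   "!!t. 0 < t & t < ta 0 ==> ~ in_section (g0 t)" using cur[OF W(2)] by (auto simp: P(1))
 define ge where "ge t = g0 (t - ta 0 * of_int \<lfloor>t / ta 0\<rfloor>)" for t
 have per: "g0 (ta 0) = g0 0" using g0 by simp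
 have gd: "(g0 has_vector_derivative R c0 (g0 t)) (at t within {0..ta 0})" if "t : {0..ta 0}" for t using g0(3)[OF that] by simp
 note pe = periodic_extension[where X = "R c0", OF tap[OF W(2)] per gd, folded ge_def]
 have gec: "ge t : cimg c0" for t using pe(4)[of t] g0(3) by force
 define ga where "ga t = cinv c0 (ge t)" for t
 have ge0: "ge 0 = ys" using pe(2)[of 0] g0(1) tap[OF W(2)] by simp
 have ga0: "ga 0 = cinv c0 ys" "cmap c0 (ga 0) = ys" "ga 0 : cdom c0"
  by (simp_all add: ga_def ge0 cmap_cinv[OF y0] cinv_in[OF y0])
 have cinv_inj: "x = y" if "cinv c0 x = cinv c0 y" "x : cimg c0" "y : cimg c0" for x y
  using that cmap_cinv by metis
 have orbit: "closed_orbit X A R ga (ta 0)" unfolding closed_orbit_def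
 proof (intro conjI allI impI)
  show "integral_curve X A R ga UNIV"
   unfolding ga_def by (rule integral_curve_in_chart[OF vf c0 gec]) (use pe(3) in auto)
  show "0 < ta 0" by (rule tap[OF W(2)])
  show "ga (t + ta 0) = ga t" for t unfolding ga_def using pe(1) by simp
  \<comment> \<open>\<open>ta 0\<close> is the minimal period because the trajectory avoids the
    section strictly between 0 and \<open>ta 0\<close>.\<close>
  show "ga t ~= ga 0" if t: "0 < t & t < ta 0" for t
  proof
   assume "ga t = ga 0"
   hence "ge t = ys" using cinv_inj[of "ge t" ys] gec y0 by (simp add: ga_def ge0)
   hence "g0 t = ys" using pe(2)[of t] t by simp
   thus False using g0(4)[OF t] secW[OF W(2)] by simp
  qed
 qed
 have pm: "poincare_map X A R ga (ta 0) c0 H P" unfolding poincare_map_def Let_def ga0(2)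
 proof (intro conjI c0 ga0(3) sH dH exI[of _ W] exI[of _ ta] ballI)
  show "openin (top_of_set H) W" "0 : W" "continuous_on W ta" "ta 0 = ta 0" using W by (simp_all add: H_def)
  fix h assume h: "h : W"
  show "ys + h : cimg c0" "R c0 (ys + h) ~: H" "P h : H" "ys + P h : cimg c0" "0 < ta h"
   by (rule ysc[OF h] RH[OF h] PhH[OF h] PhC[OF h] tap[OF h])+
  obtain g where g: "g 0 = ys + h" "g (ta h) = ys + P h" "!!t. t : {0..ta h} ==> g t : cimg c0 &
    (g has_vector_derivative R c0 (g t)) (at t within {0..ta h})" "!!t. 0 < t & t < ta h ==> ~ in_section (g t)"
   using cur[OF h] by blast
  show "EX si. integral_curve X A R si {0..ta h} & si 0 = cinv c0 (ys + h) & si (ta h) = cinv c0 (ys + P h) &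
     (ALL t. 0 < t & t < ta h --> si t ~: (%h'. cinv c0 (ys + h')) ` W)"
  proof (intro exI[of _ "%t. cinv c0 (g t)"] conjI allI impI)
   show "integral_curve X A R (%t. cinv c0 (g t)) {0..ta h}"
    by (rule integral_curve_in_chart[OF vf c0]) (use g(3) in auto)
   show "cinv c0 (g 0) = cinv c0 (ys + h)" "cinv c0 (g (ta h)) = cinv c0 (ys + P h)" using g by auto
   fix t assume t: "0 < t & t < ta h"
   show "cinv c0 (g t) ~: (%h'. cinv c0 (ys + h')) ` W"
   proof
    assume "cinv c0 (g t) : (%h'. cinv c0 (ys + h')) ` W"
    then obtain h' where h': "h' : W" "cinv c0 (g t) = cinv c0 (ys + h')" by blast
    have "g t = ys + h'" by (rule cinv_inj[OF h'(2) _ ysc[OF h'(1)]]) (use g(3)[of t] t in auto)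
    thus False using g(4)[OF t] secW[OF h'(1)] by simp
   qed
  qed
 qed
 have fd: "(f has_derivative FD f x) (at x)" if "x : cimg c0" for x
  unfolding f_def by (rule smooth_deriv[OF reeb_smooth(2)[OF m s c0] that])
 have inv: "f (ys + P h) = f (ys + h)" if h: "h : W" for h
 proof -
  obtain g where g: "g 0 = ys + h" "g (ta h) = ys + P h" "!!t. t : {0..ta h} ==> g t : cimg c0 &
    (g has_vector_derivative R c0 (g t)) (at t within {0..ta h})" using cur[OF h] by blast
  have "((%t. f (g t)) has_vector_derivative 0) (at t within {0..ta h})" if "t : {0..ta h}" for t
   using hvd_field[OF fd, of g t "R c0 (g t)"] g(3)[OF that] finv_reeb_invariant[OF m s c0, of "g t"]
   by (simp add: f_def R_def)
  from displacement_bound[OF this, of 0 "ta h"] show ?thesis using g(1,2) tap[OF h] by simp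
 qed
 have P0: "(P has_derivative L) (at 0)" and lL: "linear L" using P has_derivative_linear by blast+
 define al where "al = FD f ys"
 have lalx: "linear al" unfolding al_def by (rule has_derivative_linear[OF fd[OF y0]])
 have line: "((%s. P (s .* u)) has_derivative (%s. L (s .* u))) (at 0)" for u
 proof -
  have "((%s. s .* u) has_derivative (%s. s .* u)) (at (0::real))" by (auto intro!: derivative_eq_intros)
  thus ?thesis by (rule has_derivative_compose) (simp add: P0)
 qed
 have nb: "EX N. open N & (0::real) : N & (ALL s:N. s .* u : W)" if u: "u : H" for u
 proof -
  obtain Ob where Ob: "open Ob" "W = H \<inter> Ob" using W(1) unfolding H_def[symmetric] openin_open by blast
  have "continuous_on UNIV (%s. s .* u)" by (intro continuous_intros)
  from continuous_open_preimage[OF this open_UNIV Ob(1)] have "open ((%s. s .* u) -` Ob)" by simp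
  thus ?thesis using W(2) Ob(2) u sH by (intro exI[of _ "(%s. s .* u) -` Ob"]) (auto simp: subspace_scale)
 qed
 have LH: "L u : H" and alL: "al (L u) = al u" if u: "u : H" for u
 proof -
  obtain N where N: "open N" "0 : N" "!!s. s : N ==> s .* u : W" using nb[OF u] by blast
  have "((%s. Y1 (P (s .* u))) has_derivative (%s. Y1 (L (s .* u)))) (at 0)"
   by (rule has_derivative_compose[OF line bounded_linear_imp_has_derivative[OF lY[unfolded linear_conv_bounded_linear]]])
  hence "((%s. 0) has_derivative (%s. Y1 (L (s .* u)))) (at 0)"
   by (rule has_derivative_transform_within_open[OF _ N(1,2)]) (use PhH N(3) in \<open>auto simp: H_def\<close>)
  from has_derivative_unique[OF this has_derivative_const] have "Y1 (L (1 .* u)) = 0" by meson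
  thus "L u : H" by (simp add: H_def)
  have "((%s. ys + P (s .* u)) has_derivative (%s. L (s .* u))) (at 0)" "((%s. ys + s .* u) has_derivative (%s. s .* u)) (at 0)"
   using has_derivative_add[OF has_derivative_const line] by (auto intro!: derivative_eq_intros)
  from has_derivative_diff[OF has_derivative_compose[OF this(1), of f al] has_derivative_compose[OF this(2), of f al]]
  have "((%s. f (ys + P (s .* u)) - f (ys + s .* u)) has_derivative (%s. al (L (s .* u)) - al (s .* u))) (at 0)"
   using fd[OF y0] by (simp add: P(1) al_def)
  hence "((%s. 0) has_derivative (%s. al (L (s .* u)) - al (s .* u))) (at 0)"
   by (rule has_derivative_transform_within_open[OF _ N(1,2)]) (use inv N(3) in auto)
  from has_derivative_unique[OF this has_derivative_const] have "al (L (1 .* u)) - al (1 .* u) = 0" by meson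
  thus "al (L u) = al u" by simp
 qed
 obtain u where u: "u : H" "u ~= 0" "L u = u"
  using fixed_vector_of_invariant_functional[OF sH lL LH lalx alL, of v] al
  unfolding al_def f_def ys_def H_def by auto
 have "complex_eigenvalue_on H L 1"
  unfolding complex_eigenvalue_on_def using u subspace_0[OF sH] by (intro bexI[of _ u] bexI[of _ 0]) (auto simp: linear_0[OF lL])
 moreover have "root_of_unity 1" unfolding root_of_unity_def by (intro exI[of _ 1]) simp
 moreover have "(P has_derivative L) (at 0 within H)" by (rule has_derivative_at_withinI[OF P0])
 ultimately show ?thesis unfolding nondegenerate_def fst_conv snd_conv using Reeb orbit pm by blast
qed

text \<open>The constants depend on each other in this order: the radius \<open>r\<close> of the
  sphere with the lower bound \<open>nv\<close> of \<open>Ns\<close> on it, the error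
  \<open>de\<close> allowed for the normalised field, and the tolerance \<open>et\<close> for the
  Reeb field. Independently, \<open>et2\<close> is the tolerance for the differential of the
  invariant function.\<close>

lemma robustly_degenerate:
 assumes s0: "(lam0, omg0) : SHS A n" and a: "a ~= 0"
  and C: "C >= 0" "!!q. norm (T (J q)) <= C * norm (T q)" and t: "0 < t" "t * (16 + 2 * C) <= 1/200"
  and PL: "agrees lam0 omg0 (lM t) (wM t a)"
 shows "EX K e. compact K & K <= cimg c0 & e > 0 & (ALL s:nhd n (lam0, omg0) c0 K e. ~ nondegenerate X A s)"
proof -
 have "16 * t <= t * (16 + 2 * C)" using t(1) C(1) by (simp add: algebra_simps)
 hence t2: "t <= 1/2" and t0: "0 <= t" using t by linarith+
 have PLc: "plateau <= cimg c0" and l0: "lc1 lam0 c0 y = lM t y" and w0: "lc2 omg0 c0 y = wM t a y" if "y : plateau" for y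
  using PL that by (auto simp: agrees_def)
 define K where "K = KK (1/8) (1/10)"
 have K: "compact K" unfolding K_def by (rule compact_KK) auto
 have KPL: "K <= plateau" by (auto simp: K_def plateau_def KK_def)
 have PhiK: "Phi q : K" if "q : RQ" for q
  using that Rr_Phi[OF RQ_imp(2)[OF that]] Ss_Phi[OF RQ_imp(2)[OF that]] by (auto simp: K_def KK_def RQ_def)
 have PhiPL: "Phi q : plateau" and Phic: "Phi q : cimg c0" if "q : RQ" for q
  using PhiK[OF that] KPL PLc by auto
 have Kc: "K <= cimg c0" using KPL PLc by blast
 have nd: "nd_pair (lM t (Phi q)) (wM t a (Phi q))" if "q : RQ" for q
  using SHS_nd_pair[OF m s0 c0 Phic[OF that]] unfolding l0[OF PhiPL[OF that]] w0[OF PhiPL[OF that]] .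
 have reeb0: "reeb lam0 omg0 c0 (Phi q) = dPhi q ((1 / mm t q) .* (f1 + t .* XX q))" if "q : RQ" for q
  unfolding reeb_def l0[OF PhiPL[OF that]] w0[OF PhiPL[OF that]] by (rule model_reeb[OF that t0 t2 a nd[OF that]])
 have finv0: "finv lam0 omg0 c0 (Phi q) = a * (real (DIM((real, 'm) vec)) - 1) + 2 * t * a * (1/2 + rh q)" if "q : RQ" for q
 proof -
  have "d1 (lc1 lam0 c0) (Phi q) u v = d1 (lM t) (Phi q) u v" for u v
   by (rule d1_cong[OF open_plateau PhiPL[OF that]]) (simp add: l0)
  hence "d1 (lc1 lam0 c0) (Phi q) = d1 (lM t) (Phi q)" by (intro ext)
  thus ?thesis unfolding finv_def l0[OF PhiPL[OF that]] w0[OF PhiPL[OF that]]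
   using model_trace[OF that t0 t2 a nd[OF that]] by simp
 qed
 have fD: "(finv lam omg c0 has_derivative FD (finv lam omg c0) y) (at y)"
  if "(lam, omg) : SHS A n" "y : cimg c0" for lam omg y
  by (rule smooth_deriv[OF reeb_smooth(2)[OF m that(1) c0] that(2)])
 have fPhiD: "((%q. finv lam omg c0 (Phi q)) has_derivative (%v. FD (finv lam omg c0) (Phi q) (dPhi q v))) (at q)"
  if "(lam, omg) : SHS A n" "q : RQ" for lam omg q
  by (rule has_derivative_compose[OF Phi_deriv[OF RQ_imp(2)[OF that(2)]] fD[OF that(1) Phic[OF that(2)]]])
 have D0: "\<bar>FD (finv lam0 omg0 c0) (Phi q) e2\<bar> >= t * \<bar>a\<bar> / 2" if q: "Ns (q - ph) <= 1/50" for q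
 proof -
  note q' = near_ph_region[OF q]
  let ?D = "FD (finv lam0 omg0 c0) (Phi q)"
  have "((%q. a * (real (DIM((real, 'm) vec)) - 1) + 2 * t * a * (1/2 + rh q)) has_derivative (%v. 2 * t * a * dr q v)) (at q)"
   by (auto intro!: derivative_eq_intros rh_derivative)
  hence "((%q. finv lam0 omg0 c0 (Phi q)) has_derivative (%v. 2 * t * a * dr q v)) (at q)"
   by (rule has_derivative_transform_within_open[OF _ open_RQ q'(1)]) (simp add: finv0)
  from has_derivative_unique[OF this fPhiD[OF s0 q'(1)]]
  have "2 * t * a * dr q e2 = ?D (dPhi q e2)" by meson
  also have "... = X1 q powr (- 1/2) * ?D e2"
   using linear_scale[OF has_derivative_linear[OF fD[OF s0 Phic[OF q'(1)]]]] by (simp add: dPhi_e2)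
  finally have e: "2 * t * a * X2 q = X1 q powr (- 1/2) * ?D e2" by (simp add: dr_def dual)
  have p: "X1 q powr (- 1/2) <= 2" "X1 q powr (- 1/2) > 0"
  proof -
   have "X1 q powr (- 1/2) <= (1/4) powr (- 1/2)" by (rule powr_mono2') (use q'(3) in auto)
   also have "... = (2::real)" by (simp add: powr_minus powr_half_sqrt real_sqrt_divide)
   finally show "X1 q powr (- 1/2) <= 2" .
   show "X1 q powr (- 1/2) > 0" using q'(3) by simp
  qed
  have "t * \<bar>a\<bar> * 1 <= t * \<bar>a\<bar> * (2 * X2 q)" using q'(2) t0 by (intro mult_left_mono) auto
  also have "... = \<bar>2 * t * a * X2 q\<bar>" using q'(2) t0 by (simp add: abs_mult)
  also have "... = X1 q powr (- 1/2) * \<bar>?D e2\<bar>" unfolding e using p by (simp add: abs_mult)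
  also have "... <= 2 * \<bar>?D e2\<bar>" using p by (intro mult_right_mono) auto
  finally show ?thesis by simp
 qed
 obtain Ks where Ks: "Ks > 0" "!!u v. \<bar>sg u v\<bar> <= Ks * Ns u * Ns v" using sg_bound by blast
 obtain r nv where r: "r > 0" "nv > 0" "!!v. Y1 v = 0 ==> norm v <= r ==> Ns v <= 1/200" "!!v. Y1 v = 0 ==> norm v = r ==> nv <= Ns v"
  using sphere_radius by blast
 \<comment> \<open>The bounds serve, in turn, for staying near \<open>ph\<close> from every
   admissible start, for paths starting on the sphere, and for the sign of the pairing in
   \<open>path_positive\<close>.\<close>
 define de where "de = min ((1/100)\<^sup>2 / 1000) (min (nv\<^sup>2 / 1000) (t * nv / (8 * Ks)))"
 have de: "de > 0" "de <= (1/100)\<^sup>2 / 1000" "de <= nv\<^sup>2 / 1000" "de <= t * nv / (8 * Ks)"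
  using t(1) r(2) Ks(1) by (auto simp: de_def)
 have Kde: "Ks * de < t * nv / 4"
 proof -
  have "Ks * de <= Ks * (t * nv / (8 * Ks))" using de(4) Ks(1) by (intro mult_left_mono) auto
  also have "... = t * nv / 8" using Ks(1) by simp
  also have "... < t * nv / 4" using t(1) r(2) by simp
  finally show ?thesis .
 qed
 obtain et where et: "et > 0" and hc: "!!q R. q : RQ ==> norm (dPhi q R - dPhi q ((1 / mm t q) .* (f1 + t .* XX q))) <= et ==>
   Y1 R > 0 & Ns ((1 / Y1 R) .* R - (f1 + t .* XX q)) <= de"
  using hat_close[OF C t0 t(2) de(1)] by blast
 \<comment> \<open>An error \<open>et2\<close> in each basis direction changes the derivative in
   direction \<open>e2\<close> by less than its lower bound \<open>t * \<bar>a\<bar> / 2\<close>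
   from \<open>D0\<close>.\<close>
 define et2 where "et2 = t * \<bar>a\<bar> / (2 * (real DIM((real, 'm) vec) * norm e2 + 1))"
 have et2: "et2 > 0" using t(1) a by (simp add: et2_def add_nonneg_pos)
 obtain ea where ea: "ea > 0" "!!s y. s : nhd n (lam0, omg0) c0 K ea ==> y : K ==> norm (reeb (fst s) (snd s) c0 y - reeb lam0 omg0 c0 y) < et"
  using reeb_uniform[OF m s0 c0 K Kc et] by auto
 obtain eb where eb: "eb > 0" "!!s y b. s : nhd n (lam0, omg0) c0 K eb ==> y : K ==> b : Basis ==>
   \<bar>FD (finv (fst s) (snd s) c0) y b - FD (finv lam0 omg0 c0) y b\<bar> < et2"
  using finv_derivative_uniform[OF m s0 c0 K Kc et2] by auto
 have "~ nondegenerate X A s" if s: "s : nhd n (lam0, omg0) c0 K (min ea eb)" for s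
 proof -
  define lam omg where "lam = fst s" and "omg = snd s"
  have S: "(lam, omg) : SHS A n" using s by (simp add: nhd_def lam_def omg_def)
  have sa: "s : nhd n (lam0, omg0) c0 K ea" and sb: "s : nhd n (lam0, omg0) c0 K eb"
   by (rule nhd_mono[OF m s0 c0 K Kc s]; simp)+
  define f where "f = finv lam omg c0"
  have D1: "FD f (Phi q) e2 ~= 0" if q: "Ns (q - ph) <= 1/50" for q
  proof -
   note q' = near_ph_region(1)[OF q]
   define g where "g = (%v. FD f (Phi q) v - FD (finv lam0 omg0 c0) (Phi q) v)"
   have lg: "linear g" unfolding g_def f_def
    by (intro linear_compose_sub has_derivative_linear[OF fD[OF S Phic[OF q']]] has_derivative_linear[OF fD[OF s0 Phic[OF q']]])
   have "\<bar>g e2\<bar> <= (\<Sum>b\<in>(Basis::(real, 'm) vec set). norm e2 * et2)"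
    unfolding linear_expand[OF lg, of e2] real_norm_def[symmetric]
   proof (rule sum_norm_le)
    fix b :: "(real, 'm) vec" assume b: "b : Basis"
    have "\<bar>g b\<bar> <= et2" using eb(2)[OF sb PhiK[OF q'] b] by (simp add: g_def f_def lam_def omg_def)
    thus "norm ((e2 \<bullet> b) .* g b) <= norm e2 * et2"
     using Basis_le_norm[OF b, of e2] by (auto simp: abs_mult intro!: mult_mono)
   qed
   also have "... = real DIM((real, 'm) vec) * norm e2 * et2" by simp
   also have "... < (real DIM((real, 'm) vec) * norm e2 + 1) * et2" using et2 by (simp add: algebra_simps)
   also have "... = t * \<bar>a\<bar> / 2"
   proof -
    have *: "x * (y / (2 * x)) = y / 2" if "x > 0" for x y :: real using that by simp
    show ?thesis unfolding et2_def by (rule *) (simp add: add_nonneg_pos)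
   qed
   finally show ?thesis using D0[OF q] by (auto simp: g_def)
  qed
  define Rh where "Rh q = (SOME R. dPhi q R = reeb lam omg c0 (Phi q))" for q
  have Rh: "dPhi q (Rh q) = reeb lam omg c0 (Phi q)" if q: "q : RQ" for q
  proof -
   obtain N where "!!v. dPhi q (N v) = v" using dPhi_bij[OF RQ_imp(2)[OF q]] by blast
   thus ?thesis unfolding Rh_def by (rule someI)
  qed
  have sRh: "smooth_on Rh RQ"
  proof (rule smooth_linear_solve[where L = dPhi and g = "%q. reeb lam omg c0 (Phi q)", OF open_RQ _ _ _ _ Rh])
   have X: "RQ <= {q. X1 q > 0}" using RQ_imp(2) by auto
   note sP = smooth_Phi[OF open_RQ X]
   show "linear (dPhi q)" if "q : RQ" for q by (rule linear_dPhi[OF RQ_imp(2)[OF that]])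
   show "v = 0" if "q : RQ" "dPhi q v = 0" for q v by (rule dPhi_inj[OF RQ_imp(2)[OF that(1)] that(2)])
   show "smooth_on (%q. dPhi q v) RQ" for v
    by (rule smooth_cong[OF smooth_FD[OF sP] _ open_RQ]) (simp add: frechet_Phi[OF RQ_imp(2)])
   show "smooth_on (%q. reeb lam omg c0 (Phi q)) RQ"
    by (rule smooth_compose[OF reeb_smooth(1)[OF m S c0] sP _ open_RQ open_cimg[OF c0]]) (use Phic in auto)
  qed
  have close: "Y1 (Rh q) > 0 & Ns ((1 / Y1 (Rh q)) .* Rh q - (f1 + t .* XX q)) <= de" if q: "q : RQ" for q
   by (rule hc[OF q]) (use ea(2)[OF sa PhiK[OF q]] in \<open>simp add: Rh[OF q] reeb0[OF q] lam_def omg_def\<close>)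
  have "EX x te. flow_data Rh t de x te"
   by (rule hat_flow[OF C t0 t(2) less_imp_le[OF de(1)] de(2) sRh]) (use close in auto)
  then obtain x te where fl: "flow_data Rh t de x te" by blast
  have curve: "near_ph p ==> hat_curve Rh p (x p) (te p)" and diff: "EX D. ((%p. x p (2 * pi)) has_derivative D) (at p)"
   and cont: "continuous_on UNIV (%p. te p (2 * pi))" for p using fl unfolding flow_data_def by blast+
  note pos = fl[unfolded flow_data_def, THEN conjunct2, THEN conjunct2, THEN conjunct2, rule_format]
  have Yph: "Y1 ph = 0" by (simp add: ph_def lin_simps dual)
  have near: "near_ph (ph + v)" if "v : Sl" "norm v <= r" for v
   using that r(3)[of v] by (auto simp: near_ph_def Sl_def lin_simps Yph)
  \<comment> \<open>In these coordinates a full turn adds \<open>2 * pi\<close> to the angle, so an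
    orbit closes up exactly when this displacement is \<open>(2 * pi) .* f1\<close>.\<close>
  define E where "E v = x (ph + v) (2 * pi) - (ph + v)" for v
  have xc: "continuous_on UNIV (%p. x p (2 * pi))"
   unfolding continuous_on_eq_continuous_at[OF open_UNIV] using diff has_derivative_continuous by blast
  have "EX v k. v : Sl & norm v <= r & E v = (2 * pi) .* f1 + k .* e2"
  proof (rule disp_in_characteristic_direction[OF r(1)])
   have "continuous_on (Sl \<inter> cball 0 r) (%v. ph + v)" by (intro continuous_intros)
   from continuous_on_compose2[OF xc this] show "continuous_on (Sl \<inter> cball 0 r) E"
    unfolding E_def by (intro continuous_intros) auto
   show "sg (E v) v > 0" if v: "v : Sl" "norm v = r" for v
   proof -
    have Y: "Y1 v = 0" "Y2 v = 0" using v by (auto simp: Sl_def)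
    have n: "nv <= Ns v" "Ns v <= 1/200" using r(3,4)[OF Y(1)] v by auto
    have "nv\<^sup>2 <= (Ns v)\<^sup>2" using n r(2) by (intro power_mono) auto
    hence d: "de <= (Ns v)\<^sup>2 / 1000" using de(3) by linarith
    have "t * nv <= t * Ns v" using n t0 by (intro mult_left_mono)
    hence "Ks * de < t * Ns v / 4" using Kde by linarith
    thus ?thesis unfolding E_def using Y n r(2) d Ks by (intro pos conjI allI) auto
   qed
   show "Y1 (E v) = 2 * pi" if v: "v : Sl" "norm v <= r" for v
   proof -
    have "Y1 (x (ph + v) (2 * pi)) = 2 * pi" using curve[OF near[OF v]] unfolding hat_curve_def by auto
    moreover have "Y1 (ph + v) = 0" using near[OF v] by (simp add: near_ph_def)
    ultimately show ?thesis unfolding E_def by (simp only: lin_simps(10))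
   qed
  qed
  then obtain v k where v: "v : Sl" "norm v <= r" "E v = (2 * pi) .* f1 + k .* e2" by blast
  define p where "p = ph + v"
  have np: "near_ph p" unfolding p_def by (rule near[OF v(1,2)])
  have xp: "x p (2 * pi) = p + k .* e2 + (2 * pi) .* f1" using v(3) by (simp add: E_def p_def algebra_simps)
  have hcv: "x p 0 = p" "!!s. s : {0..2 * pi} ==> x p s : RQ & Ns (x p s - p) <= 1/2000 &
    (x p has_vector_derivative (1 / Y1 (Rh (x p s))) .* Rh (x p s)) (at s within {0..2 * pi})"
   using curve[OF np] unfolding hat_curve_def by blast+
  \<comment> \<open>The invariant function is constant along the perturbed trajectory and periodic
    in the angle, so it agrees at \<open>p\<close> and \<open>p + k .* e2\<close>.\<close>
  have "k = 0"
  proof (rule characteristic_displacement_zero[OF np, where fh = "%q. f (Phi q)"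
     and fh' = "%q v. FD f (Phi q) (dPhi q v)"])
   have "Ns (x p (2 * pi) - p) <= 1/2000" using hcv(2)[of "2 * pi"] by simp
   thus "\<bar>k\<bar> <= 1/2000" using Ns_ge(3)[of "x p (2 * pi) - p"] by (simp add: xp lin_simps dual)
   have "((%s. f (Phi (x p s))) has_vector_derivative 0) (at s within {0..2 * pi})" if s: "s : {0..2 * pi}" for s
   proof -
    have q: "x p s : RQ" using hcv(2)[OF s] by simp
    note lin = linear_scale[OF linear_dPhi[OF RQ_imp(2)[OF q]]] linear_scale[OF has_derivative_linear[OF fD[OF S Phic[OF q]]]]
    have "((%s. f (Phi (x p s))) has_vector_derivative FD f (Phi (x p s))
      (dPhi (x p s) ((1 / Y1 (Rh (x p s))) .* Rh (x p s)))) (at s within {0..2 * pi})" unfolding f_def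
     by (rule hvd_field[where f = "%q. finv lam omg c0 (Phi q)" and q = "x p", OF fPhiD[OF S q]])
       (use hcv(2)[OF s] in simp)
    moreover have "FD f (Phi (x p s)) (dPhi (x p s) ((1 / Y1 (Rh (x p s))) .* Rh (x p s))) = 0"
     unfolding f_def lin Rh[OF q] finv_reeb_invariant[OF m S c0 Phic[OF q]] by simp
    ultimately show ?thesis by simp
   qed
   from displacement_bound[OF this, of 0 "2 * pi"] have "f (Phi (x p (2 * pi))) = f (Phi (x p 0))" by simp
   thus "f (Phi (p + k .* e2)) = f (Phi p)" unfolding xp hcv(1) Phi_periodic .
   show "((%q. f (Phi q)) has_derivative (%v. FD f (Phi q) (dPhi q v))) (at q) &
     FD f (Phi q) (dPhi q e2) ~= 0" if q: "Ns (q - ph) <= 1/50" for q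
   proof
    note q' = near_ph_region[OF q]
    show "((%q. f (Phi q)) has_derivative (%v. FD f (Phi q) (dPhi q v))) (at q)"
     unfolding f_def by (rule fPhiD[OF S q'(1)])
    have "FD f (Phi q) (dPhi q e2) = X1 q powr (- 1/2) * FD f (Phi q) e2"
     using linear_scale[OF has_derivative_linear[OF fD[OF S Phic[OF q'(1)]]]] by (simp add: dPhi_e2 f_def)
    thus "FD f (Phi q) (dPhi q e2) ~= 0" using D1[OF q] q'(3) by simp
   qed
  qed
  hence xp': "x p (2 * pi) = p + (2 * pi) .* f1" using xp by simp
  have Yp: "Y1 p = 0" using np by (simp add: near_ph_def)
  have Np: "Ns (p - ph) <= 1/200" using r(3)[of v] v(1,2) by (simp add: p_def Sl_def)
  have posRh: "!!q. q : RQ ==> Y1 (Rh q) > 0" using close by blast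
  have Np': "Ns (p - ph) < 1/100" using Np by simp
  obtain W P ta L where ret: "return_data Rh p W P ta" "(P has_derivative L) (at 0)"
   using section_return[OF posRh curve diff cont Yp Np' xp'] by blast
  have "~ nondegenerate X A (lam, omg)"
  proof (rule degenerate_of_return[OF S _ _ ret])
   show "Phi q : cimg c0 & dPhi q (Rh q) = reeb lam omg c0 (Phi q)" if "q : RQ" for q using Phic[OF that] Rh[OF that] by simp
   show "Y1 (dPhi q (Rh q)) ~= 0" if "q : RQ" "Y1 q = 0" for q
    using posRh[OF that(1)] RQ_imp(2)[OF that(1)] by (simp add: dPhi_coords that(2))
   show "Y1 e2 = 0" by (simp add: dual)
   show "FD (finv lam omg c0) (Phi p) e2 ~= 0" using D1[of p] Np by (simp add: f_def)
  qed
  thus ?thesis by (simp add: lam_def omg_def)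
 qed
 thus ?thesis using K Kc ea(1) eb(1) by (intro exI[of _ K] exI[of _ "min ea eb"]) auto
qed

end

section \<open>Assembling the deformations within the homotopy class\<close>

context oriented_mf
begin

text \<open>The class consists of all structures related to one representative \<open>s0\<close>, so
  by transitivity it also contains the end of the three successive deformations that start at the
  given member.\<close>

lemma degenerate_neighbourhood:
 assumes m: "CARD('m) = 2 * n + 1" and n: "2 * n + 1 >= 5"
  and C: "C : stable_homotopy_classes A n" and reg: "regular_class X A C"
 shows "EX s:C. EX N. openin (C2_topology A n) N & s : N & (ALL s:N. ~ nondegenerate X A s)"
proof -
 obtain s0 where s0: "C = stable_homotopy_rel A n `` {s0}"
  using C unfolding stable_homotopy_classes_def by (auto elim: quotientE)
 obtain lam omg U a where C1: "(lam, omg) : C" and U: "openin X U" "U ~= {}" "a ~= 0"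
  and reg': "!!c x v. c : A ==> x : cmap c ` (cdom c \<inter> U) ==> ext_deriv 1 (lam c) x v = a * omg c x v"
  using reg unfolding regular_class_def by blast
 have r0: "(s0, (lam, omg)) : stable_homotopy_rel A n" using C1 s0 by simp
 note s = stable_homotopy_SHS[OF r0]
 have lam: "smooth_form A 1 lam" and omg: "smooth_form A 2 omg"
  and at: "!!c x. c : A ==> x : cimg c ==> shs_at n (lc1 lam c) (lc2 omg c) x"
  using s unfolding SHS_iff[OF m] by blast+
 obtain p where p0: "p : U" using U(2) by blast
 have "topspace X = (\<Union>c\<in>A. cdom c)" using om unfolding oriented_manifold_def by blast
 then obtain c0 where p: "p : U" "c0 : A" "p : cdom c0" using p0 openin_subset[OF U(1)] by auto
 note c0 = p(2)
 define V where "V = {x : cimg c0. cinv c0 x : U}"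
 define x0 where "x0 = cmap c0 p"
 have V: "open V" "V <= cimg c0" unfolding V_def using open_cinv_vimage[OF c0 U(1)] by auto
 have x0V: "x0 : V" using p by (auto simp: V_def x0_def cmap_in cinv_cmap)
 have x0: "x0 : cimg c0" using x0V V by auto
 have contact: "d1 (lc1 lam c0) x u v = a * lc2 omg c0 x u v" if x: "x : V" for x u v
 proof -
  have "x : cmap c0 ` (cdom c0 \<inter> U)"
   using x cmap_cinv[of x c0] cinv_in[of x c0] unfolding V_def by (intro image_eqI[of _ _ "cinv c0 x"]) auto
  hence "ext_deriv 1 (lam c0) x (pair_seq u v) = a * omg c0 x (pair_seq u v)" by (rule reg'[OF c0])
  thus ?thesis using ext_deriv1_lc1[OF lam c0, of x] x V by (auto simp: cov2_def pair_seq_def lc2_def)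
 qed
 obtain lam1 omg1 r where 1: "((lam, omg), (lam1, omg1)) : stable_homotopy_rel A n"    "r > 0" "ball x0 r <= cimg c0"
   "!!x v. x:ball x0 r ==> lc1 lam1 c0 x v = lc1 lam c0 x0 v + lc2 omg c0 x0 (x - x0) v * a / 2"
   "!!x u v. x:ball x0 r ==> lc2 omg1 c0 x u v = lc2 omg c0 x0 u v"
  using normalize_contact_form[OF m c0 s V x0V U(3) contact] by blast
 note w = smooth_lc2(1)[OF omg c0 x0] and l = form1D(1)[OF smooth_lc1(1)[OF lam c0] x0]
 have vol: "vol_form n (lc1 lam c0 x0) (lc2 omg c0 x0) std_basis ~= 0"
  using at[OF c0 x0] unfolding shs_at_def by simp
 obtain R where R: "lc1 lam c0 x0 R = 1" "!!b. lc2 omg c0 x0 R b = 0"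
   "!!a. (!!b. lc2 omg c0 x0 a b = 0) ==> a = lc1 lam c0 x0 a .* R"
  using vol_form_nonzero_reeb[OF m l w vol] by blast
 \<comment> \<open>The frame is adapted to \<open>d\<lambda> = a \<omega>\<close> at
   \<open>x0\<close> rather than to \<omega>, so the sign of \<open>a\<close> does not enter the
   coordinates.\<close>
 have B: "skew_form (%u v. a * lc2 omg c0 x0 u v)" unfolding skew_form_def
 proof (intro conjI allI)
  show "linear (%v. a * lc2 omg c0 x0 u v)" "linear (%u. a * lc2 omg c0 x0 u v)" for u v
   using linear_compose_scale_right[OF skew_formD(1)[OF w]] linear_compose_scale_right[OF skew_formD(2)[OF w]]
   by (auto simp: scaleR_conv_of_real)
  show "a * lc2 omg c0 x0 u v = - (a * lc2 omg c0 x0 v u)" for u v by (subst skew_formD(3)[OF w]) simp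
 qed
 have nd: "b = 0" if b: "lc1 lam c0 x0 b = 0" "!!d. a * lc2 omg c0 x0 b d = 0" for b
 proof -
  have "lc2 omg c0 x0 b d = 0" for d using b(2)[of d] U(3) by simp
  hence "b = lc1 lam c0 x0 b .* R" by (rule R(3))
  thus "b = 0" using b(1) by simp
 qed
 have "DIM((real, 'm) vec) > 3" using m n by simp
 moreover have "a * lc2 omg c0 x0 R b = 0" for b by (simp add: R(2))
 moreover have "r / 5 > 0" using 1(2) by simp
 ultimately obtain e0 e1 f1 e2 f2 Z X1 Y1 X2 Y2 pw T J be Cw c where F: "frame e0 e1 f1 e2 f2 Z X1 Y1 X2 Y2 pw T J be Cw"
   and c: "c > 0" "norm e0 + norm e1 + norm f1 + norm e2 + norm f2 + Cw <= r / 5" "!!v. lc1 lam c0 x0 v = c * Z v"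
   "!!u v. a * lc2 omg c0 x0 u v = c * (X1 u * Y1 v - Y1 u * X1 v + (X2 u * Y2 v - Y2 u * X2 v) + be u v)"
  using frame_exists[OF _ l B R(1) _ nd, of "r/5"] by blast
 interpret F: framed_mf X A e0 e1 f1 e2 f2 Z X1 Y1 X2 Y2 pw T J be Cw x0 n c0
  by (intro framed_mf.intro oriented_mf_axioms frame_at.intro[OF F] framed_mf_axioms.intro m c0)
 have lam0: "lc1 lam1 c0 y v = c * F.aff y v" if "y : ball x0 r" for y v
  using 1(4)[OF that, of v] c(3)[of v] c(4)[of "y - x0" v] by (simp add: F.aff_def algebra_simps add_divide_distrib)
 have om0: "lc2 omg1 c0 y u v = c / a * F.Bs u v" if "y : ball x0 r" for y u v
  using 1(5)[OF that, of u v] c(4)[of u v] U(3) by (simp add: F.Bs_def field_simps)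
 obtain lam2 omg2 where 2: "((lam1, omg1), (lam2, omg2)) : stable_homotopy_rel A n"
  and P: "F.agrees lam2 omg2 F.L0 (%y u v. d1 F.L0 y u v / a)"
  using F.conformal_step[OF stable_homotopy_SHS[OF 1(1)] 1(2,3) c(2,1) U(3) lam0 om0] by blast
 obtain t0 where t0: "t0 > 0" and mod: "!!t. 0 < t & t <= t0 ==> EX lam' omg'.
   ((lam2, omg2), (lam', omg')) : stable_homotopy_rel A n & F.agrees lam' omg' (F.lM t) (F.wM t a)"
  using F.integrable_step[OF stable_homotopy_SHS[OF 2] U(3) P] by blast
 obtain Cj where Cj: "Cj >= 0" "!!q. norm (T (J q)) <= Cj * norm (T q)" using F.T_J_bound by blast
 \<comment> \<open>The first bound is the range of the last homotopy, the second is required by the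
   path estimates.\<close>
 define t where "t = min t0 (1 / (200 * (16 + 2 * Cj)))"
 have t: "0 < t" "t <= t0" "t * (16 + 2 * Cj) <= 1/200"
 proof -
  have p: "16 + 2 * Cj > 0" using Cj(1) by simp
  thus "0 < t" "t <= t0" using t0 by (auto simp: t_def)
  have "t * (16 + 2 * Cj) <= 1 / (200 * (16 + 2 * Cj)) * (16 + 2 * Cj)" using p by (intro mult_right_mono) (auto simp: t_def)
  also have "... = 1/200" using p by simp
  finally show "t * (16 + 2 * Cj) <= 1/200" .
 qed
 obtain lam' omg' where 3: "((lam2, omg2), (lam', omg')) : stable_homotopy_rel A n"
  and PL: "F.agrees lam' omg' (F.lM t) (F.wM t a)" using mod[of t] t by blast
 note s' = stable_homotopy_SHS[OF 3]
 have C': "(lam', omg') : C"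
  using stable_homotopy_trans[OF stable_homotopy_trans[OF stable_homotopy_trans[OF r0 1(1)] 2] 3] s0 by simp
 obtain K e where K: "compact K" "K <= cimg c0" "e > 0" "ALL s:nhd n (lam', omg') c0 K e. ~ nondegenerate X A s"
  using F.robustly_degenerate[OF s' U(3) Cj t(1,3) PL] by blast
 have "openin (C2_topology A n) (nhd n (lam', omg') c0 K e)"
  unfolding C2_topology_def nhd_def by (rule topology_generated_by_Basis) (use s' c0 K in blast)
 moreover have "(lam', omg') : nhd n (lam', omg') c0 K e"
  using s' K(3) by (simp add: nhd_def C2_close_on_refl)
 ultimately show ?thesis using C' K(4) by blast
qed

end

theorem theorem2:
  fixes X :: "'a topology" and A :: "('a, 'm::{finite,linorder}) chart set" and n :: nat
  assumes "oriented_manifold X A" and "CARD('m) = 2 * n + 1" and "2 * n + 1 \<ge> 5"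
  shows "\<forall>C\<in>stable_homotopy_classes A n. regular_class X A C \<longrightarrow>
           (\<exists>s'\<in>C. \<exists>N. openin (C2_topology A n) N \<and> s' \<in> N \<and>
              (\<forall>s\<in>N. \<not> nondegenerate X A s))"
proof (intro ballI impI)
 fix C assume C: "C : stable_homotopy_classes A n" "regular_class X A C"
 interpret oriented_mf X A by unfold_locales (rule assms(1))
 show "EX s':C. EX N. openin (C2_topology A n) N & s' : N & (ALL s:N. ~ nondegenerate X A s)"
  by (rule degenerate_neighbourhood[OF assms(2,3) C])
qed

end
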